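(* Let $\varrho:V\to\mathbb{R}_{\ge 0}$ be smooth. As $N\to\infty$, $\mathbb{P}^{\varrho}_N(\pi^N_{\cdot}\in\cdot)\to\delta_{\alpha}$ (weak convergence of probability measures on $D([0,T];\mathcal{M}_V)$), where $\alpha\in D([0,T];\mathcal{M}_V)$ is the trajectory of measures with density $\varrho_t(x,\sigma)$ which solves $$\dot{\varrho}_t(x,\sigma)=-\sigma\,\partial_x\varrho_t(x,\sigma)+c(-\sigma,m(\varrho_t))\,\varrho_t(x,-\sigma)-c(\sigma,m(\varrho_t))\,\varrho_t(x,\sigma),\qquad (x,\sigma)\in V,$$ with initial condition $\varrho_0(x,\sigma)=\varrho(x,\sigma)$.
   Context: Spaces. $\mathbb{T}_N=\mathbb{Z}/N\mathbb{Z}$, $S=\{-1,1\}$, $V_N=\mathbb{T}_N\times S$, $\Omega_N=\mathbb{N}^{V_N}$ (with $0\in\mathbb{N}$ here). $\mathbb{T}=[0,1]$ is the torus (endpoints identified), $V=\mathbb{T}\times S$. $\mathcal{M}_V$ is the space of positive Radon measures on $V$ with the weak topology; $D([0,T];\mathcal{M}_V)$ is the Skorokhod space, $T>0$ fixed. $\langle\beta,\phi\rangle$ is the integral of $\phi$ against $\beta\in\mathcal{M}_V$. $C^\infty([0,T]\times V)$ denotes functions smooth in $(t,x)$ for each $\sigma$. $\langle\psi,\phi\rangle_{L^2(V)}=\sum_{\sigma\in S}\int_{\mathbb{T}}\psi(x,\sigma)\phi(x,\sigma)\,dx$. The density of a measure on $V$ is with respect to Lebesgue measure on each layer $\mathbb{T}\times\{\sigma\}$.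 Rates. $c:S\times[-1,1]\to(0,\infty)$ is bounded from above and bounded away from zero, and there is $L>0$ with $|c(\sigma,m_1)-c(\sigma,m_2)|\le L|m_1-m_2|$ for all $\sigma\in S$, $m_1,m_2\in[-1,1]$. Magnetization. For $\eta\in\Omega_N$, $|\eta|=\sum_{(x,\sigma)\in V_N}\eta(x,\sigma)$ and $m_N(\eta)=\frac{1}{|\eta|}\sum_{x\in\mathbb{T}_N}(\eta(x,1)-\eta(x,-1))$, with $m_N(\eta)=0$ if $|\eta|=0$. For a density $\varrho\ge0$ on $V$, $m(\varrho)=\langle\varrho,\mathbf{1}_{\sigma=1}-\mathbf{1}_{\sigma=-1}\rangle_{L^2(V)}/\langle\varrho,1\rangle_{L^2(V)}$ (with the same convention $m=0$ when the mass is zero). Process. $\{\eta^N_t\}$ is the Markov process on $\Omega_N$ with generator $$\mathscr{L}_Nf(\eta)=N\sum_{(x,\sigma)\in V_N}\eta(x,\sigma)[f(\eta^{(x,\sigma)\to(x+\sigma,\sigma)})-f(\eta)]+\sum_{(x,\sigma)\in V_N}c(\sigma,m_N(\eta))\eta(x,\sigma)[f(\eta^{(x,\sigma)\to(x,-\sigma)})-f(\eta)],$$ where $\eta^{(x,\sigma)\to(y,\sigma')}$ is $\eta$ with one particle moved from $(x,\sigma)$ to $(y,\sigma')$. $\mathbb{P}^{\varrho}_N$ is the path-space measure (up to time $T$) of this process when $\eta^N_0$ has the law $\mu_N^{\varrho}=\bigotimes_{(x,\sigma)\in V_N}\mathrm{Pois}(\varrho(x/N,\sigma))$. The empirical measure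 is $\pi^N_t=\frac1N\sum_{(x,\sigma)\in V_N}\eta^N_t(x,\sigma)\delta_{(x/N,\sigma)}$. Solution concept. The equation is understood in the weak sense: for all $G\in C^\infty([0,T]\times V)$ and $t\in[0,T]$, $$\langle\alpha_t,G_t\rangle-\langle\alpha_0,G_0\rangle-\int_0^t\Big\langle\alpha_s,\ \partial_sG_s+\sigma\partial_xG_s+c(\sigma,m(\varrho_s))\big(G_s(x,-\sigma)-G_s(x,\sigma)\big)\Big\rangle ds=0.$$ *)

theory Defs
  imports "HOL-Probability.Probability"
begin

section \<open>The space \<open>V\<close>\<close>

text \<open>
  The circle \<open>[0,1]\<close> with endpoints identified is represented by \<open>[0,1)\<close>, on which the Borel sets
  of the circle are the usual ones.  Functions on \<open>V\<close> are represented by functions on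
  \<open>\<real> \<times> {-1,1}\<close> that are 1-periodic in the first variable; continuity and smoothness of these
  are continuity and smoothness on the circle.
\<close>

definition spins :: "int set" where
  "spins = {-1, 1}"

definition V_space :: "(real \<times> int) measure" where
  "V_space = restrict_space borel {0..<1} \<Otimes>\<^sub>M count_space spins"

definition leb_V :: "(real \<times> int) measure" where
  "leb_V = restrict_space lborel {0..<1} \<Otimes>\<^sub>M count_space spins"

definition inner_V :: "(real \<times> int \<Rightarrow> real) \<Rightarrow> (real \<times> int \<Rightarrow> real) \<Rightarrow> real" where
  "inner_V \<psi> \<phi> = (\<Sum>\<sigma>\<in>spins. LBINT x:{0..1}. \<psi> (x, \<sigma>) * \<phi> (x, \<sigma>))"

definition periodic_V :: "(real \<times> int \<Rightarrow> real) \<Rightarrow> bool" where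
  "periodic_V \<phi> \<longleftrightarrow> (\<forall>x. \<forall>\<sigma>\<in>spins. \<phi> (x + 1, \<sigma>) = \<phi> (x, \<sigma>))"

definition C_V :: "(real \<times> int \<Rightarrow> real) set" where
  "C_V = {\<phi>. periodic_V \<phi> \<and> (\<forall>\<sigma>\<in>spins. continuous_on UNIV (\<lambda>x. \<phi> (x, \<sigma>)))}"

definition smooth_V :: "(real \<times> int \<Rightarrow> real) \<Rightarrow> bool" where
  "smooth_V \<phi> \<longleftrightarrow> periodic_V \<phi> \<and>
     (\<forall>\<sigma>\<in>spins. \<forall>k x. (deriv ^^ k) (\<lambda>y. \<phi> (y, \<sigma>)) differentiable (at x))"

text \<open>
  \<open>C\<^sup>\<infinity>([0,T] \<times> V)\<close>: \<open>D i j\<close> is the partial derivative of order \<open>i\<close> in time and \<open>j\<close> in space.  Time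
  derivatives are relative to \<open>[0,T]\<close>, hence one-sided at the end points.
\<close>

definition smooth_time_V :: "real \<Rightarrow> (real \<Rightarrow> real \<times> int \<Rightarrow> real) \<Rightarrow> bool" where
  "smooth_time_V T G \<longleftrightarrow> (\<forall>t\<in>{0..T}. periodic_V (G t)) \<and>
     (\<forall>\<sigma>\<in>spins. \<exists>D :: nat \<Rightarrow> nat \<Rightarrow> real \<Rightarrow> real \<Rightarrow> real.
        (\<forall>t\<in>{0..T}. \<forall>x. D 0 0 t x = G t (x, \<sigma>)) \<and>
        (\<forall>i j. continuous_on ({0..T} \<times> UNIV) (\<lambda>(t, x). D i j t x)) \<and>
        (\<forall>i j. \<forall>t\<in>{0..T}. \<forall>x.
           ((\<lambda>s. D i j s x) has_real_derivative D (Suc i) j t x) (at t within {0..T}) \<and>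
           ((\<lambda>y. D i j t y) has_real_derivative D i (Suc j) t x) (at x)))"


section \<open>Positive Radon measures on \<open>V\<close> with the weak topology\<close>

text \<open>As \<open>V\<close> is a compact metrizable space, its positive Radon measures are the finite Borel measures.\<close>

typedef radon_V = "{\<beta> :: (real \<times> int) measure. sets \<beta> = sets V_space \<and> finite_measure \<beta>}"
proof
  show "null_measure V_space
      \<in> {\<beta> :: (real \<times> int) measure. sets \<beta> = sets V_space \<and> finite_measure \<beta>}"
    by (auto intro!: finite_measureI)
qed

setup_lifting type_definition_radon_V

definition pairing :: "radon_V \<Rightarrow> (real \<times> int \<Rightarrow> real) \<Rightarrow> real" where
  "pairing \<beta> \<phi> = (\<integral>v. \<phi> v \<partial>Rep_radon_V \<beta>)"

text \<open>
  The uniformity is the coarsest one making all \<open>\<beta> \<mapsto> pairing \<beta> \<phi>\<close>, \<open>\<phi> \<in> C_V\<close>, uniformly continuous;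
  its topology is the weak topology.
\<close>

instantiation radon_V :: uniform_space
begin

definition uniformity_radon_V :: "(radon_V \<times> radon_V) filter" where
  "uniformity_radon_V =
     (INF (\<Phi>, e)\<in>{\<Phi>. finite \<Phi> \<and> \<Phi> \<subseteq> C_V} \<times> {0<..}.
        principal {(\<beta>, \<gamma>). \<forall>\<phi>\<in>\<Phi>. \<bar>pairing \<beta> \<phi> - pairing \<gamma> \<phi>\<bar> < (e :: real)})"

definition open_radon_V :: "radon_V set \<Rightarrow> bool" where
  "open_radon_V U \<longleftrightarrow> (\<forall>\<beta>\<in>U. \<forall>\<^sub>F (\<beta>', \<gamma>) in uniformity. \<beta>' = \<beta> \<longrightarrow> \<gamma> \<in> U)"

lemma eventually_uniformity_radon_V:
  "eventually P (uniformity :: (radon_V \<times> radon_V) filter) \<longleftrightarrow>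
     (\<exists>\<Phi> e. finite \<Phi> \<and> \<Phi> \<subseteq> C_V \<and> 0 < e \<and>
        (\<forall>\<beta> \<gamma>. (\<forall>\<phi>\<in>\<Phi>. \<bar>pairing \<beta> \<phi> - pairing \<gamma> \<phi>\<bar> < e) \<longrightarrow> P (\<beta>, \<gamma>)))"
proof -
  let ?B = "{\<Phi>. finite \<Phi> \<and> \<Phi> \<subseteq> C_V} \<times> {0 :: real <..}"
  let ?F = "\<lambda>(\<Phi>, e). principal {(\<beta>, \<gamma>). \<forall>\<phi>\<in>\<Phi>. \<bar>pairing \<beta> \<phi> - pairing \<gamma> \<phi>\<bar> < (e :: real)}"
  have "eventually P (INF b\<in>?B. ?F b) \<longleftrightarrow> (\<exists>b\<in>?B. eventually P (?F b))"
  proof (rule eventually_INF_base)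
    have "({}, 1) \<in> ?B" by auto
    then show "?B \<noteq> {}" by blast
  next
    fix a b assume "a \<in> ?B" "b \<in> ?B"
    then show "\<exists>x\<in>?B. ?F x \<le> inf (?F a) (?F b)"
      by (intro bexI[of _ "(fst a \<union> fst b, min (snd a) (snd b))"])
         (auto simp: split_beta)
  qed
  also have "\<dots> \<longleftrightarrow> (\<exists>\<Phi> e. finite \<Phi> \<and> \<Phi> \<subseteq> C_V \<and> 0 < e \<and>
        (\<forall>\<beta> \<gamma>. (\<forall>\<phi>\<in>\<Phi>. \<bar>pairing \<beta> \<phi> - pairing \<gamma> \<phi>\<bar> < e) \<longrightarrow> P (\<beta>, \<gamma>)))"
    by (simp add: Bex_def eventually_principal)
  finally show ?thesis
    unfolding uniformity_radon_V_def .
qed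

instance
proof
  fix U :: "radon_V set"
  show "open U \<longleftrightarrow> (\<forall>x\<in>U. \<forall>\<^sub>F (x', y) in uniformity. x' = x \<longrightarrow> y \<in> U)"
    by (rule open_radon_V_def)
next
  fix P :: "radon_V \<times> radon_V \<Rightarrow> bool" and x
  assume "eventually P uniformity"
  then show "P (x, x)"
    unfolding eventually_uniformity_radon_V by (metis abs_zero diff_self)
next
  fix P :: "radon_V \<times> radon_V \<Rightarrow> bool"
  assume "eventually P uniformity"
  then obtain \<Phi> e where "finite \<Phi>" "\<Phi> \<subseteq> C_V" "0 < e"
    and "\<And>\<beta> \<gamma>. (\<forall>\<phi>\<in>\<Phi>. \<bar>pairing \<beta> \<phi> - pairing \<gamma> \<phi>\<bar> < e) \<Longrightarrow> P (\<beta>, \<gamma>)"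
    unfolding eventually_uniformity_radon_V by blast
  then show "\<forall>\<^sub>F (x, y) in uniformity. P (y, x)"
    unfolding eventually_uniformity_radon_V
    by (intro exI[of _ \<Phi>] exI[of _ e]) (simp add: abs_minus_commute)
next
  fix P :: "radon_V \<times> radon_V \<Rightarrow> bool"
  assume "eventually P uniformity"
  then obtain \<Phi> e where \<Phi>: "finite \<Phi>" "\<Phi> \<subseteq> C_V" "0 < e"
    and P: "\<And>\<beta> \<gamma>. (\<forall>\<phi>\<in>\<Phi>. \<bar>pairing \<beta> \<phi> - pairing \<gamma> \<phi>\<bar> < e) \<Longrightarrow> P (\<beta>, \<gamma>)"
    unfolding eventually_uniformity_radon_V by blast
  let ?D = "\<lambda>(\<beta>, \<gamma>). \<forall>\<phi>\<in>\<Phi>. \<bar>pairing \<beta> \<phi> - pairing \<gamma> \<phi>\<bar> < e / 2"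
  have "eventually ?D uniformity"
    unfolding eventually_uniformity_radon_V using \<Phi>
    by (intro exI[of _ \<Phi>] exI[of _ "e / 2"]) auto
  moreover have "P (x, z)" if "?D (x, y)" "?D (y, z)" for x y z
  proof (rule P, intro ballI)
    fix \<phi> assume "\<phi> \<in> \<Phi>"
    then have "\<bar>pairing x \<phi> - pairing y \<phi>\<bar> < e / 2" "\<bar>pairing y \<phi> - pairing z \<phi>\<bar> < e / 2"
      using that by auto
    then show "\<bar>pairing x \<phi> - pairing z \<phi>\<bar> < e" by linarith
  qed
  ultimately show "\<exists>D. eventually D uniformity \<and> (\<forall>x y z. D (x, y) \<longrightarrow> D (y, z) \<longrightarrow> P (x, z))"
    by blast
qed

end


section \<open>Skorokhod space and weak convergence\<close>

definition cadlag :: "real \<Rightarrow> (real \<Rightarrow> 'a :: topological_space) \<Rightarrow> bool" where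
  "cadlag T x \<longleftrightarrow> (\<forall>t\<in>{0..<T}. (x \<longlongrightarrow> x t) (at_right t)) \<and>
     (\<forall>t\<in>{0<..T}. \<exists>l. (x \<longlongrightarrow> l) (at_left t))"

definition skorokhod_space :: "real \<Rightarrow> (real \<Rightarrow> 'a :: topological_space) set" where
  "skorokhod_space T = {x \<in> extensional {0..T}. cadlag T x}"

text \<open>
  The J1 topology for paths in a uniform space: \<open>y\<close> is close to \<open>x\<close> if, up to a time change
  uniformly close to the identity, it is uniformly close to \<open>x\<close>.  If the uniformity comes from a
  metric, this is the topology of the usual Skorokhod metric.
\<close>

definition skorokhod_nbhd ::
  "real \<Rightarrow> (real \<Rightarrow> 'a :: uniform_space) \<Rightarrow> ('a \<times> 'a \<Rightarrow> bool) \<Rightarrow> real \<Rightarrow> (real \<Rightarrow> 'a) set" where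
  "skorokhod_nbhd T x E e = {y \<in> skorokhod_space T.
     \<exists>\<theta>. strict_mono_on {0..T} \<theta> \<and> \<theta> ` {0..T} = {0..T} \<and>
         (\<forall>t\<in>{0..T}. \<bar>\<theta> t - t\<bar> < e \<and> E (x t, y (\<theta> t)))}"

definition skorokhod :: "real \<Rightarrow> (real \<Rightarrow> 'a :: uniform_space) topology" where
  "skorokhod T = topology (\<lambda>U. U \<subseteq> skorokhod_space T \<and>
     (\<forall>x\<in>U. \<exists>E e. eventually E uniformity \<and> 0 < e \<and> skorokhod_nbhd T x E e \<subseteq> U))"

lemma openin_skorokhod:
  fixes U :: "(real \<Rightarrow> 'a :: uniform_space) set"
  shows "openin (skorokhod T) U \<longleftrightarrow> U \<subseteq> skorokhod_space T \<and>
     (\<forall>x\<in>U. \<exists>E e. eventually E uniformity \<and> 0 < e \<and> skorokhod_nbhd T x E e \<subseteq> U)"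
proof -
  let ?o = "\<lambda>U :: (real \<Rightarrow> 'a) set. U \<subseteq> skorokhod_space T \<and>
     (\<forall>x\<in>U. \<exists>E e. eventually E uniformity \<and> 0 < e \<and> skorokhod_nbhd T x E e \<subseteq> U)"
  have "istopology ?o"
    unfolding istopology_def
  proof (intro conjI allI impI)
    fix A B :: "(real \<Rightarrow> 'a) set" assume A: "?o A" and B: "?o B"
    show "A \<inter> B \<subseteq> skorokhod_space T" using A by blast
    show "\<forall>x\<in>A \<inter> B. \<exists>E e. eventually E uniformity \<and> 0 < e \<and> skorokhod_nbhd T x E e \<subseteq> A \<inter> B"
    proof
      fix x assume "x \<in> A \<inter> B"
      then obtain E e E' e' where "eventually E uniformity" "0 < e" "skorokhod_nbhd T x E e \<subseteq> A"
        and "eventually E' uniformity" "0 < e'" "skorokhod_nbhd T x E' e' \<subseteq> B"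
        using A B by (metis IntE)
      moreover have "skorokhod_nbhd T x (\<lambda>p. E p \<and> E' p) (min e e')
          \<subseteq> skorokhod_nbhd T x E e \<inter> skorokhod_nbhd T x E' e'"
        unfolding skorokhod_nbhd_def by auto
      ultimately show
        "\<exists>E e. eventually E uniformity \<and> 0 < e \<and> skorokhod_nbhd T x E e \<subseteq> A \<inter> B"
        by (intro exI[of _ "\<lambda>p. E p \<and> E' p"] exI[of _ "min e e'"])
           (auto simp: eventually_conj_iff)
    qed
  next
    fix K :: "(real \<Rightarrow> 'a) set set" assume K: "\<forall>A\<in>K. ?o A"
    then show "\<Union>K \<subseteq> skorokhod_space T" by blast
    show "\<forall>x\<in>\<Union>K. \<exists>E e. eventually E uniformity \<and> 0 < e \<and> skorokhod_nbhd T x E e \<subseteq> \<Union>K"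
    proof
      fix x assume "x \<in> \<Union>K"
      then obtain A where A: "A \<in> K" "x \<in> A" by blast
      with K obtain E e where "eventually E uniformity" "0 < e" "skorokhod_nbhd T x E e \<subseteq> A"
        by meson
      with A show "\<exists>E e. eventually E uniformity \<and> 0 < e \<and> skorokhod_nbhd T x E e \<subseteq> \<Union>K"
        by blast
    qed
  qed
  then show ?thesis
    by (simp add: skorokhod_def topology_inverse')
qed

lemma topspace_skorokhod: "topspace (skorokhod T) = skorokhod_space T"
proof
  show "topspace (skorokhod T) \<subseteq> skorokhod_space T"
    unfolding topspace_def by (auto simp: openin_skorokhod)
  have "openin (skorokhod T) (skorokhod_space T)"
    by (auto simp: openin_skorokhod skorokhod_nbhd_def intro!: exI[of _ "\<lambda>_. True"] exI[of _ 1])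
  then show "skorokhod_space T \<subseteq> topspace (skorokhod T)"
    by (rule openin_subset)
qed

definition borel_of :: "'a topology \<Rightarrow> 'a measure" where
  "borel_of X = sigma (topspace X) {U. openin X U}"

definition weakly_converges :: "'a topology \<Rightarrow> (nat \<Rightarrow> 'a measure) \<Rightarrow> 'a measure \<Rightarrow> bool" where
  "weakly_converges X \<mu> \<nu> \<longleftrightarrow>
     (\<forall>F. continuous_map X euclideanreal F \<and> bounded (F ` topspace X) \<longrightarrow>
        (\<lambda>n. \<integral>x. F x \<partial>\<mu> n) \<longlonglongrightarrow> (\<integral>x. F x \<partial>\<nu>))"


section \<open>Markov processes on a countable state space\<close>

definition markov_semigroup :: "'a set \<Rightarrow> (real \<Rightarrow> 'a \<Rightarrow> 'a pmf) \<Rightarrow> bool" where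
  "markov_semigroup E P \<longleftrightarrow> (\<forall>x\<in>E. P 0 x = return_pmf x \<and>
     (\<forall>t\<ge>0. set_pmf (P t x) \<subseteq> E) \<and>
     (\<forall>s\<ge>0. \<forall>t\<ge>0. P (s + t) x = bind_pmf (P s x) (P t)))"

text \<open>
  \<open>L f\<close> is the derivative at time 0 of the semigroup applied to \<open>f\<close>, pointwise on \<open>E\<close>, for all
  bounded \<open>f\<close>; for indicator functions \<open>f\<close> this says that the semigroup has the Q-matrix of \<open>L\<close>.
\<close>

definition has_generator ::
  "'a set \<Rightarrow> (real \<Rightarrow> 'a \<Rightarrow> 'a pmf) \<Rightarrow> (('a \<Rightarrow> real) \<Rightarrow> 'a \<Rightarrow> real) \<Rightarrow> bool" where
  "has_generator E P L \<longleftrightarrow> (\<forall>f. bounded (f ` E) \<longrightarrow> (\<forall>x\<in>E.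
     ((\<lambda>t. (measure_pmf.expectation (P t x) f - f x) / t) \<longlongrightarrow> L f x) (at_right 0)))"

text \<open>The Markov property with transition semigroup \<open>P\<close>, in terms of finite-dimensional distributions.\<close>

definition markov_property ::
  "'w measure \<Rightarrow> real \<Rightarrow> 'a set \<Rightarrow> (real \<Rightarrow> 'a \<Rightarrow> 'a pmf) \<Rightarrow> (real \<Rightarrow> 'w \<Rightarrow> 'a) \<Rightarrow> bool" where
  "markov_property M T E P X \<longleftrightarrow>
     (\<forall>(n :: nat) \<tau> \<xi>. mono_on {..n} \<tau> \<and> \<tau> ` {..n} \<subseteq> {0..T} \<and> \<xi> ` {..n} \<subseteq> E \<longrightarrow>
        measure M {\<omega> \<in> space M. \<forall>i\<le>n. X (\<tau> i) \<omega> = \<xi> i} =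
        measure M {\<omega> \<in> space M. X (\<tau> 0) \<omega> = \<xi> 0} *
          (\<Prod>i<n. pmf (P (\<tau> (Suc i) - \<tau> i) (\<xi> i)) (\<xi> (Suc i))))"

definition markov_process ::
  "'w measure \<Rightarrow> real \<Rightarrow> 'a :: topological_space set \<Rightarrow> (('a \<Rightarrow> real) \<Rightarrow> 'a \<Rightarrow> real) \<Rightarrow>
   (real \<Rightarrow> 'w \<Rightarrow> 'a) \<Rightarrow> bool" where
  "markov_process M T E L X \<longleftrightarrow> prob_space M \<and>
     (\<forall>t\<in>{0..T}. X t \<in> measurable M (count_space E)) \<and>
     (\<forall>\<omega>\<in>space M. cadlag T (\<lambda>t. X t \<omega>)) \<and>
     (\<exists>P. markov_semigroup E P \<and> has_generator E P L \<and> markov_property M T E P X)"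


section \<open>The particle system\<close>

text \<open>\<open>\<int>/N\<int>\<close> is represented by the residues \<open>0, \<dots>, N - 1\<close>.\<close>

definition sites :: "nat \<Rightarrow> (int \<times> int) set" where
  "sites N = {0..<int N} \<times> spins"

text \<open>
  Configurations are extended by 0 outside \<open>sites N\<close>.  In the topology of pointwise convergence,
  to which \<^const>\<open>cadlag\<close> refers, this set is discrete and closed.
\<close>

definition configs :: "nat \<Rightarrow> (int \<times> int \<Rightarrow> nat) set" where
  "configs N = {\<eta>. \<forall>v. v \<notin> sites N \<longrightarrow> \<eta> v = 0}"

definition move :: "int \<times> int \<Rightarrow> int \<times> int \<Rightarrow> (int \<times> int \<Rightarrow> nat) \<Rightarrow> int \<times> int \<Rightarrow> nat" where
  "move v w \<eta> = (let \<zeta> = \<eta>(v := \<eta> v - 1) in \<zeta>(w := \<zeta> w + 1))"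

definition magnetization_N :: "nat \<Rightarrow> (int \<times> int \<Rightarrow> nat) \<Rightarrow> real" where
  "magnetization_N N \<eta> =
     (let n = (\<Sum>v\<in>sites N. \<eta> v) in
      if n = 0 then 0
      else (1 / real n) * (\<Sum>x\<in>{0..<int N}. real (\<eta> (x, 1)) - real (\<eta> (x, -1))))"

definition generator ::
  "(int \<Rightarrow> real \<Rightarrow> real) \<Rightarrow> nat \<Rightarrow> ((int \<times> int \<Rightarrow> nat) \<Rightarrow> real) \<Rightarrow> (int \<times> int \<Rightarrow> nat) \<Rightarrow> real" where
  "generator c N f \<eta> =
     real N * (\<Sum>(x, \<sigma>)\<in>sites N.
        real (\<eta> (x, \<sigma>)) * (f (move (x, \<sigma>) ((x + \<sigma>) mod int N, \<sigma>) \<eta>) - f \<eta>)) +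
     (\<Sum>(x, \<sigma>)\<in>sites N.
        c \<sigma> (magnetization_N N \<eta>) * real (\<eta> (x, \<sigma>)) * (f (move (x, \<sigma>) (x, - \<sigma>) \<eta>) - f \<eta>))"

text \<open>\<^const>\<open>poisson_pmf\<close> is only specified for positive rates.\<close>

definition pois :: "real \<Rightarrow> nat pmf" where
  "pois r = (if r = 0 then return_pmf 0 else poisson_pmf r)"

definition initial_law :: "nat \<Rightarrow> (real \<times> int \<Rightarrow> real) \<Rightarrow> (int \<times> int \<Rightarrow> nat) pmf" where
  "initial_law N \<rho> = Pi_pmf (sites N) 0 (\<lambda>(x, \<sigma>). pois (\<rho> (of_int x / real N, \<sigma>)))"

text \<open>
  The sum of the point masses \<open>\<eta>(x,\<sigma>)/N\<close> at \<open>(x/N,\<sigma>)\<close>, as the image of a measure on \<open>sites N\<close>.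
\<close>

lift_definition empirical :: "nat \<Rightarrow> (int \<times> int \<Rightarrow> nat) \<Rightarrow> radon_V" is
  "\<lambda>N \<eta>. distr (point_measure (sites N) (\<lambda>v. ennreal (real (\<eta> v) / real N))) V_space
     (\<lambda>(x, \<sigma>). (of_int x / real N, \<sigma>))"
proof (intro conjI)
  fix N :: nat and \<eta> :: "int \<times> int \<Rightarrow> nat"
  let ?m = "point_measure (sites N) (\<lambda>v. ennreal (real (\<eta> v) / real N))"
  let ?g = "\<lambda>(x :: int, \<sigma> :: int). (of_int x / real N, \<sigma>)"
  show "sets (distr ?m V_space ?g) = sets V_space" by simp
  have "finite (sites N)" by (simp add: sites_def spins_def)
  then have "finite_measure ?m"
    by (intro finite_measureI) (simp add: space_point_measure emeasure_point_measure_finite)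
  moreover have "?g \<in> measurable ?m V_space"
    by (auto simp: V_space_def space_pair_measure sites_def
        space_restrict_space)
  ultimately show "finite_measure (distr ?m V_space ?g)"
    by (rule finite_measure.finite_measure_distr)
qed

definition empirical_path ::
  "real \<Rightarrow> nat \<Rightarrow> (real \<Rightarrow> 'w \<Rightarrow> int \<times> int \<Rightarrow> nat) \<Rightarrow> 'w \<Rightarrow> real \<Rightarrow> radon_V" where
  "empirical_path T N \<eta> \<omega> = (\<lambda>t\<in>{0..T}. empirical N (\<eta> t \<omega>))"


section \<open>The limiting equation\<close>

definition magnetization :: "(real \<times> int \<Rightarrow> real) \<Rightarrow> real" where
  "magnetization \<rho> =
     (if inner_V \<rho> (\<lambda>_. 1) = 0 then 0
      else inner_V \<rho> (\<lambda>(x, \<sigma>). of_bool (\<sigma> = 1) - of_bool (\<sigma> = -1)) / inner_V \<rho> (\<lambda>_. 1))"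

definition has_density_V :: "radon_V \<Rightarrow> (real \<times> int \<Rightarrow> real) \<Rightarrow> bool" where
  "has_density_V \<beta> \<rho> \<longleftrightarrow> \<rho> \<in> borel_measurable V_space \<and> (\<forall>v\<in>space V_space. 0 \<le> \<rho> v) \<and>
     Rep_radon_V \<beta> = density leb_V (\<lambda>v. ennreal (\<rho> v))"

definition weak_equation ::
  "(int \<Rightarrow> real \<Rightarrow> real) \<Rightarrow> real \<Rightarrow> (real \<Rightarrow> radon_V) \<Rightarrow> (real \<Rightarrow> real \<times> int \<Rightarrow> real) \<Rightarrow> bool" where
  "weak_equation c T \<alpha> \<rho> \<longleftrightarrow> (\<forall>G. smooth_time_V T G \<longrightarrow> (\<forall>t\<in>{0..T}.
     pairing (\<alpha> t) (G t) - pairing (\<alpha> 0) (G 0) -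
     (LBINT s:{0..t}. pairing (\<alpha> s) (\<lambda>(x, \<sigma>).
        vector_derivative (\<lambda>r. G r (x, \<sigma>)) (at s within {0..T}) +
        of_int \<sigma> * deriv (\<lambda>y. G s (y, \<sigma>)) x +
        c \<sigma> (magnetization (\<rho> s)) * (G s (x, - \<sigma>) - G s (x, \<sigma>)))) = 0))"

definition hydrodynamic_trajectory ::
  "(int \<Rightarrow> real \<Rightarrow> real) \<Rightarrow> real \<Rightarrow> (real \<times> int \<Rightarrow> real) \<Rightarrow> (real \<Rightarrow> radon_V) \<Rightarrow> bool" where
  "hydrodynamic_trajectory c T \<rho>\<^sub>0 \<alpha> \<longleftrightarrow> \<alpha> \<in> skorokhod_space T \<and>
     (\<exists>\<rho>. (\<forall>t\<in>{0..T}. has_density_V (\<alpha> t) (\<rho> t)) \<and>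
          (\<forall>v\<in>space V_space. \<rho> 0 v = \<rho>\<^sub>0 v) \<and> weak_equation c T \<alpha> \<rho>)"

end

theory Submission
  imports Defs
begin

text \<open>
  The Fourier modes \<open>cos (2 \<pi> k x + b)\<close> on the two layers form, for each frequency, a family that is
  closed under the dynamics except for the magnetization in the rates.  With \<open>m\<close> the solution of the
  scalar limiting equation of the magnetization, the squared deviations of the empirical modes from
  the limiting ones, together with that of the total spin from \<open>m\<close> times the total mass, satisfy a
  closed Gronwall inequality with an error of order \<open>1/N\<close>: replacing the empirical magnetization by
  \<open>m\<close> costs at most the deviation of the total spin.  Discounting exponentially and adding the
  remaining noise turns this into a nonnegative supermartingale, so Doob's inequality gives
  convergence in probability uniformly in time.  As the number of particles is conserved, the process
  lives on finite sets of configurations, where the forward equation holds for all functions.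
  Trigonometric polynomials are dense in \<open>C_V\<close>, which yields convergence of the paths.

  The limit is obtained by first solving the scalar equation for \<open>m\<close> and then a linear equation along
  characteristics.  Uniqueness holds since all modes solve a Gronwall inequality as well and
  determine the measure.
\<close>

section \<open>Pairings and Fourier modes\<close>

text \<open>The rates see the ratio of total spin to total mass, and the mass is random and may be
  small or zero. For this reason the spin is compared with \<open>mh t\<close> times the mass
  \<open>q\<close> of the configuration itself. The deviation is then the error in the magnetization
  times \<open>q\<close>, and since every mode is bounded by \<open>q\<close>, nothing is ever
  divided by the mass. On the side of the limit, rates occur only in products with pairings, which
  vanish together with the mass. Differentiating a cosine advances its phase by pi/2, so two phases
  on two layers, together with the spin, are five statistics that close up to the rates. The process
  is given only by a semigroup whose derivative at time 0 is known on bounded functions;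
  conservation of particles and the forward equation for unbounded statistics must be derived from
  this. The limit is deterministic, hence uniform closeness in probability yields weak convergence
  without compactness arguments. It remains to see that the path map is measurable for the Borel
  sets of a Skorokhod topology given by a uniformity. This works because a jump path agrees with its
  discretizations up to small time changes.\<close>

lemma finite_spins [simp]: "finite spins"
  by (simp add: spins_def)

lemma sum_spins: "(\<Sum>\<sigma>\<in>spins. f \<sigma>) = f 1 + f (-1)"
  by (simp add: spins_def add.commute)

lemma uminus_spins [simp]: "- \<sigma> \<in> spins \<longleftrightarrow> \<sigma> \<in> spins"
  by (auto simp: spins_def)

lemma spins_cases [consumes 1]:
  assumes "\<sigma> \<in> spins" obtains "\<sigma> = 1" | "\<sigma> = -1"
  using assms by (auto simp: spins_def)

lemma one_in_spins [simp]: "1 \<in> spins" "-1 \<in> spins"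
  by (auto simp: spins_def)

lemma finite_sites [simp]: "finite (sites N)"
  by (simp add: sites_def)

section \<open>The measurable space V and its test functions\<close>

lemma space_V_space: "space V_space = {0..<1} \<times> spins"
  by (simp add: V_space_def space_pair_measure space_restrict_space)

lemma sets_leb_V: "sets leb_V = sets V_space"
  unfolding leb_V_def V_space_def
  by (intro sets_pair_measure_cong sets_restrict_space_cong) simp_all

lemma space_leb_V: "space leb_V = {0..<1} \<times> spins"
  using sets_eq_imp_space_eq[OF sets_leb_V] space_V_space by simp

text \<open>The second factor is finite and discrete, so the function is a finite sum over the
  layers of a layer indicator times a function of the position alone.\<close>

lemma borel_measurable_V_space:
  fixes f :: "real \<times> int \<Rightarrow> real"
  assumes "\<And>\<sigma>. \<sigma> \<in> spins \<Longrightarrow> (\<lambda>x. f (x, \<sigma>)) \<in> borel_measurable (restrict_space borel {0..<1})"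
  shows "f \<in> borel_measurable V_space"
proof -
  have "(\<lambda>v. \<Sum>\<sigma>\<in>spins. indicator (UNIV \<times> {\<sigma>}) v * f (fst v, \<sigma>)) \<in> borel_measurable V_space"
  proof (intro borel_measurable_sum borel_measurable_times)
    fix \<sigma> :: int assume \<sigma>: "\<sigma> \<in> spins"
    show "(\<lambda>v. f (fst v, \<sigma>)) \<in> borel_measurable V_space"
      using measurable_compose[OF measurable_fst assms[OF \<sigma>]] unfolding V_space_def by blast
    have "indicator (space (restrict_space borel {0..<1 :: real}) \<times> {\<sigma>})
        \<in> borel_measurable V_space"
      unfolding V_space_def using \<sigma> by (intro borel_measurable_indicator pair_measureI) (auto simp: sets_restrict_space_iff)
    then show "(\<lambda>v. indicator (UNIV \<times> {\<sigma>}) v :: real) \<in> borel_measurable V_space"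
      by (rule measurable_cong[THEN iffD1, rotated])
         (auto simp: space_V_space space_restrict_space indicator_def)
  qed
  then show ?thesis
    by (rule measurable_cong[THEN iffD1, rotated])
       (auto simp: space_V_space indicator_def sum_spins elim!: spins_cases)
qed

lemma C_V_measurable: "\<phi> \<in> C_V \<Longrightarrow> \<phi> \<in> borel_measurable V_space"
  by (intro borel_measurable_V_space measurable_restrict_space1 borel_measurable_continuous_onI)
     (auto simp: C_V_def)

lemma periodic_V_int:
  assumes "periodic_V \<phi>" "\<sigma> \<in> spins"
  shows "\<phi> (x + of_int n, \<sigma>) = \<phi> (x, \<sigma>)"
proof -
  have p: "\<phi> (x + real n, \<sigma>) = \<phi> (x, \<sigma>)" for n x
  proof (induction n)
    case (Suc n)
    have "\<phi> ((x + real n) + 1, \<sigma>) = \<phi> (x + real n, \<sigma>)"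
      using assms unfolding periodic_V_def by blast
    with Suc show ?case by (simp add: algebra_simps)
  qed simp
  show ?thesis
  proof (cases "0 \<le> n")
    case True
    then show ?thesis using p[of x "nat n"] by simp
  next
    case False
    then show ?thesis using p[of "x + of_int n" "nat (- n)"] by simp
  qed
qed

lemma periodic_V_frac:
  "periodic_V \<phi> \<Longrightarrow> \<sigma> \<in> spins \<Longrightarrow> \<phi> (frac x, \<sigma>) = \<phi> (x, \<sigma>)"
  using periodic_V_int[of \<phi> \<sigma> "frac x" "\<lfloor>x\<rfloor>"] by (simp add: frac_def)

text \<open>Periodicity reduces the supremum over the line to the compact interval from 0 to 1,
  separately on each layer.\<close>

lemma C_V_bounded:
  assumes "\<phi> \<in> C_V"
  obtains B where "0 < B" "\<And>x \<sigma>. \<sigma> \<in> spins \<Longrightarrow> \<bar>\<phi> (x, \<sigma>)\<bar> \<le> B"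
proof -
  have "\<exists>B. \<forall>x\<in>{0..1}. \<bar>\<phi> (x, \<sigma>)\<bar> \<le> B" if "\<sigma> \<in> spins" for \<sigma>
  proof -
    have "continuous_on {0..1} (\<lambda>x. \<phi> (x, \<sigma>))"
      using assms that continuous_on_subset unfolding C_V_def by blast
    then have "bounded ((\<lambda>x. \<phi> (x, \<sigma>)) ` {0..1})"
      by (intro compact_imp_bounded compact_continuous_image) auto
    then show ?thesis by (auto simp: bounded_iff)
  qed
  then obtain B where B: "\<And>\<sigma> x. \<sigma> \<in> spins \<Longrightarrow> x \<in> {0..1} \<Longrightarrow> \<bar>\<phi> (x, \<sigma>)\<bar> \<le> B \<sigma>"
    by metis
  have per: "periodic_V \<phi>" using assms by (simp add: C_V_def)
  have "\<bar>\<phi> (x, \<sigma>)\<bar> \<le> B \<sigma>" if "\<sigma> \<in> spins" for x \<sigma>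
    using B[OF that, of "frac x"] periodic_V_frac[OF per that, of x] frac_lt_1[of x]
    by (auto simp: less_imp_le)
  then have B': "\<bar>\<phi> (x, 1)\<bar> \<le> B 1" "\<bar>\<phi> (x, -1)\<bar> \<le> B (-1)" for x
    by auto
  have "\<bar>\<phi> (x, \<sigma>)\<bar> \<le> 1 + \<bar>B 1\<bar> + \<bar>B (-1)\<bar>" if "\<sigma> \<in> spins" for x \<sigma>
    using that by (cases rule: spins_cases) (use B'[of x] in auto)
  then show ?thesis by (intro that[of "1 + \<bar>B 1\<bar> + \<bar>B (-1)\<bar>"]) auto
qed

lemma C_V_const [simp]: "(\<lambda>_. k) \<in> C_V"
  by (auto simp: C_V_def periodic_V_def)

lemma C_V_cmult: "\<phi> \<in> C_V \<Longrightarrow> (\<lambda>v. k * \<phi> v) \<in> C_V"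
  by (auto simp: C_V_def periodic_V_def intro!: continuous_intros)

lemma C_V_add: "\<phi> \<in> C_V \<Longrightarrow> \<psi> \<in> C_V \<Longrightarrow> (\<lambda>v. \<phi> v + \<psi> v) \<in> C_V"
  by (auto simp: C_V_def periodic_V_def intro!: continuous_intros)

lemma C_V_diff: "\<phi> \<in> C_V \<Longrightarrow> \<psi> \<in> C_V \<Longrightarrow> (\<lambda>v. \<phi> v - \<psi> v) \<in> C_V"
  by (auto simp: C_V_def periodic_V_def intro!: continuous_intros)

section \<open>Pairings of measures with test functions\<close>

lemma sets_Rep_radon_V: "sets (Rep_radon_V \<beta>) = sets V_space"
  and finite_Rep_radon_V: "finite_measure (Rep_radon_V \<beta>)"
  using Rep_radon_V[of \<beta>] by auto

lemma space_Rep_radon_V: "space (Rep_radon_V \<beta>) = {0..<1} \<times> spins"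
  using sets_eq_imp_space_eq[OF sets_Rep_radon_V] space_V_space by simp

lemma integrable_radon_V:
  assumes "\<phi> \<in> C_V"
  shows "integrable (Rep_radon_V \<beta>) \<phi>"
proof -
  interpret finite_measure "Rep_radon_V \<beta>" by (rule finite_Rep_radon_V)
  obtain B where B: "\<And>x \<sigma>. \<sigma> \<in> spins \<Longrightarrow> \<bar>\<phi> (x, \<sigma>)\<bar> \<le> B"
    using C_V_bounded[OF assms] by metis
  show ?thesis
  proof (rule integrable_const_bound)
    show "AE x in Rep_radon_V \<beta>. norm (\<phi> x) \<le> B"
      using B by (auto simp: space_Rep_radon_V intro!: AE_I2)
    show "\<phi> \<in> borel_measurable (Rep_radon_V \<beta>)"
      using C_V_measurable[OF assms] measurable_cong_sets[OF sets_Rep_radon_V refl] by blast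
  qed
qed

lemma pairing_cong:
  "(\<And>x \<sigma>. x \<in> {0..<1} \<Longrightarrow> \<sigma> \<in> spins \<Longrightarrow> \<phi> (x, \<sigma>) = \<psi> (x, \<sigma>)) \<Longrightarrow> pairing \<beta> \<phi> = pairing \<beta> \<psi>"
  unfolding pairing_def by (intro Bochner_Integration.integral_cong) (auto simp: space_Rep_radon_V)

lemma pairing_add:
  "\<phi> \<in> C_V \<Longrightarrow> \<psi> \<in> C_V \<Longrightarrow> pairing \<beta> (\<lambda>v. \<phi> v + \<psi> v) = pairing \<beta> \<phi> + pairing \<beta> \<psi>"
  by (simp add: pairing_def integrable_radon_V)

lemma pairing_diff:
  "\<phi> \<in> C_V \<Longrightarrow> \<psi> \<in> C_V \<Longrightarrow> pairing \<beta> (\<lambda>v. \<phi> v - \<psi> v) = pairing \<beta> \<phi> - pairing \<beta> \<psi>"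
  by (simp add: pairing_def integrable_radon_V)

lemma pairing_cmult: "pairing \<beta> (\<lambda>v. k * \<phi> v) = k * pairing \<beta> \<phi>"
  by (simp add: pairing_def)

lemma pairing_one_nonneg: "0 \<le> pairing \<beta> (\<lambda>_. 1)"
  by (simp add: pairing_def)

lemma abs_pairing_le:
  assumes "\<phi> \<in> C_V" "\<And>x \<sigma>. \<sigma> \<in> spins \<Longrightarrow> \<bar>\<phi> (x, \<sigma>)\<bar> \<le> B"
  shows "\<bar>pairing \<beta> \<phi>\<bar> \<le> B * pairing \<beta> (\<lambda>_. 1)"
proof -
  have "\<bar>pairing \<beta> \<phi>\<bar> \<le> (\<integral>v. \<bar>\<phi> v\<bar> \<partial>Rep_radon_V \<beta>)"
    unfolding pairing_def by (rule integral_abs_bound)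
  also have "\<dots> \<le> (\<integral>v. B \<partial>Rep_radon_V \<beta>)"
    using assms integrable_radon_V[OF C_V_const]
    by (intro integral_mono integrable_abs integrable_radon_V) (auto simp: space_Rep_radon_V)
  finally show ?thesis by (simp add: pairing_def mult.commute)
qed

text \<open>Basic neighbourhoods are cut out by finitely many pairings, and finitely many eventual
  conditions hold simultaneously; so weak convergence may be tested one function at a time.\<close>

lemma tendsto_radon_V_iff:
  "(f \<longlongrightarrow> \<beta>) F \<longleftrightarrow> (\<forall>\<phi>\<in>C_V. ((\<lambda>t. pairing (f t) \<phi>) \<longlongrightarrow> pairing \<beta> \<phi>) F)"
proof
  assume L: "(f \<longlongrightarrow> \<beta>) F"
  show "\<forall>\<phi>\<in>C_V. ((\<lambda>t. pairing (f t) \<phi>) \<longlongrightarrow> pairing \<beta> \<phi>) F"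
  proof
    fix \<phi> assume \<phi>: "\<phi> \<in> C_V"
    show "((\<lambda>t. pairing (f t) \<phi>) \<longlongrightarrow> pairing \<beta> \<phi>) F"
    proof (rule tendstoI)
      fix e :: real assume "0 < e"
      then have "eventually (\<lambda>(x', y). x' = \<beta> \<longrightarrow> dist (pairing y \<phi>) (pairing \<beta> \<phi>) < e) uniformity"
        unfolding eventually_uniformity_radon_V using \<phi>
        by (intro exI[of _ "{\<phi>}"] exI[of _ e]) (auto simp: dist_real_def abs_minus_commute)
      then have "eventually (\<lambda>y. dist (pairing y \<phi>) (pairing \<beta> \<phi>) < e) (nhds \<beta>)"
        by (simp add: eventually_nhds_uniformity)
      with L show "eventually (\<lambda>t. dist (pairing (f t) \<phi>) (pairing \<beta> \<phi>) < e) F"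
        unfolding filterlim_iff by blast
    qed
  qed
next
  assume R: "\<forall>\<phi>\<in>C_V. ((\<lambda>t. pairing (f t) \<phi>) \<longlongrightarrow> pairing \<beta> \<phi>) F"
  show "(f \<longlongrightarrow> \<beta>) F"
    unfolding filterlim_iff
  proof (intro allI impI)
    fix Q assume "eventually Q (nhds \<beta>)"
    then obtain \<Phi> e where \<Phi>: "finite \<Phi>" "\<Phi> \<subseteq> C_V" "0 < e"
      and Q: "\<And>\<gamma>. (\<forall>\<phi>\<in>\<Phi>. \<bar>pairing \<beta> \<phi> - pairing \<gamma> \<phi>\<bar> < e) \<Longrightarrow> Q \<gamma>"
      unfolding eventually_nhds_uniformity eventually_uniformity_radon_V by auto
    have "eventually (\<lambda>t. \<forall>\<phi>\<in>\<Phi>. \<bar>pairing \<beta> \<phi> - pairing (f t) \<phi>\<bar> < e) F"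
      using \<Phi> R
      by (intro eventually_ball_finite ballI)
         (fastforce dest: tendstoD[where e = e] simp: dist_real_def abs_minus_commute)+
    then show "eventually (\<lambda>t. Q (f t)) F"
      by eventually_elim (rule Q)
  qed
qed

lemma pairing_empirical:
  assumes "0 < N" "\<phi> \<in> C_V"
  shows "pairing (empirical N \<eta>) \<phi> =
    (\<Sum>(x, \<sigma>)\<in>sites N. real (\<eta> (x, \<sigma>)) * \<phi> (of_int x / real N, \<sigma>)) / real N"
proof -
  let ?g = "\<lambda>(x :: int, \<sigma> :: int). (of_int x / real N, \<sigma>)"
  let ?m = "point_measure (sites N) (\<lambda>v. ennreal (real (\<eta> v) / real N))"
  have g: "?g \<in> measurable ?m V_space"
    using assms(1) by (auto simp: V_space_def space_pair_measure sites_def space_restrict_space)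
  have "pairing (empirical N \<eta>) \<phi> = (\<integral>v. \<phi> v \<partial>distr ?m V_space ?g)"
    by (simp add: pairing_def empirical.rep_eq)
  also have "\<dots> = (\<integral>v. \<phi> (?g v) \<partial>?m)"
    by (rule integral_distr[OF g C_V_measurable[OF assms(2)]])
  also have "\<dots> = (\<Sum>v\<in>sites N. (real (\<eta> v) / real N) * \<phi> (?g v))"
    by (subst lebesgue_integral_point_measure_finite) auto
  finally show ?thesis
    by (simp add: sum_divide_distrib case_prod_unfold)
qed

lemma has_density_pairing:
  assumes d: "has_density_V \<beta> r" and \<phi>: "\<phi> \<in> C_V"
  shows "pairing \<beta> \<phi> = (\<Sum>\<sigma>\<in>spins. LBINT x:{0..1}. r (x, \<sigma>) * \<phi> (x, \<sigma>))"
proof -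
  let ?A = "restrict_space lborel {0..<1 :: real}"
  have r: "r \<in> borel_measurable leb_V" "\<And>v. v \<in> space leb_V \<Longrightarrow> 0 \<le> r v"
    and R: "Rep_radon_V \<beta> = density leb_V (\<lambda>v. ennreal (r v))"
    using d measurable_cong_sets[OF sets_leb_V refl] unfolding has_density_V_def
    by (auto simp: space_V_space space_leb_V)
  have \<phi>m: "\<phi> \<in> borel_measurable leb_V"
    using C_V_measurable[OF \<phi>] measurable_cong_sets[OF sets_leb_V refl] by blast
  have int: "integrable leb_V (\<lambda>v. r v * \<phi> v)"
    using integrable_radon_V[OF \<phi>, of \<beta>] r \<phi>m unfolding R
    by (subst (asm) integrable_density) (auto intro!: AE_I2)
  have eq: "pairing \<beta> \<phi> = (\<integral>v. r v * \<phi> v \<partial>leb_V)"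
    unfolding pairing_def R using r \<phi>m
    by (subst integral_density) (auto intro!: AE_I2)
  have sf: "sigma_finite_measure ?A"
    by (rule sigma_finite_measure_restrict_space) (auto intro: lborel.sigma_finite_measure_axioms)
  interpret A: sigma_finite_measure ?A by (rule sf)
  interpret B: sigma_finite_measure "count_space spins"
    by (rule sigma_finite_measure_count_space_finite) simp
  interpret pair_sigma_finite ?A "count_space spins" ..
  have int': "integrable (?A \<Otimes>\<^sub>M count_space spins) (case_prod (\<lambda>x \<sigma>. r (x, \<sigma>) * \<phi> (x, \<sigma>)))"
    using int unfolding leb_V_def by (simp add: case_prod_unfold)
  have "(\<integral>v. r v * \<phi> v \<partial>leb_V) = (\<integral>\<sigma>. (\<integral>x. r (x, \<sigma>) * \<phi> (x, \<sigma>) \<partial>?A) \<partial>count_space spins)"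
    unfolding leb_V_def by (subst integral_snd[OF int']) (simp add: case_prod_unfold)
  also have "\<dots> = (\<Sum>\<sigma>\<in>spins. \<integral>x. r (x, \<sigma>) * \<phi> (x, \<sigma>) \<partial>?A)"
    by (rule lebesgue_integral_count_space_finite) simp
  also have "\<dots> = (\<Sum>\<sigma>\<in>spins. LBINT x:{0..1}. r (x, \<sigma>) * \<phi> (x, \<sigma>))"
  proof (rule sum.cong[OF refl])
    fix \<sigma> :: int assume \<sigma>: "\<sigma> \<in> spins"
    have "(\<lambda>x. (x, \<sigma>)) \<in> measurable ?A leb_V"
      unfolding leb_V_def using \<sigma> by (intro measurable_Pair) auto
    then have m: "(\<lambda>x. r (x, \<sigma>) * \<phi> (x, \<sigma>)) \<in> borel_measurable ?A"
      using r(1) \<phi>m by (intro borel_measurable_times) (erule measurable_compose, assumption)+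
    have m': "(\<lambda>x. indicator {0..<1} x *\<^sub>R (r (x, \<sigma>) * \<phi> (x, \<sigma>))) \<in> borel_measurable lborel"
      using m by (simp add: borel_measurable_restrict_space_iff)
    \<comment> \<open>\<open>inner_V\<close> integrates over the closed interval, while
      \<open>r\<close> is only known to be measurable on the half-open one. Splitting off the single
      point 1 makes the closed integrand measurable, whatever \<open>r\<close> is there.\<close>
    have eq: "indicator {0..1} x *\<^sub>R (r (x, \<sigma>) * \<phi> (x, \<sigma>)) =
        indicator {0..<1} x *\<^sub>R (r (x, \<sigma>) * \<phi> (x, \<sigma>)) +
        indicator {1} x *\<^sub>R (r (1, \<sigma>) * \<phi> (1, \<sigma>))" for x
      by (auto simp: indicator_def)
    have m'': "(\<lambda>x. indicator {0..1} x *\<^sub>R (r (x, \<sigma>) * \<phi> (x, \<sigma>))) \<in> borel_measurable lborel"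
      unfolding eq using m' by measurable
    have "(\<integral>x. r (x, \<sigma>) * \<phi> (x, \<sigma>) \<partial>?A) = (LBINT x:{0..<1}. r (x, \<sigma>) * \<phi> (x, \<sigma>))"
      unfolding set_lebesgue_integral_def by (subst integral_restrict_space) auto
    also have "\<dots> = (LBINT x:{0..1}. r (x, \<sigma>) * \<phi> (x, \<sigma>))"
      unfolding set_lebesgue_integral_def
    proof (rule integral_cong_AE[OF m' m''])
      show "AE x in lborel. indicator {0..<1} x *\<^sub>R (r (x, \<sigma>) * \<phi> (x, \<sigma>)) =
          indicator {0..1} x *\<^sub>R (r (x, \<sigma>) * \<phi> (x, \<sigma>))"
        using AE_lborel_singleton[of 1] by eventually_elim (auto simp: indicator_def)
    qed
    finally show "(\<integral>x. r (x, \<sigma>) * \<phi> (x, \<sigma>) \<partial>?A) = (LBINT x:{0..1}. r (x, \<sigma>) * \<phi> (x, \<sigma>))" .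
  qed
  finally show ?thesis using eq by simp
qed

lemma has_density_pairing_inner:
  "has_density_V \<beta> r \<Longrightarrow> \<phi> \<in> C_V \<Longrightarrow> pairing \<beta> \<phi> = inner_V r \<phi>"
  by (simp add: has_density_pairing inner_V_def)

text \<open>A phase replaces the distinction of sine and cosine: the spatial derivative is
  \<open>2 * pi * k\<close> times the mode with phase \<open>b + pi / 2\<close>, and phase
  \<open>pi\<close> gives the negative of phase 0, so the phases 0 and \<open>pi / 2\<close>
  suffice.\<close>

definition mode :: "int \<Rightarrow> int \<Rightarrow> real \<Rightarrow> real \<times> int \<Rightarrow> real" where
  "mode k \<sigma> b = (\<lambda>(x, \<tau>). of_bool (\<tau> = \<sigma>) * cos (2 * pi * k * x + b))"

lemma cos_period_mode: "cos (2 * pi * of_int k * (x + 1) + b) = cos (2 * pi * of_int k * x + b)"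
  using sin_cos_eq_iff[of "2 * pi * of_int k * (x + 1) + b" "2 * pi * of_int k * x + b"]
  by (auto simp: algebra_simps)

lemma mode_C_V [simp]: "mode k \<sigma> b \<in> C_V"
  unfolding C_V_def periodic_V_def mode_def
  by (auto simp: cos_period_mode intro!: continuous_intros)

section \<open>Trigonometric polynomials and their density\<close>

inductive_set trig :: "(real \<Rightarrow> real) set" where
  cos: "(\<lambda>t. cos (of_int k * t)) \<in> trig"
| sin: "(\<lambda>t. sin (of_int k * t)) \<in> trig"
| add: "p \<in> trig \<Longrightarrow> q \<in> trig \<Longrightarrow> (\<lambda>t. p t + q t) \<in> trig"
| scale: "p \<in> trig \<Longrightarrow> (\<lambda>t. r * p t) \<in> trig"

text \<open>The product-to-sum formulas settle products of two generators, and a double induction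
  extends this to all products. It makes the set an algebra, as Stone-Weierstrass demands.\<close>

lemma trig_mult:
  assumes "p \<in> trig" "q \<in> trig"
  shows "(\<lambda>t. p t * q t) \<in> trig"
proof -
  have cc: "(\<lambda>t. cos (of_int j * t) * cos (of_int k * t)) \<in> trig" for j k
  proof -
    have "(\<lambda>t. (1/2) * (cos (of_int (j - k) * t) + cos (of_int (j + k) * t))) \<in> trig"
      by (intro trig.intros)
    then show ?thesis by (simp add: cos_times_cos algebra_simps add_divide_distrib)
  qed
  have ss: "(\<lambda>t. sin (of_int j * t) * sin (of_int k * t)) \<in> trig" for j k
  proof -
    have "(\<lambda>t. (1/2) * (cos (of_int (j - k) * t) + (-1) * cos (of_int (j + k) * t))) \<in> trig"
      by (intro trig.intros)
    then show ?thesis by (simp add: sin_times_sin algebra_simps diff_divide_distrib)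
  qed
  have sc: "(\<lambda>t. sin (of_int j * t) * cos (of_int k * t)) \<in> trig" for j k
  proof -
    have "(\<lambda>t. sin (of_int j * t) * cos (of_int k * t)) =
        (\<lambda>t :: real. (1/2) * (sin (of_int (j + k) * t) + sin (of_int (j - k) * t)))"
      by (rule ext) (simp only: sin_times_cos of_int_add of_int_diff distrib_right left_diff_distrib; linarith)
    then show ?thesis by (simp only:) (intro trig.intros)
  qed
  have cp: "(\<lambda>t. cos (of_int j * t) * q t) \<in> trig" for j
    using assms(2)
  proof induction
    case (add p q)
    then show ?case using trig.add by (fastforce simp: distrib_left)
  next
    case (scale p r)
    then show ?case using trig.scale[OF scale.IH, of r] by (simp add: mult.left_commute)
  qed (use cc sc in \<open>simp_all add: mult.commute\<close>)
  have sp: "(\<lambda>t. sin (of_int j * t) * q t) \<in> trig" for j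
    using assms(2)
  proof induction
    case (add p q)
    then show ?case using trig.add by (fastforce simp: distrib_left)
  next
    case (scale p r)
    then show ?case using trig.scale[OF scale.IH, of r] by (simp add: mult.left_commute)
  qed (use sc ss in simp_all)
  show ?thesis
    using assms(1)
  proof induction
    case (add p q)
    then show ?case using trig.add by (fastforce simp: distrib_right)
  next
    case (scale p r)
    then show ?case using trig.scale[OF scale.IH, of r] by (simp add: mult.assoc)
  qed (use cp sp in simp_all)
qed

text \<open>A function of period 1 is a function on the unit circle, which is compact, so
  Stone-Weierstrass applies there; \<open>Re\<close> and \<open>Im\<close> separate points and pull
  back to cosine and sine. The work lies in the continuity of the function transported to the
  circle.\<close>

lemma trig_dense:
  fixes f :: "real \<Rightarrow> real"
  assumes f: "continuous_on UNIV f" and per: "\<And>x. f (x + 1) = f x" and "0 < e"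
  obtains p where "p \<in> trig" "\<And>x. \<bar>f x - p (2 * pi * x)\<bar> < e"
proof -
  have per_int: "f (x + of_int n) = f x" for x n
    using periodic_V_int[of "\<lambda>(x, _). f x" 1 x n] per by (simp add: periodic_V_def)
  have f_eq: "f (a / (2 * pi)) = f (b / (2 * pi))" if ab: "cis a = cis b" for a b
  proof -
    have "sin a = sin b \<and> cos a = cos b" using ab by (simp add: complex_eq_iff)
    then obtain n :: int where "a = b + 2 * pi * n" by (auto simp: sin_cos_eq_iff)
    then have "a / (2 * pi) = b / (2 * pi) + of_int n" by (simp add: field_simps)
    then show ?thesis using per_int by simp
  qed
  define g where "g z = f (Arg z / (2 * pi))" for z
  have g_cis: "g (cis t) = f (t / (2 * pi))" for t
    unfolding g_def by (rule f_eq) (simp add: cis_Arg sgn_div_norm)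
  \<comment> \<open>\<open>Arg\<close> jumps on the negative real axis. This second formula for the
    same function is continuous there.\<close>
  have g_minus: "g z = f ((Arg (- z) + pi) / (2 * pi))" if "z \<noteq> 0" for z
    unfolding g_def
  proof (rule f_eq)
    have "cis (Arg (- z) + pi) = - cis (Arg (- z))" by (simp add: complex_eq_iff)
    also have "\<dots> = cis (Arg z)" using that by (simp add: cis_Arg sgn_div_norm)
    finally show "cis (Arg z) = cis (Arg (- z) + pi)" by simp
  qed
  have isCont_f: "isCont f x" for x
    using f by (simp add: continuous_on_eq_continuous_at)
  have isCont_g: "isCont g z" if z: "z \<noteq> 0" for z
  proof (cases "z \<in> \<real>\<^sub>\<le>\<^sub>0")
    case False
    then show ?thesis unfolding g_def
      by (intro isCont_o2[OF _ isCont_f] continuous_intros continuous_at_Arg) auto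
  next
    case True
    with z have "- z \<notin> \<real>\<^sub>\<le>\<^sub>0"
      by (auto simp: complex_nonpos_Reals_iff complex_eq_iff)
    then have "isCont (\<lambda>z. f ((Arg (- z) + pi) / (2 * pi))) z"
      by (intro isCont_o2[OF _ isCont_f] continuous_intros isCont_o2[OF _ continuous_at_Arg]) auto
    moreover have "\<forall>\<^sub>F w in nhds z. g w = f ((Arg (- w) + pi) / (2 * pi))"
      using z g_minus by (auto simp: eventually_nhds intro!: exI[of _ "- {0}"])
    ultimately show ?thesis using isCont_cong by fast
  qed
  let ?R = "{h :: complex \<Rightarrow> real. continuous_on (sphere 0 1) h \<and> (\<lambda>t. h (cis t)) \<in> trig}"
  interpret function_ring_on ?R "sphere 0 1 :: complex set"
  proof
    show "compact (sphere 0 1 :: complex set)" by simp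
  next
    fix f g assume "f \<in> ?R" "g \<in> ?R"
    then show "(\<lambda>x. f x + g x) \<in> ?R" "(\<lambda>x. f x * g x) \<in> ?R"
      by (auto intro!: continuous_intros trig_mult trig.add)
  next
    fix c :: real
    show "(\<lambda>_. c) \<in> ?R" using trig.scale[OF trig.cos[of 0], of c] by simp
  next
    fix x y :: complex assume "x \<noteq> y"
    then have "Re x \<noteq> Re y \<or> Im x \<noteq> Im y" by (simp add: complex_eq_iff)
    moreover have "Re \<in> ?R" "Im \<in> ?R"
      using trig.cos[of 1] trig.sin[of 1] by (auto intro!: continuous_intros)
    ultimately show "\<exists>f\<in>?R. f x \<noteq> f y" by blast
  qed auto
  have "continuous_on (sphere 0 1) g"
    by (intro continuous_at_imp_continuous_on ballI isCont_g) auto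
  from Stone_Weierstrass_basic[OF this \<open>0 < e\<close>] obtain h
    where h: "h \<in> ?R" "\<And>z. z \<in> sphere 0 1 \<Longrightarrow> \<bar>g z - h z\<bar> < e" by blast
  show ?thesis
  proof (rule that)
    show "(\<lambda>t. h (cis t)) \<in> trig" using h by simp
    show "\<bar>f x - h (cis (2 * pi * x))\<bar> < e" for x
      using h(2)[of "cis (2 * pi * x)"] g_cis[of "2 * pi * x"] by simp
  qed
qed

lemma C_V_layer:
  assumes "continuous_on UNIV f" "\<And>x. f (x + 1) = f x"
  shows "(\<lambda>(x, \<tau>). of_bool (\<tau> = \<sigma>) * f x) \<in> C_V"
  unfolding C_V_def periodic_V_def using assms by (auto intro!: continuous_intros)

lemma trig_props:
  assumes "p \<in> trig"
  shows "continuous_on UNIV p" "p (2 * pi * (x + 1)) = p (2 * pi * x)"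
  using assms
proof (induction)
  case (cos k) case 2 show ?case using cos_period_mode[of k x 0] by (simp add: mult_ac)
next
  case (sin k) case 2 show ?case using cos_period_mode[of k x "- (pi / 2)"]
    by (simp add: cos_diff mult_ac)
qed (auto intro!: continuous_intros)

text \<open>Density of the trigonometric polynomials, cast as an induction rule: a property that
  passes to linear combinations and uniform limits needs to be checked on modes only. Both
  uniqueness and convergence are concluded this way.\<close>

lemma C_V_induct [consumes 1, case_names mode add scale limit]:
  assumes "\<phi> \<in> C_V"
    and mode: "\<And>k \<sigma> b. \<sigma> \<in> spins \<Longrightarrow> b \<in> {0, pi / 2} \<Longrightarrow> Pr (mode k \<sigma> b)"
    and add: "\<And>f g. f \<in> C_V \<Longrightarrow> g \<in> C_V \<Longrightarrow> Pr f \<Longrightarrow> Pr g \<Longrightarrow> Pr (\<lambda>v. f v + g v)"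
    and scale: "\<And>f r. f \<in> C_V \<Longrightarrow> Pr f \<Longrightarrow> Pr (\<lambda>v. r * f v)"
    and limit: "\<And>f. f \<in> C_V \<Longrightarrow>
      (\<And>e. 0 < e \<Longrightarrow> \<exists>g\<in>C_V. Pr g \<and> (\<forall>x. \<forall>\<sigma>\<in>spins. \<bar>f (x, \<sigma>) - g (x, \<sigma>)\<bar> \<le> e)) \<Longrightarrow> Pr f"
  shows "Pr \<phi>"
proof (rule limit[OF assms(1)])
  fix e :: real assume e: "0 < e"
  let ?lay = "\<lambda>p \<sigma>. \<lambda>(x, \<tau>). of_bool (\<tau> = \<sigma>) * p (2 * pi * x)"
  have lay: "?lay p \<sigma> \<in> C_V" if "p \<in> trig" for p and \<sigma> :: int
    using trig_props[OF that]
    by (intro C_V_layer) (auto intro!: continuous_on_compose2[of UNIV p] continuous_intros)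
  have Pr_lay: "Pr (?lay p \<sigma>)" if "p \<in> trig" "\<sigma> \<in> spins" for p and \<sigma> :: int
    using that
  proof induction
    case (cos k)
    then show ?case using mode[of \<sigma> 0 k] by (simp add: mode_def mult_ac)
  next
    case (sin k)
    \<comment> \<open>The sine is minus the cosine with phase \<open>pi / 2\<close>.\<close>
    then have "Pr (\<lambda>v. (-1) * mode k \<sigma> (pi / 2) v)" by (intro scale mode) auto
    then show ?case by (simp add: mode_def cos_add case_prod_unfold mult_ac)
  next
    case (add p q)
    then have "Pr (\<lambda>v. ?lay p \<sigma> v + ?lay q \<sigma> v)" by (intro assms(3) lay)
    then show ?case by (simp add: case_prod_unfold distrib_left)
  next
    case (scale p r)
    then have "Pr (\<lambda>v. r * ?lay p \<sigma> v)" by (intro assms(4) lay)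
    then show ?case by (simp add: case_prod_unfold mult.left_commute)
  qed
  have "\<exists>p\<in>trig. \<forall>x. \<bar>\<phi> (x, \<sigma>) - p (2 * pi * x)\<bar> < e" if "\<sigma> \<in> spins" for \<sigma>
  proof -
    have "continuous_on UNIV (\<lambda>x. \<phi> (x, \<sigma>))" "\<And>x. \<phi> (x + 1, \<sigma>) = \<phi> (x, \<sigma>)"
      using assms(1) that by (simp_all add: C_V_def periodic_V_def)
    from trig_dense[OF this e] show ?thesis by metis
  qed
  then obtain p where p: "\<And>\<sigma>. \<sigma> \<in> spins \<Longrightarrow> p \<sigma> \<in> trig"
    "\<And>x \<sigma>. \<sigma> \<in> spins \<Longrightarrow> \<bar>\<phi> (x, \<sigma>) - p \<sigma> (2 * pi * x)\<bar> < e" by metis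
  have "Pr (\<lambda>v. ?lay (p 1) 1 v + ?lay (p (-1)) (-1) v)"
    using p by (intro add lay Pr_lay) auto
  moreover have "\<bar>\<phi> (x, \<sigma>) - (?lay (p 1) 1 (x, \<sigma>) + ?lay (p (-1)) (-1) (x, \<sigma>))\<bar> \<le> e"
    if "\<sigma> \<in> spins" for x \<sigma>
    using that p(2)[OF that, of x] by (cases rule: spins_cases) simp_all
  moreover have "(\<lambda>v. ?lay (p 1) 1 v + ?lay (p (-1)) (-1) v) \<in> C_V"
    using p(1) by (intro C_V_add lay) simp_all
  ultimately show "\<exists>g\<in>C_V. Pr g \<and> (\<forall>x. \<forall>\<sigma>\<in>spins. \<bar>\<phi> (x, \<sigma>) - g (x, \<sigma>)\<bar> \<le> e)"
    by blast
qed

section \<open>Measures on V are determined by their pairings\<close>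

lemma sets_layer:
  assumes "A \<in> sets borel" "\<sigma> \<in> spins"
  shows "(A \<inter> {0..<1}) \<times> {\<sigma>} \<in> sets (Rep_radon_V \<beta>)"
  unfolding sets_Rep_radon_V V_space_def using assms
  by (intro pair_measureI) (auto simp: sets_restrict_space_iff)

text \<open>The truncations \<open>min 1 (n * max 0 (h x))\<close> increase to the indicator of the
  arc, so dominated convergence carries the equality of pairings over to the measure of the arc. For
  \<open>a > 1\<close> the arc is empty.\<close>

lemma measure_arc:
  assumes a: "0 \<le> a" and \<sigma>: "\<sigma> \<in> spins"
    and eq: "\<And>\<phi>. \<phi> \<in> C_V \<Longrightarrow> pairing \<beta> \<phi> = pairing \<gamma> \<phi>"
  shows "measure (Rep_radon_V \<beta>) (({a<..} \<inter> {0..<1}) \<times> {\<sigma>}) =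
    measure (Rep_radon_V \<gamma>) (({a<..} \<inter> {0..<1}) \<times> {\<sigma>})"
proof -
  \<comment> \<open>this product of sines has period 1 and is positive exactly on the arc\<close>
  define h where "h x = sin (pi * (x - a)) * sin (pi * (1 - x))" for x :: real
  define f where "f n x = min 1 (real n * max 0 (h x))" for n x
  define \<phi> where "\<phi> n = (\<lambda>(x :: real, \<tau>). of_bool (\<tau> = \<sigma>) * f n x)" for n
  have h_per: "h (x + 1) = h x" for x
  proof -
    have "sin (pi * (x + 1 - a)) = - sin (pi * (x - a))"
      using sin_periodic_pi[of "pi * (x - a)"] by (simp add: algebra_simps)
    moreover have "sin (pi * (1 - (x + 1))) = - sin (pi * (1 - x))"
      using sin_periodic_pi[of "- (pi * x)"] by (simp add: algebra_simps)
    ultimately show ?thesis by (simp add: h_def)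
  qed
  have h_pos: "0 < h x" if "x \<in> {0..<1}" "a < x" for x
  proof -
    have "pi * (x - a) < pi * 1" "pi * (1 - x) \<le> pi * 1"
      using that a by (intro mult_strict_left_mono mult_left_mono; simp)+
    moreover have "pi * (1 - x) < pi" if "x > 0" using that by simp
    ultimately show ?thesis
      unfolding h_def using that a by (intro mult_pos_pos sin_gt_zero) auto
  qed
  have h_neg: "h x \<le> 0" if "x \<in> {0..<1}" "x \<le> a" "a \<le> 1" for x
  proof -
    have "0 \<le> sin (pi * (a - x))" "0 \<le> sin (pi * (1 - x))"
      using that a by (auto intro!: sin_ge_zero simp: mult_le_cancel_left1)
    moreover have "sin (pi * (x - a)) = - sin (pi * (a - x))"
      using sin_minus[of "pi * (a - x)"] by (simp add: algebra_simps)
    ultimately show ?thesis by (simp add: h_def mult_le_0_iff)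
  qed
  have \<phi>_CV: "\<phi> n \<in> C_V" for n
    unfolding \<phi>_def
  proof (rule C_V_layer)
    show "continuous_on UNIV (f n)"
      unfolding f_def h_def by (intro continuous_intros)
  qed (simp add: f_def h_per)
  have lim: "(\<lambda>n. pairing \<delta> (\<phi> n)) \<longlonglongrightarrow> measure (Rep_radon_V \<delta>) (({a<..} \<inter> {0..<1}) \<times> {\<sigma>})"
    if a1: "a \<le> 1" for \<delta>
  proof -
    interpret finite_measure "Rep_radon_V \<delta>" by (rule finite_Rep_radon_V)
    let ?E = "({a<..} \<inter> {0..<1}) \<times> {\<sigma>}"
    have E: "?E \<in> sets (Rep_radon_V \<delta>)" using \<sigma> by (intro sets_layer) auto
    have "(\<lambda>n. \<integral>v. \<phi> n v \<partial>Rep_radon_V \<delta>) \<longlonglongrightarrow> (\<integral>v. indicator ?E v \<partial>Rep_radon_V \<delta>)"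
    proof (rule integral_dominated_convergence[where w = "\<lambda>_. 1"])
      show "AE v in Rep_radon_V \<delta>. norm (\<phi> n v) \<le> 1" for n
        by (auto simp: \<phi>_def f_def)
      show "AE v in Rep_radon_V \<delta>. (\<lambda>n. \<phi> n v) \<longlonglongrightarrow> indicator ?E v"
      proof (intro AE_I2)
        fix v assume v: "v \<in> space (Rep_radon_V \<delta>)"
        obtain x \<tau> where [simp]: "v = (x, \<tau>)" by fastforce
        have x: "x \<in> {0..<1}" using v by (auto simp: space_Rep_radon_V)
        show "(\<lambda>n. \<phi> n v) \<longlonglongrightarrow> indicator ?E v"
        proof (cases "a < x")
          case True
          then have hx: "0 < h x" using h_pos x by blast
          have "\<forall>\<^sub>F n in sequentially. f n x = 1"
            using eventually_ge_at_top[of "nat \<lceil>1 / h x\<rceil>"]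
          proof eventually_elim
            case (elim n)
            then have "1 / h x \<le> real n" by linarith
            then have "1 \<le> real n * h x" using hx by (simp add: field_simps)
            then show ?case using hx by (simp add: f_def)
          qed
          then have "(\<lambda>n. f n x) \<longlonglongrightarrow> 1" by (rule tendsto_eventually)
          then have "(\<lambda>n. of_bool (\<tau> = \<sigma>) * f n x) \<longlonglongrightarrow> of_bool (\<tau> = \<sigma>) * 1"
            by (intro tendsto_intros)
          then show ?thesis using x True by (auto simp: \<phi>_def)
        next
          case False
          then show ?thesis using h_neg[OF x _ a1] by (simp add: \<phi>_def f_def max_absorb1)
        qed
      qed
    qed (use E in \<open>auto intro!: borel_measurable_integrable[OF integrable_radon_V[OF \<phi>_CV]]\<close>)
    then show ?thesis using E by (simp add: pairing_def)
  qed
  show ?thesis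
  proof (cases "a \<le> 1")
    case True
    have "(\<lambda>n. pairing \<gamma> (\<phi> n)) \<longlonglongrightarrow> measure (Rep_radon_V \<beta>) (({a<..} \<inter> {0..<1}) \<times> {\<sigma>})"
      using lim[OF True, of \<beta>] by (simp add: eq[OF \<phi>_CV])
    then show ?thesis using lim[OF True, of \<gamma>] LIMSEQ_unique by blast
  next
    case False
    then have "{a<..} \<inter> {0..<1} = {}" by auto
    then show ?thesis by simp
  qed
qed

text \<open>Each layer is pushed forward to the real line, where a finite measure is determined by
  its values on half-lines; those are the measures of arcs. The two layers are then put
  together.\<close>

lemma radon_V_eqI:
  assumes eq: "\<And>\<phi>. \<phi> \<in> C_V \<Longrightarrow> pairing \<beta> \<phi> = pairing \<gamma> \<phi>"
  shows "\<beta> = \<gamma>"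
proof -
  define \<nu> where "\<nu> \<delta> \<sigma> = distr (restrict_space (Rep_radon_V \<delta>) ({0..<1} \<times> {\<sigma>})) borel fst"
    for \<delta> and \<sigma> :: int
  have \<nu>: "emeasure (\<nu> \<delta> \<sigma>) A = emeasure (Rep_radon_V \<delta>) ((A \<inter> {0..<1}) \<times> {\<sigma>})"
    if "\<sigma> \<in> spins" "A \<in> sets borel" for \<delta> \<sigma> A
  proof -
    have L: "{0..<1} \<times> {\<sigma>} \<in> sets (Rep_radon_V \<delta>)"
      using sets_layer[of UNIV \<sigma> \<delta>] that by simp
    have m: "fst \<in> measurable (restrict_space (Rep_radon_V \<delta>) ({0..<1} \<times> {\<sigma>})) borel"
    proof (rule measurable_restrict_space1)
      have "fst \<in> measurable V_space borel"
        unfolding V_space_def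
        by (rule measurable_compose[OF measurable_fst])
           (auto intro: measurable_restrict_space1)
      then show "fst \<in> measurable (Rep_radon_V \<delta>) borel"
        using measurable_cong_sets[OF sets_Rep_radon_V refl] by blast
    qed
    have "fst -` A \<inter> space (restrict_space (Rep_radon_V \<delta>) ({0..<1} \<times> {\<sigma>})) = (A \<inter> {0..<1}) \<times> {\<sigma>}"
      using that by (auto simp: space_restrict_space space_Rep_radon_V)
    then show ?thesis
      unfolding \<nu>_def using m that sets.Int[OF L sets.top]
      by (subst emeasure_distr) (auto intro!: emeasure_restrict_space)
  qed
  \<comment> \<open>No arc with \<open>0 \<le> a\<close> contains the point 0. Half-lines that start
    below 0 meet the whole layer, whose mass is the pairing with the mode of frequency 0.\<close>
  have one: "measure (Rep_radon_V \<beta>) ({0..<1} \<times> {\<sigma>}) = measure (Rep_radon_V \<gamma>) ({0..<1} \<times> {\<sigma>})"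
    if "\<sigma> \<in> spins" for \<sigma>
  proof -
    have "pairing \<delta> (mode 0 \<sigma> 0) = measure (Rep_radon_V \<delta>) ({0..<1} \<times> {\<sigma>})" for \<delta>
    proof -
      have "pairing \<delta> (mode 0 \<sigma> 0) = (\<integral>v. indicator ({0..<1} \<times> {\<sigma>}) v \<partial>Rep_radon_V \<delta>)"
        unfolding pairing_def
        by (intro Bochner_Integration.integral_cong)
           (auto simp: space_Rep_radon_V mode_def indicator_def)
      also have "{0..<1} \<times> {\<sigma>} \<subseteq> space (Rep_radon_V \<delta>)"
        using that by (auto simp: space_Rep_radon_V)
      then have "(\<integral>v. indicator ({0..<1} \<times> {\<sigma>}) v \<partial>Rep_radon_V \<delta>) =
          measure (Rep_radon_V \<delta>) ({0..<1} \<times> {\<sigma>})"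
        by (simp add: Int_absorb2)
      finally show ?thesis .
    qed
    then show ?thesis using eq[OF mode_C_V] by metis
  qed
  have fin: "emeasure (Rep_radon_V \<delta>) A = ennreal (measure (Rep_radon_V \<delta>) A)" for \<delta> A
    using finite_measure.emeasure_eq_measure[OF finite_Rep_radon_V] .
  have \<nu>_eq: "\<nu> \<beta> \<sigma> = \<nu> \<gamma> \<sigma>" if \<sigma>: "\<sigma> \<in> spins" for \<sigma>
  proof (rule measure_eqI_lessThan)
    fix x :: real
    show "emeasure (\<nu> \<beta> \<sigma>) {x<..} < \<infinity>" using \<sigma> by (simp add: \<nu> fin)
    show "emeasure (\<nu> \<beta> \<sigma>) {x<..} = emeasure (\<nu> \<gamma> \<sigma>) {x<..}"
    proof (cases "0 \<le> x")
      case True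
      then show ?thesis using measure_arc[OF True \<sigma> eq] \<sigma> by (simp add: \<nu> fin)
    next
      case False
      then have "{x<..} \<inter> {0..<1} = {0..<1}" by auto
      then show ?thesis using one[OF \<sigma>] \<sigma> by (simp add: \<nu> fin)
    qed
  qed (simp_all add: \<nu>_def)
  have "Rep_radon_V \<beta> = Rep_radon_V \<gamma>"
  proof (rule measure_eqI)
    show "sets (Rep_radon_V \<beta>) = sets (Rep_radon_V \<gamma>)" by (simp add: sets_Rep_radon_V)
    fix A assume A: "A \<in> sets (Rep_radon_V \<beta>)"
    have slice: "(\<lambda>x. (x, \<sigma>)) -` A \<inter> {0..<1} \<in> sets borel" if "\<sigma> \<in> spins" for \<sigma>
    proof -
      have "(\<lambda>x. (x, \<sigma>)) \<in> measurable (restrict_space borel {0..<1 :: real}) V_space"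
        unfolding V_space_def using that by (intro measurable_Pair) auto
      then have "(\<lambda>x. (x, \<sigma>)) -` A \<inter> space (restrict_space borel {0..<1 :: real})
          \<in> sets (restrict_space borel {0..<1 :: real})"
        by (rule measurable_sets) (use A sets_Rep_radon_V in blast)
      then show ?thesis by (simp add: sets_restrict_space_iff space_restrict_space)
    qed
    have A_eq: "emeasure (Rep_radon_V \<delta>) A =
        (\<Sum>\<sigma>\<in>spins. emeasure (\<nu> \<delta> \<sigma>) ((\<lambda>x. (x, \<sigma>)) -` A \<inter> {0..<1}))"
      for \<delta>
    proof -
      have "A \<subseteq> {0..<1} \<times> spins" using sets.sets_into_space[OF A] space_Rep_radon_V by simp
      then have "A = (\<Union>\<sigma>\<in>spins. (((\<lambda>x. (x, \<sigma>)) -` A \<inter> {0..<1}) \<inter> {0..<1}) \<times> {\<sigma>})"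
        by auto
      then have "emeasure (Rep_radon_V \<delta>) A = emeasure (Rep_radon_V \<delta>)
          (\<Union>\<sigma>\<in>spins. (((\<lambda>x. (x, \<sigma>)) -` A \<inter> {0..<1}) \<inter> {0..<1}) \<times> {\<sigma>})"
        by simp
      also have "\<dots> = (\<Sum>\<sigma>\<in>spins. emeasure (Rep_radon_V \<delta>)
          ((((\<lambda>x. (x, \<sigma>)) -` A \<inter> {0..<1}) \<inter> {0..<1}) \<times> {\<sigma>}))"
        by (rule sum_emeasure[symmetric])
           (auto simp: disjoint_family_on_def intro!: sets_layer[OF slice, simplified])
      also have "\<dots> = (\<Sum>\<sigma>\<in>spins. emeasure (\<nu> \<delta> \<sigma>) ((\<lambda>x. (x, \<sigma>)) -` A \<inter> {0..<1}))"
        by (intro sum.cong refl \<nu>[symmetric] slice)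
      finally show ?thesis .
    qed
    show "emeasure (Rep_radon_V \<beta>) A = emeasure (Rep_radon_V \<gamma>) A"
      unfolding A_eq by (intro sum.cong refl) (simp add: \<nu>_eq)
  qed
  then show ?thesis by (simp add: Rep_radon_V_inject)
qed

section \<open>The semigroup on configurations with a fixed number of particles\<close>

definition particles :: "nat \<Rightarrow> (int \<times> int \<Rightarrow> nat) \<Rightarrow> nat" where
  "particles N \<eta> = (\<Sum>v\<in>sites N. \<eta> v)"

definition sector :: "nat \<Rightarrow> nat \<Rightarrow> (int \<times> int \<Rightarrow> nat) set" where
  "sector N K = {\<eta> \<in> configs N. particles N \<eta> = K}"

lemma sector_subset: "sector N K \<subseteq> configs N"
  by (auto simp: sector_def)

lemma finite_sector [simp]: "finite (sector N K)"
proof (rule finite_subset)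
  show "sector N K \<subseteq> {\<eta>. \<forall>v. (v \<in> sites N \<longrightarrow> \<eta> v \<in> {..K}) \<and> (v \<notin> sites N \<longrightarrow> \<eta> v = 0)}"
  proof (intro subsetI CollectI allI conjI impI)
    fix \<eta> v assume \<eta>: "\<eta> \<in> sector N K"
    show "\<eta> v \<in> {..K}" if "v \<in> sites N"
      using member_le_sum[OF that, of \<eta>] \<eta> by (auto simp: sector_def particles_def)
    show "\<eta> v = 0" if "v \<notin> sites N"
      using \<eta> that unfolding sector_def configs_def by blast
  qed
  show "finite {\<eta>. \<forall>v. (v \<in> sites N \<longrightarrow> \<eta> v \<in> {..K}) \<and> (v \<notin> sites N \<longrightarrow> \<eta> v = 0)}"
    by (intro finite_set_of_finite_funs) auto
qed

lemma countable_configs: "countable (configs N)"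
proof -
  have "configs N = (\<Union>K. sector N K)"
    by (auto simp: sector_def)
  then show ?thesis
    by (metis countable_UN countable_finite finite_sector uncountable_infinite countableI_type)
qed

lemma sum_move:
  fixes w :: "int \<times> int \<Rightarrow> real"
  assumes "v \<in> sites N" "u \<in> sites N" "0 < \<eta> v"
  shows "(\<Sum>a\<in>sites N. w a * real (move v u \<eta> a)) = (\<Sum>a\<in>sites N. w a * real (\<eta> a)) + w u - w v"
proof -
  \<comment> \<open>As \<open>\<eta> v\<close> is positive, the truncated subtraction in
    \<open>move\<close> is exact. The formula also covers \<open>u = v\<close>, a jump that changes
    nothing and occurs for \<open>N = 1\<close>.\<close>
  have "real (move v u \<eta> a) = real (\<eta> a) + of_bool (a = u) - of_bool (a = v)" for a
    using assms(3) by (auto simp: move_def Let_def of_nat_diff)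
  then have "(\<Sum>a\<in>sites N. w a * real (move v u \<eta> a)) =
      (\<Sum>a\<in>sites N. w a * real (\<eta> a) + w a * of_bool (a = u) - w a * of_bool (a = v))"
    by (intro sum.cong refl) (simp only: right_diff_distrib distrib_left)
  also have "\<dots> = (\<Sum>a\<in>sites N. w a * real (\<eta> a)) + w u - w v"
  proof -
    have "(\<Sum>a\<in>sites N. w a * of_bool (a = b)) = w b" if "b \<in> sites N" for b
    proof -
      have "(\<Sum>a\<in>sites N. w a * of_bool (a = b)) = (\<Sum>a\<in>sites N. if a = b then w a else 0)"
        by (intro sum.cong) auto
      then show ?thesis using that by simp
    qed
    then show ?thesis using assms(1,2) by (simp add: sum.distrib sum_subtractf)
  qed
  finally show ?thesis .
qed

lemma particles_move:
  assumes "v \<in> sites N" "u \<in> sites N" "0 < \<eta> v"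
  shows "particles N (move v u \<eta>) = particles N \<eta>"
  using sum_move[where w = "\<lambda>_. 1" and \<eta> = \<eta>, OF assms] unfolding particles_def
  by (simp flip: of_nat_sum)

lemma move_sector:
  assumes "v \<in> sites N" "u \<in> sites N" "0 < \<eta> v" "\<eta> \<in> sector N K"
  shows "move v u \<eta> \<in> sector N K"
  using assms particles_move[of v N u \<eta>] by (auto simp: sector_def configs_def move_def Let_def)

lemma step_sites: "0 < N \<Longrightarrow> (x, \<sigma>) \<in> sites N \<Longrightarrow> ((x + \<sigma>) mod int N, \<sigma>) \<in> sites N"
  and flip_sites: "(x, \<sigma>) \<in> sites N \<Longrightarrow> (x, - \<sigma>) \<in> sites N"
  by (auto simp: sites_def)

text \<open>A move out of an empty site would create a particle, but it carries the factor
  \<open>\<eta> v = 0\<close>. All other moves keep the particle number, so at a configuration of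
  the sector the generator sees only values on the sector.\<close>

lemma generator_cong:
  assumes N: "0 < N" and \<eta>: "\<eta> \<in> sector N K" and fg: "\<And>\<zeta>. \<zeta> \<in> sector N K \<Longrightarrow> f \<zeta> = g \<zeta>"
  shows "generator c N f \<eta> = generator c N g \<eta>"
proof -
  have "real (\<eta> v) * (f (move v u \<eta>) - f \<eta>) = real (\<eta> v) * (g (move v u \<eta>) - g \<eta>)"
    if "v \<in> sites N" "u \<in> sites N" for v u
    using fg[OF \<eta>] fg[OF move_sector[OF that _ \<eta>]] by (cases "\<eta> v = 0") auto
  then have "r * real (\<eta> v) * (f (move v u \<eta>) - f \<eta>) = r * real (\<eta> v) * (g (move v u \<eta>) - g \<eta>)"
    if "v \<in> sites N" "u \<in> sites N" for v u r
    using that by (simp add: mult.assoc)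
  with \<open>\<And>v u. \<lbrakk>v \<in> sites N; u \<in> sites N\<rbrakk> \<Longrightarrow> real (\<eta> v) * (f (move v u \<eta>) - f \<eta>) = real (\<eta> v) * (g (move v u \<eta>) - g \<eta>)\<close>
  show ?thesis
    unfolding generator_def
    by (intro arg_cong2[where f = "(+)"] arg_cong2[where f = "(*)"] sum.cong refl)
       (auto simp: step_sites[OF N] flip_sites)
qed

lemma generator_const: "generator c N (\<lambda>_. r) \<eta> = 0"
  by (auto simp: generator_def case_prod_unfold)

lemma expectation_finite_support:
  assumes "finite A" "set_pmf p \<subseteq> A"
  shows "measure_pmf.expectation p f = (\<Sum>a\<in>A. pmf p a * f a)"
proof -
  have "measure_pmf.expectation p f = (\<Sum>a\<in>A. pmf p a *\<^sub>R f a)"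
    using assms by (intro integral_measure_pmf) auto
  then show ?thesis by simp
qed

lemma expectation_bind_finite:
  fixes f :: "'b \<Rightarrow> real"
  assumes "finite A" "set_pmf p \<subseteq> A" "finite B" "\<And>a. a \<in> A \<Longrightarrow> set_pmf (q a) \<subseteq> B"
  shows "measure_pmf.expectation (bind_pmf p q) f =
    measure_pmf.expectation p (\<lambda>a. measure_pmf.expectation (q a) f)"
proof -
  have sub: "set_pmf (bind_pmf p q) \<subseteq> B" using assms by (auto simp: set_bind_pmf)
  have "measure_pmf.expectation (bind_pmf p q) f = (\<Sum>b\<in>B. (\<Sum>a\<in>A. pmf p a * pmf (q a) b) * f b)"
    by (simp add: expectation_finite_support[OF assms(3) sub] pmf_bind
        expectation_finite_support[OF assms(1,2)])
  also have "\<dots> = (\<Sum>a\<in>A. pmf p a * (\<Sum>b\<in>B. pmf (q a) b * f b))"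
    by (simp add: sum_distrib_right sum_distrib_left mult.assoc sum.swap[of _ B A])
  also have "\<dots> = (\<Sum>a\<in>A. pmf p a * measure_pmf.expectation (q a) f)"
    by (intro sum.cong refl) (simp add: expectation_finite_support[OF assms(3,4)])
  also have "\<dots> = measure_pmf.expectation p (\<lambda>a. measure_pmf.expectation (q a) f)"
    by (rule expectation_finite_support[OF assms(1,2), symmetric])
  finally show ?thesis .
qed

section \<open>Invariance of the sectors and the forward equation\<close>

locale particle_semigroup =
  fixes c :: "int \<Rightarrow> real \<Rightarrow> real" and N :: nat
    and P :: "real \<Rightarrow> (int \<times> int \<Rightarrow> nat) \<Rightarrow> (int \<times> int \<Rightarrow> nat) pmf"
  assumes N_pos: "0 < N"
    and semigroup: "markov_semigroup (configs N) P"
    and gen: "has_generator (configs N) P (generator c N)"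
begin

abbreviation L where "L \<equiv> generator c N"

definition E :: "real \<Rightarrow> (int \<times> int \<Rightarrow> nat) \<Rightarrow> ((int \<times> int \<Rightarrow> nat) \<Rightarrow> real) \<Rightarrow> real" where
  "E t x f = measure_pmf.expectation (P t x) f"

lemma P_0: "x \<in> configs N \<Longrightarrow> P 0 x = return_pmf x"
  and P_add: "x \<in> configs N \<Longrightarrow> 0 \<le> s \<Longrightarrow> 0 \<le> t \<Longrightarrow> P (s + t) x = bind_pmf (P s x) (P t)"
  using semigroup by (auto simp: markov_semigroup_def)

lemma gen_bounded:
  assumes "x \<in> configs N" "bounded (f ` configs N)"
  shows "((\<lambda>t. (E t x f - f x) / t) \<longlongrightarrow> L f x) (at_right 0)"
  using gen assms by (auto simp: has_generator_def E_def)

text \<open>The sum over the finite sector bounds the exit probability from every starting point at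
  once and still has a computable rate at time 0.\<close>

definition leak :: "nat \<Rightarrow> real \<Rightarrow> real" where
  "leak K h = (\<Sum>x\<in>sector N K. measure_pmf.prob (P h x) (- sector N K))"

lemma leak_nonneg: "0 \<le> leak K h"
  by (simp add: leak_def sum_nonneg)

lemma prob_le_leak:
  assumes "x \<in> sector N K"
  shows "measure_pmf.prob (P h x) (- sector N K) \<le> leak K h"
  unfolding leak_def
  by (rule member_le_sum[OF assms, of "\<lambda>x. measure_pmf.prob (P h x) (- sector N K)"]) auto

text \<open>The indicator of the complement is bounded, hence admissible for the generator, and on
  the sector the generator treats it like the zero function.\<close>

lemma leak_small: "((\<lambda>h. leak K h / h) \<longlongrightarrow> 0) (at_right 0)"
proof -
  have "((\<lambda>h. measure_pmf.prob (P h x) (- sector N K) / h) \<longlongrightarrow> 0) (at_right 0)"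
    if x: "x \<in> sector N K" for x
  proof -
    let ?f = "indicator (- sector N K) :: _ \<Rightarrow> real"
    have xc: "x \<in> configs N" using x sector_subset by blast
    have "bounded (?f ` configs N)" by (auto simp: bounded_iff indicator_def intro!: exI[of _ 1])
    from gen_bounded[OF xc this]
    have "((\<lambda>t. (E t x ?f - ?f x) / t) \<longlongrightarrow> L ?f x) (at_right 0)" .
    moreover have "L ?f x = L (\<lambda>_. 0) x"
      by (rule generator_cong[OF N_pos x]) auto
    ultimately show ?thesis
      using x by (simp add: generator_const E_def)
  qed
  then have "((\<lambda>h. \<Sum>x\<in>sector N K. measure_pmf.prob (P h x) (- sector N K) / h)
      \<longlongrightarrow> (\<Sum>x\<in>sector N K. 0)) (at_right 0)"
    by (intro tendsto_sum)
  then show ?thesis by (simp add: leak_def sum_divide_distrib)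
qed

text \<open>The exit probability is subadditive in time, so it vanishes because its rate at time 0 does.\<close>

lemma leak_iterate:
  assumes "0 \<le> h" "x \<in> sector N K"
  shows "measure_pmf.prob (P (real n * h) x) (- sector N K) \<le> real n * leak K h"
  using assms(2)
proof (induction n arbitrary: x)
  case 0
  then have "P 0 x = return_pmf x" using P_0 sector_subset by blast
  then show ?case using 0 by (simp add: indicator_def)
next
  case (Suc n)
  have xc: "x \<in> configs N" using Suc.prems sector_subset by blast
  let ?S = "- sector N K"
  have "P (real (Suc n) * h) x = bind_pmf (P (real n * h) x) (P h)"
    using P_add[OF xc, of "real n * h" h] assms(1) by (simp add: algebra_simps)
  then have "emeasure (P (real (Suc n) * h) x) ?S = (\<integral>\<^sup>+y. emeasure (P h y) ?S \<partial>P (real n * h) x)"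
    by simp
  \<comment> \<open>A path that is outside after n steps is charged the full probability 1, one that
    is inside the quantity \<open>leak\<close>.\<close>
  also have "\<dots> \<le> (\<integral>\<^sup>+y. indicator ?S y + ennreal (leak K h) \<partial>P (real n * h) x)"
  proof (intro nn_integral_mono)
    fix y
    show "emeasure (P h y) ?S \<le> indicator ?S y + ennreal (leak K h)"
    proof (cases "y \<in> sector N K")
      case True
      then show ?thesis using prob_le_leak[OF True]
        by (simp add: measure_pmf.emeasure_eq_measure ennreal_leI)
    next
      case False
      then show ?thesis
        using measure_pmf.emeasure_le_1[of "P h y" ?S]
        by (simp add: add_increasing2)
    qed
  qed
  also have "\<dots> = emeasure (P (real n * h) x) ?S + ennreal (leak K h)"
    by (simp add: nn_integral_add)
  also have "\<dots> \<le> ennreal (real n * leak K h) + ennreal (leak K h)"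
    using Suc.IH[OF Suc.prems]
    by (intro add_right_mono) (simp add: measure_pmf.emeasure_eq_measure ennreal_leI)
  also have "\<dots> = ennreal (real (Suc n) * leak K h)"
    by (subst ennreal_plus[symmetric]) (simp_all add: leak_nonneg algebra_simps)
  finally show ?case
    by (subst (asm) measure_pmf.emeasure_eq_measure, subst (asm) ennreal_le_iff)
       (simp_all add: leak_nonneg)
qed

text \<open>Conservation of particles is a property of the generator at time 0; for the semigroup at
  positive times it has to be deduced, by cutting the time interval into ever shorter steps.\<close>

lemma set_P_sector:
  assumes "x \<in> sector N K" "0 \<le> t"
  shows "set_pmf (P t x) \<subseteq> sector N K"
proof -
  have "measure_pmf.prob (P t x) (- sector N K) = 0"
  proof (cases "t = 0")
    case True
    then show ?thesis using P_0 assms(1) sector_subset by (simp add: indicator_def subset_iff)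
  next
    case False
    then have t: "0 < t" using assms by simp
    \<comment> \<open>For steps of length \<open>h = t / Suc n\<close> the bound of
      \<open>leak_iterate\<close> is \<open>t * (leak K h / h)\<close>, a difference quotient at
      0.\<close>
    have lim: "filterlim (\<lambda>n. t / real (Suc n)) (at_right 0) sequentially"
    proof (rule tendsto_imp_filterlim_at_right)
      show "(\<lambda>n. t / real (Suc n)) \<longlonglongrightarrow> 0"
        using tendsto_mult_right_zero[OF LIMSEQ_inverse_real_of_nat, of t] by (simp add: divide_inverse)
      show "\<forall>\<^sub>F n in sequentially. t / real (Suc n) > 0" using t by simp
    qed
    have "(\<lambda>n. leak K (t / real (Suc n)) / (t / real (Suc n))) \<longlonglongrightarrow> 0"
      by (rule filterlim_compose[OF leak_small lim])
    from tendsto_mult_right_zero[OF this, of t]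
    have "(\<lambda>n. t * (leak K (t / real (Suc n)) / (t / real (Suc n)))) \<longlonglongrightarrow> 0" .
    moreover have "t * (leak K (t / real (Suc n)) / (t / real (Suc n))) =
        real (Suc n) * leak K (t / real (Suc n))" for n
      using t by (simp del: of_nat_Suc)
    ultimately have "(\<lambda>n. real (Suc n) * leak K (t / real (Suc n))) \<longlonglongrightarrow> 0"
      by (simp only:)
    moreover have "measure_pmf.prob (P t x) (- sector N K) \<le> real (Suc n) * leak K (t / real (Suc n))" for n
    proof -
      have "real (Suc n) * (t / real (Suc n)) = t" by (simp del: of_nat_Suc)
      then show ?thesis using leak_iterate[OF _ assms(1), of "t / real (Suc n)" "Suc n"] t
        by (simp del: of_nat_Suc)
    qed
    ultimately have "measure_pmf.prob (P t x) (- sector N K) \<le> 0"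
      by (intro LIMSEQ_le_const) auto
    then show ?thesis by (simp add: measure_le_0_iff)
  qed
  then show ?thesis
    by (auto simp: measure_pmf_zero_iff)
qed

lemma E_sum: "x \<in> sector N K \<Longrightarrow> 0 \<le> t \<Longrightarrow> E t x f = (\<Sum>y\<in>sector N K. pmf (P t x) y * f y)"
  unfolding E_def by (intro expectation_finite_support set_P_sector) auto

lemma E_0: "x \<in> configs N \<Longrightarrow> E 0 x f = f x"
  by (simp add: E_def P_0)

lemma E_mono:
  assumes "x \<in> sector N K" "0 \<le> t" "\<And>y. y \<in> sector N K \<Longrightarrow> f y \<le> g y"
  shows "E t x f \<le> E t x g"
  using assms by (auto simp: E_sum intro!: sum_mono mult_left_mono)

lemma E_cong:
  assumes "x \<in> sector N K" "0 \<le> t" "\<And>y. y \<in> sector N K \<Longrightarrow> f y = g y"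
  shows "E t x f = E t x g"
  using assms by (auto simp: E_sum)

lemma E_add: "x \<in> sector N K \<Longrightarrow> 0 \<le> t \<Longrightarrow> E t x (\<lambda>y. f y + g y) = E t x f + E t x g"
  by (simp add: E_sum sum.distrib distrib_left)

lemma E_diff: "x \<in> sector N K \<Longrightarrow> 0 \<le> t \<Longrightarrow> E t x (\<lambda>y. f y - g y) = E t x f - E t x g"
  by (simp add: E_sum sum_subtractf right_diff_distrib)

lemma E_cmult: "E t x (\<lambda>y. r * f y) = r * E t x f"
  by (simp add: E_def)

lemma E_const: "E t x (\<lambda>y. r) = r"
  by (simp add: E_def)

lemma abs_E_le:
  assumes "x \<in> sector N K" "0 \<le> t" "\<And>y. y \<in> sector N K \<Longrightarrow> \<bar>f y\<bar> \<le> B"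
  shows "\<bar>E t x f\<bar> \<le> B"
  using E_mono[OF assms(1,2), of f "\<lambda>_. B"] E_mono[OF assms(1,2), of "\<lambda>_. - B" f] assms(3)
  by (force simp: E_const abs_le_iff)

lemma E_semigroup:
  assumes "x \<in> sector N K" "0 \<le> s" "0 \<le> t"
  shows "E (s + t) x f = E s x (\<lambda>y. E t y f)"
proof -
  have "P (s + t) x = bind_pmf (P s x) (P t)"
    using assms sector_subset by (intro P_add) auto
  then show ?thesis unfolding E_def
    using assms by (simp add: expectation_bind_finite[OF finite_sector set_P_sector finite_sector set_P_sector])
qed

text \<open>The generator is prescribed on bounded functions only. On a finite sector any function
  may be cut off to 0 outside, and neither the semigroup nor the generator notices this from within
  the sector.\<close>

lemma gen_sector:
  assumes "x \<in> sector N K"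
  shows "((\<lambda>h. (E h x f - f x) / h) \<longlongrightarrow> L f x) (at_right 0)"
proof -
  let ?g = "\<lambda>y. indicator (sector N K) y * f y"
  have xc: "x \<in> configs N" using assms sector_subset by blast
  have "bounded (?g ` configs N)"
  proof (rule finite_imp_bounded, rule finite_subset)
    show "?g ` configs N \<subseteq> insert 0 (f ` sector N K)" by (auto simp: indicator_def)
  qed simp
  from gen_bounded[OF xc this]
  have "((\<lambda>h. (E h x ?g - ?g x) / h) \<longlongrightarrow> L ?g x) (at_right 0)" .
  moreover have "L ?g x = L f x"
    by (rule generator_cong[OF N_pos assms]) auto
  ultimately have lim: "((\<lambda>h. (E h x ?g - ?g x) / h) \<longlongrightarrow> L f x) (at_right 0)"
    by simp
  have "\<forall>\<^sub>F h in at_right 0. (E h x ?g - ?g x) / h = (E h x f - f x) / h"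
    using eventually_at_right_less[of 0]
  proof eventually_elim
    case (elim h)
    have "E h x ?g = E h x f" using elim by (intro E_cong[OF assms]) auto
    then show ?case using assms by simp
  qed
  from Lim_transform_eventually[OF lim this] show ?thesis .
qed

text \<open>Error of the difference quotient at time 0, summed over the sector: finiteness makes the
  pointwise convergence uniform in the starting point.\<close>

definition gap :: "nat \<Rightarrow> ((int \<times> int \<Rightarrow> nat) \<Rightarrow> real) \<Rightarrow> real \<Rightarrow> real" where
  "gap K f h = (\<Sum>y\<in>sector N K. \<bar>(E h y f - f y) / h - L f y\<bar>)"

lemma gap_tendsto: "(gap K f \<longlongrightarrow> 0) (at_right 0)"
proof -
  have "((\<lambda>h. \<Sum>y\<in>sector N K. \<bar>(E h y f - f y) / h - L f y\<bar>) \<longlongrightarrow> (\<Sum>y\<in>sector N K. \<bar>L f y - L f y\<bar>)) (at_right 0)"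
    by (intro tendsto_sum tendsto_intros gen_sector)
  then show ?thesis unfolding gap_def by simp
qed

text \<open>By the semigroup property an increment at time t is an average of increments at time 0,
  whose error \<open>gap\<close> bounds uniformly.\<close>

lemma E_increment:
  assumes x: "x \<in> sector N K" and t: "0 \<le> t" and h: "0 < h"
  shows "\<bar>E (t + h) x f - E t x f - h * E t x (L f)\<bar> \<le> h * gap K f h"
proof -
  have "E (t + h) x f = E t x (\<lambda>y. E h y f)" using x t h by (intro E_semigroup) auto
  then have "E (t + h) x f - E t x f - h * E t x (L f) = E t x (\<lambda>y. E h y f - f y - h * L f y)"
    using x t by (simp add: E_diff E_cmult)
  moreover have "\<bar>\<dots>\<bar> \<le> h * gap K f h"
  proof (rule abs_E_le[OF x t])
    fix y assume y: "y \<in> sector N K"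
    have "E h y f - f y - h * L f y = h * ((E h y f - f y) / h - L f y)"
      using h by (simp add: field_simps)
    moreover have "\<bar>(E h y f - f y) / h - L f y\<bar> \<le> gap K f h"
      unfolding gap_def by (rule member_le_sum[OF y, of "\<lambda>y. \<bar>(E h y f - f y) / h - L f y\<bar>"]) auto
    ultimately show "\<bar>E h y f - f y - h * L f y\<bar> \<le> h * gap K f h"
      using h by (simp add: abs_mult)
  qed
  ultimately show ?thesis by simp
qed

text \<open>Bounds increments uniformly in t. It is applied to \<open>L f\<close>, to compare its
  expectation at two neighbouring times.\<close>

lemma E_lipschitz:
  assumes x: "x \<in> sector N K"
  obtains C d where "0 < d" "0 \<le> C" "\<And>t h. 0 \<le> t \<Longrightarrow> 0 < h \<Longrightarrow> h < d \<Longrightarrow> \<bar>E (t + h) x f - E t x f\<bar> \<le> C * h"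
proof -
  have "\<forall>\<^sub>F h in at_right 0. gap K f h < 1"
    using order_tendstoD(2)[OF gap_tendsto, of 1] by simp
  then obtain d where d: "0 < d" "\<And>h. 0 < h \<Longrightarrow> h < d \<Longrightarrow> gap K f h < 1"
    by (auto simp: eventually_at_right_field)
  define B where "B = (\<Sum>y\<in>sector N K. \<bar>L f y\<bar>)"
  have B: "\<bar>L f y\<bar> \<le> B" if "y \<in> sector N K" for y
    unfolding B_def by (rule member_le_sum[OF that, of "\<lambda>y. \<bar>L f y\<bar>"]) auto
  show ?thesis
  proof (rule that[OF d(1), of "B + 1"])
    show "0 \<le> B + 1" unfolding B_def by (simp add: sum_nonneg add_nonneg_nonneg)
    fix t h :: real assume t: "0 \<le> t" and h: "0 < h" "h < d"
    have "\<bar>E t x (L f)\<bar> \<le> B" by (rule abs_E_le[OF x t B])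
    then have "\<bar>h * E t x (L f)\<bar> \<le> h * B" using h by (simp add: abs_mult)
    moreover have "h * gap K f h \<le> h * 1" using d(2)[OF h] h by (intro mult_left_mono) auto
    ultimately show "\<bar>E (t + h) x f - E t x f\<bar> \<le> (B + 1) * h"
      using E_increment[OF x t h(1), of f] by (simp add: algebra_simps)
  qed
qed

text \<open>The forward equation. \<open>E_increment\<close> controls right difference quotients; a
  quotient to the left of t is a right quotient at the earlier time s, and the continuity of the
  expectation of \<open>L f\<close> bridges the two times.\<close>

lemma E_has_derivative:
  assumes x: "x \<in> sector N K" and t: "0 \<le> t"
  shows "((\<lambda>s. E s x f) has_real_derivative E t x (L f)) (at t within {0..})"
proof -
  obtain C d where C: "0 < d" "0 \<le> C"
    "\<And>t h. 0 \<le> t \<Longrightarrow> 0 < h \<Longrightarrow> h < d \<Longrightarrow> \<bar>E (t + h) x (L f) - E t x (L f)\<bar> \<le> C * h"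
    using E_lipschitz[OF x, of "L f"] by metis
  have "((\<lambda>h. gap K f h + C * h) \<longlongrightarrow> 0 + C * 0) (at_right 0)"
    by (intro tendsto_intros gap_tendsto)
  show ?thesis
    unfolding has_field_derivative_iff
  proof (rule tendstoI)
    fix e :: real assume e: "0 < e"
    have "\<forall>\<^sub>F h in at_right 0. gap K f h + C * h < e"
      using order_tendstoD(2)[OF \<open>((\<lambda>h. gap K f h + C * h) \<longlongrightarrow> 0 + C * 0) (at_right 0)\<close>, of e] e by simp
    then obtain d' where d': "0 < d'" "\<And>h. 0 < h \<Longrightarrow> h < d' \<Longrightarrow> gap K f h + C * h < e"
      by (auto simp: eventually_at_right_field)
    have main: "\<bar>(E s x f - E t x f) / (s - t) - E t x (L f)\<bar> < e"
      if s: "0 \<le> s" "s \<noteq> t" "\<bar>s - t\<bar> < min d d'" for s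
    proof -
      define h where "h = \<bar>s - t\<bar>"
      have h: "0 < h" "h < d" "h < d'" using s by (auto simp: h_def)
      \<comment> \<open>The earlier of the two times: on either side of t the quotient is a right
        quotient at \<open>a\<close>.\<close>
      define a where "a = min s t"
      have a: "0 \<le> a" "a + h = max s t" using s t by (auto simp: a_def h_def)
      have q: "(E s x f - E t x f) / (s - t) = (E (a + h) x f - E a x f) / h"
        unfolding a(2) using s by (auto simp: a_def h_def max_def min_def abs_if field_simps)
      have "\<bar>E (a + h) x f - E a x f - h * E a x (L f)\<bar> / h \<le> h * gap K f h / h"
        using E_increment[OF x a(1) h(1), of f] h by (intro divide_right_mono) auto
      moreover have "\<bar>E (a + h) x f - E a x f - h * E a x (L f)\<bar> / h =
          \<bar>(E (a + h) x f - E a x f - h * E a x (L f)) / h\<bar>"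
        using h by (simp add: abs_divide)
      moreover have "(E (a + h) x f - E a x f - h * E a x (L f)) / h = (E (a + h) x f - E a x f) / h - E a x (L f)"
        using h by (simp add: field_simps)
      ultimately have 1: "\<bar>(E (a + h) x f - E a x f) / h - E a x (L f)\<bar> \<le> gap K f h"
        using h by simp
      have 2: "\<bar>E a x (L f) - E t x (L f)\<bar> \<le> C * h"
      proof (cases "a = t")
        case False
        then have "t = a + h" using a(2) by (auto simp: a_def)
        then show ?thesis using C(3)[OF a(1) h(1,2)] by (simp add: abs_minus_commute)
      qed (use C h in auto)
      show ?thesis using 1 2 d'(2)[OF h(1,3)] q by linarith
    qed
    show "\<forall>\<^sub>F s in at t within {0..}. dist ((E s x f - E t x f) / (s - t)) (E t x (L f)) < e"
      unfolding eventually_at using C(1) d'(1) main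
      by (intro exI[of _ "min d d'"]) (auto simp: dist_real_def)
  qed
qed

end

section \<open>Generator estimates for linear statistics\<close>

text \<open>The pairing with the empirical measure, written as a plain sum so that the generator can
  act on it.\<close>

definition lin_stat :: "nat \<Rightarrow> (real \<times> int \<Rightarrow> real) \<Rightarrow> (int \<times> int \<Rightarrow> nat) \<Rightarrow> real" where
  "lin_stat N \<phi> \<eta> = (\<Sum>(x, \<sigma>)\<in>sites N. real (\<eta> (x, \<sigma>)) * \<phi> (of_int x / real N, \<sigma>)) / real N"

text \<open>One layer at a time, because the rate \<open>c \<tau>\<close> is constant on the layer
  and can then be taken out of the statistic.\<close>

definition flip :: "int \<Rightarrow> (real \<times> int \<Rightarrow> real) \<Rightarrow> real \<times> int \<Rightarrow> real" where
  "flip \<tau> \<phi> = (\<lambda>(x, \<sigma>). of_bool (\<sigma> = \<tau>) * (\<phi> (x, - \<sigma>) - \<phi> (x, \<sigma>)))"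

definition spin_fun :: "real \<times> int \<Rightarrow> real" where
  "spin_fun = (\<lambda>(x, \<sigma>). of_int \<sigma>)"

lemma pairing_empirical_lin_stat:
  "0 < N \<Longrightarrow> \<phi> \<in> C_V \<Longrightarrow> pairing (empirical N \<eta>) \<phi> = lin_stat N \<phi> \<eta>"
  by (simp add: pairing_empirical lin_stat_def)

lemma lin_stat_add: "lin_stat N (\<lambda>v. \<phi> v + \<psi> v) \<eta> = lin_stat N \<phi> \<eta> + lin_stat N \<psi> \<eta>"
  by (simp add: lin_stat_def case_prod_unfold distrib_left sum.distrib add_divide_distrib)

lemma lin_stat_cmult: "lin_stat N (\<lambda>v. r * \<phi> v) \<eta> = r * lin_stat N \<phi> \<eta>"
  by (simp add: lin_stat_def case_prod_unfold mult.left_commute flip: sum_distrib_left)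

lemma lin_stat_diff: "lin_stat N (\<lambda>v. \<phi> v - \<psi> v) \<eta> = lin_stat N \<phi> \<eta> - lin_stat N \<psi> \<eta>"
  using lin_stat_add[of N \<phi> "\<lambda>v. (-1) * \<psi> v" \<eta>] lin_stat_cmult[of N "-1" \<psi> \<eta>] by simp

lemma lin_stat_cong:
  "(\<And>x \<sigma>. \<sigma> \<in> spins \<Longrightarrow> \<phi> (x, \<sigma>) = \<psi> (x, \<sigma>)) \<Longrightarrow> lin_stat N \<phi> \<eta> = lin_stat N \<psi> \<eta>"
  unfolding lin_stat_def by (intro arg_cong2[where f = "(/)"] sum.cong) (auto simp: sites_def)

lemma lin_stat_one: "lin_stat N (\<lambda>_. 1) \<eta> = real (particles N \<eta>) / real N"
  by (simp add: lin_stat_def particles_def case_prod_unfold)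

lemma abs_lin_stat_le:
  assumes "\<And>x \<sigma>. \<sigma> \<in> spins \<Longrightarrow> \<bar>\<phi> (x, \<sigma>)\<bar> \<le> B"
  shows "\<bar>lin_stat N \<phi> \<eta>\<bar> \<le> B * lin_stat N (\<lambda>_. 1) \<eta>"
proof -
  have "\<bar>\<Sum>(x, \<sigma>)\<in>sites N. real (\<eta> (x, \<sigma>)) * \<phi> (of_int x / real N, \<sigma>)\<bar>
      \<le> (\<Sum>(x, \<sigma>)\<in>sites N. real (\<eta> (x, \<sigma>)) * B)"
    using assms
    by (intro order.trans[OF sum_abs] sum_mono) (auto simp: sites_def abs_mult intro!: mult_left_mono)
  then have "\<bar>\<Sum>(x, \<sigma>)\<in>sites N. real (\<eta> (x, \<sigma>)) * \<phi> (of_int x / real N, \<sigma>)\<bar> / real N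
      \<le> (\<Sum>(x, \<sigma>)\<in>sites N. real (\<eta> (x, \<sigma>)) * B) / real N"
    by (intro divide_right_mono) auto
  then show ?thesis
    by (simp add: lin_stat_def case_prod_unfold abs_divide sum_distrib_right[symmetric] mult.commute[of B])
qed

lemma lin_stat_move:
  assumes "0 < N" "(x, \<sigma>) \<in> sites N" "(y, \<tau>) \<in> sites N" "0 < \<eta> (x, \<sigma>)"
  shows "lin_stat N \<phi> (move (x, \<sigma>) (y, \<tau>) \<eta>) =
    lin_stat N \<phi> \<eta> + (\<phi> (of_int y / real N, \<tau>) - \<phi> (of_int x / real N, \<sigma>)) / real N"
  using sum_move[where w = "\<lambda>(x, \<sigma>). \<phi> (of_int x / real N, \<sigma>)" and \<eta> = \<eta>, OF assms(2-4)]
  unfolding lin_stat_def by (simp add: case_prod_unfold mult.commute add_divide_distrib diff_divide_distrib)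

lemma periodic_step:
  assumes "0 < N" "periodic_V \<phi>" "\<sigma> \<in> spins"
  shows "\<phi> (of_int ((x + \<sigma>) mod int N) / real N, \<sigma>) = \<phi> (of_int x / real N + of_int \<sigma> / real N, \<sigma>)"
proof -
  have "real_of_int (x + \<sigma>) = of_int ((x + \<sigma>) div int N) * real N + of_int ((x + \<sigma>) mod int N)"
    using div_mult_mod_eq[of "x + \<sigma>" "int N"] by (metis of_int_add of_int_mult of_int_of_nat_eq)
  then have "of_int x / real N + of_int \<sigma> / real N =
      of_int ((x + \<sigma>) mod int N) / real N + of_int ((x + \<sigma>) div int N)"
    using assms(1) by (simp add: field_simps)
  then show ?thesis using periodic_V_int[OF assms(2,3)] by simp
qed

text \<open>The drift produced by transport: speed N times the change of \<phi> in a jump of length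
  1/N. In the limit it becomes \<sigma> times the derivative of \<phi>.\<close>

definition shift_diff :: "nat \<Rightarrow> (real \<times> int \<Rightarrow> real) \<Rightarrow> real \<times> int \<Rightarrow> real" where
  "shift_diff N \<phi> = (\<lambda>(x, \<sigma>). real N * (\<phi> (x + of_int \<sigma> / real N, \<sigma>) - \<phi> (x, \<sigma>)))"

text \<open>Every jump changes a linear statistic by an explicit amount, and periodicity absorbs the
  jump across the end of the residues. The outer function g is kept general in order to obtain both
  the drift (identity) and the quadratic term (square). A transport jump contributes
  \<open>shift_diff\<close> over the square of N, one factor N being part of
  \<open>shift_diff\<close>.\<close>

lemma generator_compose_lin_stat:
  assumes N: "0 < N" and \<phi>: "periodic_V \<phi>"
  shows "generator c N (\<lambda>\<zeta>. g (lin_stat N \<phi> \<zeta>)) \<eta> =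
    (\<Sum>(x, \<sigma>)\<in>sites N. real (\<eta> (x, \<sigma>)) *
       (real N * (g (lin_stat N \<phi> \<eta> + shift_diff N \<phi> (of_int x / real N, \<sigma>) / (real N)\<^sup>2) - g (lin_stat N \<phi> \<eta>)) +
        c \<sigma> (magnetization_N N \<eta>) * (g (lin_stat N \<phi> \<eta> +
          (\<phi> (of_int x / real N, - \<sigma>) - \<phi> (of_int x / real N, \<sigma>)) / real N) - g (lin_stat N \<phi> \<eta>))))"
proof -
  have shift: "(\<phi> (of_int ((x + \<sigma>) mod int N) / real N, \<sigma>) - \<phi> (of_int x / real N, \<sigma>)) / real N =
      shift_diff N \<phi> (of_int x / real N, \<sigma>) / (real N)\<^sup>2" if "(x, \<sigma>) \<in> sites N" for x \<sigma>
    using that N periodic_step[OF N \<phi>, of \<sigma> x]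
    by (simp add: shift_diff_def sites_def power2_eq_square)
  show ?thesis
    unfolding generator_def sum_distrib_left sum.distrib[symmetric]
  proof (intro sum.cong refl, clarify)
    fix x \<sigma> assume v: "(x, \<sigma>) \<in> sites N"
    show "real N * (real (\<eta> (x, \<sigma>)) *
        (g (lin_stat N \<phi> (move (x, \<sigma>) ((x + \<sigma>) mod int N, \<sigma>) \<eta>)) - g (lin_stat N \<phi> \<eta>))) +
      c \<sigma> (magnetization_N N \<eta>) * real (\<eta> (x, \<sigma>)) *
        (g (lin_stat N \<phi> (move (x, \<sigma>) (x, - \<sigma>) \<eta>)) - g (lin_stat N \<phi> \<eta>)) =
      real (\<eta> (x, \<sigma>)) *
       (real N * (g (lin_stat N \<phi> \<eta> + shift_diff N \<phi> (of_int x / real N, \<sigma>) / (real N)\<^sup>2) - g (lin_stat N \<phi> \<eta>)) +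
        c \<sigma> (magnetization_N N \<eta>) * (g (lin_stat N \<phi> \<eta> +
          (\<phi> (of_int x / real N, - \<sigma>) - \<phi> (of_int x / real N, \<sigma>)) / real N) - g (lin_stat N \<phi> \<eta>)))"
    proof (cases "\<eta> (x, \<sigma>) = 0")
      case False
      then show ?thesis
        using lin_stat_move[where \<eta> = \<eta> and \<phi> = \<phi>, OF N v step_sites[OF N v]]
          lin_stat_move[where \<eta> = \<eta> and \<phi> = \<phi>, OF N v flip_sites[OF v]] shift[OF v]
        by (simp add: algebra_simps)
    qed simp
  qed
qed

lemma generator_lin_stat:
  assumes N: "0 < N" and \<phi>: "periodic_V \<phi>"
  shows "generator c N (lin_stat N \<phi>) \<eta> = lin_stat N (shift_diff N \<phi>) \<eta> +
    (\<Sum>\<tau>\<in>spins. c \<tau> (magnetization_N N \<eta>) * lin_stat N (flip \<tau> \<phi>) \<eta>)"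
proof -
  let ?m = "magnetization_N N \<eta>"
  have "generator c N (lin_stat N \<phi>) \<eta> = (\<Sum>(x, \<sigma>)\<in>sites N. real (\<eta> (x, \<sigma>)) *
       (shift_diff N \<phi> (of_int x / real N, \<sigma>) +
        c \<sigma> ?m * (\<phi> (of_int x / real N, - \<sigma>) - \<phi> (of_int x / real N, \<sigma>))) / real N)"
    using generator_compose_lin_stat[OF N \<phi>, of c "\<lambda>z. z" \<eta>] N
    by (simp add: power2_eq_square case_prod_unfold add_divide_distrib distrib_left)
  also have "\<dots> = (\<Sum>(x, \<sigma>)\<in>sites N. real (\<eta> (x, \<sigma>)) * shift_diff N \<phi> (of_int x / real N, \<sigma>) / real N +
      (\<Sum>\<tau>\<in>spins. c \<tau> ?m * (real (\<eta> (x, \<sigma>)) * flip \<tau> \<phi> (of_int x / real N, \<sigma>) / real N)))"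
  proof (intro sum.cong refl, clarify)
    fix x \<sigma> assume "(x, \<sigma>) \<in> sites N"
    then have "\<sigma> \<in> spins" by (simp add: sites_def)
    then show "real (\<eta> (x, \<sigma>)) * (shift_diff N \<phi> (of_int x / real N, \<sigma>) +
        c \<sigma> ?m * (\<phi> (of_int x / real N, - \<sigma>) - \<phi> (of_int x / real N, \<sigma>))) / real N =
      real (\<eta> (x, \<sigma>)) * shift_diff N \<phi> (of_int x / real N, \<sigma>) / real N +
      (\<Sum>\<tau>\<in>spins. c \<tau> ?m * (real (\<eta> (x, \<sigma>)) * flip \<tau> \<phi> (of_int x / real N, \<sigma>) / real N))"
      by (cases rule: spins_cases) (simp_all add: sum_spins flip_def algebra_simps add_divide_distrib diff_divide_distrib)
  qed
  also have "\<dots> = lin_stat N (shift_diff N \<phi>) \<eta> + (\<Sum>\<tau>\<in>spins. c \<tau> ?m * lin_stat N (flip \<tau> \<phi>) \<eta>)"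
    unfolding lin_stat_def
    by (simp add: case_prod_unfold sum.distrib sum_spins sum_divide_distrib sum_distrib_left)
  finally show ?thesis .
qed

text \<open>The excess over the chain rule is the sum of rate times squared jump. A transport jump
  of size at most \<open>B / N^2\<close> has rate N, a flip of size at most \<open>B / N\<close> has
  rate at most \<open>c_hi\<close>; so a particle contributes at most order \<open>1 / N^2\<close>,
  and all particles together order mass over N.\<close>

lemma generator_lin_stat_square:
  assumes N: "0 < N" and \<phi>: "periodic_V \<phi>" and c: "\<And>\<sigma>. \<sigma> \<in> spins \<Longrightarrow> c \<sigma> (magnetization_N N \<eta>) \<le> c_hi" "0 \<le> c_hi"
    and B: "\<And>x \<sigma>. \<sigma> \<in> spins \<Longrightarrow> \<bar>shift_diff N \<phi> (x, \<sigma>)\<bar> \<le> B" "\<And>x \<sigma>. \<sigma> \<in> spins \<Longrightarrow> \<bar>\<phi> (x, - \<sigma>) - \<phi> (x, \<sigma>)\<bar> \<le> B"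
  shows "generator c N (\<lambda>\<zeta>. (lin_stat N \<phi> \<zeta> - a)\<^sup>2) \<eta> \<le>
    2 * (lin_stat N \<phi> \<eta> - a) * generator c N (lin_stat N \<phi>) \<eta> +
    (1 + c_hi) * B\<^sup>2 * lin_stat N (\<lambda>_. 1) \<eta> / real N"
proof -
  let ?m = "magnetization_N N \<eta>" and ?W = "lin_stat N \<phi> \<eta>"
  let ?d = "\<lambda>x \<sigma>. shift_diff N \<phi> (of_int x / real N, \<sigma>)"
  let ?e = "\<lambda>x \<sigma>. \<phi> (of_int x / real N, - \<sigma>) - \<phi> (of_int x / real N, \<sigma>)"
  have "generator c N (\<lambda>\<zeta>. (lin_stat N \<phi> \<zeta> - a)\<^sup>2) \<eta> - 2 * (?W - a) * generator c N (lin_stat N \<phi>) \<eta>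
     = (\<Sum>(x, \<sigma>)\<in>sites N. real (\<eta> (x, \<sigma>)) *
        (real N * (?d x \<sigma> / (real N)\<^sup>2)\<^sup>2 + c \<sigma> ?m * (?e x \<sigma> / real N)\<^sup>2))"
    unfolding generator_compose_lin_stat[OF N \<phi>, of c "\<lambda>z. (z - a)\<^sup>2"]
      generator_compose_lin_stat[OF N \<phi>, of c "\<lambda>z. z"] sum_distrib_left sum_subtractf[symmetric]
    by (intro sum.cong refl) (clarsimp simp: power2_eq_square algebra_simps)
  also have "\<dots> \<le> (\<Sum>(x, \<sigma>)\<in>sites N. real (\<eta> (x, \<sigma>)) * ((1 + c_hi) * B\<^sup>2 / (real N)\<^sup>2))"
  proof (intro sum_mono, clarify, intro mult_left_mono)
    fix x \<sigma> assume "(x, \<sigma>) \<in> sites N"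
    then have \<sigma>: "\<sigma> \<in> spins" by (simp add: sites_def)
    have N1: "1 \<le> real N" using N by simp
    have "real N * (?d x \<sigma> / (real N)\<^sup>2)\<^sup>2 = (?d x \<sigma>)\<^sup>2 / (real N ^ 3)"
      using N by (simp add: field_simps power2_eq_square power3_eq_cube)
    also have "\<dots> \<le> B\<^sup>2 / (real N)\<^sup>2"
      using B(1)[OF \<sigma>] N1 power_mono[of "\<bar>?d x \<sigma>\<bar>" B 2]
      by (intro frac_le) (auto simp: power_increasing)
    finally have 1: "real N * (?d x \<sigma> / (real N)\<^sup>2)\<^sup>2 \<le> B\<^sup>2 / (real N)\<^sup>2" .
    have "c \<sigma> ?m * (?e x \<sigma> / real N)\<^sup>2 \<le> c_hi * (B / real N)\<^sup>2"
    proof (rule mult_mono)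
      show "(?e x \<sigma> / real N)\<^sup>2 \<le> (B / real N)\<^sup>2"
        using B(2)[OF \<sigma>] power_mono[of "\<bar>?e x \<sigma>\<bar>" B 2]
        by (simp add: power_divide divide_right_mono)
    qed (use c \<sigma> in auto)
    with 1 show "real N * (?d x \<sigma> / (real N)\<^sup>2)\<^sup>2 + c \<sigma> ?m * (?e x \<sigma> / real N)\<^sup>2 \<le> (1 + c_hi) * B\<^sup>2 / (real N)\<^sup>2"
      by (simp add: power_divide distrib_right add_divide_distrib)
  qed simp
  also have "\<dots> = (1 + c_hi) * B\<^sup>2 * lin_stat N (\<lambda>_. 1) \<eta> / real N"
    by (simp add: lin_stat_def case_prod_unfold power2_eq_square
        flip: sum_distrib_right sum_divide_distrib)
  finally show ?thesis by simp
qed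

section \<open>The generator on Fourier modes and on the total spin\<close>

lemma abs_cos_diff_le: "\<bar>cos x - cos y\<bar> \<le> \<bar>x - y :: real\<bar>"
proof -
  have "\<bar>cos x - cos y\<bar> = 2 * \<bar>sin ((x + y) / 2)\<bar> * \<bar>sin ((y - x) / 2)\<bar>"
    by (simp add: cos_diff_cos abs_mult)
  also have "\<dots> \<le> 2 * 1 * \<bar>(y - x) / 2\<bar>"
    by (intro mult_mono abs_sin_x_le_abs_x) (auto intro: abs_sin_le_one)
  finally show ?thesis by simp
qed

text \<open>By the mean value theorem the increment is h times the derivative at a point within
  distance \<open>\<bar>h\<bar>\<close> of x, and the derivative is 1-Lipschitz. It is written as a
  phase shift in order to match \<open>mode\<close>.\<close>

lemma cos_taylor: "\<bar>cos (x + h) - cos x - h * cos (x + pi / 2)\<bar> \<le> h\<^sup>2" for x h :: real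
proof -
  have "\<exists>\<xi>. \<bar>\<xi> - x\<bar> \<le> \<bar>h\<bar> \<and> cos (x + h) - cos x = h * (- sin \<xi>)"
  proof (cases h "0 :: real" rule: linorder_cases)
    case less
    obtain z where "x + h < z" "z < x" "cos x - cos (x + h) = (x - (x + h)) * (- sin z)"
      using MVT2[of "x + h" x cos "\<lambda>z. - sin z"] less by (auto intro!: derivative_eq_intros)
    then show ?thesis using less by (intro exI[of _ z]) auto
  next
    case greater
    obtain z where "x < z" "z < x + h" "cos (x + h) - cos x = ((x + h) - x) * (- sin z)"
      using MVT2[of x "x + h" cos "\<lambda>z. - sin z"] greater by (auto intro!: derivative_eq_intros)
    then show ?thesis using greater by (intro exI[of _ z]) auto
  qed auto
  then obtain \<xi> where \<xi>: "\<bar>\<xi> - x\<bar> \<le> \<bar>h\<bar>" "cos (x + h) - cos x = h * (- sin \<xi>)" by blast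
  have "\<bar>cos (\<xi> + pi / 2) - cos (x + pi / 2)\<bar> \<le> \<bar>h\<bar>"
    using abs_cos_diff_le[of "\<xi> + pi / 2" "x + pi / 2"] \<xi>(1) by linarith
  then have "\<bar>h\<bar> * \<bar>cos (\<xi> + pi / 2) - cos (x + pi / 2)\<bar> \<le> \<bar>h\<bar> * \<bar>h\<bar>"
    by (intro mult_left_mono) auto
  moreover have "cos (x + h) - cos x - h * cos (x + pi / 2) = h * (cos (\<xi> + pi / 2) - cos (x + pi / 2))"
    unfolding \<xi>(2) by (simp add: cos_add right_diff_distrib)
  ultimately show ?thesis by (simp add: abs_mult power2_eq_square)
qed

lemma abs_mode_le: "\<bar>mode k \<sigma> b v\<bar> \<le> 1"
  by (auto simp: mode_def case_prod_unfold)

lemma shift_diff_mode: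
  assumes "0 < N" "\<tau> \<in> spins" "\<sigma> \<in> spins"
  shows "\<bar>shift_diff N (mode k \<sigma> b) (x, \<tau>) - 2 * pi * of_int (k * \<sigma>) * mode k \<sigma> (b + pi / 2) (x, \<tau>)\<bar>
      \<le> (2 * pi * of_int k)\<^sup>2 / real N"
    and "\<bar>shift_diff N (mode k \<sigma> b) (x, \<tau>)\<bar> \<le> 2 * pi * \<bar>of_int k\<bar>"
proof -
  let ?h = "2 * pi * of_int k * (of_int \<sigma> / real N)" and ?y = "2 * pi * of_int k * x + b"
  have abs\<sigma>: "\<bar>real_of_int \<sigma>\<bar> = 1" and sq: "(real_of_int \<sigma>)\<^sup>2 = 1" using assms(3) by (auto simp: spins_def)
  have y: "2 * pi * of_int k * (x + of_int \<sigma> / real N) + b = ?y + ?h"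
    by (simp add: algebra_simps)
  have "\<bar>cos (?y + ?h) - cos ?y - ?h * cos (?y + pi / 2)\<bar> \<le> ?h\<^sup>2" by (rule cos_taylor)
  then have "real N * \<bar>cos (?y + ?h) - cos ?y - ?h * cos (?y + pi / 2)\<bar> \<le> real N * ?h\<^sup>2"
    by (intro mult_left_mono) auto
  also have "real N * ?h\<^sup>2 = (2 * pi * of_int k)\<^sup>2 / real N"
    using assms(1) sq by (simp add: power_mult_distrib power_divide field_simps power2_eq_square)
  also have "real N * \<bar>cos (?y + ?h) - cos ?y - ?h * cos (?y + pi / 2)\<bar> =
      \<bar>real N * (cos (?y + ?h) - cos ?y) - 2 * pi * of_int (k * \<sigma>) * cos (?y + pi / 2)\<bar>"
  proof -
    have "real N * \<bar>cos (?y + ?h) - cos ?y - ?h * cos (?y + pi / 2)\<bar> =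
        \<bar>real N * (cos (?y + ?h) - cos ?y - ?h * cos (?y + pi / 2))\<bar>" by (simp add: abs_mult)
    also have "real N * (cos (?y + ?h) - cos ?y - ?h * cos (?y + pi / 2)) =
      real N * (cos (?y + ?h) - cos ?y) - 2 * pi * of_int (k * \<sigma>) * cos (?y + pi / 2)"
      using assms(1) by (simp add: right_diff_distrib)
    finally show ?thesis .
  qed
  finally show "\<bar>shift_diff N (mode k \<sigma> b) (x, \<tau>) - 2 * pi * of_int (k * \<sigma>) * mode k \<sigma> (b + pi / 2) (x, \<tau>)\<bar>
      \<le> (2 * pi * of_int k)\<^sup>2 / real N"
    by (cases "\<tau> = \<sigma>") (auto simp: shift_diff_def mode_def y add.assoc)
  have "real N * \<bar>cos (?y + ?h) - cos ?y\<bar> \<le> real N * \<bar>?h\<bar>"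
    using abs_cos_diff_le[of "?y + ?h" ?y] by (intro mult_left_mono) auto
  also have "\<dots> = 2 * pi * \<bar>of_int k\<bar>"
    using assms(1) abs\<sigma> by (simp add: abs_mult)
  finally show "\<bar>shift_diff N (mode k \<sigma> b) (x, \<tau>)\<bar> \<le> 2 * pi * \<bar>of_int k\<bar>"
    by (cases "\<tau> = \<sigma>") (auto simp: shift_diff_def mode_def y abs_mult)
qed

lemma flip_mode:
  assumes "\<sigma> \<in> spins" "s \<in> spins"
  shows "flip \<sigma> (mode k \<sigma> b) (x, s) = - mode k \<sigma> b (x, s)"
    and "flip (- \<sigma>) (mode k \<sigma> b) (x, s) = mode k (- \<sigma>) b (x, s)"
  using assms by (auto simp: flip_def mode_def spins_def)

lemma sum_spins_pm: "\<sigma> \<in> spins \<Longrightarrow> (\<Sum>\<tau>\<in>spins. f \<tau>) = f \<sigma> + f (- \<sigma>)"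
  by (cases rule: spins_cases) (auto simp: sum_spins add.commute)

text \<open>Transport advances the phase and flips exchange the layers, so only modes of the same
  frequency appear. The error is that of the difference quotient against the derivative, times the
  mass.\<close>

lemma generator_mode:
  assumes N: "0 < N" and \<sigma>: "\<sigma> \<in> spins"
  shows "\<bar>generator c N (lin_stat N (mode k \<sigma> b)) \<eta> -
      (2 * pi * of_int (k * \<sigma>) * lin_stat N (mode k \<sigma> (b + pi / 2)) \<eta> +
       c (- \<sigma>) (magnetization_N N \<eta>) * lin_stat N (mode k (- \<sigma>) b) \<eta> -
       c \<sigma> (magnetization_N N \<eta>) * lin_stat N (mode k \<sigma> b) \<eta>)\<bar>
    \<le> (2 * pi * of_int k)\<^sup>2 / real N * lin_stat N (\<lambda>_. 1) \<eta>"
proof -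
  have per: "periodic_V (mode k \<sigma> b)" using mode_C_V by (simp add: C_V_def)
  have "lin_stat N (flip \<sigma> (mode k \<sigma> b)) \<eta> = lin_stat N (\<lambda>v. (-1) * mode k \<sigma> b v) \<eta>"
    using flip_mode[OF \<sigma>] by (intro lin_stat_cong) simp
  moreover have "lin_stat N (flip (- \<sigma>) (mode k \<sigma> b)) \<eta> = lin_stat N (mode k (- \<sigma>) b) \<eta>"
    using flip_mode[OF \<sigma>] by (intro lin_stat_cong) simp
  ultimately have "generator c N (lin_stat N (mode k \<sigma> b)) \<eta> -
      (2 * pi * of_int (k * \<sigma>) * lin_stat N (mode k \<sigma> (b + pi / 2)) \<eta> +
       c (- \<sigma>) (magnetization_N N \<eta>) * lin_stat N (mode k (- \<sigma>) b) \<eta> -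
       c \<sigma> (magnetization_N N \<eta>) * lin_stat N (mode k \<sigma> b) \<eta>) =
    lin_stat N (\<lambda>v. shift_diff N (mode k \<sigma> b) v - 2 * pi * of_int (k * \<sigma>) * mode k \<sigma> (b + pi / 2) v) \<eta>"
    by (simp add: generator_lin_stat[OF N per] sum_spins_pm[OF \<sigma>] lin_stat_diff lin_stat_cmult
        del: of_int_mult) (use lin_stat_cmult[of N "-1"] in simp)
  also have "\<bar>\<dots>\<bar> \<le> (2 * pi * of_int k)\<^sup>2 / real N * lin_stat N (\<lambda>_. 1) \<eta>"
    by (rule abs_lin_stat_le) (use shift_diff_mode(1)[OF N _ \<sigma>] in blast)
  finally show ?thesis .
qed

text \<open>Without particles both sides of the identity vanish, so later arguments can multiply by
  the mass instead of dividing by it.\<close>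

lemma magnetization_N_eq:
  assumes "0 < N"
  shows "lin_stat N spin_fun \<eta> = magnetization_N N \<eta> * lin_stat N (\<lambda>_. 1) \<eta>"
    and "magnetization_N N \<eta> \<in> {-1..1}"
proof -
  have sum_eq: "(\<Sum>x\<in>{0..<int N}. real (\<eta> (x, 1)) - real (\<eta> (x, -1))) =
      (\<Sum>(x, \<sigma>)\<in>sites N. real (\<eta> (x, \<sigma>)) * of_int \<sigma>)"
    unfolding sites_def sum.cartesian_product[symmetric] by (simp add: sum_spins)
  have sp: "(\<Sum>(x, \<sigma>)\<in>sites N. real (\<eta> (x, \<sigma>)) * of_int \<sigma>) = real N * lin_stat N spin_fun \<eta>"
    using assms by (simp add: lin_stat_def spin_fun_def)
  have *: "\<bar>lin_stat N spin_fun \<eta>\<bar> \<le> 1 * lin_stat N (\<lambda>_. 1) \<eta>"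
    by (rule abs_lin_stat_le) (auto simp: spin_fun_def spins_def)
  have "lin_stat N spin_fun \<eta> = magnetization_N N \<eta> * lin_stat N (\<lambda>_. 1) \<eta> \<and> magnetization_N N \<eta> \<in> {-1..1}"
  proof (cases "particles N \<eta> = 0")
    case True
    then show ?thesis using * by (simp add: magnetization_N_def particles_def Let_def lin_stat_one)
  next
    case False
    then have "magnetization_N N \<eta> = lin_stat N spin_fun \<eta> / lin_stat N (\<lambda>_. 1) \<eta>"
      unfolding magnetization_N_def sum_eq sp lin_stat_one particles_def[symmetric] Let_def
      by (simp add: field_simps)
    moreover have pos: "0 < lin_stat N (\<lambda>_. 1) \<eta>" using False assms by (simp add: lin_stat_one)
    moreover have "lin_stat N spin_fun \<eta> / lin_stat N (\<lambda>_. 1) \<eta> \<in> {-1..1}"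
      using * pos by (auto simp: abs_le_iff le_divide_eq divide_le_eq)
    ultimately show ?thesis by simp
  qed
  then show "lin_stat N spin_fun \<eta> = magnetization_N N \<eta> * lin_stat N (\<lambda>_. 1) \<eta>"
    and "magnetization_N N \<eta> \<in> {-1..1}" by auto
qed

text \<open>Change of the total spin per unit mass: a fraction \<open>(1 - m) / 2\<close> of the
  particles has spin -1, and each of their flips adds 2; likewise for spin 1.\<close>

definition mag_drift :: "(int \<Rightarrow> real \<Rightarrow> real) \<Rightarrow> real \<Rightarrow> real" where
  "mag_drift c m = c (-1) m * (1 - m) - c 1 m * (1 + m)"

lemma generator_spin_fun:
  assumes N: "0 < N"
  shows "generator c N (lin_stat N spin_fun) \<eta> = lin_stat N (\<lambda>_. 1) \<eta> * mag_drift c (magnetization_N N \<eta>)"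
proof -
  have per: "periodic_V spin_fun" by (simp add: spin_fun_def periodic_V_def)
  have "lin_stat N (shift_diff N spin_fun) \<eta> = 0"
    by (simp add: shift_diff_def spin_fun_def lin_stat_def case_prod_unfold)
  \<comment> \<open>On the two layers \<open>1 + \<tau> * spin_fun\<close> is twice the indicator of
    layer \<tau>, and a flip there changes the spin by \<open>- 2 * \<tau>\<close>.\<close>
  moreover have flip: "lin_stat N (flip \<tau> spin_fun) \<eta> =
      - of_int \<tau> * (lin_stat N (\<lambda>_. 1) \<eta> + of_int \<tau> * lin_stat N spin_fun \<eta>)" if "\<tau> \<in> spins" for \<tau>
  proof -
    have "lin_stat N (flip \<tau> spin_fun) \<eta> =
        lin_stat N (\<lambda>v. - of_int \<tau> * (1 + of_int \<tau> * spin_fun v)) \<eta>"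
      using that by (intro lin_stat_cong) (auto simp: flip_def spin_fun_def spins_def)
    then show ?thesis unfolding lin_stat_cmult lin_stat_add .
  qed
  ultimately show ?thesis
    unfolding generator_lin_stat[OF N per] sum_spins flip[OF one_in_spins(1)] flip[OF one_in_spins(2)]
    by (simp add: magnetization_N_eq(1)[OF N] mag_drift_def algebra_simps)
qed

section \<open>A supermartingale controlling the distance to the limit\<close>

text \<open>The function \<open>u s * exp (- C * s) - e * s\<close> is nonincreasing; the signs of C
  and e enter when the discount on the error is dropped.\<close>

lemma gronwall_derivative:
  fixes u u' :: "real \<Rightarrow> real"
  assumes h: "0 \<le> h" and C: "0 \<le> C" and e: "0 \<le> e"
    and d: "\<And>s. s \<in> {0..h} \<Longrightarrow> (u has_real_derivative u' s) (at s within {0..h})"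
    and le: "\<And>s. s \<in> {0..h} \<Longrightarrow> u' s \<le> C * u s + e"
  shows "u h \<le> (u 0 + e * h) * exp (C * h)"
proof -
  let ?v = "\<lambda>s. u s * exp (- C * s) - e * s"
  have dv: "(?v has_real_derivative (u' s - C * u s) * exp (- C * s) - e) (at s within {0..h})"
    if "s \<in> {0..h}" for s
    by (rule derivative_eq_intros d[OF that] refl)+ (simp add: algebra_simps)
  have neg: "(u' s - C * u s) * exp (- C * s) - e \<le> 0" if "s \<in> {0..h}" for s
  proof -
    have "(u' s - C * u s) * exp (- C * s) \<le> e * exp (- C * s)"
      using le[OF that] by (intro mult_right_mono) auto
    also have "\<dots> \<le> e * 1" using e C that by (intro mult_left_mono) auto
    finally show ?thesis by simp
  qed
  have "?v h \<le> ?v 0"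
  proof (cases "h = 0")
    case False
    then have "0 < h" using h by simp
    have "\<exists>z\<in>{0<..<h}. ?v h - ?v 0 = (h - 0) * ((u' z - C * u z) * exp (- C * z) - e)"
    proof (rule mvt_simple[OF \<open>0 < h\<close>, simplified has_field_derivative_def[symmetric], THEN bexE])
      fix x assume "0 \<le> x" "x \<le> h"
      then show "(?v has_derivative (\<lambda>z. z * ((u' x - C * u x) * exp (- C * x) - e))) (at x within {0..h})"
        using dv[of x] by (simp add: has_field_derivative_def mult_commute_abs)
    qed auto
    then obtain z where z: "z \<in> {0<..<h}" "?v h - ?v 0 = h * ((u' z - C * u z) * exp (- C * z) - e)"
      by auto
    then have "?v h - ?v 0 \<le> 0" using neg[of z] h by (simp add: mult_nonneg_nonpos)
    then show ?thesis by simp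
  qed simp
  then have "u h * exp (- C * h) \<le> u 0 + e * h" by simp
  then have "u h * exp (- C * h) * exp (C * h) \<le> (u 0 + e * h) * exp (C * h)"
    by (rule mult_right_mono) simp
  then show ?thesis by (simp add: mult.assoc exp_add[symmetric])
qed

lemma generator_add: "generator c N (\<lambda>\<zeta>. f \<zeta> + g \<zeta>) \<eta> = generator c N f \<eta> + generator c N g \<eta>"
  by (simp add: generator_def case_prod_unfold algebra_simps sum.distrib sum_subtractf)

lemma generator_cmult: "generator c N (\<lambda>\<zeta>. r * f \<zeta>) \<eta> = r * generator c N f \<eta>"
proof -
  have "r * f a - r * f b = r * (f a - f b)" for a b by (simp add: right_diff_distrib)
  then show ?thesis
    by (simp add: generator_def case_prod_unfold sum_distrib_left distrib_left mult_ac)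
qed

context particle_semigroup
begin

text \<open>The centring A moves in time. Expanding the square leaves time-dependent coefficients in
  front of expectations of two fixed functions, f and its square, to which the forward equation
  applies; afterwards the terms are collected again.\<close>

lemma E_square_derivative:
  assumes x: "x \<in> sector N K" and S: "S \<subseteq> {0..}" "s \<in> S"
    and A: "(A has_real_derivative A') (at s within S)"
  shows "((\<lambda>s. E s x (\<lambda>y. (f y - A s)\<^sup>2)) has_real_derivative
    E s x (\<lambda>y. L (\<lambda>\<zeta>. (f \<zeta> - A s)\<^sup>2) y - 2 * (f y - A s) * A')) (at s within S)"
proof -
  have s0: "0 \<le> s" using S by auto
  have eq: "E s x (\<lambda>y. (f y - A s)\<^sup>2) = E s x (\<lambda>y. (f y)\<^sup>2) + (- 2 * A s) * E s x f + (A s)\<^sup>2"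
    if "0 \<le> s" for s
  proof -
    have "E s x (\<lambda>y. (f y - A s)\<^sup>2) = E s x (\<lambda>y. (f y)\<^sup>2 + (- 2 * A s) * f y + (A s)\<^sup>2)"
      by (intro arg_cong[where f = "E s x"] ext) (simp add: power2_eq_square algebra_simps)
    also have "\<dots> = E s x (\<lambda>y. (f y)\<^sup>2) + (- 2 * A s) * E s x f + (A s)\<^sup>2"
      using x that by (simp only: E_add E_cmult E_const)
    finally show ?thesis .
  qed
  have L_eq: "L (\<lambda>\<zeta>. (f \<zeta> - A s)\<^sup>2) y = L (\<lambda>\<zeta>. (f \<zeta>)\<^sup>2) y + (- 2 * A s) * L f y" for y
  proof -
    have "L (\<lambda>\<zeta>. (f \<zeta> - A s)\<^sup>2) y = L (\<lambda>\<zeta>. (f \<zeta>)\<^sup>2 + (- 2 * A s) * f \<zeta> + (A s)\<^sup>2) y"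
      by (intro arg_cong2[where f = L] ext) (simp_all add: power2_eq_square algebra_simps)
    then show ?thesis by (simp only: generator_add generator_cmult generator_const)
  qed
  have dE: "((\<lambda>s. E s x g) has_real_derivative E s x (L g)) (at s within S)" for g
    by (rule has_field_derivative_subset[OF E_has_derivative[OF x s0] S(1)])
  have "((\<lambda>s. E s x (\<lambda>y. (f y)\<^sup>2) + (- 2 * A s) * E s x f + (A s)\<^sup>2) has_real_derivative
     (E s x (L (\<lambda>y. (f y)\<^sup>2)) + ((- 2 * A') * E s x f + (- 2 * A s) * E s x (L f)) + 2 * A s * A'))
     (at s within S)"
    by (rule derivative_eq_intros dE A refl)+ (simp add: algebra_simps)
  also have "(E s x (L (\<lambda>y. (f y)\<^sup>2)) + ((- 2 * A') * E s x f + (- 2 * A s) * E s x (L f)) + 2 * A s * A') =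
     E s x (\<lambda>y. (L (\<lambda>\<zeta>. (f \<zeta>)\<^sup>2) y + (- 2 * A s) * L f y) + ((- 2 * A') * f y + 2 * A s * A'))"
    using x s0 by (simp only: E_add E_cmult E_const)
  also have "\<dots> = E s x (\<lambda>y. L (\<lambda>\<zeta>. (f \<zeta> - A s)\<^sup>2) y - 2 * (f y - A s) * A')"
    unfolding L_eq by (intro arg_cong[where f = "E s x"] ext) (simp add: algebra_simps)
  finally show ?thesis
    by (rule has_field_derivative_transform_within[OF _ zero_less_one S(2)]) (use eq S(1) in auto)
qed

lemma E_sum': "finite I \<Longrightarrow> x \<in> sector N K \<Longrightarrow> 0 \<le> s \<Longrightarrow> E s x (\<lambda>y. \<Sum>i\<in>I. g i y) = (\<Sum>i\<in>I. E s x (g i))"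
  by (induction I rule: finite_induct) (simp_all add: E_const E_add)

text \<open>The drift bound holds pointwise on the sector, so it may be averaged under the law at
  each time.\<close>

lemma E_gronwall:
  assumes x: "x \<in> sector N K" and h: "0 \<le> h" and I: "finite I" and C: "0 \<le> C" "0 \<le> e"
    and A: "\<And>i s. i \<in> I \<Longrightarrow> s \<in> {0..h} \<Longrightarrow> (A i has_real_derivative A' i s) (at s within {0..h})"
    and le: "\<And>s y. s \<in> {0..h} \<Longrightarrow> y \<in> sector N K \<Longrightarrow>
      (\<Sum>i\<in>I. L (\<lambda>\<zeta>. (f i \<zeta> - A i s)\<^sup>2) y - 2 * (f i y - A i s) * A' i s)
        \<le> C * (\<Sum>i\<in>I. (f i y - A i s)\<^sup>2) + e"
  shows "E h x (\<lambda>y. \<Sum>i\<in>I. (f i y - A i h)\<^sup>2) \<le> ((\<Sum>i\<in>I. (f i x - A i 0)\<^sup>2) + e * h) * exp (C * h)"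
proof -
  let ?u = "\<lambda>s. \<Sum>i\<in>I. E s x (\<lambda>y. (f i y - A i s)\<^sup>2)"
  let ?u' = "\<lambda>s. \<Sum>i\<in>I. E s x (\<lambda>y. L (\<lambda>\<zeta>. (f i \<zeta> - A i s)\<^sup>2) y - 2 * (f i y - A i s) * A' i s)"
  have u: "?u s = E s x (\<lambda>y. \<Sum>i\<in>I. (f i y - A i s)\<^sup>2)" if "0 \<le> s" for s
    using E_sum'[OF I x that] by simp
  have "?u h \<le> (?u 0 + e * h) * exp (C * h)"
  proof (rule gronwall_derivative[OF h C])
    fix s assume s: "s \<in> {0..h}"
    show "(?u has_real_derivative ?u' s) (at s within {0..h})"
      by (intro DERIV_sum E_square_derivative[OF x _ s] A s) auto
    have "?u' s = E s x (\<lambda>y. \<Sum>i\<in>I. L (\<lambda>\<zeta>. (f i \<zeta> - A i s)\<^sup>2) y - 2 * (f i y - A i s) * A' i s)"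
      using E_sum'[OF I x] s by simp
    also have "\<dots> \<le> E s x (\<lambda>y. C * (\<Sum>i\<in>I. (f i y - A i s)\<^sup>2) + e)"
      using le[OF s] s by (intro E_mono[OF x]) auto
    also have "\<dots> = C * ?u s + e"
      using u[of s] s x by (simp add: E_add E_cmult E_const)
    finally show "?u' s \<le> C * ?u s + e" .
  qed
  then show ?thesis
    using u[OF h] u[of 0] subsetD[OF sector_subset x] by (simp add: E_0)
qed

end

lemma abs_combine4:
  fixes x :: real
  assumes "x = g + p + u - v" "\<bar>g\<bar> \<le> G" "\<bar>p\<bar> \<le> P" "\<bar>u\<bar> \<le> U" "\<bar>v\<bar> \<le> V"
  shows "\<bar>x\<bar> \<le> G + P + U + V"
  using assms by linarith

locale bounded_rates =
  fixes c :: "int \<Rightarrow> real \<Rightarrow> real" and c_hi Lc :: real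
  assumes c_nonneg: "\<And>\<sigma> m. \<sigma> \<in> spins \<Longrightarrow> m \<in> {-1..1} \<Longrightarrow> 0 \<le> c \<sigma> m"
    and c_le: "\<And>\<sigma> m. \<sigma> \<in> spins \<Longrightarrow> m \<in> {-1..1} \<Longrightarrow> c \<sigma> m \<le> c_hi"
    and Lc_nonneg: "0 \<le> Lc"
    and c_lip: "\<And>\<sigma> m m'. \<sigma> \<in> spins \<Longrightarrow> m \<in> {-1..1} \<Longrightarrow> m' \<in> {-1..1} \<Longrightarrow> \<bar>c \<sigma> m - c \<sigma> m'\<bar> \<le> Lc * \<bar>m - m'\<bar>"
begin

lemma c_hi_nonneg: "0 \<le> c_hi"
  using c_nonneg[of 1 0] c_le[of 1 0] by simp

lemma abs_c_le: "\<sigma> \<in> spins \<Longrightarrow> m \<in> {-1..1} \<Longrightarrow> \<bar>c \<sigma> m\<bar> \<le> c_hi"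
  using c_nonneg[of \<sigma> m] c_le[of \<sigma> m] by simp

text \<open>Of the constant, \<open>4 * Lc\<close> comes from varying the two rates against weights
  of size at most 2, and \<open>2 * c_hi\<close> from varying the two weights.\<close>

lemma mag_drift_lipschitz:
  assumes "m \<in> {-1..1}" "m' \<in> {-1..1}"
  shows "\<bar>mag_drift c m - mag_drift c m'\<bar> \<le> (4 * Lc + 2 * c_hi) * \<bar>m - m'\<bar>"
proof -
  have b: "\<bar>(c \<sigma> m - c \<sigma> m') * r\<bar> \<le> 2 * Lc * \<bar>m - m'\<bar>" if "\<sigma> \<in> spins" "\<bar>r\<bar> \<le> 2" for \<sigma> r
  proof -
    have "\<bar>c \<sigma> m - c \<sigma> m'\<bar> * \<bar>r\<bar> \<le> (Lc * \<bar>m - m'\<bar>) * 2"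
      using c_lip[OF that(1) assms] that(2) Lc_nonneg by (intro mult_mono) auto
    then show ?thesis by (simp add: abs_mult)
  qed
  have d: "\<bar>c \<sigma> m' * (m - m')\<bar> \<le> c_hi * \<bar>m - m'\<bar>" if "\<sigma> \<in> spins" for \<sigma>
    using abs_c_le[OF that assms(2)] by (simp add: abs_mult mult_right_mono)
  have "mag_drift c m - mag_drift c m' = (c (-1) m - c (-1) m') * (1 - m) - c (-1) m' * (m - m')
      - ((c 1 m - c 1 m') * (1 + m) + c 1 m' * (m - m'))"
    by (simp add: mag_drift_def algebra_simps)
  moreover have "\<bar>(c (-1) m - c (-1) m') * (1 - m)\<bar> \<le> 2 * Lc * \<bar>m - m'\<bar>"
    "\<bar>(c 1 m - c 1 m') * (1 + m)\<bar> \<le> 2 * Lc * \<bar>m - m'\<bar>"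
    using assms by (auto intro!: b)
  ultimately show ?thesis
    using d[of 1] d[of "-1"] by (simp add: distrib_right abs_le_iff)
qed

end

text \<open>All that the estimate has to know of the limit: the magnetization \<open>mh\<close> and
  the modes \<open>a\<close>. The phase pi arises when the phase \<open>pi / 2\<close> is advanced
  once more, hence \<open>a_pi\<close>.\<close>

locale limit_modes = bounded_rates +
  fixes T :: real and mh :: "real \<Rightarrow> real" and a :: "int \<Rightarrow> int \<Rightarrow> real \<Rightarrow> real \<Rightarrow> real"
  assumes T_nonneg: "0 \<le> T"
    and mh_range: "\<And>t. t \<in> {0..T} \<Longrightarrow> mh t \<in> {-1..1}"
    and mh_deriv: "\<And>t. t \<in> {0..T} \<Longrightarrow> (mh has_real_derivative mag_drift c (mh t)) (at t within {0..T})"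
    and a_pi: "\<And>k \<sigma> t. a k \<sigma> pi t = - a k \<sigma> 0 t"
    and a_deriv: "\<And>k \<sigma> b t. \<sigma> \<in> spins \<Longrightarrow> t \<in> {0..T} \<Longrightarrow> (a k \<sigma> b has_real_derivative
      2 * pi * of_int (k * \<sigma>) * a k \<sigma> (b + pi / 2) t + c (- \<sigma>) (mh t) * a k (- \<sigma>) b t
        - c \<sigma> (mh t) * a k \<sigma> b t) (at t within {0..T})"

section \<open>Deviations of the five statistics from their limits\<close>

locale particle_limit = limit_modes c c_hi Lc T mh a + particle_semigroup c N P
  for c c_hi Lc T mh a N P
begin

text \<open>\<open>None\<close> stands for the total spin, \<open>Some\<close> for the four modes of
  one frequency.\<close>

definition mode_set :: "(int \<times> real) option set" where
  "mode_set = insert None (Some ` (spins \<times> {0, pi / 2}))"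

definition stat :: "int \<Rightarrow> (int \<times> real) option \<Rightarrow> (int \<times> int \<Rightarrow> nat) \<Rightarrow> real" where
  "stat k i = (case i of None \<Rightarrow> lin_stat N spin_fun | Some (\<sigma>, b) \<Rightarrow> lin_stat N (mode k \<sigma> b))"

text \<open>The spin is compared with \<open>mh t\<close> times the mass q of the configuration, not
  with the limiting spin. The deviation is then the error in the magnetization times q, which is
  what the products with rates require; and q is conserved, so the target is deterministic on a
  sector.\<close>

definition target :: "int \<Rightarrow> (int \<times> real) option \<Rightarrow> real \<Rightarrow> real \<Rightarrow> real" where
  "target k i q t = (case i of None \<Rightarrow> mh t * q | Some (\<sigma>, b) \<Rightarrow> a k \<sigma> b t)"

definition target' :: "int \<Rightarrow> (int \<times> real) option \<Rightarrow> real \<Rightarrow> real \<Rightarrow> real" where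
  "target' k i q t = (case i of None \<Rightarrow> mag_drift c (mh t) * q | Some (\<sigma>, b) \<Rightarrow>
     2 * pi * of_int (k * \<sigma>) * a k \<sigma> (b + pi / 2) t + c (- \<sigma>) (mh t) * a k (- \<sigma>) b t
        - c \<sigma> (mh t) * a k \<sigma> b t)"

definition deviation :: "int \<Rightarrow> real \<Rightarrow> (int \<times> int \<Rightarrow> nat) \<Rightarrow> real" where
  "deviation k t \<eta> = (\<Sum>i\<in>mode_set. (stat k i \<eta> - target k i (lin_stat N (\<lambda>_. 1) \<eta>) t)\<^sup>2)"

text \<open>\<open>2 * pi * \<bar>k\<bar>\<close> bounds transport; the rest is the Lipschitz
  constant of \<open>mag_drift\<close> and also dominates the cost \<open>2 * (Lc + c_hi)\<close> of
  the two flip terms of a mode.\<close>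

definition C0 :: "int \<Rightarrow> real" where
  "C0 k = 2 * pi * \<bar>of_int k\<bar> + 4 * Lc + 2 * c_hi"

text \<open>At most five statistics; each contributes \<open>2 * C0 k\<close> from the product of
  deviation and drift error, and 1 from separating the discretization error.\<close>

definition growth :: "int \<Rightarrow> real" where
  "growth k = 5 * (2 * C0 k + 1)"

text \<open>Five times the squared discretization error of the drift plus the quadratic term of the
  generator. It depends on the configuration only through the conserved mass.\<close>

definition noise :: "int \<Rightarrow> (int \<times> int \<Rightarrow> nat) \<Rightarrow> real" where
  "noise k \<eta> = (let q = lin_stat N (\<lambda>_. 1) \<eta> in
     5 * (((2 * pi * of_int k)\<^sup>2 * q / real N)\<^sup>2 + (1 + c_hi) * (2 * pi * \<bar>of_int k\<bar> + 2)\<^sup>2 * q / real N))"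

lemma finite_mode_set [simp]: "finite mode_set"
  by (simp add: mode_set_def)

lemma card_mode_set: "card mode_set \<le> 5"
proof -
  have "card (Some ` (spins \<times> {0, pi / 2})) \<le> 4"
    by (rule order.trans[OF card_image_le]) (simp_all add: spins_def)
  then show ?thesis unfolding mode_set_def by (auto intro: order.trans[OF card_insert_le_m1])
qed

lemma C0_nonneg: "0 \<le> C0 k"
  using Lc_nonneg c_hi_nonneg by (simp add: C0_def)

lemma lin_stat_one_nonneg: "0 \<le> lin_stat N (\<lambda>_. 1) \<eta>"
  by (simp add: lin_stat_one)

lemma noise_nonneg: "0 \<le> noise k \<eta>"
  using c_hi_nonneg lin_stat_one_nonneg[of \<eta>] by (simp add: noise_def Let_def)

lemma target_deriv:
  assumes "i \<in> mode_set" "t \<in> {0..T}"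
  shows "(target k i q has_real_derivative target' k i q t) (at t within {0..T})"
proof (cases i)
  case None
  have "((\<lambda>t. mh t * q) has_real_derivative mag_drift c (mh t) * q) (at t within {0..T})"
    by (rule DERIV_cmult_right[OF mh_deriv[OF assms(2)]])
  then show ?thesis by (simp add: None target_def[abs_def] target'_def)
next
  case (Some p)
  then obtain \<sigma> b where p: "p = (\<sigma>, b)" "\<sigma> \<in> spins" using assms(1) by (auto simp: mode_set_def)
  then show ?thesis using a_deriv[OF p(2) assms(2), of k b]
    by (simp add: Some target_def[abs_def] target'_def)
qed

lemma abs_le_deviation:
  assumes "i \<in> mode_set"
  shows "\<bar>stat k i \<eta> - target k i (lin_stat N (\<lambda>_. 1) \<eta>) t\<bar> \<le> sqrt (deviation k t \<eta>)"
proof -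
  have "(stat k i \<eta> - target k i (lin_stat N (\<lambda>_. 1) \<eta>) t)\<^sup>2 \<le> deviation k t \<eta>"
    unfolding deviation_def
    by (rule member_le_sum[OF assms, of "\<lambda>i. (stat k i \<eta> - target k i (lin_stat N (\<lambda>_. 1) \<eta>) t)\<^sup>2"]) auto
  then show ?thesis using real_le_rsqrt by (metis power2_abs)
qed

text \<open>A product of rate and mode is varied one factor at a time. Varying the rate costs at
  most \<open>Lc * \<bar>m - mh t\<bar> * q\<close>, since a mode is bounded by q, and this is
  controlled by the deviation of the spin.\<close>

lemma drift_error:
  fixes \<eta> :: "int \<times> int \<Rightarrow> nat"
  assumes i: "i \<in> mode_set" and t: "t \<in> {0..T}"
  defines "q \<equiv> lin_stat N (\<lambda>_. 1) \<eta>"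
  shows "\<bar>L (stat k i) \<eta> - target' k i q t\<bar>
    \<le> C0 k * sqrt (deviation k t \<eta>) + (2 * pi * of_int k)\<^sup>2 * q / real N"
proof -
  define r where "r = sqrt (deviation k t \<eta>)"
  define m where "m = magnetization_N N \<eta>"
  have q0: "0 \<le> q" by (simp add: q_def lin_stat_one_nonneg)
  have r0: "0 \<le> r" unfolding r_def deviation_def by (simp add: sum_nonneg)
  have mr: "m \<in> {-1..1}" unfolding m_def by (rule magnetization_N_eq(2)[OF N_pos])
  \<comment> \<open>The spin entry of the deviation, read as error of the magnetization times
    mass.\<close>
  have Y: "\<bar>m - mh t\<bar> * q \<le> r"
  proof -
    have "\<bar>stat k None \<eta> - target k None q t\<bar> \<le> r"
      unfolding r_def q_def by (rule abs_le_deviation) (simp add: mode_set_def)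
    then have "\<bar>(m - mh t) * q\<bar> \<le> r"
      by (simp add: stat_def target_def magnetization_N_eq(1)[OF N_pos] m_def q_def left_diff_distrib)
    then show ?thesis using q0 by (simp add: abs_mult)
  qed
  show ?thesis
  proof (cases i)
    case None
    have "L (stat k i) \<eta> - target' k i q t = q * (mag_drift c m - mag_drift c (mh t))"
      by (simp add: None stat_def target'_def generator_spin_fun[OF N_pos] m_def q_def right_diff_distrib)
    then have "\<bar>L (stat k i) \<eta> - target' k i q t\<bar> = q * \<bar>mag_drift c m - mag_drift c (mh t)\<bar>"
      using q0 by (simp add: abs_mult)
    also have "\<dots> \<le> q * ((4 * Lc + 2 * c_hi) * \<bar>m - mh t\<bar>)"
      using mag_drift_lipschitz[OF mr mh_range[OF t]] q0 by (intro mult_left_mono)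
    also have "\<dots> = (4 * Lc + 2 * c_hi) * (\<bar>m - mh t\<bar> * q)" by (simp add: mult_ac)
    also have "\<dots> \<le> C0 k * r"
      using Y r0 Lc_nonneg c_hi_nonneg q0 unfolding C0_def by (intro mult_mono) auto
    finally show ?thesis using q0 by (simp add: r_def[symmetric] add_increasing2)
  next
    case (Some p)
    then have "p \<in> spins \<times> {0, pi / 2}" using i unfolding mode_set_def by blast
    then obtain \<sigma> b where p: "p = (\<sigma>, b)" and \<sigma>: "\<sigma> \<in> spins" and b: "b \<in> {0, pi / 2}"
      by (rule SigmaE)
    define W where "W \<tau> b = lin_stat N (mode k \<tau> b) \<eta>" for \<tau> b
    have dev: "\<bar>W \<tau> b - a k \<tau> b t\<bar> \<le> r" if "\<tau> \<in> spins" "b \<in> {0, pi / 2}" for \<tau> b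
      using abs_le_deviation[of "Some (\<tau>, b)" k \<eta> t] that
      by (auto simp: mode_set_def stat_def target_def r_def W_def)
    have W_pi: "W \<tau> pi = - W \<tau> 0" for \<tau>
    proof -
      have "W \<tau> pi = lin_stat N (\<lambda>v. (-1) * mode k \<tau> 0 v) \<eta>"
        unfolding W_def by (intro lin_stat_cong) (simp add: mode_def)
      then show ?thesis unfolding lin_stat_cmult W_def by simp
    qed
    \<comment> \<open>From phase \<open>pi / 2\<close> the derivative leads to phase pi, where mode
      and target are the negatives of those at phase 0.\<close>
    have dev': "\<bar>W \<sigma> (b + pi / 2) - a k \<sigma> (b + pi / 2) t\<bar> \<le> r"
    proof (cases "b = 0")
      case True
      then show ?thesis using dev[OF \<sigma>, of "pi / 2"] by simp
    next
      case False
      then have "b + pi / 2 = pi" using b by auto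
      then show ?thesis using dev[OF \<sigma>, of 0] by (simp add: W_pi a_pi)
    qed
    have Wq: "\<bar>W \<tau> b\<bar> \<le> q" for \<tau>
      using abs_lin_stat_le[of "mode k \<tau> b" 1 N \<eta>] abs_mode_le by (simp add: W_def q_def)
    have prod: "\<bar>c \<tau> m * W s b - c \<tau> (mh t) * a k s b t\<bar> \<le> (Lc + c_hi) * r"
      if \<tau>: "\<tau> \<in> spins" and s: "s \<in> spins" for \<tau> s
    proof -
      have "\<bar>(c \<tau> m - c \<tau> (mh t)) * W s b\<bar> \<le> (Lc * \<bar>m - mh t\<bar>) * q"
        unfolding abs_mult using c_lip[OF \<tau> mr mh_range[OF t]] Wq Lc_nonneg by (intro mult_mono) auto
      also have "\<dots> \<le> Lc * r" using Y Lc_nonneg by (simp add: mult.assoc mult_left_mono)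
      finally have 1: "\<bar>(c \<tau> m - c \<tau> (mh t)) * W s b\<bar> \<le> Lc * r" .
      have 2: "\<bar>c \<tau> (mh t) * (W s b - a k s b t)\<bar> \<le> c_hi * r"
        unfolding abs_mult using abs_c_le[OF \<tau> mh_range[OF t]] dev[OF s b] c_hi_nonneg
        by (intro mult_mono) auto
      have "c \<tau> m * W s b - c \<tau> (mh t) * a k s b t =
          (c \<tau> m - c \<tau> (mh t)) * W s b + c \<tau> (mh t) * (W s b - a k s b t)"
        by (simp add: algebra_simps)
      then show ?thesis using 1 2 by (simp add: distrib_right)
    qed
    have tr: "\<bar>2 * pi * of_int (k * \<sigma>) * (W \<sigma> (b + pi / 2) - a k \<sigma> (b + pi / 2) t)\<bar> \<le> 2 * pi * \<bar>of_int k\<bar> * r"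
    proof -
      have "\<bar>real_of_int \<sigma>\<bar> = 1" using \<sigma> by (auto simp: spins_def)
      then have "\<bar>2 * pi * real_of_int (k * \<sigma>)\<bar> = 2 * pi * \<bar>of_int k\<bar>"
        by (simp add: abs_mult)
      then show ?thesis unfolding abs_mult[of "2 * pi * of_int (k * \<sigma>)"] using dev'
        by (intro mult_mono) auto
    qed
    have G: "\<bar>L (stat k i) \<eta> - (2 * pi * of_int (k * \<sigma>) * W \<sigma> (b + pi / 2) + c (- \<sigma>) m * W (- \<sigma>) b - c \<sigma> m * W \<sigma> b)\<bar>
        \<le> (2 * pi * of_int k)\<^sup>2 * q / real N"
      using generator_mode[OF N_pos \<sigma>, of c k b \<eta>] by (simp add: Some p stat_def W_def m_def q_def)
    have "L (stat k i) \<eta> - target' k i q t =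
      (L (stat k i) \<eta> - (2 * pi * of_int (k * \<sigma>) * W \<sigma> (b + pi / 2) + c (- \<sigma>) m * W (- \<sigma>) b - c \<sigma> m * W \<sigma> b))
      + 2 * pi * of_int (k * \<sigma>) * (W \<sigma> (b + pi / 2) - a k \<sigma> (b + pi / 2) t)
      + (c (- \<sigma>) m * W (- \<sigma>) b - c (- \<sigma>) (mh t) * a k (- \<sigma>) b t)
      - (c \<sigma> m * W \<sigma> b - c \<sigma> (mh t) * a k \<sigma> b t)"
      by (simp add: Some p target'_def algebra_simps)
    moreover have "\<bar>c (- \<sigma>) m * W (- \<sigma>) b - c (- \<sigma>) (mh t) * a k (- \<sigma>) b t\<bar> \<le> (Lc + c_hi) * r"
      "\<bar>c \<sigma> m * W \<sigma> b - c \<sigma> (mh t) * a k \<sigma> b t\<bar> \<le> (Lc + c_hi) * r"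
      using \<sigma> by (simp_all add: prod)
    ultimately have "\<bar>L (stat k i) \<eta> - target' k i q t\<bar> \<le>
        (2 * pi * of_int k)\<^sup>2 * q / real N + 2 * pi * \<bar>of_int k\<bar> * r + (Lc + c_hi) * r + (Lc + c_hi) * r"
      using G tr by (intro abs_combine4)
    also have "\<dots> \<le> C0 k * r + (2 * pi * of_int k)\<^sup>2 * q / real N"
      using mult_nonneg_nonneg[OF Lc_nonneg r0] by (simp add: C0_def algebra_simps)
    finally show ?thesis by (simp add: r_def)
  qed
qed

text \<open>The bound \<open>2 * pi * \<bar>k\<bar> + 2\<close> serves both kinds of jumps: the
  first summand bounds \<open>shift_diff\<close>, the second the change of a mode or of the spin
  under a flip.\<close>

lemma stat_square_bound:
  assumes i: "i \<in> mode_set"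
  shows "L (\<lambda>\<zeta>. (stat k i \<zeta> - z)\<^sup>2) \<eta> \<le> 2 * (stat k i \<eta> - z) * L (stat k i) \<eta> +
    (1 + c_hi) * (2 * pi * \<bar>of_int k\<bar> + 2)\<^sup>2 * lin_stat N (\<lambda>_. 1) \<eta> / real N"
proof (cases i)
  case None
  have per: "periodic_V spin_fun" by (simp add: spin_fun_def periodic_V_def)
  show ?thesis unfolding None stat_def option.case
    by (rule generator_lin_stat_square[where c = c and \<eta> = \<eta>, OF N_pos per c_le[OF _ magnetization_N_eq(2)[OF N_pos]] c_hi_nonneg])
       (auto simp: shift_diff_def spin_fun_def spins_def)
next
  case (Some p)
  then obtain \<sigma> b where p: "p = (\<sigma>, b)" and \<sigma>: "\<sigma> \<in> spins" using i by (auto simp: mode_set_def)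
  have per: "periodic_V (mode k \<sigma> b)" using mode_C_V by (simp add: C_V_def)
  show ?thesis unfolding Some p stat_def option.case prod.case
  proof (rule generator_lin_stat_square[where c = c and \<eta> = \<eta>, OF N_pos per c_le[OF _ magnetization_N_eq(2)[OF N_pos]] c_hi_nonneg])
    fix x \<tau> assume \<tau>: "\<tau> \<in> spins"
    show "\<bar>shift_diff N (mode k \<sigma> b) (x, \<tau>)\<bar> \<le> 2 * pi * \<bar>of_int k\<bar> + 2"
      using shift_diff_mode(2)[OF N_pos \<tau> \<sigma>, of k b x] by linarith
    have "\<bar>mode k \<sigma> b (x, - \<tau>) - mode k \<sigma> b (x, \<tau>)\<bar> \<le> 2"
      using abs_mode_le[of k \<sigma> b "(x, \<tau>)"] abs_mode_le[of k \<sigma> b "(x, - \<tau>)"] by linarith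
    moreover have "0 \<le> 2 * pi * \<bar>real_of_int k\<bar>" by simp
    ultimately show "\<bar>mode k \<sigma> b (x, - \<tau>) - mode k \<sigma> b (x, \<tau>)\<bar> \<le> 2 * pi * \<bar>of_int k\<bar> + 2"
      by linarith
  qed
qed

text \<open>Each summand is twice the deviation times the drift error, plus the quadratic term of
  the generator.\<close>

lemma deviation_drift:
  fixes \<eta> :: "int \<times> int \<Rightarrow> nat"
  assumes t: "t \<in> {0..T}"
  defines "q \<equiv> lin_stat N (\<lambda>_. 1) \<eta>"
  shows "(\<Sum>i\<in>mode_set. L (\<lambda>\<zeta>. (stat k i \<zeta> - target k i q t)\<^sup>2) \<eta> -
      2 * (stat k i \<eta> - target k i q t) * target' k i q t) \<le> growth k * deviation k t \<eta> + noise k \<eta>"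
proof -
  let ?r = "sqrt (deviation k t \<eta>)" and ?B = "(2 * pi * of_int k)\<^sup>2 * q / real N"
  let ?G = "(1 + c_hi) * (2 * pi * \<bar>of_int k\<bar> + 2)\<^sup>2 * q / real N"
  have dev0: "0 \<le> deviation k t \<eta>" unfolding deviation_def by (simp add: sum_nonneg)
  have q0: "0 \<le> q" by (simp add: q_def lin_stat_one_nonneg)
  have "L (\<lambda>\<zeta>. (stat k i \<zeta> - target k i q t)\<^sup>2) \<eta> - 2 * (stat k i \<eta> - target k i q t) * target' k i q t
      \<le> (2 * C0 k + 1) * deviation k t \<eta> + ?B\<^sup>2 + ?G" if i: "i \<in> mode_set" for i
  proof -
    let ?d = "stat k i \<eta> - target k i q t"
    have "?d * (L (stat k i) \<eta> - target' k i q t) \<le> \<bar>?d\<bar> * \<bar>L (stat k i) \<eta> - target' k i q t\<bar>"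
      by (simp flip: abs_mult)
    also have "\<dots> \<le> ?r * (C0 k * ?r + ?B)"
      using abs_le_deviation[OF i, of k \<eta> t] drift_error[OF i t, of k \<eta>] dev0
      unfolding q_def by (intro mult_mono) auto
    finally have 1: "?d * (L (stat k i) \<eta> - target' k i q t) \<le> C0 k * deviation k t \<eta> + ?r * ?B"
      using dev0 by (simp add: algebra_simps flip: power2_eq_square)
    \<comment> \<open>This lets the discretization error enter squared instead of multiplied by the
      deviation.\<close>
    have "2 * (?r * ?B) \<le> ?r\<^sup>2 + ?B\<^sup>2"
      using sum_squares_bound[of ?r ?B] by (simp add: mult.assoc)
    then have 2: "2 * (?r * ?B) \<le> deviation k t \<eta> + ?B\<^sup>2" using dev0 by simp
    have 3: "L (\<lambda>\<zeta>. (stat k i \<zeta> - target k i q t)\<^sup>2) \<eta> \<le> 2 * ?d * L (stat k i) \<eta> + ?G"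
      using stat_square_bound[OF i, of k "target k i q t" \<eta>] by (simp add: q_def)
    have "L (\<lambda>\<zeta>. (stat k i \<zeta> - target k i q t)\<^sup>2) \<eta> - 2 * ?d * target' k i q t \<le>
        2 * (?d * (L (stat k i) \<eta> - target' k i q t)) + ?G"
      using 3 by (simp add: algebra_simps)
    also have "\<dots> \<le> 2 * (C0 k * deviation k t \<eta>) + (deviation k t \<eta> + ?B\<^sup>2) + ?G"
      using 1 2 by linarith
    finally show ?thesis by (simp add: distrib_right)
  qed
  then have "(\<Sum>i\<in>mode_set. L (\<lambda>\<zeta>. (stat k i \<zeta> - target k i q t)\<^sup>2) \<eta> -
      2 * (stat k i \<eta> - target k i q t) * target' k i q t)
    \<le> real (card mode_set) * ((2 * C0 k + 1) * deviation k t \<eta> + ?B\<^sup>2 + ?G)"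
    by (intro sum_bounded_above)
  also have "\<dots> \<le> 5 * ((2 * C0 k + 1) * deviation k t \<eta> + ?B\<^sup>2 + ?G)"
    using card_mode_set dev0 C0_nonneg[of k] q0 c_hi_nonneg
    by (intro mult_right_mono add_nonneg_nonneg) auto
  also have "\<dots> = growth k * deviation k t \<eta> + noise k \<eta>"
    by (simp add: growth_def noise_def Let_def q_def)
  finally show ?thesis .
qed

lemma deviation_growth:
  assumes x: "x \<in> sector N K" and s: "0 \<le> s" "s \<le> t" "t \<le> T"
  shows "E (t - s) x (deviation k t) \<le> (deviation k s x + noise k x * (t - s)) * exp (growth k * (t - s))"
proof -
  let ?q = "lin_stat N (\<lambda>_. 1) x"
  \<comment> \<open>The mass is constant on the sector, so along the semigroup the targets are
    functions of time alone, as \<open>E_gronwall\<close> requires.\<close>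
  have q: "lin_stat N (\<lambda>_. 1) y = ?q" if "y \<in> sector N K" for y
    using that x by (simp add: lin_stat_one sector_def)
  have nz: "noise k y = noise k x" if "y \<in> sector N K" for y
    using q[OF that] by (simp add: noise_def)
  have "E (t - s) x (\<lambda>y. \<Sum>i\<in>mode_set. (stat k i y - target k i ?q (s + (t - s)))\<^sup>2)
      \<le> ((\<Sum>i\<in>mode_set. (stat k i x - target k i ?q (s + 0))\<^sup>2) + noise k x * (t - s)) * exp (growth k * (t - s))"
  proof (rule E_gronwall[OF x, where A' = "\<lambda>i r. target' k i ?q (s + r)"])
    show "0 \<le> growth k" using C0_nonneg[of k] by (simp add: growth_def)
    fix i r assume i: "i \<in> mode_set" and r: "r \<in> {0..t - s}"
    have "(\<lambda>r. s + r) ` {0..t - s} \<subseteq> {0..T}" using s by auto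
    then have "(target k i ?q has_real_derivative target' k i ?q (s + r)) (at (s + r) within (\<lambda>r. s + r) ` {0..t - s})"
      using target_deriv[OF i, of "s + r" k ?q] r s by (auto intro: has_field_derivative_subset)
    moreover have "((\<lambda>r. s + r) has_real_derivative 1) (at r within {0..t - s})"
      by (auto intro!: derivative_eq_intros)
    ultimately show "((\<lambda>r. target k i ?q (s + r)) has_real_derivative target' k i ?q (s + r)) (at r within {0..t - s})"
      using DERIV_image_chain[of "target k i ?q" "target' k i ?q (s + r)" "\<lambda>r. s + r" r "{0..t - s}" 1]
      by (simp add: o_def)
  next
    fix r y assume r: "r \<in> {0..t - s}" and y: "y \<in> sector N K"
    show "(\<Sum>i\<in>mode_set. L (\<lambda>\<zeta>. (stat k i \<zeta> - target k i ?q (s + r))\<^sup>2) y -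
        2 * (stat k i y - target k i ?q (s + r)) * target' k i ?q (s + r))
      \<le> growth k * (\<Sum>i\<in>mode_set. (stat k i y - target k i ?q (s + r))\<^sup>2) + noise k x"
      using deviation_drift[where t = "s + r" and \<eta> = y and k = k] r s q[OF y] nz[OF y] by (simp add: deviation_def)
  qed (use s noise_nonneg in auto)
  moreover have "E (t - s) x (deviation k t) =
      E (t - s) x (\<lambda>y. \<Sum>i\<in>mode_set. (stat k i y - target k i ?q (s + (t - s)))\<^sup>2)"
    using s by (intro E_cong[OF x]) (auto simp: deviation_def q)
  ultimately show ?thesis by (simp add: deviation_def)
qed

definition potential :: "int \<Rightarrow> real \<Rightarrow> (int \<times> int \<Rightarrow> nat) \<Rightarrow> real" where
  "potential k t \<eta> = exp (- growth k * t) * deviation k t \<eta> + noise k \<eta> * (T - t)"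

lemma potential_supermartingale:
  assumes x: "x \<in> sector N K" and s: "0 \<le> s" "s \<le> t" "t \<le> T"
  shows "E (t - s) x (potential k t) \<le> potential k s x"
proof -
  have nz: "noise k y = noise k x" if "y \<in> sector N K" for y
    using that x by (simp add: noise_def lin_stat_one sector_def)
  have g0: "0 \<le> growth k" using C0_nonneg[of k] by (simp add: growth_def)
  have "E (t - s) x (potential k t) = E (t - s) x (\<lambda>y. exp (- growth k * t) * deviation k t y + noise k x * (T - t))"
    using s nz by (intro E_cong[OF x]) (auto simp: potential_def)
  also have "\<dots> = exp (- growth k * t) * E (t - s) x (deviation k t) + noise k x * (T - t)"
    using s x by (simp add: E_add E_cmult E_const)
  also have "\<dots> \<le> exp (- growth k * t) * ((deviation k s x + noise k x * (t - s)) * exp (growth k * (t - s))) + noise k x * (T - t)"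
    using deviation_growth[OF x s] by (intro add_right_mono mult_left_mono) auto
  also have "exp (- growth k * t) * ((deviation k s x + noise k x * (t - s)) * exp (growth k * (t - s))) =
      exp (- growth k * s) * deviation k s x + exp (- growth k * s) * (noise k x * (t - s))"
  proof -
    have "exp (- growth k * t) * exp (growth k * (t - s)) = exp (- growth k * s)"
      by (simp add: algebra_simps flip: exp_add)
    then show ?thesis by (simp add: distrib_left distrib_right mult_ac)
  qed
  \<comment> \<open>Noise is charged at full price, without the discount, so that the allowance for
    the remaining time is linear in \<open>T - t\<close>.\<close>
  also have "exp (- growth k * s) * (noise k x * (t - s)) \<le> 1 * (noise k x * (t - s))"
    using g0 s noise_nonneg by (intro mult_right_mono mult_nonneg_nonneg) auto
  finally have "E (t - s) x (potential k t) \<le>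
      exp (- growth k * s) * deviation k s x + (noise k x * (t - s) + noise k x * (T - t))"
    by simp
  also have "noise k x * (t - s) + noise k x * (T - t) = noise k x * (T - s)"
    by (simp add: algebra_simps)
  finally show ?thesis by (simp only: potential_def[abs_def])
qed

lemma deviation_nonneg: "0 \<le> deviation k t \<eta>"
  unfolding deviation_def by (simp add: sum_nonneg)

lemma potential_nonneg: "t \<le> T \<Longrightarrow> 0 \<le> potential k t \<eta>"
  unfolding potential_def using noise_nonneg deviation_nonneg by simp

lemma potential_continuous: "continuous_on {0..T} (\<lambda>t. potential k t \<eta>)"
proof -
  have "continuous_on {0..T} (target k i q)" if "i \<in> mode_set" for i q
    using DERIV_continuous_on[OF target_deriv[OF that]] .
  then show ?thesis unfolding potential_def deviation_def
    by (intro continuous_intros) auto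
qed

end

section \<open>Maximal inequality along the paths\<close>

text \<open>Joint law of the process at the times \<open>\<tau> 0, ..., \<tau> n\<close>, with the
  current state at the end of the list. It carries the discrete form of Doob's inequality.\<close>

fun chain_pmf :: "'a pmf \<Rightarrow> (real \<Rightarrow> 'a \<Rightarrow> 'a pmf) \<Rightarrow> (nat \<Rightarrow> real) \<Rightarrow> nat \<Rightarrow> 'a list pmf" where
  "chain_pmf \<mu> P \<tau> 0 = map_pmf (\<lambda>x. [x]) \<mu>"
| "chain_pmf \<mu> P \<tau> (Suc n) = bind_pmf (chain_pmf \<mu> P \<tau> n)
     (\<lambda>l. map_pmf (\<lambda>y. l @ [y]) (P (\<tau> (Suc n) - \<tau> n) (last l)))"

lemma pmf_chain_snoc:
  "pmf (chain_pmf \<mu> P \<tau> (Suc n)) (l @ [y]) =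
    pmf (chain_pmf \<mu> P \<tau> n) l * pmf (P (\<tau> (Suc n) - \<tau> n) (last l)) y"
proof -
  have "pmf (map_pmf (\<lambda>y. l' @ [y]) q) (l @ [y]) = indicator {l} l' * pmf q y" for l' and q :: "'a pmf"
  proof (cases "l' = l")
    case True
    have "pmf (map_pmf (\<lambda>y. l @ [y]) q) ((\<lambda>y. l @ [y]) y) = pmf q y"
      by (rule pmf_map_inj') (simp add: inj_def)
    then show ?thesis using True by simp
  next
    case False
    then show ?thesis by (auto simp: pmf_eq_0_set_pmf)
  qed
  then have "pmf (chain_pmf \<mu> P \<tau> (Suc n)) (l @ [y]) =
      (\<integral>l'. indicator {l} l' * pmf (P (\<tau> (Suc n) - \<tau> n) (last l')) y \<partial>chain_pmf \<mu> P \<tau> n)"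
    by (simp add: pmf_bind)
  also have "\<dots> = (\<Sum>l'\<in>{l}. pmf (chain_pmf \<mu> P \<tau> n) l' *\<^sub>R (indicator {l} l' * pmf (P (\<tau> (Suc n) - \<tau> n) (last l')) y))"
    by (rule integral_measure_pmf) (auto simp: indicator_def split: if_splits)
  finally show ?thesis by simp
qed

lemma pmf_chain:
  "pmf (chain_pmf \<mu> P \<tau> n) (map \<xi> [0..<Suc n]) =
    pmf \<mu> (\<xi> 0) * (\<Prod>i<n. pmf (P (\<tau> (Suc i) - \<tau> i) (\<xi> i)) (\<xi> (Suc i)))"
proof (induction n)
  case 0
  have "pmf (map_pmf (\<lambda>x. [x]) \<mu>) ((\<lambda>x. [x]) (\<xi> 0)) = pmf \<mu> (\<xi> 0)"
    by (rule pmf_map_inj') (simp add: inj_def)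
  then show ?case by simp
next
  case (Suc n)
  have "map \<xi> [0..<Suc (Suc n)] = map \<xi> [0..<Suc n] @ [\<xi> (Suc n)]" by simp
  moreover have "last (map \<xi> [0..<Suc n]) = \<xi> n" by (simp add: last_map)
  ultimately show ?case
    using pmf_chain_snoc[of \<mu> P \<tau> n "map \<xi> [0..<Suc n]" "\<xi> (Suc n)"] Suc.IH
    by (simp del: upt_Suc chain_pmf.simps add: mult.assoc)
qed

lemma set_chain_pmf:
  assumes \<mu>: "set_pmf \<mu> \<subseteq> A" and P: "\<And>t x. 0 \<le> t \<Longrightarrow> x \<in> A \<Longrightarrow> set_pmf (P t x) \<subseteq> A"
    and mono: "mono_on {..n} \<tau>"
  shows "l \<in> set_pmf (chain_pmf \<mu> P \<tau> n) \<Longrightarrow> length l = Suc n \<and> set l \<subseteq> A"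
  using mono
proof (induction n arbitrary: l)
  case 0
  then show ?case using \<mu> by auto
next
  case (Suc n)
  then obtain l' y where l': "l' \<in> set_pmf (chain_pmf \<mu> P \<tau> n)" "l = l' @ [y]"
    "y \<in> set_pmf (P (\<tau> (Suc n) - \<tau> n) (last l'))"
    by auto
  have "mono_on {..n} \<tau>" by (rule mono_on_subset[OF Suc.prems(2)]) auto
  then have IH: "length l' = Suc n \<and> set l' \<subseteq> A" by (rule Suc.IH[OF l'(1)])
  then have "last l' \<in> A" by (cases l' rule: rev_cases) auto
  moreover have "\<tau> n \<le> \<tau> (Suc n)" using mono_onD[OF Suc.prems(2), of n "Suc n"] by simp
  ultimately have "y \<in> A" using P[of "\<tau> (Suc n) - \<tau> n" "last l'"] l'(3) by auto
  then show ?case using IH l'(2) by auto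
qed

text \<open>\<open>\<Phi>\<close> is the process frozen at the value r from the first time it
  reaches r. Its expectation does not increase, and it dominates r times the indicator of the bad
  event.\<close>

lemma chain_maximal_inequality:
  fixes g :: "nat \<Rightarrow> 'a \<Rightarrow> ennreal"
  assumes \<mu>: "set_pmf \<mu> \<subseteq> A" and P: "\<And>t x. 0 \<le> t \<Longrightarrow> x \<in> A \<Longrightarrow> set_pmf (P t x) \<subseteq> A"
    and mono: "mono_on {..n} \<tau>"
    and super: "\<And>i x. i < n \<Longrightarrow> x \<in> A \<Longrightarrow> (\<integral>\<^sup>+y. g (Suc i) y \<partial>P (\<tau> (Suc i) - \<tau> i) x) \<le> g i x"
  shows "r * emeasure (chain_pmf \<mu> P \<tau> n) {l. \<exists>i\<le>n. r \<le> g i (l ! i)} \<le> (\<integral>\<^sup>+x. g 0 x \<partial>\<mu>)"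
proof -
  define \<Phi> where "\<Phi> n l = (if \<exists>i\<le>n. r \<le> g i (l ! i) then r else g n (last l))" for n l
  have *: "k \<le> n \<Longrightarrow> (\<integral>\<^sup>+l. \<Phi> k l \<partial>chain_pmf \<mu> P \<tau> k) \<le> (\<integral>\<^sup>+x. g 0 x \<partial>\<mu>)" for k
  proof (induction k)
    case 0
    have "(\<integral>\<^sup>+l. \<Phi> 0 l \<partial>chain_pmf \<mu> P \<tau> 0) = (\<integral>\<^sup>+x. (if r \<le> g 0 x then r else g 0 x) \<partial>\<mu>)"
      by (simp add: \<Phi>_def cong: if_cong)
    also have "\<dots> \<le> (\<integral>\<^sup>+x. g 0 x \<partial>\<mu>)" by (intro nn_integral_mono) auto
    finally show ?case .
  next
    case (Suc k)
    have mono_k: "mono_on {..k} \<tau>"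
      by (rule mono_on_subset[OF mono]) (use Suc.prems in auto)
    have "(\<integral>\<^sup>+l. \<Phi> (Suc k) l \<partial>chain_pmf \<mu> P \<tau> (Suc k)) =
        (\<integral>\<^sup>+l. (\<integral>\<^sup>+y. \<Phi> (Suc k) (l @ [y]) \<partial>P (\<tau> (Suc k) - \<tau> k) (last l)) \<partial>chain_pmf \<mu> P \<tau> k)"
      by simp
    also have "\<dots> \<le> (\<integral>\<^sup>+l. \<Phi> k l \<partial>chain_pmf \<mu> P \<tau> k)"
    proof (intro nn_integral_mono_AE AE_pmfI)
      fix l assume "l \<in> set_pmf (chain_pmf \<mu> P \<tau> k)"
      then have l: "length l = Suc k" "set l \<subseteq> A" using set_chain_pmf[OF \<mu> P mono_k] by auto
      then have last: "last l \<in> A" by (cases l rule: rev_cases) auto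
      have nth: "i \<le> k \<Longrightarrow> (l @ [y]) ! i = l ! i" "(l @ [y]) ! Suc k = y" for i y
        using l by (auto simp: nth_append)
      have bad: "(\<exists>i\<le>Suc k. r \<le> g i ((l @ [y]) ! i)) \<longleftrightarrow> (\<exists>i\<le>k. r \<le> g i (l ! i)) \<or> r \<le> g (Suc k) y" for y
        using nth by (auto simp: le_Suc_eq)
      show "(\<integral>\<^sup>+y. \<Phi> (Suc k) (l @ [y]) \<partial>P (\<tau> (Suc k) - \<tau> k) (last l)) \<le> \<Phi> k l"
      proof (cases "\<exists>i\<le>k. r \<le> g i (l ! i)")
        case True
        then have "\<Phi> (Suc k) (l @ [y]) = r" for y by (simp add: \<Phi>_def bad)
        then show ?thesis using True by (simp add: \<Phi>_def)
      next
        case False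
        have "(\<integral>\<^sup>+y. \<Phi> (Suc k) (l @ [y]) \<partial>P (\<tau> (Suc k) - \<tau> k) (last l))
            \<le> (\<integral>\<^sup>+y. g (Suc k) y \<partial>P (\<tau> (Suc k) - \<tau> k) (last l))"
          using False by (intro nn_integral_mono) (auto simp: \<Phi>_def bad)
        also have "\<dots> \<le> g k (last l)" using super[of k "last l"] Suc.prems last by simp
        also have "g k (last l) = \<Phi> k l" using False unfolding \<Phi>_def by (simp only: if_False)
        finally show ?thesis .
      qed
    qed
    finally show ?case using Suc by simp
  qed
  have "r * emeasure (chain_pmf \<mu> P \<tau> n) {l. \<exists>i\<le>n. r \<le> g i (l ! i)} =
      (\<integral>\<^sup>+l. r * indicator {l. \<exists>i\<le>n. r \<le> g i (l ! i)} l \<partial>chain_pmf \<mu> P \<tau> n)"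
    by (simp add: nn_integral_cmult_indicator)
  also have "\<dots> \<le> (\<integral>\<^sup>+l. \<Phi> n l \<partial>chain_pmf \<mu> P \<tau> n)"
    by (intro nn_integral_mono) (auto simp: \<Phi>_def indicator_def)
  finally show ?thesis using *[of n] by simp
qed

section \<open>From sampled times to continuous time\<close>

locale markov_paths = prob_space M
  for M :: "'w measure" +
  fixes T :: real and A :: "'a :: topological_space set" and P :: "real \<Rightarrow> 'a \<Rightarrow> 'a pmf"
    and X :: "real \<Rightarrow> 'w \<Rightarrow> 'a" and \<mu> :: "'a pmf"
  assumes T_pos: "0 < T" and countable_A: "countable A"
    and X_measurable: "\<And>t. t \<in> {0..T} \<Longrightarrow> X t \<in> measurable M (count_space A)"
    and P_semigroup: "markov_semigroup A P"
    and markov: "markov_property M T A P X"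
    and set_\<mu>: "set_pmf \<mu> \<subseteq> A"
    and start: "\<And>x. measure M {\<omega> \<in> space M. X 0 \<omega> = x} = pmf \<mu> x"
begin

lemma X_in: "t \<in> {0..T} \<Longrightarrow> \<omega> \<in> space M \<Longrightarrow> X t \<omega> \<in> A"
  using measurable_space[OF X_measurable] by simp

lemma X_event: "t \<in> {0..T} \<Longrightarrow> {\<omega> \<in> space M. X t \<omega> = x} \<in> sets M"
proof -
  assume t: "t \<in> {0..T}"
  show ?thesis
  proof (cases "x \<in> A")
    case True
    have "X t -` {x} \<inter> space M \<in> sets M"
      by (rule measurable_sets[OF X_measurable[OF t]]) (use True in auto)
    moreover have "{\<omega> \<in> space M. X t \<omega> = x} = X t -` {x} \<inter> space M" by auto
    ultimately show ?thesis by simp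
  next
    case False
    then have "{\<omega> \<in> space M. X t \<omega> = x} = {}" using X_in[OF t] by auto
    then show ?thesis by (simp only: sets.empty_sets)
  qed
qed

definition skeleton :: "(nat \<Rightarrow> real) \<Rightarrow> nat \<Rightarrow> 'w \<Rightarrow> 'a list" where
  "skeleton \<tau> n \<omega> = map (\<lambda>i. X (\<tau> i) \<omega>) [0..<Suc n]"

lemma skeleton_measurable:
  assumes "\<And>i. i \<le> n \<Longrightarrow> \<tau> i \<in> {0..T}"
  shows "skeleton \<tau> n \<in> measurable M (count_space UNIV)"
proof -
  have "skeleton \<tau> n \<in> measurable M (count_space (lists A))"
    unfolding measurable_count_space_eq_countable[OF countable_lists[OF countable_A]]
  proof (intro conjI ballI)
    show "skeleton \<tau> n \<in> space M \<rightarrow> lists A"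
      using X_in assms by (auto simp: skeleton_def)
    fix l
    show "skeleton \<tau> n -` {l} \<inter> space M \<in> sets M"
    proof (cases "length l = Suc n")
      case True
      then have "skeleton \<tau> n -` {l} \<inter> space M = (\<Inter>i\<in>{..n}. {\<omega> \<in> space M. X (\<tau> i) \<omega> = l ! i})"
        by (auto simp: skeleton_def list_eq_iff_nth_eq less_Suc_eq_le simp del: upt_Suc)
      also have "\<dots> \<in> sets M" using assms by (intro sets.finite_INT X_event) auto
      finally show ?thesis .
    next
      case False
      then have "skeleton \<tau> n -` {l} \<inter> space M = {}" by (auto simp: skeleton_def)
      then show ?thesis by (simp only: sets.empty_sets)
    qed
  qed
  from measurable_compose[OF this, of "\<lambda>l. l" "count_space UNIV"] show ?thesis by simp
qed

text \<open>Both sides are concentrated on a countable set of lists, and on a single list the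
  equation is the Markov property. \<open>\<tau> 0 = 0\<close> identifies the law of the first
  entry.\<close>

lemma distr_skeleton:
  assumes mono: "mono_on {..n} \<tau>" and \<tau>: "\<And>i. i \<le> n \<Longrightarrow> \<tau> i \<in> {0..T}" and \<tau>0: "\<tau> 0 = 0"
  shows "distr M (count_space UNIV) (skeleton \<tau> n) = measure_pmf (chain_pmf \<mu> P \<tau> n)"
proof (rule measure_eqI_countable_AE[where \<Omega> = "{l \<in> lists A. length l = Suc n}"])
  note m = skeleton_measurable[OF \<tau>]
  have P: "\<And>t x. 0 \<le> t \<Longrightarrow> x \<in> A \<Longrightarrow> set_pmf (P t x) \<subseteq> A"
    using P_semigroup by (auto simp: markov_semigroup_def)
  show "AE l in distr M (count_space UNIV) (skeleton \<tau> n). l \<in> {l \<in> lists A. length l = Suc n}"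
    by (subst AE_distr_iff[OF m]) (use X_in \<tau> in \<open>auto simp: skeleton_def intro!: AE_I2\<close>)
  show "AE l in chain_pmf \<mu> P \<tau> n. l \<in> {l \<in> lists A. length l = Suc n}"
    using set_chain_pmf[OF set_\<mu> P mono] by (auto simp: AE_measure_pmf_iff lists_eq_set)
  show "countable {l \<in> lists A. length l = Suc n}"
    by (rule countable_subset[OF _ countable_lists[OF countable_A]]) auto
  fix l assume l: "l \<in> {l \<in> lists A. length l = Suc n}"
  define \<xi> where "\<xi> i = l ! i" for i
  have l_eq: "l = map \<xi> [0..<Suc n]"
    using l map_nth[of l] unfolding \<xi>_def by (simp del: upt_Suc)
  have \<xi>: "\<xi> ` {..n} \<subseteq> A" using l by (auto simp: \<xi>_def in_lists_conv_set)
  have "emeasure (distr M (count_space UNIV) (skeleton \<tau> n)) {l} = emeasure M (skeleton \<tau> n -` {l} \<inter> space M)"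
    by (rule emeasure_distr[OF m]) auto
  also have "skeleton \<tau> n -` {l} \<inter> space M = {\<omega> \<in> space M. \<forall>i\<le>n. X (\<tau> i) \<omega> = \<xi> i}"
    unfolding l_eq skeleton_def by (auto simp del: upt_Suc simp: less_Suc_eq_le)
  also have "emeasure M \<dots> = ennreal (measure M {\<omega> \<in> space M. \<forall>i\<le>n. X (\<tau> i) \<omega> = \<xi> i})"
    by (rule emeasure_eq_measure)
  also have "measure M {\<omega> \<in> space M. \<forall>i\<le>n. X (\<tau> i) \<omega> = \<xi> i} =
      measure M {\<omega> \<in> space M. X (\<tau> 0) \<omega> = \<xi> 0} * (\<Prod>i<n. pmf (P (\<tau> (Suc i) - \<tau> i) (\<xi> i)) (\<xi> (Suc i)))"
    using markov mono \<tau> \<xi> unfolding markov_property_def by (auto simp: image_subset_iff)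
  also have "\<dots> = pmf (chain_pmf \<mu> P \<tau> n) l"
    unfolding l_eq pmf_chain \<tau>0 start ..
  finally show "emeasure (distr M (count_space UNIV) (skeleton \<tau> n)) {l} = emeasure (measure_pmf (chain_pmf \<mu> P \<tau> n)) {l}"
    by (simp add: emeasure_pmf_single)
qed simp_all

text \<open>Doob's inequality on the dyadic times, extended to all times by right-continuity.\<close>

lemma maximal_inequality:
  fixes G :: "real \<Rightarrow> 'a \<Rightarrow> real"
  assumes cont: "\<And>x. x \<in> A \<Longrightarrow> continuous_on {0..T} (\<lambda>t. G t x)"
    and super: "\<And>s t x. 0 \<le> s \<Longrightarrow> s \<le> t \<Longrightarrow> t \<le> T \<Longrightarrow> x \<in> A \<Longrightarrow>
      (\<integral>\<^sup>+y. ennreal (G t y) \<partial>P (t - s) x) \<le> ennreal (G s x)"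
    and jump: "\<And>\<omega> t. \<omega> \<in> space M \<Longrightarrow> 0 \<le> t \<Longrightarrow> t < T \<Longrightarrow> \<forall>\<^sub>F s in at_right t. X s \<omega> = X t \<omega>"
    and r: "0 < r"
  obtains B where "B \<in> sets M" "ennreal r * emeasure M B \<le> (\<integral>\<^sup>+x. ennreal (G 0 x) \<partial>\<mu>)"
    "\<And>\<omega> t. \<omega> \<in> space M - B \<Longrightarrow> t \<in> {0..T} \<Longrightarrow> G t (X t \<omega>) \<le> r"
proof -
  define \<tau> where "\<tau> n i = T * real i / 2 ^ n" for n i :: nat
  define S where "S n = {l. \<exists>i\<le>2 ^ n. ennreal r \<le> ennreal (G (\<tau> n i) (l ! i))}" for n :: nat
  define B where "B n = {\<omega> \<in> space M. \<exists>i\<le>2 ^ n. r \<le> G (\<tau> n i) (X (\<tau> n i) \<omega>)}" for n :: nat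
  have \<tau>: "\<tau> n i \<in> {0..T}" if "i \<le> 2 ^ n" for n i :: nat
  proof -
    have "T * real i \<le> T * 2 ^ n" using that T_pos by (intro mult_left_mono) (auto simp: numeral_power_le_of_nat_cancel_iff of_nat_le_numeral_power_cancel_iff)
    then show ?thesis using T_pos by (auto simp: \<tau>_def field_simps)
  qed
  have mono: "mono_on {..2 ^ n} (\<tau> n)" for n :: nat
    using T_pos by (auto simp: mono_on_def \<tau>_def divide_right_mono mult_left_mono)
  have \<tau>0: "\<tau> n 0 = 0" for n by (simp add: \<tau>_def)
  have B_eq: "B n = skeleton (\<tau> n) (2 ^ n) -` S n \<inter> space M" for n
    using r by (auto simp: B_def S_def skeleton_def less_Suc_eq_le ennreal_le_iff2 simp del: upt_Suc)
  have B_sets: "B n \<in> sets M" for n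
    unfolding B_eq by (rule measurable_sets[OF skeleton_measurable[OF \<tau>]]) auto
  have B_bound: "ennreal r * emeasure M (B n) \<le> (\<integral>\<^sup>+x. ennreal (G 0 x) \<partial>\<mu>)" for n
  proof -
    have "emeasure M (B n) = emeasure (distr M (count_space UNIV) (skeleton (\<tau> n) (2 ^ n))) (S n)"
      unfolding B_eq by (rule emeasure_distr[symmetric, OF skeleton_measurable[OF \<tau>]]) auto
    also have "\<dots> = emeasure (chain_pmf \<mu> P (\<tau> n) (2 ^ n)) (S n)"
      by (subst distr_skeleton[OF mono \<tau> \<tau>0]) auto
    finally have e: "emeasure M (B n) = emeasure (chain_pmf \<mu> P (\<tau> n) (2 ^ n)) (S n)" .
    have "ennreal r * emeasure (chain_pmf \<mu> P (\<tau> n) (2 ^ n)) (S n) \<le> (\<integral>\<^sup>+x. ennreal (G (\<tau> n 0) x) \<partial>\<mu>)"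
      unfolding S_def
    proof (rule chain_maximal_inequality[OF set_\<mu> _ mono])
      show "0 \<le> t \<Longrightarrow> x \<in> A \<Longrightarrow> set_pmf (P t x) \<subseteq> A" for t x
        using P_semigroup by (auto simp: markov_semigroup_def)
      fix i :: nat and x assume i: "i < 2 ^ n" and x: "x \<in> A"
      have "\<tau> n i \<le> \<tau> n (Suc i)" using mono_onD[OF mono, of i n "Suc i"] i by simp
      then show "(\<integral>\<^sup>+y. ennreal (G (\<tau> n (Suc i)) y) \<partial>P (\<tau> n (Suc i) - \<tau> n i) x) \<le> ennreal (G (\<tau> n i) x)"
        using \<tau>[of i n] \<tau>[of "Suc i" n] i x by (intro super) auto
    qed
    then show ?thesis by (simp add: e \<tau>0)
  qed
  \<comment> \<open>The dyadic grids are nested, so the bad events increase and the bound survives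
    in the limit.\<close>
  have B_Suc: "B n \<subseteq> B (Suc n)" for n :: nat
  proof
    fix \<omega> assume "\<omega> \<in> B n"
    then obtain i where i: "\<omega> \<in> space M" "i \<le> 2 ^ n" "r \<le> G (\<tau> n i) (X (\<tau> n i) \<omega>)" by (auto simp: B_def)
    have "\<tau> n i = \<tau> (Suc n) (2 * i)" by (simp add: \<tau>_def)
    then show "\<omega> \<in> B (Suc n)" using i by (auto simp: B_def intro!: exI[of _ "2 * i"])
  qed
  show ?thesis
  proof (rule that[of "\<Union>n. B n"])
    show "(\<Union>n. B n) \<in> sets M" using B_sets by auto
    have "emeasure M (\<Union>n. B n) = (SUP n. emeasure M (B n))"
      by (rule SUP_emeasure_incseq[symmetric]) (use B_sets B_Suc in \<open>auto intro: incseq_SucI\<close>)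
    then have "ennreal r * emeasure M (\<Union>n. B n) = (SUP n. ennreal r * emeasure M (B n))"
      by (simp add: SUP_mult_left_ennreal)
    also have "\<dots> \<le> (\<integral>\<^sup>+x. ennreal (G 0 x) \<partial>\<mu>)" using B_bound by (intro SUP_least) auto
    finally show "ennreal r * emeasure M (\<Union>n. B n) \<le> (\<integral>\<^sup>+x. ennreal (G 0 x) \<partial>\<mu>)" .
    fix \<omega> t assume \<omega>: "\<omega> \<in> space M - (\<Union>n. B n)" and t: "t \<in> {0..T}"
    show "G t (X t \<omega>) \<le> r"
    proof (rule ccontr)
      assume "\<not> G t (X t \<omega>) \<le> r"
      then have gt: "r < G t (X t \<omega>)" by simp
      show False
      proof (cases "t = T")
        case True
        \<comment> \<open>T is a point of every grid, already of the coarsest one, where it has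
          index 1; no later time could stand in for it.\<close>
        then have "\<omega> \<in> B 0" using \<omega> gt by (auto simp: B_def \<tau>_def intro!: exI[of _ "1 :: nat"])
        then show False using \<omega> by blast
      next
        case False
        then have tT: "0 \<le> t" "t < T" using t by auto
        have xA: "X t \<omega> \<in> A" using X_in t \<omega> by auto
        have "((\<lambda>s. G s (X t \<omega>)) \<longlongrightarrow> G t (X t \<omega>)) (at t within {0..T})"
          using cont[OF xA] t by (simp add: continuous_on)
        then have "\<forall>\<^sub>F s in at t within {0..T}. r < G s (X t \<omega>)"
          by (rule order_tendstoD(1)) (use gt in simp)
        then obtain d1 where d1: "0 < d1" "\<And>s. s \<in> {0..T} \<Longrightarrow> s \<noteq> t \<Longrightarrow> dist s t < d1 \<Longrightarrow> r < G s (X t \<omega>)"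
          by (auto simp: eventually_at)
        obtain d2 where d2: "t < d2" "\<And>s. t < s \<Longrightarrow> s < d2 \<Longrightarrow> X s \<omega> = X t \<omega>"
          using jump[of \<omega> t] \<omega> tT by (auto simp: eventually_at_right_field)
        define d where "d = min d1 (min (d2 - t) (T - t))"
        have d: "0 < d" using d1 d2 tT by (simp add: d_def)
        obtain n where n: "T / d < 2 ^ n" using real_arch_pow[of 2 "T / d"] by auto
        \<comment> \<open>The first grid point strictly after t: both neighbourhoods found above
          exclude t itself.\<close>
        define i where "i = nat \<lfloor>t * 2 ^ n / T\<rfloor> + 1"
        have fl: "real (nat \<lfloor>t * 2 ^ n / T\<rfloor>) \<le> t * 2 ^ n / T" "t * 2 ^ n / T < real (nat \<lfloor>t * 2 ^ n / T\<rfloor>) + 1"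
        proof -
          have "0 \<le> \<lfloor>t * 2 ^ n / T\<rfloor>" using tT T_pos by simp
          then have "real (nat \<lfloor>t * 2 ^ n / T\<rfloor>) = of_int \<lfloor>t * 2 ^ n / T\<rfloor>" by simp
          then show "real (nat \<lfloor>t * 2 ^ n / T\<rfloor>) \<le> t * 2 ^ n / T" "t * 2 ^ n / T < real (nat \<lfloor>t * 2 ^ n / T\<rfloor>) + 1"
            by linarith+
        qed
        have i: "real i = real (nat \<lfloor>t * 2 ^ n / T\<rfloor>) + 1" by (simp add: i_def)
        have "t * 2 ^ n / T < real i" using fl i by linarith
        then have lower: "t < \<tau> n i" using T_pos by (simp add: \<tau>_def field_simps)
        have "real i \<le> t * 2 ^ n / T + 1" using fl i by linarith
        then have "T * real i \<le> t * 2 ^ n + T" using T_pos by (simp add: field_simps)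
        then have "\<tau> n i \<le> t + T / 2 ^ n" by (simp add: \<tau>_def field_simps)
        also have "T / 2 ^ n < d" using n d by (simp add: field_simps)
        finally have upper: "\<tau> n i < t + d" by simp
        have "\<tau> n i < T" using upper by (simp add: d_def)
        then have "real i < 2 ^ n" using T_pos by (simp add: \<tau>_def field_simps)
        then have "i \<le> 2 ^ n" by (metis less_imp_le of_nat_less_numeral_power_cancel_iff)
        moreover have "r \<le> G (\<tau> n i) (X (\<tau> n i) \<omega>)"
        proof -
          have "\<tau> n i < t + d1" "\<tau> n i < d2" using upper by (auto simp: d_def)
          then show ?thesis
            using d1(2)[of "\<tau> n i"] d2(2)[of "\<tau> n i"] lower \<open>\<tau> n i < T\<close> tT
            by (auto simp: dist_real_def)
        qed
        ultimately have "\<omega> \<in> B n" using \<omega> by (auto simp: B_def)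
        then show False using \<omega> by blast
      qed
    qed
  qed
qed

end

section \<open>Paths in the Skorokhod space\<close>

text \<open>Only the finitely many coordinates in \<open>sites N\<close> can be nonzero, and each of
  them, being a natural number, eventually equals its limit.\<close>

lemma tendsto_configs_eventually:
  assumes lim: "(x \<longlongrightarrow> l) F" and conf: "\<forall>\<^sub>F s in F. x s \<in> configs N" and F: "F \<noteq> bot"
  shows "\<forall>\<^sub>F s in F. x s = l"
proof -
  have coord: "\<forall>\<^sub>F s in F. x s v = l v" for v
  proof -
    have "continuous_on UNIV (\<lambda>f :: int \<times> int \<Rightarrow> nat. f v)"
      by (rule continuous_on_product_then_coordinatewise) (rule continuous_on_id)
    then have "((\<lambda>s. x s v) \<longlongrightarrow> l v) F"
      by (rule continuous_on_tendsto_compose[OF _ lim]) auto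
    then show ?thesis by (simp add: tendsto_discrete)
  qed
  have l: "l v = 0" if "v \<notin> sites N" for v
  proof -
    have "\<forall>\<^sub>F s in F. l v = 0"
      using coord[of v] conf
      by eventually_elim (metis (mono_tags, lifting) configs_def mem_Collect_eq that)
    then show ?thesis using F by simp
  qed
  have "\<forall>\<^sub>F s in F. \<forall>v\<in>sites N. x s v = l v"
    using coord by (intro eventually_ball_finite) auto
  then show ?thesis using conf
    by eventually_elim (use l in \<open>fastforce simp: configs_def\<close>)
qed

definition step_path :: "real \<Rightarrow> (real \<Rightarrow> 'a) \<Rightarrow> bool" where
  "step_path T x \<longleftrightarrow> (\<forall>t. 0 \<le> t \<and> t < T \<longrightarrow> (\<forall>\<^sub>F s in at_right t. x s = x t)) \<and>
     (\<forall>t. 0 < t \<and> t \<le> T \<longrightarrow> (\<exists>l. \<forall>\<^sub>F s in at_left t. x s = l))"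

lemma cadlag_step_path:
  assumes c: "cadlag T x" and conf: "\<And>t. t \<in> {0..T} \<Longrightarrow> x t \<in> configs N"
  shows "step_path T x"
  unfolding step_path_def
proof (intro conjI allI impI)
  fix t assume t: "0 \<le> t \<and> t < T"
  have "\<forall>\<^sub>F s in at_right t. x s \<in> configs N"
    using t conf by (auto simp: eventually_at_right_field intro!: exI[of _ T])
  then show "\<forall>\<^sub>F s in at_right t. x s = x t"
    using c t by (intro tendsto_configs_eventually) (auto simp: cadlag_def)
next
  fix t assume t: "0 < t \<and> t \<le> T"
  then have "t \<in> {0<..T}" by simp
  then obtain l where l: "(x \<longlongrightarrow> l) (at_left t)" using c unfolding cadlag_def by blast
  have "\<forall>\<^sub>F s in at_left t. x s \<in> configs N"
    using t conf by (auto simp: eventually_at_left_field intro!: exI[of _ 0])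
  then show "\<exists>l. \<forall>\<^sub>F s in at_left t. x s = l"
    using tendsto_configs_eventually[OF l] by auto
qed

text \<open>Local constancy on either side of each time survives composition with an arbitrary
  f.\<close>

lemma step_path_skorokhod:
  assumes "step_path T x"
  shows "(\<lambda>t\<in>{0..T}. f (x t)) \<in> skorokhod_space T"
  unfolding skorokhod_space_def cadlag_def
proof (intro CollectI IntI conjI ballI restrict_extensional)
  fix t assume t: "t \<in> {0..<T}"
  have "\<forall>\<^sub>F s in at_right t. s < T" using t by (auto simp: eventually_at_right_field)
  moreover have "\<forall>\<^sub>F s in at_right t. t < s" by (rule eventually_at_right_less)
  moreover have "\<forall>\<^sub>F s in at_right t. x s = x t" using assms t by (simp add: step_path_def)
  ultimately have "\<forall>\<^sub>F s in at_right t. (\<lambda>t\<in>{0..T}. f (x t)) s = (\<lambda>t\<in>{0..T}. f (x t)) t"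
    by eventually_elim (use t in auto)
  then show "((\<lambda>t\<in>{0..T}. f (x t)) \<longlongrightarrow> (\<lambda>t\<in>{0..T}. f (x t)) t) (at_right t)"
    by (rule tendsto_eventually)
next
  fix t assume t: "t \<in> {0<..T}"
  then obtain l where l: "\<forall>\<^sub>F s in at_left t. x s = l" using assms by (auto simp: step_path_def)
  have "\<forall>\<^sub>F s in at_left t. 0 < s" using t by (auto simp: eventually_at_left_field)
  moreover have "\<forall>\<^sub>F s in at_left t. s < t" by (auto simp: eventually_at_left_field intro!: exI[of _ "t - 1"])
  ultimately have "\<forall>\<^sub>F s in at_left t. (\<lambda>t\<in>{0..T}. f (x t)) s = f l"
    using l by eventually_elim (use t in auto)
  then show "\<exists>l. ((\<lambda>t\<in>{0..T}. f (x t)) \<longlongrightarrow> l) (at_left t)"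
    by (intro exI[of _ "f l"] tendsto_eventually)
qed

text \<open>Bisection: near any time only this time itself can separate constant pieces, and
  compactness leaves finitely many. The interval is open on the left and closed on the right since a
  path takes its new value at the jump time.\<close>

lemma step_path_jumps:
  assumes x: "step_path T x" and T: "0 \<le> T"
  obtains J where "finite J" "J \<subseteq> {0..T}" "0 \<in> J" "T \<in> J"
    "\<And>s t. 0 \<le> s \<Longrightarrow> s \<le> t \<Longrightarrow> t \<le> T \<Longrightarrow> J \<inter> {s<..t} = {} \<Longrightarrow> x s = x t"
proof -
  \<comment> \<open>Clipping to \<open>{0..T}\<close> is for the small intervals around 0 and T,
    which may stick out on one side.\<close>
  define Q where "Q a b \<longleftrightarrow> (\<exists>J. finite J \<and>
    (\<forall>s t. max a 0 \<le> s \<and> s \<le> t \<and> t \<le> min b T \<and> J \<inter> {s<..t} = {} \<longrightarrow> x s = x t))" for a b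
  have "Q 0 T"
    using T
  proof (induction rule: Bolzano)
    case (trans a b c)
    from trans(1) obtain J1 where J1: "finite J1" "\<And>s t. max a 0 \<le> s \<Longrightarrow> s \<le> t \<Longrightarrow> t \<le> min b T \<Longrightarrow> J1 \<inter> {s<..t} = {} \<Longrightarrow> x s = x t"
      unfolding Q_def by blast
    from trans(2) obtain J2 where J2: "finite J2" "\<And>s t. max b 0 \<le> s \<Longrightarrow> s \<le> t \<Longrightarrow> t \<le> min c T \<Longrightarrow> J2 \<inter> {s<..t} = {} \<Longrightarrow> x s = x t"
      unfolding Q_def by blast
    show ?case unfolding Q_def
    proof (intro exI[of _ "J1 \<union> J2"] conjI allI impI)
      show "finite (J1 \<union> J2)" using J1 J2 by simp
      fix s t assume st: "max a 0 \<le> s \<and> s \<le> t \<and> t \<le> min c T \<and> (J1 \<union> J2) \<inter> {s<..t} = {}"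
      consider "t \<le> b" | "b \<le> s" | "s < b" "b < t" by linarith
      then show "x s = x t"
      proof cases
        case 1
        then show ?thesis using st by (intro J1(2)) auto
      next
        case 2
        then show ?thesis using st by (intro J2(2)) auto
      next
        case 3
        have "x s = x b" using st 3 by (intro J1(2)) auto
        also have "x b = x t" using st 3 by (intro J2(2)) auto
        finally show ?thesis .
      qed
    qed
  next
    case (local t0)
    have "\<exists>d>0. \<forall>s. t0 < s \<and> s < t0 + d \<and> s \<le> T \<longrightarrow> x s = x t0"
    proof (cases "t0 < T")
      case True
      then obtain u where "t0 < u" "\<And>s. t0 < s \<Longrightarrow> s < u \<Longrightarrow> x s = x t0"
        using x local unfolding step_path_def eventually_at_right_field by metis
      then show ?thesis by (intro exI[of _ "u - t0"]) auto
    qed (auto intro!: exI[of _ 1])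
    then obtain d1 where d1: "0 < d1" "\<And>s. t0 < s \<Longrightarrow> s < t0 + d1 \<Longrightarrow> s \<le> T \<Longrightarrow> x s = x t0" by blast
    have "\<exists>l. \<exists>d>0. \<forall>s. t0 - d < s \<and> s < t0 \<and> 0 \<le> s \<longrightarrow> x s = l"
    proof (cases "0 < t0")
      case True
      then obtain l u where "u < t0" "\<And>s. u < s \<Longrightarrow> s < t0 \<Longrightarrow> x s = l"
        using x local unfolding step_path_def eventually_at_left_field by metis
      then show ?thesis by (intro exI[of _ l] exI[of _ "t0 - u"]) auto
    qed (auto intro!: exI[of _ 1])
    then obtain l d2 where d2: "0 < d2" "\<And>s. t0 - d2 < s \<Longrightarrow> s < t0 \<Longrightarrow> 0 \<le> s \<Longrightarrow> x s = l" by blast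
    show ?case
    proof (intro exI[of _ "min d1 d2"] conjI allI impI)
      fix a b assume ab: "a \<le> t0 \<and> t0 \<le> b \<and> b - a < min d1 d2"
      show "Q a b" unfolding Q_def
      proof (intro exI[of _ "{t0}"] conjI allI impI)
        fix s t assume st: "max a 0 \<le> s \<and> s \<le> t \<and> t \<le> min b T \<and> {t0} \<inter> {s<..t} = {}"
        then consider "t < t0" | "s = t0" "t = t0" | "t0 \<le> s" "s \<le> t" by force
        then show "x s = x t"
        proof cases
          case 1
          then have "x s = l" "x t = l" using st ab by (auto intro!: d2(2))
          then show ?thesis by simp
        next
          case 3
          have eq: "x r = x t0" if "t0 \<le> r" "r \<le> min b T" for r
            using that ab by (cases "r = t0") (auto intro!: d1(2))
          have "s \<le> min b T" "t0 \<le> t" "t \<le> min b T" using st 3 by linarith+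
          then show ?thesis using eq[of s] eq[of t] 3(1) by metis
        qed auto
      qed simp
    qed (use d1 d2 in auto)
  qed
  then obtain J where J: "finite J" "\<And>s t. 0 \<le> s \<Longrightarrow> s \<le> t \<Longrightarrow> t \<le> T \<Longrightarrow> J \<inter> {s<..t} = {} \<Longrightarrow> x s = x t"
    unfolding Q_def using T by (metis max.idem min.idem)
  show ?thesis
  \<comment> \<open>The end points are added because the time changes built from J must fix
    them.\<close>
  proof (rule that[of "insert 0 (insert T (J \<inter> {0..T}))"])
    fix s t assume st: "0 \<le> s" "s \<le> t" "t \<le> T" "insert 0 (insert T (J \<inter> {0..T})) \<inter> {s<..t} = {}"
    show "x s = x t" using st by (intro J(2)) auto
  qed (use J T in auto)
qed

section \<open>Time changes and discretization\<close>

definition time_change :: "real \<Rightarrow> real \<Rightarrow> (real \<Rightarrow> real) \<Rightarrow> bool" where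
  "time_change T e \<theta> \<longleftrightarrow> strict_mono_on {0..T} \<theta> \<and> \<theta> ` {0..T} = {0..T} \<and> (\<forall>t\<in>{0..T}. \<bar>\<theta> t - t\<bar> < e)"

lemma time_change_mono: "time_change T e \<theta> \<Longrightarrow> e \<le> e' \<Longrightarrow> time_change T e' \<theta>"
  by (auto simp: time_change_def)

lemma time_change_compose:
  assumes "time_change T e \<theta>" "time_change T e' \<theta>'"
  shows "time_change T (e + e') (\<lambda>t. \<theta>' (\<theta> t))"
proof -
  have in1: "\<theta> t \<in> {0..T}" if "t \<in> {0..T}" for t
    using assms(1) that unfolding time_change_def by blast
  have "strict_mono_on {0..T} (\<lambda>t. \<theta>' (\<theta> t))"
    using assms in1 by (auto simp: time_change_def strict_mono_on_def)
  moreover have "(\<lambda>t. \<theta>' (\<theta> t)) ` {0..T} = \<theta>' ` (\<theta> ` {0..T})" by auto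
  then have "(\<lambda>t. \<theta>' (\<theta> t)) ` {0..T} = {0..T}" using assms by (simp add: time_change_def)
  moreover have "\<bar>\<theta>' (\<theta> t) - t\<bar> < e + e'" if "t \<in> {0..T}" for t
  proof -
    have "\<bar>\<theta>' (\<theta> t) - \<theta> t\<bar> < e'" "\<bar>\<theta> t - t\<bar> < e"
      using assms in1[OF that] that by (auto simp: time_change_def)
    then show ?thesis by linarith
  qed
  ultimately show ?thesis by (simp add: time_change_def)
qed

lemma time_change_inverse:
  assumes "time_change T e \<theta>"
  obtains \<theta>' where "time_change T e \<theta>'" "\<And>t. t \<in> {0..T} \<Longrightarrow> \<theta> (\<theta>' t) = t" "\<And>t. t \<in> {0..T} \<Longrightarrow> \<theta>' t \<in> {0..T}"
proof
  let ?i = "inv_into {0..T} \<theta>"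
  have inj: "inj_on \<theta> {0..T}" using assms by (auto simp: time_change_def intro: strict_mono_on_imp_inj_on)
  have im: "\<theta> ` {0..T} = {0..T}" using assms by (simp add: time_change_def)
  show r: "\<theta> (?i t) = t" if "t \<in> {0..T}" for t
    by (rule f_inv_into_f) (use that im in simp)
  show i: "?i t \<in> {0..T}" if "t \<in> {0..T}" for t
    by (rule inv_into_into) (use that im in simp)
  show "time_change T e ?i"
    unfolding time_change_def
  proof (intro conjI ballI)
    show "strict_mono_on {0..T} ?i"
    proof (rule strict_mono_onI)
      fix s t assume st: "s \<in> {0..T}" "t \<in> {0..T}" "s < t"
      show "?i s < ?i t"
      proof (rule ccontr)
        assume "\<not> ?i s < ?i t"
        then have "?i t \<le> ?i s" by simp
        then have "\<theta> (?i t) \<le> \<theta> (?i s)"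
          using assms i[OF st(1)] i[OF st(2)]
          by (auto simp: time_change_def strict_mono_on_def le_less)
        then show False using r st by simp
      qed
    qed
    show "?i ` {0..T} = {0..T}"
      using inv_into_image_cancel[OF inj subset_refl] im by simp
    fix t assume t: "t \<in> {0..T}"
    have "\<bar>\<theta> (?i t) - ?i t\<bar> < e" using assms i[OF t] by (simp add: time_change_def)
    then show "\<bar>?i t - t\<bar> < e" using r[OF t] by linarith
  qed
qed

text \<open>Moving finitely many points slightly: a sum of small tents is added to the identity.\<close>

lemma time_change_exists:
  assumes T: "0 < T" and e: "0 < e" and J: "finite J" "J \<subseteq> {0..T}" "0 \<in> J" "T \<in> J"
  obtains d where "0 < d" "\<And>f. (\<And>t. t \<in> J \<Longrightarrow> \<bar>f t - t\<bar> \<le> d) \<Longrightarrow> f 0 = 0 \<Longrightarrow> f T = T \<Longrightarrow>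
    \<exists>\<theta>. time_change T e \<theta> \<and> (\<forall>t\<in>J. \<theta> t = f t)"
proof -
  have "\<exists>g>0. \<forall>s\<in>J. \<forall>t\<in>J. s \<noteq> t \<longrightarrow> g \<le> \<bar>s - t\<bar>"
  proof -
    \<comment> \<open>The value 1 on the diagonal keeps the minimum positive and is harmless, as
      only pairs of distinct points are compared.\<close>
    have "finite ((\<lambda>(s, t). if s = t then 1 else \<bar>s - t\<bar>) ` (J \<times> J))" using J by simp
    moreover have "(\<lambda>(s, t). if s = t then 1 else \<bar>s - t\<bar>) ` (J \<times> J) \<noteq> {}" using J by auto
    ultimately have "0 < Min ((\<lambda>(s, t). if s = t then 1 else \<bar>s - t\<bar>) ` (J \<times> J))"
      by (subst Min_gr_iff) auto
    moreover have "Min ((\<lambda>(s, t). if s = t then 1 else \<bar>s - t\<bar>) ` (J \<times> J)) \<le> \<bar>s - t\<bar>"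
      if "s \<in> J" "t \<in> J" "s \<noteq> t" for s t
      using that J by (intro Min_le) (auto intro!: image_eqI[of _ _ "(s, t)"])
    ultimately show ?thesis by blast
  qed
  then obtain g where g: "0 < g" "\<And>s t. s \<in> J \<Longrightarrow> t \<in> J \<Longrightarrow> s \<noteq> t \<Longrightarrow> g \<le> \<bar>s - t\<bar>" by blast
  \<comment> \<open>The tents have slope \<open>1 / g\<close>, and each vanishes at all other points
    of J. Shifts of size d then change the identity by a function with Lipschitz constant
    \<open>d * card J / g \<le> 1 / 2\<close>, which keeps it strictly increasing, and of size at
    most \<open>e / 2\<close>.\<close>
  define d where "d = min (g / 2) (e / 2) / real (card J)"
  have cJ: "0 < card J" using J by (auto simp: card_gt_0_iff)
  have d: "0 < d" "d * real (card J) \<le> g / 2" "d * real (card J) \<le> e / 2"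
    using g e cJ by (auto simp: d_def)
  show ?thesis
  proof (rule that[OF d(1)])
    fix f assume f: "\<And>t. t \<in> J \<Longrightarrow> \<bar>f t - t\<bar> \<le> d" and f0: "f 0 = 0" and fT: "f T = T"
    define tent where "tent j t = max 0 (1 - \<bar>t - j\<bar> / g)" for j t :: real
    define \<theta> where "\<theta> t = t + (\<Sum>j\<in>J. (f j - j) * tent j t)" for t
    have tent_lip: "\<bar>tent j s - tent j t\<bar> \<le> \<bar>s - t\<bar> / g" for j s t
    proof -
      have "\<bar>(1 - \<bar>s - j\<bar> / g) - (1 - \<bar>t - j\<bar> / g)\<bar> = \<bar>\<bar>t - j\<bar> - \<bar>s - j\<bar>\<bar> / g"
        using g by (simp add: diff_divide_distrib[symmetric] abs_divide)
      also have "\<dots> \<le> \<bar>s - t\<bar> / g" using g by (intro divide_right_mono) auto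
      finally show ?thesis unfolding tent_def by linarith
    qed
    have on_J: "\<theta> t = f t" if t: "t \<in> J" for t
    proof -
      have "tent j t = of_bool (j = t)" if "j \<in> J" for j
        using g(2)[OF that t] g(1) by (auto simp: tent_def abs_minus_commute)
      then have "\<theta> t = t + (\<Sum>j\<in>J. if j = t then f j - j else 0)"
        unfolding \<theta>_def by (intro arg_cong2[where f = "(+)"] sum.cong) auto
      then show ?thesis using t J by simp
    qed
    have lip: "\<bar>(\<theta> s - s) - (\<theta> t - t)\<bar> \<le> \<bar>s - t\<bar> / 2" for s t
    proof -
      have "\<bar>(\<theta> s - s) - (\<theta> t - t)\<bar> = \<bar>\<Sum>j\<in>J. (f j - j) * (tent j s - tent j t)\<bar>"
        by (simp add: \<theta>_def sum_subtractf right_diff_distrib)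
      also have "\<dots> \<le> (\<Sum>j\<in>J. \<bar>(f j - j) * (tent j s - tent j t)\<bar>)" by (rule sum_abs)
      also have "\<dots> \<le> (\<Sum>j\<in>J. d * (\<bar>s - t\<bar> / g))"
        unfolding abs_mult using f tent_lip d by (intro sum_mono mult_mono) auto
      also have "\<dots> = (d * real (card J)) * (\<bar>s - t\<bar> / g)" by simp
      also have "\<dots> \<le> (g / 2) * (\<bar>s - t\<bar> / g)" using d g by (intro mult_right_mono) auto
      finally show ?thesis using g by simp
    qed
    have bound: "\<bar>\<theta> t - t\<bar> < e" for t
    proof -
      have "\<bar>\<theta> t - t\<bar> \<le> (\<Sum>j\<in>J. \<bar>(f j - j) * tent j t\<bar>)" unfolding \<theta>_def by (simp add: sum_abs)
      also have "\<dots> \<le> (\<Sum>j\<in>J. d * 1)"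
        unfolding abs_mult using f d g by (intro sum_mono mult_mono) (auto simp: tent_def)
      also have "\<dots> \<le> e / 2" using d by (simp add: mult.commute)
      finally show ?thesis using e by simp
    qed
    have mono: "\<theta> s < \<theta> t" if "s < t" for s t
    proof -
      have "(\<theta> s - s) - (\<theta> t - t) \<le> (t - s) / 2"
        using abs_le_D1[OF lip[of s t]] that by simp
      then have "\<theta> s - \<theta> t \<le> - (t - s) / 2" by (simp add: field_simps)
      also have "\<dots> < 0" using that by simp
      finally show ?thesis by simp
    qed
    have ends: "\<theta> 0 = 0" "\<theta> T = T" using on_J J f0 fT by auto
    have cont: "continuous_on {0..T} \<theta>"
      unfolding \<theta>_def tent_def using g by (intro continuous_intros) auto
    have "\<theta> ` {0..T} = {0..T}"
    proof (intro equalityI subsetI)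
      fix y assume "y \<in> \<theta> ` {0..T}"
      then obtain t where "t \<in> {0..T}" "y = \<theta> t" by blast
      then show "y \<in> {0..T}" using mono[of 0 t] mono[of t T] ends
        by (cases "t = 0"; cases "t = T") auto
    next
      fix y assume "y \<in> {0..T}"
      then show "y \<in> \<theta> ` {0..T}" using IVT'[of \<theta> 0 y T] ends cont T by auto
    qed
    then have "time_change T e \<theta>" using mono bound by (auto simp: time_change_def strict_mono_on_def)
    then show "\<exists>\<theta>. time_change T e \<theta> \<and> (\<forall>t\<in>J. \<theta> t = f t)" using on_J by blast
  qed
qed

definition discretize :: "real \<Rightarrow> nat \<Rightarrow> (real \<Rightarrow> 'a) \<Rightarrow> real \<Rightarrow> 'a" where
  "discretize T n x t = x (T * of_int \<lfloor>t * real n / T\<rfloor> / real n)"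

text \<open>The discretized path jumps at the first grid point not before each jump of the path. A
  time change that moves the jump times to these grid points therefore matches the two paths
  exactly, not just approximately, once the grid is finer than the shift that
  \<open>time_change_exists\<close> allows.\<close>

lemma discretize_time_change:
  assumes x: "step_path T x" and T: "0 < T" and e: "0 < e"
  shows "\<forall>\<^sub>F n in sequentially. \<exists>\<theta>. time_change T e \<theta> \<and> (\<forall>t\<in>{0..T}. x t = discretize T n x (\<theta> t))"
proof -
  obtain J where J: "finite J" "J \<subseteq> {0..T}" "0 \<in> J" "T \<in> J"
    and const: "\<And>s t. 0 \<le> s \<Longrightarrow> s \<le> t \<Longrightarrow> t \<le> T \<Longrightarrow> J \<inter> {s<..t} = {} \<Longrightarrow> x s = x t"
    using step_path_jumps[OF x less_imp_le[OF T]] by metis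
  obtain d where d: "0 < d" "\<And>f. (\<And>t. t \<in> J \<Longrightarrow> \<bar>f t - t\<bar> \<le> d) \<Longrightarrow> f 0 = 0 \<Longrightarrow> f T = T \<Longrightarrow>
    \<exists>\<theta>. time_change T e \<theta> \<and> (\<forall>t\<in>J. \<theta> t = f t)"
    using time_change_exists[OF T e J] by metis
  have "\<forall>\<^sub>F n in sequentially. 0 < n \<and> T / real n < d"
  proof -
    have "(\<lambda>n. T / real n) \<longlonglongrightarrow> 0" by (rule lim_const_over_n)
    then have "\<forall>\<^sub>F n in sequentially. T / real n < d" by (rule order_tendstoD(2)) (use d in simp)
    then show ?thesis using eventually_gt_at_top[of "0 :: nat"] by eventually_elim simp
  qed
  then show ?thesis
  proof eventually_elim
    case (elim n)
    then have n: "0 < real n" by simp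
    define f where "f t = T * of_int \<lceil>t * real n / T\<rceil> / real n" for t
    have f_ge: "t \<le> f t" for t
    proof -
      have "T * (t * real n / T) \<le> T * of_int \<lceil>t * real n / T\<rceil>"
        using T by (intro mult_left_mono) auto
      then show ?thesis using n T by (simp add: f_def field_simps)
    qed
    have f_le: "f t \<le> t + T / real n" for t
    proof -
      have "of_int \<lceil>t * real n / T\<rceil> \<le> t * real n / T + 1" by linarith
      then have "T * of_int \<lceil>t * real n / T\<rceil> \<le> T * (t * real n / T + 1)"
        using T by (intro mult_left_mono) auto
      also have "\<dots> = t * real n + T" using T by (simp add: distrib_left)
      finally show ?thesis using n by (simp add: f_def field_simps)
    qed
    obtain \<theta> where \<theta>: "time_change T e \<theta>" "\<And>t. t \<in> J \<Longrightarrow> \<theta> t = f t"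
    proof -
      have "\<bar>f t - t\<bar> \<le> d" for t using f_ge[of t] f_le[of t] elim by linarith
      moreover have "f 0 = 0" "f T = T" using T n by (simp_all add: f_def)
      ultimately show ?thesis using d(2)[of f] that by blast
    qed
    have mono: "s \<in> {0..T} \<Longrightarrow> t \<in> {0..T} \<Longrightarrow> s < t \<Longrightarrow> \<theta> s < \<theta> t" for s t
      using \<theta>(1) by (simp add: time_change_def strict_mono_on_def)
    have "x t = discretize T n x (\<theta> t)" if t: "t \<in> {0..T}" for t
    proof -
      have \<theta>t: "\<theta> t \<in> {0..T}" using \<theta>(1) t unfolding time_change_def by blast
      define u where "u = T * of_int \<lfloor>\<theta> t * real n / T\<rfloor> / real n"
      have u_le: "u \<le> \<theta> t"
      proof -
        have "T * of_int \<lfloor>\<theta> t * real n / T\<rfloor> \<le> T * (\<theta> t * real n / T)"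
          using T by (intro mult_left_mono) auto
        then show ?thesis using n T by (simp add: u_def field_simps)
      qed
      have u0: "0 \<le> u" using \<theta>t T n by (simp add: u_def)
      have u_grid: "f j \<le> u" if "f j \<le> \<theta> t" for j
      proof -
        have "of_int \<lceil>j * real n / T\<rceil> \<le> \<theta> t * real n / T" using that n T by (simp add: f_def field_simps)
        then have "\<lceil>j * real n / T\<rceil> \<le> \<lfloor>\<theta> t * real n / T\<rfloor>" by (simp add: le_floor_iff)
        then show ?thesis using n T by (simp add: f_def u_def divide_right_mono)
      qed
      \<comment> \<open>\<open>j\<close> lies between \<open>t\<close> and \<open>u\<close> for no jump time \<open>j\<close>, since \<open>j \<le> t\<close> iff \<open>f j \<le> \<theta> t\<close> iff \<open>f j \<le> u\<close> iff \<open>j \<le> u\<close>\<close>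
      have before: "j \<le> u" if "j \<in> J" "j \<le> t" for j
      proof -
        have "\<theta> j \<le> \<theta> t" using mono[of j t] that J t by (cases "j = t") auto
        then have "f j \<le> u" using \<theta>(2)[OF that(1)] u_grid by simp
        then show ?thesis using f_ge[of j] by simp
      qed
      have after: "j \<le> t" if "j \<in> J" "j \<le> u" for j
      proof (rule ccontr)
        assume "\<not> j \<le> t"
        then have "\<theta> t < f j" using mono[of t j] \<theta>(2)[OF that(1)] that J t by auto
        moreover have "f j \<le> u"
        proof -
          have "j * real n / T \<le> of_int \<lfloor>\<theta> t * real n / T\<rfloor>"
            using that(2) n T by (simp add: u_def field_simps)
          then have "\<lceil>j * real n / T\<rceil> \<le> \<lfloor>\<theta> t * real n / T\<rfloor>" by (simp add: ceiling_le_iff)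
          then show ?thesis using n T by (simp add: f_def u_def divide_right_mono)
        qed
        ultimately show False using u_le by simp
      qed
      have "x t = x u"
      proof (cases "t \<le> u")
        case True
        have "J \<inter> {t<..u} = {}" using after by force
        then show ?thesis using True t u_le \<theta>t by (intro const) auto
      next
        case False
        have "J \<inter> {u<..t} = {}" using before by force
        then show ?thesis using False t u0 const[of u t] by auto
      qed
      then show ?thesis by (simp add: discretize_def u_def)
    qed
    then show ?case using \<theta>(1) by blast
  qed
qed

text \<open>Whether a path lies in an open set is decided by its discretizations: it does so exactly
  if, for some radius, the time-change balls around all sufficiently fine discretizations are mapped
  into the set. Each discretization depends on finitely many times, which leaves countable unions
  and intersections of events.\<close>

lemma empirical_path_measurable:
  assumes paths: "markov_paths M T (configs N) P X \<mu>"
    and cad: "\<And>\<omega>. \<omega> \<in> space M \<Longrightarrow> cadlag T (\<lambda>t. X t \<omega>)"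
  shows "empirical_path T N X \<in> measurable M (borel_of (skorokhod T))"
proof -
  interpret markov_paths M T "configs N" P X \<mu> by (rule paths)
  have step: "step_path T (\<lambda>t. X t \<omega>)" if "\<omega> \<in> space M" for \<omega>
    by (rule cadlag_step_path[OF cad[OF that]]) (use X_in that in auto)
  let ?ep = "\<lambda>x. \<lambda>t\<in>{0..T}. empirical N (x t)"
  have ep: "empirical_path T N X \<omega> = ?ep (\<lambda>t. X t \<omega>)" for \<omega>
    by (simp add: empirical_path_def)
  show ?thesis
    unfolding borel_of_def
  proof (rule measurable_measure_of)
    show "{U. openin (skorokhod T) U} \<subseteq> Pow (topspace (skorokhod T))"
      by (auto dest: openin_subset)
    show "empirical_path T N X \<in> space M \<rightarrow> topspace (skorokhod T)"
      unfolding topspace_skorokhod ep using step_path_skorokhod[OF step] by blast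
    fix U :: "(real \<Rightarrow> radon_V) set" assume "U \<in> {U. openin (skorokhod T) U}"
    then have U: "openin (skorokhod T) U" by simp
    \<comment> \<open>\<open>inner j y\<close>: the ball of radius \<open>1/j\<close> around \<open>y\<close> is mapped into \<open>U\<close>\<close>
    define inner where "inner j y \<longleftrightarrow> (\<forall>z \<theta>. ?ep z \<in> skorokhod_space T \<and> time_change T (1 / real (Suc j)) \<theta> \<and>
      (\<forall>t\<in>{0..T}. y t = z (\<theta> t)) \<longrightarrow> ?ep z \<in> U)" for j :: nat and y
    have iff: "?ep x \<in> U \<longleftrightarrow> (\<exists>j n0. \<forall>n\<ge>n0. inner j (discretize T (Suc n) x))"
      if x: "step_path T x" for x
    proof
      assume "?ep x \<in> U"
      then obtain E e where E: "eventually E uniformity" "0 < e" "skorokhod_nbhd T (?ep x) E e \<subseteq> U"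
        using U unfolding openin_skorokhod by blast
      \<comment> \<open>Half of e is for passing from the path to its discretization, half for the
        ball around the latter.\<close>
      obtain j where j: "1 / real (Suc j) < e / 2"
        using reals_Archimedean[of "e / 2"] E(2) by (auto simp: inverse_eq_divide)
      have "\<forall>\<^sub>F n in sequentially. \<exists>\<theta>. time_change T (e / 2) \<theta> \<and> (\<forall>t\<in>{0..T}. x t = discretize T n x (\<theta> t))"
        by (rule discretize_time_change[OF x T_pos]) (use E in simp)
      then obtain n0 where n0: "\<And>n. n \<ge> n0 \<Longrightarrow> \<exists>\<theta>. time_change T (e / 2) \<theta> \<and> (\<forall>t\<in>{0..T}. x t = discretize T n x (\<theta> t))"
        by (auto simp: eventually_sequentially)
      have "inner j (discretize T (Suc n) x)" if n: "n0 \<le> n" for n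
        unfolding inner_def
      proof (intro allI impI, elim conjE)
        fix z \<theta>' assume z: "?ep z \<in> skorokhod_space T" and \<theta>': "time_change T (1 / real (Suc j)) \<theta>'"
          and eq: "\<forall>t\<in>{0..T}. discretize T (Suc n) x t = z (\<theta>' t)"
        obtain \<theta> where \<theta>: "time_change T (e / 2) \<theta>" "\<forall>t\<in>{0..T}. x t = discretize T (Suc n) x (\<theta> t)"
          using n0[OF le_SucI[OF n]] by blast
        have tc: "time_change T (e / 2 + e / 2) (\<lambda>t. \<theta>' (\<theta> t))"
          by (rule time_change_compose[OF \<theta>(1) time_change_mono[OF \<theta>' less_imp_le[OF j]]])
        have \<theta>_in: "\<theta> t \<in> {0..T}" if "t \<in> {0..T}" for t using \<theta>(1) that unfolding time_change_def by blast
        have in2: "\<theta>' (\<theta> t) \<in> {0..T}" if "t \<in> {0..T}" for t using tc that unfolding time_change_def by blast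
        have xz: "x t = z (\<theta>' (\<theta> t))" if "t \<in> {0..T}" for t using \<theta>(2) eq \<theta>_in that by auto
        \<comment> \<open>The paths take equal values after the time change, so any entourage is met
          by reflexivity.\<close>
        have refl: "E (\<beta>, \<beta>)" for \<beta> using uniformity_refl[OF E(1)] .
        have "?ep z \<in> skorokhod_nbhd T (?ep x) E e"
          unfolding skorokhod_nbhd_def using z tc in2 xz refl
          by (auto simp: time_change_def intro!: exI[of _ "\<lambda>t. \<theta>' (\<theta> t)"])
        then show "?ep z \<in> U" using E(3) by blast
      qed
      then show "\<exists>j n0. \<forall>n\<ge>n0. inner j (discretize T (Suc n) x)" by blast
    next
      assume "\<exists>j n0. \<forall>n\<ge>n0. inner j (discretize T (Suc n) x)"
      then obtain j n0 where jn: "\<And>n. n \<ge> n0 \<Longrightarrow> inner j (discretize T (Suc n) x)" by blast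
      have "\<forall>\<^sub>F n in sequentially. \<exists>\<theta>. time_change T (1 / real (Suc j)) \<theta> \<and> (\<forall>t\<in>{0..T}. x t = discretize T n x (\<theta> t))"
        by (rule discretize_time_change[OF x T_pos]) simp
      then obtain n1 where n1: "\<And>n. n \<ge> n1 \<Longrightarrow> \<exists>\<theta>. time_change T (1 / real (Suc j)) \<theta> \<and> (\<forall>t\<in>{0..T}. x t = discretize T n x (\<theta> t))"
        by (auto simp: eventually_sequentially)
      let ?n = "max n0 n1"
      obtain \<theta> where \<theta>: "time_change T (1 / real (Suc j)) \<theta>" "\<forall>t\<in>{0..T}. x t = discretize T (Suc ?n) x (\<theta> t)"
        using n1[OF le_SucI[OF max.cobounded2]] by blast
      \<comment> \<open>Conversely, by the inverse time change the path itself lies in the ball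
        around its discretization.\<close>
      obtain \<theta>' where \<theta>': "time_change T (1 / real (Suc j)) \<theta>'" "\<And>t. t \<in> {0..T} \<Longrightarrow> \<theta> (\<theta>' t) = t"
        "\<And>t. t \<in> {0..T} \<Longrightarrow> \<theta>' t \<in> {0..T}"
        using time_change_inverse[OF \<theta>(1)] by metis
      have "\<forall>t\<in>{0..T}. discretize T (Suc ?n) x t = x (\<theta>' t)" using \<theta>(2) \<theta>'(2,3) by metis
      then show "?ep x \<in> U"
        using jn[of ?n] \<theta>'(1) step_path_skorokhod[OF x] unfolding inner_def by (metis max.cobounded1)
    qed
    have meas: "{\<omega> \<in> space M. inner j (discretize T (Suc n) (\<lambda>t. X t \<omega>))} \<in> sets M" for j n
    proof -
      define \<tau> where "\<tau> i = T * real i / real (Suc n)" for i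
      have \<tau>: "\<tau> i \<in> {0..T}" if "i \<le> Suc n" for i
        using that T_pos by (simp add: \<tau>_def divide_le_eq mult_left_mono del: of_nat_Suc)
      \<comment> \<open>\<open>inner j\<close> is a condition on whole paths, but on a
        discretization it concerns only \<open>n + 2\<close> values, and every set of lists is
        measurable.\<close>
      define S where "S = {l. inner j (\<lambda>t. l ! nat \<lfloor>t * real (Suc n) / T\<rfloor>)}"
      have disc: "discretize T (Suc n) (\<lambda>t. X t \<omega>) t = skeleton \<tau> (Suc n) \<omega> ! nat \<lfloor>t * real (Suc n) / T\<rfloor>"
        if t: "t \<in> {0..T}" for t \<omega>
      proof -
        have "0 \<le> \<lfloor>t * real (Suc n) / T\<rfloor>" using t T_pos by simp
        moreover have "t * real (Suc n) / T \<le> real (Suc n)"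
          using t T_pos by (simp add: divide_le_eq mult.commute mult_right_mono del: of_nat_Suc)
        then have "\<lfloor>t * real (Suc n) / T\<rfloor> \<le> int (Suc n)" by linarith
        ultimately show ?thesis
          by (simp add: discretize_def skeleton_def \<tau>_def nat_le_iff less_Suc_eq_le nth_map_upt del: upt_Suc of_nat_Suc)
      qed
      have "inner j (discretize T (Suc n) (\<lambda>t. X t \<omega>)) \<longleftrightarrow> skeleton \<tau> (Suc n) \<omega> \<in> S" for \<omega>
        unfolding S_def mem_Collect_eq inner_def using disc[of _ \<omega>] by simp
      then have "{\<omega> \<in> space M. inner j (discretize T (Suc n) (\<lambda>t. X t \<omega>))} = skeleton \<tau> (Suc n) -` S \<inter> space M"
        by auto
      also have "\<dots> \<in> sets M" by (rule measurable_sets[OF skeleton_measurable[OF \<tau>]]) auto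
      finally show ?thesis .
    qed
    have "empirical_path T N X -` U \<inter> space M =
      (\<Union>j. \<Union>n0. \<Inter>n\<in>{n0..}. {\<omega> \<in> space M. inner j (discretize T (Suc n) (\<lambda>t. X t \<omega>))})"
    proof (rule set_eqI)
      fix \<omega>
      show "\<omega> \<in> empirical_path T N X -` U \<inter> space M \<longleftrightarrow> \<omega> \<in>
        (\<Union>j. \<Union>n0. \<Inter>n\<in>{n0..}. {\<omega> \<in> space M. inner j (discretize T (Suc n) (\<lambda>t. X t \<omega>))})"
        using iff[OF step, of \<omega>] by (cases "\<omega> \<in> space M") (simp_all add: ep Bex_def Ball_def, blast, blast intro: order_refl)
    qed
    also have "\<dots> \<in> sets M"
      using meas by (intro sets.countable_UN'' sets.countable_INT'' sets.countable_UN sets.countable_INT') auto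
    finally show "empirical_path T N X -` U \<inter> space M \<in> sets M" .
  qed
qed

text \<open>The limit law is a point mass, so closeness in probability suffices: a Skorokhod
  neighbourhood of \<alpha> on which F varies little contains, by the identity time change, all
  paths in the space that are uniformly close to \<alpha> for finitely many test functions.\<close>

lemma weakly_converges_returnI:
  assumes \<alpha>: "\<alpha> \<in> skorokhod_space T"
    and prob: "\<And>N. 0 < N \<Longrightarrow> prob_space (M N)"
    and meas: "\<And>N. 0 < N \<Longrightarrow> Z N \<in> measurable (M N) (borel_of (skorokhod T))"
    and close: "\<And>\<phi> e d. \<phi> \<in> C_V \<Longrightarrow> 0 < e \<Longrightarrow> 0 < d \<Longrightarrow> \<forall>\<^sub>F N in sequentially. \<exists>B\<in>sets (M N).
      measure (M N) B \<le> d \<and> (\<forall>\<omega>\<in>space (M N) - B. \<forall>t\<in>{0..T}. \<bar>pairing (Z N \<omega> t) \<phi> - pairing (\<alpha> t) \<phi>\<bar> < e)"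
  shows "weakly_converges (skorokhod T) (\<lambda>N. distr (M N) (borel_of (skorokhod T)) (Z N))
    (return (borel_of (skorokhod T)) \<alpha>)"
  unfolding weakly_converges_def
proof (intro allI impI)
  let ?X = "skorokhod T :: (real \<Rightarrow> radon_V) topology"
  fix F assume F: "continuous_map ?X euclideanreal F \<and> bounded (F ` topspace ?X)"
  have sp: "space (borel_of ?X) = topspace ?X"
    unfolding borel_of_def by (rule space_measure_of) (auto dest: openin_subset)
  have sets: "U \<in> sets (borel_of ?X)" if "openin ?X U" for U
    unfolding borel_of_def using that by (auto intro!: in_measure_of dest: openin_subset)
  have Fm: "F \<in> borel_measurable (borel_of ?X)"
  proof (rule borel_measurableI)
    fix S :: "real set" assume "open S"
    then have "openin ?X {x \<in> topspace ?X. F x \<in> S}"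
      using F openin_continuous_map_preimage[of ?X euclideanreal F S] by simp
    moreover have "F -` S \<inter> space (borel_of ?X) = {x \<in> topspace ?X. F x \<in> S}" by (auto simp: sp)
    ultimately show "F -` S \<inter> space (borel_of ?X) \<in> sets (borel_of ?X)" using sets by simp
  qed
  obtain K where K: "0 < K" "\<And>x. x \<in> topspace ?X \<Longrightarrow> \<bar>F x\<bar> \<le> K"
    using F by (auto simp: bounded_pos)
  have \<alpha>_in: "\<alpha> \<in> topspace ?X" using \<alpha> by (simp add: topspace_skorokhod)
  have ret: "(\<integral>x. F x \<partial>return (borel_of ?X) \<alpha>) = F \<alpha>"
    using Fm \<alpha>_in sp by (intro integral_return) auto
  show "(\<lambda>N. \<integral>x. F x \<partial>distr (M N) (borel_of ?X) (Z N)) \<longlonglongrightarrow> (\<integral>x. F x \<partial>return (borel_of ?X) \<alpha>)"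
    unfolding ret
  proof (rule tendstoI)
    fix \<epsilon> :: real assume \<epsilon>: "0 < \<epsilon>"
    have "openin ?X {x \<in> topspace ?X. F x \<in> ball (F \<alpha>) (\<epsilon> / 2)}"
      using F by (intro openin_continuous_map_preimage[of ?X euclideanreal]) auto
    moreover have "\<alpha> \<in> {x \<in> topspace ?X. F x \<in> ball (F \<alpha>) (\<epsilon> / 2)}" using \<alpha>_in \<epsilon> by simp
    ultimately obtain E r where E: "eventually E uniformity" "0 < r"
      "skorokhod_nbhd T \<alpha> E r \<subseteq> {x \<in> topspace ?X. F x \<in> ball (F \<alpha>) (\<epsilon> / 2)}"
      unfolding openin_skorokhod by blast
    obtain \<Phi> e where \<Phi>: "finite \<Phi>" "\<Phi> \<subseteq> C_V" "0 < e"
      "\<And>\<beta> \<gamma>. (\<forall>\<phi>\<in>\<Phi>. \<bar>pairing \<beta> \<phi> - pairing \<gamma> \<phi>\<bar> < e) \<Longrightarrow> E (\<beta>, \<gamma>)"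
      using E(1) unfolding eventually_uniformity_radon_V by blast
    \<comment> \<open>Chosen such that the exceptional events, of total probability at most
      \<open>card \<Phi> * d\<close>, contribute at most \<open>\<epsilon> / 4\<close>, where F is
      only bounded by K. Adding 1 covers an empty \<open>\<Phi>\<close>.\<close>
    define d where "d = \<epsilon> / (8 * K * (real (card \<Phi>) + 1))"
    have d: "0 < d" using \<epsilon> K by (simp add: d_def)
    have "\<forall>\<^sub>F N in sequentially. \<forall>\<phi>\<in>\<Phi>. \<exists>B\<in>sets (M N). measure (M N) B \<le> d \<and>
        (\<forall>\<omega>\<in>space (M N) - B. \<forall>t\<in>{0..T}. \<bar>pairing (Z N \<omega> t) \<phi> - pairing (\<alpha> t) \<phi>\<bar> < e)"
      using \<Phi> d close by (intro eventually_ball_finite) auto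
    then show "\<forall>\<^sub>F N in sequentially. dist (\<integral>x. F x \<partial>distr (M N) (borel_of ?X) (Z N)) (F \<alpha>) < \<epsilon>"
      using eventually_gt_at_top[of "0 :: nat"]
    proof eventually_elim
      case (elim N)
      interpret prob_space "M N" by (rule prob[OF elim(2)])
      obtain B where B: "\<And>\<phi>. \<phi> \<in> \<Phi> \<Longrightarrow> B \<phi> \<in> sets (M N)" "\<And>\<phi>. \<phi> \<in> \<Phi> \<Longrightarrow> measure (M N) (B \<phi>) \<le> d"
        "\<And>\<phi> \<omega> t. \<phi> \<in> \<Phi> \<Longrightarrow> \<omega> \<in> space (M N) - B \<phi> \<Longrightarrow> t \<in> {0..T} \<Longrightarrow>
          \<bar>pairing (Z N \<omega> t) \<phi> - pairing (\<alpha> t) \<phi>\<bar> < e"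
        using elim(1) by metis
      define B' where "B' = (\<Union>\<phi>\<in>\<Phi>. B \<phi>)"
      have B'_sets: "B' \<in> sets (M N)" unfolding B'_def using \<Phi> B by (intro sets.finite_UN) auto
      have "measure (M N) B' \<le> (\<Sum>\<phi>\<in>\<Phi>. measure (M N) (B \<phi>))"
        unfolding B'_def using \<Phi> B by (intro finite_measure_subadditive_finite) auto
      also have "\<dots> \<le> real (card \<Phi>) * d" by (rule sum_bounded_above) (use B in auto)
      finally have mB: "measure (M N) B' \<le> real (card \<Phi>) * d" .
      note Zm = meas[OF elim(2)]
      have Z_in: "Z N \<omega> \<in> topspace ?X" if "\<omega> \<in> space (M N)" for \<omega>
        using measurable_space[OF Zm that] sp by simp
      have good: "\<bar>F (Z N \<omega>) - F \<alpha>\<bar> \<le> \<epsilon> / 2" if \<omega>: "\<omega> \<in> space (M N) - B'" for \<omega>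
      proof -
        have "E (\<alpha> t, Z N \<omega> t)" if "t \<in> {0..T}" for t
          using B(3)[of _ \<omega> t] \<omega> that by (intro \<Phi>(4)) (auto simp: B'_def abs_minus_commute)
        then have "Z N \<omega> \<in> skorokhod_nbhd T \<alpha> E r"
          unfolding skorokhod_nbhd_def using Z_in[of \<omega>] \<omega> E(2)
          by (auto simp: topspace_skorokhod strict_mono_on_def intro!: exI[of _ "\<lambda>t. t"])
        then have "F (Z N \<omega>) \<in> ball (F \<alpha>) (\<epsilon> / 2)" using E(3) by blast
        then show ?thesis by (simp add: dist_real_def abs_minus_commute)
      qed
      have FZ: "(\<lambda>\<omega>. F (Z N \<omega>)) \<in> borel_measurable (M N)" by (rule measurable_compose[OF Zm Fm])
      have int: "integrable (M N) (\<lambda>\<omega>. F (Z N \<omega>))"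
        by (rule integrable_const_bound[of _ K]) (use K(2) Z_in FZ in auto)
      have le: "\<bar>F (Z N \<omega>) - F \<alpha>\<bar> \<le> \<epsilon> / 2 + 2 * K * indicator B' \<omega>" if "\<omega> \<in> space (M N)" for \<omega>
      proof (cases "\<omega> \<in> B'")
        case True
        then show ?thesis using K(2)[OF Z_in[OF that]] K(2)[OF \<alpha>_in] \<epsilon> by simp
      next
        case False
        then show ?thesis using good that by simp
      qed
      have "(\<integral>x. F x \<partial>distr (M N) (borel_of ?X) (Z N)) = (\<integral>\<omega>. F (Z N \<omega>) \<partial>M N)"
        by (rule integral_distr[OF Zm Fm])
      then have "dist (\<integral>x. F x \<partial>distr (M N) (borel_of ?X) (Z N)) (F \<alpha>) = \<bar>\<integral>\<omega>. F (Z N \<omega>) - F \<alpha> \<partial>M N\<bar>"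
        using int by (simp add: dist_real_def prob_space)
      also have "\<dots> \<le> (\<integral>\<omega>. \<bar>F (Z N \<omega>) - F \<alpha>\<bar> \<partial>M N)" by (rule integral_abs_bound)
      also have "\<dots> \<le> (\<integral>\<omega>. \<epsilon> / 2 + 2 * K * indicator B' \<omega> \<partial>M N)"
        using int le B'_sets by (intro integral_mono) (auto simp: integrable_real_mult_indicator emeasure_eq_measure)
      also have "\<dots> = \<epsilon> / 2 + 2 * K * measure (M N) B'"
        using B'_sets by (simp add: prob_space emeasure_eq_measure)
      also have "\<dots> \<le> \<epsilon> / 2 + 2 * K * (real (card \<Phi>) * d)" using mB K by simp
      also have "\<dots> \<le> \<epsilon> / 2 + \<epsilon> / 4"
      proof -
        have "2 * K * (real (card \<Phi>) * d) \<le> 2 * K * ((real (card \<Phi>) + 1) * d)" using K d by simp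
        also have "\<dots> = \<epsilon> / 4"
        proof -
          have "K \<noteq> 0" "real (card \<Phi>) + 1 \<noteq> 0" using K by linarith+
          then show ?thesis by (simp add: d_def)
        qed
        finally show ?thesis by simp
      qed
      finally show ?case using \<epsilon> by simp
    qed
  qed
qed

section \<open>Existence of the limiting density\<close>

lemma continuous_on_compose_strip:
  fixes f :: "real \<Rightarrow> real \<Rightarrow> real"
  assumes "continuous_on ({0..T} \<times> UNIV) (\<lambda>(s, x). f s x)" "continuous_on A g" "continuous_on A h"
    and "\<And>x. x \<in> A \<Longrightarrow> g x \<in> {0..T}"
  shows "continuous_on A (\<lambda>x. f (g x) (h x))"
proof -
  have "continuous_on A (\<lambda>x. (\<lambda>(s, x). f s x) (g x, h x))"
    by (rule continuous_on_compose2[OF assms(1)]) (use assms in \<open>auto intro!: continuous_intros\<close>)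
  then show ?thesis by simp
qed

text \<open>Banach's fixed point theorem for distances relative to the weight w, with contraction
  constant 1/2. It is phrased by inequalities since functions in C are compared on S only; the bound
  W turns weighted into uniform convergence, under which C is closed.\<close>

lemma weighted_fixpoint:
  fixes \<Psi> :: "('x \<Rightarrow> real) \<Rightarrow> 'x \<Rightarrow> real" and w :: "'x \<Rightarrow> real"
  assumes w: "\<And>x. x \<in> S \<Longrightarrow> 0 \<le> w x" "\<And>x. x \<in> S \<Longrightarrow> w x \<le> W"
    and u0: "u0 \<in> C" and \<Psi>: "\<And>u. u \<in> C \<Longrightarrow> \<Psi> u \<in> C"
    and closed: "\<And>f u. (\<And>n :: nat. f n \<in> C) \<Longrightarrow> uniform_limit S f u sequentially \<Longrightarrow> u \<in> C"
    and init: "0 \<le> A" "\<And>x. x \<in> S \<Longrightarrow> \<bar>\<Psi> u0 x - u0 x\<bar> \<le> A * w x"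
    and contr: "\<And>u v B x. u \<in> C \<Longrightarrow> v \<in> C \<Longrightarrow> 0 \<le> B \<Longrightarrow> (\<And>x. x \<in> S \<Longrightarrow> \<bar>u x - v x\<bar> \<le> B * w x) \<Longrightarrow>
      x \<in> S \<Longrightarrow> \<bar>\<Psi> u x - \<Psi> v x\<bar> \<le> B / 2 * w x"
  obtains u where "u \<in> C" "\<And>x. x \<in> S \<Longrightarrow> \<Psi> u x = u x"
proof -
  define f where "f n = (\<Psi> ^^ n) u0" for n
  have f_Suc: "f (Suc n) = \<Psi> (f n)" for n by (simp add: f_def)
  have fC: "f n \<in> C" for n by (induction n) (simp_all add: f_def u0 \<Psi>)
  have step: "\<bar>f (Suc n) x - f n x\<bar> \<le> A / 2 ^ n * w x" if "x \<in> S" for n x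
    using that
  proof (induction n arbitrary: x)
    case 0
    then show ?case using init by (simp add: f_def)
  next
    case (Suc n)
    have "\<bar>\<Psi> (f (Suc n)) x - \<Psi> (f n) x\<bar> \<le> (A / 2 ^ n) / 2 * w x"
      by (rule contr[OF fC fC]) (use Suc init in auto)
    then show ?case by (simp add: f_Suc field_simps)
  qed
  have W0: "A / 2 ^ n * w x \<le> A * W * (1 / 2) ^ n" if "x \<in> S" for n x
    using mult_left_mono[OF w(2)[OF that], of "A / 2 ^ n"] init by (simp add: power_one_over field_simps)
  have "uniform_limit S (\<lambda>n x. \<Sum>i<n. f (Suc i) x - f i x) (\<lambda>x. \<Sum>i. f (Suc i) x - f i x) sequentially"
  proof (rule Weierstrass_m_test)
    show "norm (f (Suc n) x - f n x) \<le> A * W * (1 / 2) ^ n" if "x \<in> S" for n x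
      using step[OF that, of n] W0[OF that, of n] by simp
    show "summable (\<lambda>n. A * W * (1 / 2 :: real) ^ n)" by (intro summable_mult summable_geometric) simp
  qed
  moreover have "(\<Sum>i<n. f (Suc i) x - f i x) = f n x - u0 x" for n x
    using sum_lessThan_telescope[of "\<lambda>i. f i x" n] by (simp add: f_def)
  ultimately have lim0: "uniform_limit S (\<lambda>n x. f n x - u0 x) (\<lambda>x. \<Sum>i. f (Suc i) x - f i x) sequentially"
    by simp
  define u where "u x = u0 x + (\<Sum>i. f (Suc i) x - f i x)" for x
  have lim: "uniform_limit S f u sequentially"
    using lim0 unfolding uniform_limit_iff u_def by (simp add: dist_real_def algebra_simps)
  have uC: "u \<in> C" by (rule closed[OF fC lim])
  have ptw: "(\<lambda>n. f n x) \<longlonglongrightarrow> u x" if "x \<in> S" for x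
    using tendsto_uniform_limitI[OF lim that] .
  \<comment> \<open>The distance to the limit is kept in weighted form, because \<open>contr\<close>
    is applied once more, to \<open>f n\<close> and u.\<close>
  have tail: "\<bar>u x - f n x\<bar> \<le> 2 * A / 2 ^ n * w x" if x: "x \<in> S" for n x
  proof -
    have "\<bar>f (n + k) x - f n x\<bar> \<le> (2 * A / 2 ^ n - 2 * A / 2 ^ (n + k)) * w x" for k
    proof (induction k)
      case (Suc k)
      have "\<bar>f (n + Suc k) x - f n x\<bar> \<le> A / 2 ^ (n + k) * w x + (2 * A / 2 ^ n - 2 * A / 2 ^ (n + k)) * w x"
        using step[OF x, of "n + k"] Suc by simp
      also have "\<dots> = (2 * A / 2 ^ n - 2 * A / 2 ^ (n + Suc k)) * w x"
        by (simp add: field_simps)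
      finally show ?case .
    qed simp
    moreover have "(2 * A / 2 ^ n - 2 * A / 2 ^ (n + k)) * w x \<le> 2 * A / 2 ^ n * w x" for k
      using init w(1)[OF x] by (intro mult_right_mono) auto
    ultimately have b: "\<bar>f (n + k) x - f n x\<bar> \<le> 2 * A / 2 ^ n * w x" for k by (meson order.trans)
    have "(\<lambda>k. \<bar>f (k + n) x - f n x\<bar>) \<longlonglongrightarrow> \<bar>u x - f n x\<bar>"
      by (intro tendsto_intros LIMSEQ_ignore_initial_segment ptw x)
    then show ?thesis by (rule LIMSEQ_le_const2) (use b in \<open>auto simp: add.commute\<close>)
  qed
  have "\<Psi> u x = u x" if x: "x \<in> S" for x
  proof -
    have "\<bar>f (Suc n) x - \<Psi> u x\<bar> \<le> A * W * (1 / 2) ^ n" for n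
    proof -
      have "\<bar>\<Psi> (f n) x - \<Psi> u x\<bar> \<le> (2 * A / 2 ^ n) / 2 * w x"
        by (rule contr[OF fC uC]) (use tail x init in \<open>auto simp: abs_minus_commute\<close>)
      also have "\<dots> \<le> A * W * (1 / 2) ^ n" using W0[OF x, of n] by simp
      finally show ?thesis by (simp add: f_Suc)
    qed
    then have bound: "\<forall>\<^sub>F n in sequentially. norm (f (Suc n) x - \<Psi> u x) \<le> A * W * (1 / 2) ^ n"
      by simp
    have "(\<lambda>n. A * W * (1 / 2 :: real) ^ n) \<longlonglongrightarrow> A * W * 0"
      by (intro tendsto_intros LIMSEQ_realpow_zero) auto
    then have "(\<lambda>n. A * W * (1 / 2 :: real) ^ n) \<longlonglongrightarrow> 0" by simp
    from Lim_null_comparison[OF bound this]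
    have "(\<lambda>n. f (Suc n) x - \<Psi> u x) \<longlonglongrightarrow> 0" .
    then have "(\<lambda>n. f (Suc n) x) \<longlonglongrightarrow> \<Psi> u x" by (simp add: LIM_zero_iff)
    moreover have "(\<lambda>n. f (Suc n) x) \<longlonglongrightarrow> u x" by (rule LIMSEQ_Suc[OF ptw[OF x]])
    ultimately show ?thesis using LIMSEQ_unique by blast
  qed
  then show ?thesis using that uC by blast
qed

text \<open>The gain \<open>1 / l\<close> makes an integral operator a contraction in the weight
  \<open>exp (l * t)\<close> on the whole time interval, for l large.\<close>

lemma abs_integral_le_exp:
  fixes h :: "real \<Rightarrow> real"
  assumes h: "continuous_on {0..t} h" and t: "0 \<le> t" and l: "0 < l"
    and le: "\<And>s. s \<in> {0..t} \<Longrightarrow> \<bar>h s\<bar> \<le> B * exp (l * s)" and B: "0 \<le> B"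
  shows "\<bar>integral {0..t} h\<bar> \<le> B / l * exp (l * t)"
proof -
  have "((\<lambda>s. B * exp (l * s)) has_integral (B / l * exp (l * t) - B / l * exp (l * 0))) {0..t}"
    using t l by (intro fundamental_theorem_of_calculus)
      (auto intro!: derivative_eq_intros simp flip: has_real_derivative_iff_has_vector_derivative)
  then have *: "(\<lambda>s. B * exp (l * s)) integrable_on {0..t}"
    "integral {0..t} (\<lambda>s. B * exp (l * s)) = B / l * exp (l * t) - B / l"
    by (auto simp: has_integral_integrable_integral)
  have "norm (integral {0..t} h) \<le> integral {0..t} (\<lambda>s. B * exp (l * s))"
    by (rule integral_norm_bound_integral) (use h le * integrable_continuous_interval in auto)
  also have "\<dots> \<le> B / l * exp (l * t)" using * B l by simp
  finally show ?thesis by simp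
qed

text \<open>After the last time at which f is at most K it would stay above K until t, but there it
  cannot increase, by the mean value theorem.\<close>

lemma barrier:
  fixes f f' :: "real \<Rightarrow> real"
  assumes d: "\<And>t. t \<in> {0..T} \<Longrightarrow> (f has_real_derivative f' t) (at t within {0..T})"
    and f0: "f 0 \<le> K" and neg: "\<And>t. t \<in> {0..T} \<Longrightarrow> K < f t \<Longrightarrow> f' t \<le> 0" and t: "t \<in> {0..T}"
  shows "f t \<le> K"
proof (rule ccontr)
  assume "\<not> f t \<le> K"
  then have ft: "K < f t" by simp
  have cont: "continuous_on {0..t} f"
    using DERIV_continuous_on[OF d] t by (auto intro: continuous_on_subset)
  let ?S = "{r \<in> {0..t}. f r \<le> K}"
  have "closed ({0..t} \<inter> f -` {..K})"
    by (rule continuous_closed_preimage[OF cont]) auto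
  moreover have "{0..t} \<inter> f -` {..K} = ?S" by auto
  moreover have "bounded ?S" by (rule bounded_subset[of "{0..t}"]) auto
  ultimately have "compact ?S" by (simp add: compact_eq_bounded_closed)
  moreover have "?S \<noteq> {}" using f0 t by auto
  ultimately obtain s where s: "s \<in> ?S" "\<And>r. r \<in> ?S \<Longrightarrow> r \<le> s"
    using compact_attains_sup[of ?S] by blast
  have st: "s < t" using s(1) ft by (cases "s = t") auto
  have above: "K < f r" if "s < r" "r \<le> t" for r
    using s(2)[of r] s(1) that by fastforce
  have "\<exists>z\<in>{s<..<t}. f t - f s = (\<lambda>x. f' z * x) (t - s)"
  proof (rule mvt_simple[OF st])
    fix x assume "s \<le> x" "x \<le> t"
    then have "x \<in> {0..T}" "{s..t} \<subseteq> {0..T}" using s(1) t by auto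
    then show "(f has_derivative (*) (f' x)) (at x within {s..t})"
      using has_derivative_subset[OF d[unfolded has_field_derivative_def]] by blast
  qed
  then obtain z where z: "z \<in> {s<..<t}" "f t - f s = f' z * (t - s)" by auto
  have "f' z \<le> 0" using z(1) s(1) t above[of z] by (intro neg) auto
  then have "f t - f s \<le> 0" using z(2) st by (simp add: mult_nonpos_nonneg)
  then show False using s(1) ft by simp
qed

text \<open>The substitution \<open>s = t * r\<close> moves the dependence on t from the limit of
  integration into the integrand, over the fixed interval from 0 to 1.\<close>

lemma continuous_on_indefinite_integral_param:
  fixes q :: "real \<Rightarrow> real \<Rightarrow> real"
  assumes q: "continuous_on ({0..T} \<times> UNIV) (\<lambda>(s, z). q s z)"
  shows "continuous_on ({0..T} \<times> UNIV) (\<lambda>(t, z). integral {0..t} (\<lambda>s. q s z))"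
proof -
  have eq: "integral {0..t} (\<lambda>s. q s z) = integral (cbox 0 1) (\<lambda>r. t * q (t * r) z)" if t: "t \<in> {0..T}" for t z
  proof (cases "t = 0")
    case False
    then have t0: "0 < t" using t by simp
    have "continuous_on {0..t} (\<lambda>s. q s z)"
      by (rule continuous_on_compose_strip[OF q]) (use t in \<open>auto intro!: continuous_intros\<close>)
    then have "((\<lambda>s. q s z) has_integral integral {0..t} (\<lambda>s. q s z)) {0..t}"
      by (simp add: integrable_integral integrable_continuous_interval)
    from has_integral_stretch_real[OF this, of t] t0
    have "((\<lambda>r. q (t * r) z) has_integral integral {0..t} (\<lambda>s. q s z) / t) {0..1}"
      by (simp add: image_divide_atLeastAtMost)
    from has_integral_mult_right[OF this, of t]
    have "((\<lambda>r. t * q (t * r) z) has_integral integral {0..t} (\<lambda>s. q s z)) {0..1}" using t0 by simp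
    from integral_unique[OF this] show ?thesis by (simp only: box_real)
  qed simp
  have "continuous_on (({0..T} \<times> UNIV) \<times> cbox 0 1) (\<lambda>(p, r). fst p * q (fst p * r) (snd p))"
    unfolding case_prod_unfold
  proof (intro continuous_intros)
    have "fst (fst x) * snd x \<le> T" if "x \<in> ({0..T} \<times> (UNIV :: real set)) \<times> cbox 0 1" for x
      using that mult_mono[of "fst (fst x)" T "snd x" 1] by auto
    then show "continuous_on (({0..T} \<times> UNIV) \<times> cbox 0 1) (\<lambda>x. q (fst (fst x) * snd x) (snd (fst x)))"
      by (intro continuous_on_compose_strip[OF q]) (auto intro!: continuous_intros)
  qed
  then have "continuous_on ({0..T} \<times> UNIV) (\<lambda>p. integral (cbox 0 1) (\<lambda>r. fst p * q (fst p * r) (snd p)))"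
    by (rule integral_continuous_on_param)
  then show ?thesis
    by (rule continuous_on_eq) (auto simp: eq)
qed

section \<open>Solving for the magnetization and for the density\<close>

context bounded_rates
begin

lemma c_continuous: "\<sigma> \<in> spins \<Longrightarrow> continuous_on {-1..1} (c \<sigma>)"
proof (rule continuous_onI)
  fix x e :: real assume \<sigma>: "\<sigma> \<in> spins" and x: "x \<in> {-1..1}" and e: "0 < e"
  have "dist (c \<sigma> x') (c \<sigma> x) \<le> e" if "x' \<in> {-1..1}" "dist x' x < e / (Lc + 1)" for x'
  proof -
    have "\<bar>c \<sigma> x' - c \<sigma> x\<bar> \<le> Lc * \<bar>x' - x\<bar>" by (rule c_lip[OF \<sigma> that(1) x])
    also have "\<dots> \<le> (Lc + 1) * \<bar>x' - x\<bar>" using Lc_nonneg by (intro mult_right_mono) auto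
    also have "\<dots> \<le> (Lc + 1) * (e / (Lc + 1))" using that Lc_nonneg by (intro mult_left_mono) (auto simp: dist_real_def)
    finally show ?thesis using Lc_nonneg by (simp add: dist_real_def)
  qed
  then show "\<exists>d>0. \<forall>x'\<in>{-1..1}. dist x' x < d \<longrightarrow> dist (c \<sigma> x') (c \<sigma> x) \<le> e"
    using e Lc_nonneg by (intro exI[of _ "e / (Lc + 1)"]) auto
qed

text \<open>The rates are controlled on \<open>{-1..1}\<close> only, so the drift is first extended
  by clamping its argument, which makes it globally Lipschitz. The clamped equation is solved by the
  weighted fixed point, and the barrier lemma shows that its solution stays where clamping has no
  effect.\<close>

lemma magnetization_ode:
  assumes T: "0 \<le> T" and m0: "m0 \<in> {-1..1}"
  obtains m where "m 0 = m0" "\<And>t. t \<in> {0..T} \<Longrightarrow> m t \<in> {-1..1}"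
    "\<And>t. t \<in> {0..T} \<Longrightarrow> (m has_real_derivative mag_drift c (m t)) (at t within {0..T})"
proof -
  define K where "K = 4 * Lc + 2 * c_hi"
  have K: "0 \<le> K" using Lc_nonneg c_hi_nonneg by (simp add: K_def)
  \<comment> \<open>Large enough that the Lipschitz constant K divided by l is at most 1/2; the
    summand 1 covers \<open>K = 0\<close>.\<close>
  define l where "l = 2 * K + 1"
  have l: "0 < l" "K / l \<le> 1 / 2" using K by (auto simp: l_def field_simps)
  define cl where "cl z = max (-1) (min 1 z)" for z :: real
  have cl: "cl z \<in> {-1..1}" "\<bar>cl z - cl z'\<bar> \<le> \<bar>z - z'\<bar>" for z z' by (auto simp: cl_def)
  define b where "b z = mag_drift c (cl z)" for z
  have b_lip: "\<bar>b z - b z'\<bar> \<le> K * \<bar>z - z'\<bar>" for z z'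
    using mag_drift_lipschitz[OF cl(1) cl(1), of z z'] mult_left_mono[OF cl(2)[of z z'] K]
    unfolding b_def K_def by linarith
  have b_cont: "continuous_on UNIV b"
  proof (rule continuous_onI)
    fix x e :: real assume "0 < e"
    have "dist (b x') (b x) \<le> e" if "dist x' x < e / (K + 1)" for x'
    proof -
      have "\<bar>b x' - b x\<bar> \<le> K * \<bar>x' - x\<bar>" by (rule b_lip)
      also have "\<dots> \<le> (K + 1) * \<bar>x' - x\<bar>" using K by (intro mult_right_mono) auto
      also have "\<dots> \<le> (K + 1) * (e / (K + 1))" using that K by (intro mult_left_mono) (auto simp: dist_real_def)
      finally show ?thesis using K by (simp add: dist_real_def)
    qed
    then show "\<exists>d>0. \<forall>x'\<in>UNIV. dist x' x < d \<longrightarrow> dist (b x') (b x) \<le> e"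
      using \<open>0 < e\<close> K by (intro exI[of _ "e / (K + 1)"]) auto
  qed
  have bu: "continuous_on {0..T} (\<lambda>s. b (u s))" if "continuous_on {0..T} u" for u
    by (rule continuous_on_compose2[OF b_cont that]) simp
  define \<Psi> where "\<Psi> u t = m0 + integral {0..t} (\<lambda>s. b (u s))" for u and t :: real
  have \<Psi>_cont: "continuous_on {0..T} (\<Psi> u)" if "continuous_on {0..T} u" for u
    unfolding \<Psi>_def
    by (intro continuous_intros indefinite_integral_continuous_1 integrable_continuous_interval bu that)
  have B0: "\<exists>B. \<forall>t\<in>{0..T}. \<bar>\<Psi> (\<lambda>_. 0) t\<bar> \<le> B"
  proof -
    have "compact (\<Psi> (\<lambda>_. 0) ` {0..T})" by (intro compact_continuous_image \<Psi>_cont) auto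
    then show ?thesis using compact_imp_bounded by (fastforce simp: bounded_iff)
  qed
  then obtain B where B: "\<And>t. t \<in> {0..T} \<Longrightarrow> \<bar>\<Psi> (\<lambda>_. 0) t\<bar> \<le> B" by blast
  obtain m where m: "continuous_on {0..T} m" "\<And>t. t \<in> {0..T} \<Longrightarrow> \<Psi> m t = m t"
  proof (rule weighted_fixpoint[where \<Psi> = \<Psi> and C = "{u. continuous_on {0..T} u}" and S = "{0..T}"
      and w = "\<lambda>t. exp (l * t)" and W = "exp (l * T)" and A = "max B 0" and ?u0.0 = "\<lambda>_. 0"])
    fix f u assume "\<And>n :: nat. f n \<in> {u. continuous_on {0..T} u}" "uniform_limit {0..T} f u sequentially"
    then show "u \<in> {u. continuous_on {0..T} u}"
      by (auto intro!: uniform_limit_theorem[where f = f and F = sequentially])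
  next
    fix x assume x: "x \<in> {0..T}"
    have "\<bar>\<Psi> (\<lambda>_. 0) x\<bar> \<le> max B 0 * 1" using B[OF x] by simp
    also have "\<dots> \<le> max B 0 * exp (l * x)" using x l by (intro mult_left_mono) auto
    finally show "\<bar>\<Psi> (\<lambda>_. 0) x - 0\<bar> \<le> max B 0 * exp (l * x)" by simp
  next
    fix u v D x assume u: "u \<in> {u. continuous_on {0..T} u}" and v: "v \<in> {u. continuous_on {0..T} u}"
      and D: "0 \<le> D" and uv: "\<And>x. x \<in> {0..T} \<Longrightarrow> \<bar>u x - v x\<bar> \<le> D * exp (l * x)" and x: "x \<in> {0..T}"
    have cont: "continuous_on {0..x} (\<lambda>s. b (u s))" "continuous_on {0..x} (\<lambda>s. b (v s))"
      using bu[of u] bu[of v] u v x by (auto intro: continuous_on_subset)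
    have "\<Psi> u x - \<Psi> v x = integral {0..x} (\<lambda>s. b (u s) - b (v s))"
      unfolding \<Psi>_def using cont by (simp add: Henstock_Kurzweil_Integration.integral_diff integrable_continuous_interval)
    also have "\<bar>\<dots>\<bar> \<le> (K * D) / l * exp (l * x)"
    proof (rule abs_integral_le_exp)
      fix s assume s: "s \<in> {0..x}"
      have "\<bar>b (u s) - b (v s)\<bar> \<le> K * (D * exp (l * s))"
        using b_lip[of "u s" "v s"] mult_left_mono[OF uv[of s] K] s x by force
      then show "\<bar>b (u s) - b (v s)\<bar> \<le> K * D * exp (l * s)" by (simp add: mult.assoc)
    qed (use cont x l K D in \<open>auto intro!: continuous_intros\<close>)
    also have "(K * D) / l * exp (l * x) = (K / l) * (D * exp (l * x))" by simp
    also have "\<dots> \<le> (1 / 2) * (D * exp (l * x))" using l D by (intro mult_right_mono) auto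
    finally show "\<bar>\<Psi> u x - \<Psi> v x\<bar> \<le> D / 2 * exp (l * x)" by simp
  qed (use T l \<Psi>_cont in auto)
  have der: "(m has_real_derivative b (m t)) (at t within {0..T})" if t: "t \<in> {0..T}" for t
  proof -
    have "((\<lambda>t. m0 + integral {0..t} (\<lambda>s. b (m s))) has_real_derivative b (m t)) (at t within {0..T})"
      using integral_has_real_derivative[OF bu[OF m(1)] t] by (auto intro!: derivative_eq_intros)
    then show ?thesis
      by (rule has_field_derivative_transform_within[OF _ zero_less_one t]) (use m(2) in \<open>auto simp: \<Psi>_def\<close>)
  qed
  have m_0: "m 0 = m0" using m(2)[of 0] T by (simp add: \<Psi>_def)
  have upper: "m t \<le> 1" if "t \<in> {0..T}" for t
  proof (rule barrier[OF der _ _ that])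
    fix t assume "1 < m t"
    \<comment> \<open>Above 1 the clamped drift is constantly \<open>- 2 * c 1 1\<close>, as only
      flips out of spin 1 remain.\<close>
    then show "b (m t) \<le> 0" using c_nonneg[of 1 1] by (simp add: b_def cl_def mag_drift_def)
  qed (use m0 m_0 in auto)
  have lower: "- m t \<le> 1" if "t \<in> {0..T}" for t
  proof (rule barrier[OF DERIV_minus[OF der] _ _ that])
    fix t assume "1 < - m t"
    then show "- b (m t) \<le> 0" using c_nonneg[of "-1" "-1"] by (simp add: b_def cl_def mag_drift_def)
  qed (use m0 m_0 in auto)
  show ?thesis
  proof (rule that[of m])
    show "m 0 = m0" by (rule m_0)
    fix t assume t: "t \<in> {0..T}"
    show range: "m t \<in> {-1..1}" using upper[OF t] lower[OF t] by simp
    then have "cl (m t) = m t" by (auto simp: cl_def)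
    then show "(m has_real_derivative mag_drift c (m t)) (at t within {0..T})"
      using der[OF t] by (simp add: b_def)
  qed
qed

text \<open>Adding \<open>c_hi\<close> to the exit rates makes all coefficients of the integrated equation nonnegative;
  this is undone by the factor \<open>exp (- c_hi * t)\<close>.\<close>

lemma density_exists:
  assumes T: "0 \<le> T" and m: "continuous_on {0..T} m" "\<And>t. t \<in> {0..T} \<Longrightarrow> m t \<in> {-1..1}"
    and \<rho>: "\<rho> \<in> C_V" "\<And>x \<sigma>. \<sigma> \<in> spins \<Longrightarrow> 0 \<le> \<rho> (x, \<sigma>)"
  obtains r where "\<And>\<sigma>. \<sigma> \<in> spins \<Longrightarrow> continuous_on ({0..T} \<times> UNIV) (\<lambda>(t, x). r t (x, \<sigma>))"
    "\<And>t. t \<in> {0..T} \<Longrightarrow> r t \<in> C_V"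
    "\<And>t x \<sigma>. t \<in> {0..T} \<Longrightarrow> \<sigma> \<in> spins \<Longrightarrow> 0 \<le> r t (x, \<sigma>)"
    "\<And>x \<sigma>. \<sigma> \<in> spins \<Longrightarrow> r 0 (x, \<sigma>) = \<rho> (x, \<sigma>)"
    "\<And>t y \<sigma>. t \<in> {0..T} \<Longrightarrow> \<sigma> \<in> spins \<Longrightarrow>
      ((\<lambda>t. r t (y + of_int \<sigma> * t, \<sigma>)) has_real_derivative
        c (- \<sigma>) (m t) * r t (y + of_int \<sigma> * t, - \<sigma>) - c \<sigma> (m t) * r t (y + of_int \<sigma> * t, \<sigma>))
      (at t within {0..T})"
proof -
  \<comment> \<open>The two coefficients in Q are at most \<open>c_hi\<close> each, so
    \<open>2 * c_hi / l\<close> is the contraction constant.\<close>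
  define l where "l = 4 * c_hi + 1"
  have l: "0 < l" "2 * c_hi / l \<le> 1 / 2" using c_hi_nonneg by (auto simp: l_def field_simps)
  define S where "S = {0..T} \<times> (UNIV :: real set) \<times> spins"
  \<comment> \<open>Continuity, nonnegativity and periodicity survive uniform limits, so the fixed
    point inherits them from the iteration.\<close>
  define C where "C = {u :: real \<times> real \<times> int \<Rightarrow> real.
    (\<forall>\<sigma>\<in>spins. continuous_on ({0..T} \<times> UNIV) (\<lambda>(t, x). u (t, x, \<sigma>))) \<and>
    (\<forall>t\<in>{0..T}. \<forall>x. \<forall>\<sigma>\<in>spins. 0 \<le> u (t, x, \<sigma>) \<and> u (t, x + 1, \<sigma>) = u (t, x, \<sigma>))}"
  define Q where "Q u \<sigma> s x = c (- \<sigma>) (m s) * u (s, x, - \<sigma>) + (c_hi - c \<sigma> (m s)) * u (s, x, \<sigma>)"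
    for u :: "real \<times> real \<times> int \<Rightarrow> real" and \<sigma> :: int and s x :: real
  \<comment> \<open>The integral in Duhamel's formula along the characteristic
    \<open>z + \<sigma> * s\<close>, where z is the position at time 0. Only continuity of u in
    space is involved.\<close>
  define H where "H u \<sigma> t z = integral {0..t} (\<lambda>s. Q u \<sigma> s (z + of_int \<sigma> * s))" for u \<sigma> t z
  define \<Psi> where "\<Psi> u = (\<lambda>(t, x, \<sigma>). \<rho> (x - of_int \<sigma> * t, \<sigma>) + H u \<sigma> t (x - of_int \<sigma> * t))" for u
  have cm: "continuous_on {0..T} (\<lambda>s. c \<sigma> (m s))" if "\<sigma> \<in> spins" for \<sigma>
    by (rule continuous_on_compose2[OF c_continuous[OF that] m(1)]) (use m(2) in auto)
  have Q_cont: "continuous_on ({0..T} \<times> UNIV) (\<lambda>(s, z). Q u \<sigma> s (z + of_int \<sigma> * s))"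
    if u: "u \<in> C" and \<sigma>: "\<sigma> \<in> spins" for u \<sigma>
  proof -
    have uc: "continuous_on ({0..T} \<times> UNIV) (\<lambda>p. u (fst p, snd p + of_int \<sigma> * fst p, \<tau>))" if "\<tau> \<in> spins" for \<tau>
      by (rule continuous_on_compose_strip[where f = "\<lambda>t x. u (t, x, \<tau>)"])
         (use u that in \<open>auto simp: C_def intro!: continuous_intros\<close>)
    have cc: "continuous_on ({0..T} \<times> UNIV) (\<lambda>p. c \<tau> (m (fst p)))" if "\<tau> \<in> spins" for \<tau>
      by (rule continuous_on_compose2[OF cm[OF that]]) (auto intro!: continuous_intros)
    show ?thesis unfolding Q_def case_prod_unfold using \<sigma>
      by (intro continuous_intros uc cc) auto
  qed
  have Q_int: "continuous_on {0..t} (\<lambda>s. Q u \<sigma> s (z + of_int \<sigma> * s))"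
    if "u \<in> C" "\<sigma> \<in> spins" "t \<in> {0..T}" for u \<sigma> t z
    by (rule continuous_on_compose_strip[OF Q_cont[OF that(1,2)]])
       (use that(3) in \<open>auto intro!: continuous_intros\<close>)
  have H_cont: "continuous_on ({0..T} \<times> UNIV) (\<lambda>p. H u \<sigma> (fst p) (snd p - of_int \<sigma> * fst p))"
    if "u \<in> C" "\<sigma> \<in> spins" for u \<sigma>
    unfolding H_def
    by (rule continuous_on_compose_strip[OF continuous_on_indefinite_integral_param[OF Q_cont[OF that]]])
       (auto intro!: continuous_intros)
  have \<rho>_cont: "continuous_on UNIV (\<lambda>x. \<rho> (x, \<sigma>))" if "\<sigma> \<in> spins" for \<sigma>
    using \<rho> that by (simp add: C_V_def)
  have \<Psi>C: "\<Psi> u \<in> C" if u: "u \<in> C" for u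
    unfolding C_def
  proof (intro CollectI conjI ballI allI)
    fix \<sigma> assume \<sigma>: "\<sigma> \<in> spins"
    have "continuous_on ({0..T} \<times> UNIV) (\<lambda>p :: real \<times> real. \<rho> (snd p - of_int \<sigma> * fst p, \<sigma>))"
      by (rule continuous_on_compose2[OF \<rho>_cont[OF \<sigma>]]) (auto intro!: continuous_intros)
    then show "continuous_on ({0..T} \<times> UNIV) (\<lambda>(t, x). \<Psi> u (t, x, \<sigma>))"
      unfolding \<Psi>_def case_prod_unfold by (auto intro!: continuous_on_add H_cont u \<sigma>)
  next
    fix t x \<sigma> assume t: "t \<in> {0..T}" and \<sigma>: "\<sigma> \<in> spins"
    have u0: "0 \<le> u (s, y, \<tau>)" "u (s, y + 1, \<tau>) = u (s, y, \<tau>)" if "s \<in> {0..T}" "\<tau> \<in> spins" for s y \<tau>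
      using u that by (auto simp: C_def)
    have "0 \<le> H u \<sigma> t z" for z
      unfolding H_def
    proof (rule integral_nonneg)
      show "(\<lambda>s. Q u \<sigma> s (z + of_int \<sigma> * s)) integrable_on {0..t}"
        by (intro integrable_continuous_interval Q_int u \<sigma> t)
      fix s assume s: "s \<in> {0..t}"
      then have sT: "s \<in> {0..T}" using t by auto
      show "0 \<le> Q u \<sigma> s (z + of_int \<sigma> * s)"
        unfolding Q_def using u0(1)[OF sT] \<sigma> c_nonneg[OF _ m(2)[OF sT]] c_le[OF _ m(2)[OF sT]]
        by (intro add_nonneg_nonneg mult_nonneg_nonneg) auto
    qed
    then show "0 \<le> \<Psi> u (t, x, \<sigma>)" using \<rho>(2)[OF \<sigma>] by (simp add: \<Psi>_def)
    have "H u \<sigma> t (z + 1) = H u \<sigma> t z" for z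
      unfolding H_def
    proof (rule integral_cong)
      fix s assume "s \<in> {0..t}"
      then have sT: "s \<in> {0..T}" using t by auto
      show "Q u \<sigma> s (z + 1 + of_int \<sigma> * s) = Q u \<sigma> s (z + of_int \<sigma> * s)"
        using u0(2)[OF sT, of \<sigma> "z + of_int \<sigma> * s"] u0(2)[OF sT, of "- \<sigma>" "z + of_int \<sigma> * s"] \<sigma>
        by (simp add: Q_def algebra_simps)
    qed
    from this[of "x - of_int \<sigma> * t"] show "\<Psi> u (t, x + 1, \<sigma>) = \<Psi> u (t, x, \<sigma>)"
      using \<rho>(1) \<sigma> periodic_V_int[of \<rho> \<sigma> "x - of_int \<sigma> * t" 1] by (simp add: \<Psi>_def C_V_def algebra_simps)
  qed
  obtain B where B: "0 < B" "\<And>x \<sigma>. \<sigma> \<in> spins \<Longrightarrow> \<bar>\<rho> (x, \<sigma>)\<bar> \<le> B" using C_V_bounded[OF \<rho>(1)] by metis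
  obtain u where u: "u \<in> C" "\<And>x. x \<in> S \<Longrightarrow> \<Psi> u x = u x"
  proof (rule weighted_fixpoint[where \<Psi> = \<Psi> and C = C and S = S
      and w = "\<lambda>p. exp (l * fst p)" and W = "exp (l * T)" and A = B and ?u0.0 = "\<lambda>_. 0"])
    show "exp (l * fst x) \<le> exp (l * T)" if "x \<in> S" for x :: "real \<times> real \<times> int"
      using that l by (auto simp: S_def)
    show "(\<lambda>_. 0) \<in> C" by (simp add: C_def)
    fix f u assume f: "\<And>n :: nat. f n \<in> C" and lim: "uniform_limit S f u sequentially"
    have ptw: "(\<lambda>n. f n (t, x, \<sigma>)) \<longlonglongrightarrow> u (t, x, \<sigma>)" if "t \<in> {0..T}" "\<sigma> \<in> spins" for t x \<sigma>
      using tendsto_uniform_limitI[OF lim] that by (simp add: S_def)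
    show "u \<in> C" unfolding C_def
    proof (intro CollectI conjI ballI allI)
      fix \<sigma> assume \<sigma>: "\<sigma> \<in> spins"
      have "uniform_limit ({0..T} \<times> UNIV) (\<lambda>n (t, x). f n (t, x, \<sigma>)) (\<lambda>(t, x). u (t, x, \<sigma>)) sequentially"
        unfolding uniform_limit_iff
      proof (intro allI impI)
        fix e :: real assume "0 < e"
        then have "\<forall>\<^sub>F n in sequentially. \<forall>x\<in>S. dist (f n x) (u x) < e"
          using lim by (simp add: uniform_limit_iff)
        then show "\<forall>\<^sub>F n in sequentially. \<forall>x\<in>{0..T} \<times> UNIV.
            dist (case x of (t, x) \<Rightarrow> f n (t, x, \<sigma>)) (case x of (t, x) \<Rightarrow> u (t, x, \<sigma>)) < e"
          by eventually_elim (use \<sigma> in \<open>auto simp: S_def\<close>)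
      qed
      then show "continuous_on ({0..T} \<times> UNIV) (\<lambda>(t, x). u (t, x, \<sigma>))"
        by (rule uniform_limit_theorem[rotated]) (use f \<sigma> in \<open>auto simp: C_def\<close>)
    next
      fix t x \<sigma> assume t: "t \<in> {0..T}" and \<sigma>: "\<sigma> \<in> spins"
      show "0 \<le> u (t, x, \<sigma>)"
        by (rule LIMSEQ_le_const[OF ptw[OF t \<sigma>]]) (use f t \<sigma> in \<open>auto simp: C_def\<close>)
      have "(\<lambda>n. f n (t, x + 1, \<sigma>)) = (\<lambda>n. f n (t, x, \<sigma>))" using f t \<sigma> by (auto simp: C_def)
      then show "u (t, x + 1, \<sigma>) = u (t, x, \<sigma>)"
        using ptw[OF t \<sigma>, of x] ptw[OF t \<sigma>, of "x + 1"] LIMSEQ_unique by simp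
    qed
  next
    fix x assume x: "x \<in> S"
    obtain t y \<sigma> where [simp]: "x = (t, y, \<sigma>)" and t: "t \<in> {0..T}" and \<sigma>: "\<sigma> \<in> spins"
      using x by (auto simp: S_def)
    have "\<bar>\<Psi> (\<lambda>_. 0) x - 0\<bar> \<le> B * 1" using B(2)[OF \<sigma>] by (simp add: \<Psi>_def H_def Q_def)
    also have "\<dots> \<le> B * exp (l * fst x)" using t l B by (intro mult_left_mono) auto
    finally show "\<bar>\<Psi> (\<lambda>_. 0) x - 0\<bar> \<le> B * exp (l * fst x)" .
  next
    fix u v D x assume u: "u \<in> C" and v: "v \<in> C" and D: "0 \<le> D"
      and uv: "\<And>x. x \<in> S \<Longrightarrow> \<bar>u x - v x\<bar> \<le> D * exp (l * fst x)" and x: "x \<in> S"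
    obtain t y \<sigma> where [simp]: "x = (t, y, \<sigma>)" and t: "t \<in> {0..T}" and \<sigma>: "\<sigma> \<in> spins"
      using x by (auto simp: S_def)
    let ?z = "y - of_int \<sigma> * t"
    have "\<Psi> u x - \<Psi> v x = integral {0..t} (\<lambda>s. Q u \<sigma> s (?z + of_int \<sigma> * s) - Q v \<sigma> s (?z + of_int \<sigma> * s))"
      unfolding \<Psi>_def H_def using Q_int[OF u \<sigma> t] Q_int[OF v \<sigma> t]
      by (simp add: Henstock_Kurzweil_Integration.integral_diff integrable_continuous_interval)
    also have "\<bar>\<dots>\<bar> \<le> (2 * c_hi * D) / l * exp (l * t)"
    proof (rule abs_integral_le_exp)
      show "continuous_on {0..t} (\<lambda>s. Q u \<sigma> s (?z + of_int \<sigma> * s) - Q v \<sigma> s (?z + of_int \<sigma> * s))"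
        by (intro continuous_on_diff Q_int u v \<sigma> t)
      fix s assume s: "s \<in> {0..t}"
      then have sT: "s \<in> {0..T}" using t by auto
      let ?y = "?z + of_int \<sigma> * s"
      have d: "\<bar>u (s, ?y, \<tau>) - v (s, ?y, \<tau>)\<bar> \<le> D * exp (l * s)" if "\<tau> \<in> spins" for \<tau>
        using uv[of "(s, ?y, \<tau>)"] that sT by (simp add: S_def)
      have "\<bar>c (- \<sigma>) (m s) * (u (s, ?y, - \<sigma>) - v (s, ?y, - \<sigma>))\<bar> \<le> c_hi * (D * exp (l * s))"
        unfolding abs_mult using d[of "- \<sigma>"] \<sigma> abs_c_le[OF _ m(2)[OF sT], of "- \<sigma>"] c_hi_nonneg by (intro mult_mono) auto
      moreover have "\<bar>(c_hi - c \<sigma> (m s)) * (u (s, ?y, \<sigma>) - v (s, ?y, \<sigma>))\<bar> \<le> c_hi * (D * exp (l * s))"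
        unfolding abs_mult using d[OF \<sigma>] c_nonneg[OF \<sigma> m(2)[OF sT]] c_le[OF \<sigma> m(2)[OF sT]] c_hi_nonneg
        by (intro mult_mono) auto
      moreover have "Q u \<sigma> s ?y - Q v \<sigma> s ?y = c (- \<sigma>) (m s) * (u (s, ?y, - \<sigma>) - v (s, ?y, - \<sigma>))
          + (c_hi - c \<sigma> (m s)) * (u (s, ?y, \<sigma>) - v (s, ?y, \<sigma>))"
        by (simp add: Q_def algebra_simps)
      ultimately show "\<bar>Q u \<sigma> s ?y - Q v \<sigma> s ?y\<bar> \<le> 2 * c_hi * D * exp (l * s)" by simp
    qed (use t l c_hi_nonneg D in auto)
    also have "(2 * c_hi * D) / l * exp (l * t) = (2 * c_hi / l) * (D * exp (l * t))" by simp
    also have "\<dots> \<le> (1 / 2) * (D * exp (l * t))" using l D by (intro mult_right_mono) auto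
    finally show "\<bar>\<Psi> u x - \<Psi> v x\<bar> \<le> D / 2 * exp (l * fst x)" by simp
  qed (use B \<Psi>C in auto)
  define r where "r t = (\<lambda>(x, \<sigma>). exp (- c_hi * t) * u (t, x, \<sigma>))" for t
  show ?thesis
  proof (rule that[of r])
    fix \<sigma> assume \<sigma>: "\<sigma> \<in> spins"
    show cont: "continuous_on ({0..T} \<times> UNIV) (\<lambda>(t, x). r t (x, \<sigma>))"
      using u(1) \<sigma> unfolding r_def case_prod_unfold C_def by (auto intro!: continuous_intros)
  next
    fix t assume t: "t \<in> {0..T}"
    show "r t \<in> C_V"
      unfolding C_V_def periodic_V_def
    proof (intro CollectI conjI allI ballI)
      fix \<sigma> assume \<sigma>: "\<sigma> \<in> spins"
      have "continuous_on UNIV (\<lambda>x. u (t, x, \<sigma>))"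
        by (rule continuous_on_compose_strip[where f = "\<lambda>t x. u (t, x, \<sigma>)"])
           (use u(1) t \<sigma> in \<open>auto simp: C_def intro!: continuous_intros\<close>)
      then show "continuous_on UNIV (\<lambda>x. r t (x, \<sigma>))" unfolding r_def by (auto intro!: continuous_intros)
    qed (use u(1) t in \<open>auto simp: C_def r_def\<close>)
    fix \<sigma> y assume \<sigma>: "\<sigma> \<in> spins"
    show "0 \<le> r t (y, \<sigma>)" using u(1) t \<sigma> by (auto simp: C_def r_def)
    have eq: "r s (y + of_int \<sigma> * s, \<sigma>) = exp (- c_hi * s) * (\<rho> (y, \<sigma>) + H u \<sigma> s y)" if "s \<in> {0..T}" for s
      using u(2)[of "(s, y + of_int \<sigma> * s, \<sigma>)"] that \<sigma> by (simp add: r_def \<Psi>_def S_def)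
    have dH: "((\<lambda>s. H u \<sigma> s y) has_real_derivative Q u \<sigma> t (y + of_int \<sigma> * t)) (at t within {0..T})"
      unfolding H_def using T by (intro integral_has_real_derivative Q_int u(1) \<sigma> t) auto
    have "((\<lambda>s. exp (- c_hi * s) * (\<rho> (y, \<sigma>) + H u \<sigma> s y)) has_real_derivative
        - c_hi * (exp (- c_hi * t) * (\<rho> (y, \<sigma>) + H u \<sigma> t y)) + exp (- c_hi * t) * Q u \<sigma> t (y + of_int \<sigma> * t))
        (at t within {0..T})"
      by (auto intro!: derivative_eq_intros dH)
    also have "- c_hi * (exp (- c_hi * t) * (\<rho> (y, \<sigma>) + H u \<sigma> t y)) + exp (- c_hi * t) * Q u \<sigma> t (y + of_int \<sigma> * t) =
        c (- \<sigma>) (m t) * r t (y + of_int \<sigma> * t, - \<sigma>) - c \<sigma> (m t) * r t (y + of_int \<sigma> * t, \<sigma>)"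
      unfolding eq[OF t, symmetric] by (simp add: Q_def r_def algebra_simps)
    finally show "((\<lambda>t. r t (y + of_int \<sigma> * t, \<sigma>)) has_real_derivative
        c (- \<sigma>) (m t) * r t (y + of_int \<sigma> * t, - \<sigma>) - c \<sigma> (m t) * r t (y + of_int \<sigma> * t, \<sigma>))
      (at t within {0..T})"
      by (rule has_field_derivative_transform_within[OF _ zero_less_one t]) (simp add: eq)
  next
    fix x \<sigma> assume \<sigma>: "\<sigma> \<in> spins"
    show "r 0 (x, \<sigma>) = \<rho> (x, \<sigma>)"
      using u(2)[of "(0, x, \<sigma>)"] T \<sigma> by (simp add: r_def \<Psi>_def S_def H_def)
  qed
qed

end

section \<open>The weak formulation\<close>

text \<open>The fractional part of a is a shift by less than one period; the part that sticks out
  beyond 1 is moved back by periodicity.\<close>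

lemma integral_periodic_shift:
  fixes f :: "real \<Rightarrow> real"
  assumes f: "continuous_on UNIV f" and per: "\<And>x. f (x + 1) = f x"
  shows "integral {0..1} (\<lambda>y. f (y + a)) = integral {0..1} f"
proof -
  have per_int: "f (x + of_int n) = f x" for x n
    using periodic_V_int[of "\<lambda>(x, _). f x" 1 x n] per by (simp add: periodic_V_def)
  define b where "b = frac a"
  have b: "0 \<le> b" "b < 1" by (simp_all add: b_def frac_lt_1)
  have int: "f integrable_on {u..v}" for u v
    using f by (intro integrable_continuous_interval) (auto intro: continuous_on_subset)
  have "f (y + a) = f (y + b)" for y
    using per_int[of "y + b" "\<lfloor>a\<rfloor>"] by (simp add: b_def frac_def)
  then have "integral {0..1} (\<lambda>y. f (y + a)) = integral {0..1} (\<lambda>y. f (b + y))" by (simp add: add.commute)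
  also have "\<dots> = integral {b..1 + b} f"
    using integral_shift_Icc_real[of 0 1 f b] by (simp add: o_def add.commute[of b])
  also have "\<dots> = integral {b..1} f + integral {1..1 + b} f"
    using b by (intro Henstock_Kurzweil_Integration.integral_combine[symmetric] int) auto
  also have "integral {1..1 + b} f = integral {0..b} (\<lambda>y. f (1 + y))"
    using integral_shift_Icc_real[of 0 b f 1] by (simp add: o_def add.commute[of 1])
  also have "\<dots> = integral {0..b} f" using per by (simp add: add.commute)
  also have "integral {b..1} f + integral {0..b} f = integral {0..1} f"
    using b Henstock_Kurzweil_Integration.integral_combine[of 0 b 1 f] int by (simp add: add.commute)
  finally show ?thesis .
qed

lemma periodic_derivative:
  fixes f :: "real \<Rightarrow> real"
  assumes per: "\<And>x. f (x + 1) = f x" and d: "\<And>x. (f has_real_derivative f' x) (at x)"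
  shows "f' (x + 1) = f' x"
proof -
  have "((\<lambda>y. f (y + 1)) has_real_derivative f' (x + 1)) (at x)"
    by (rule iffD1[OF DERIV_shift d])
  then show ?thesis using d[of x] DERIV_unique unfolding per by blast
qed

text \<open>Both \<open>g' x\<close> and \<open>g' (x + 1)\<close> are derivatives of the same
  function of time; \<open>0 < T\<close> makes derivatives within the time interval unique, also at
  its end points.\<close>

lemma periodic_time_derivative:
  fixes g :: "real \<Rightarrow> real \<Rightarrow> real"
  assumes T: "0 < T" and s: "s \<in> {0..T}" and per: "\<And>s. s \<in> {0..T} \<Longrightarrow> g s (x + 1) = g s x"
    and d: "\<And>x. ((\<lambda>s. g s x) has_real_derivative g' x) (at s within {0..T})"
  shows "g' (x + 1) = g' x"
proof -
  have "((\<lambda>s. g s (x + 1)) has_real_derivative g' x) (at s within {0..T})"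
    by (rule has_field_derivative_transform_within[OF d[of x] zero_less_one s]) (simp add: per)
  then have "vector_derivative (\<lambda>s. g s (x + 1)) (at s within {0..T}) = g' x"
    using T s by (intro vector_derivative_within_closed_interval)
      (auto simp: has_real_derivative_iff_has_vector_derivative)
  moreover have "vector_derivative (\<lambda>s. g s (x + 1)) (at s within {0..T}) = g' (x + 1)"
    using T s d[of "x + 1"] by (intro vector_derivative_within_closed_interval)
      (auto simp: has_real_derivative_iff_has_vector_derivative)
  ultimately show ?thesis by simp
qed

text \<open>Partial derivatives alone do not yield a chain rule. Continuity of the space derivative
  gives total differentiability, which is then composed with the curve.\<close>

lemma characteristic_derivative:
  fixes g gt gx :: "real \<Rightarrow> real \<Rightarrow> real"
  assumes t: "t \<in> {0..T}"
    and gt: "\<And>t x. t \<in> {0..T} \<Longrightarrow> ((\<lambda>s. g s x) has_real_derivative gt t x) (at t within {0..T})"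
    and gx: "\<And>t x. t \<in> {0..T} \<Longrightarrow> ((\<lambda>y. g t y) has_real_derivative gx t x) (at x)"
    and cont: "continuous_on ({0..T} \<times> UNIV) (\<lambda>(t, x). gx t x)"
  shows "((\<lambda>s. g s (y + v * s)) has_real_derivative gt t (y + v * t) + v * gx t (y + v * t)) (at t within {0..T})"
proof -
  let ?z = "y + v * t"
  have "((\<lambda>(s, x). g s x) has_derivative (\<lambda>(ts, tx). gt t ?z * ts + blinfun_scaleR_right (gx t ?z) tx))
      (at (t, ?z) within {0..T} \<times> UNIV)"
  proof (rule has_derivative_partialsI[where fy = "\<lambda>s x. blinfun_scaleR_right (gx s x)"])
    show "((\<lambda>x. g x ?z) has_derivative (*) (gt t ?z)) (at t within {0..T})"
      using gt[OF t, of ?z] by (simp add: has_field_derivative_def)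
    show "(g x has_derivative blinfun_apply (blinfun_scaleR_right (gx x y))) (at y within UNIV)" if "x \<in> {0..T}" for x y
    proof -
      have "(*\<^sub>R) (gx x y) = (*) (gx x y)" by (rule ext) simp
      then show ?thesis using gx[OF that, of y] by (simp add: has_field_derivative_def)
    qed
    have "continuous (at (t, ?z) within {0..T} \<times> UNIV) (\<lambda>(t, x). gx t x)"
      using cont t by (simp add: continuous_on_eq_continuous_within)
    then have "continuous (at (t, ?z) within {0..T} \<times> UNIV) (\<lambda>p. blinfun_scaleR_right ((\<lambda>(t, x). gx t x) p) :: real \<Rightarrow>\<^sub>L real)"
      by (rule bounded_linear.continuous[OF bounded_linear_blinfun_scaleR_right])
    then show "continuous (at (t, ?z) within {0..T} \<times> UNIV) (\<lambda>(x, y). blinfun_scaleR_right (gx x y) :: real \<Rightarrow>\<^sub>L real)"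
      by (simp add: case_prod_unfold)
  qed auto
  then have "((\<lambda>(s, x). g s x) has_derivative (\<lambda>(ts, tx). gt t ?z * ts + gx t ?z * tx))
      (at (t, ?z) within {0..T} \<times> UNIV)" by simp
  then have G: "((\<lambda>(s, x). g s x) has_derivative (\<lambda>(ts, tx). gt t ?z * ts + gx t ?z * tx))
      (at (t, ?z) within (\<lambda>s. (s, y + v * s)) ` {0..T})"
    by (rule has_derivative_subset) auto
  have "((\<lambda>s. (s, y + v * s)) has_derivative (\<lambda>h. (h, v * h))) (at t within {0..T})"
    by (auto intro!: derivative_eq_intros)
  from diff_chain_within[OF this G]
  have "((\<lambda>s. g s (y + v * s)) has_derivative (\<lambda>h. gt t ?z * h + gx t ?z * (v * h))) (at t within {0..T})"
    by (simp add: o_def)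
  moreover have "(\<lambda>h. gt t ?z * h + gx t ?z * (v * h)) = (*) (gt t ?z + v * gx t ?z)"
    by (rule ext) (simp add: algebra_simps)
  ultimately show ?thesis by (simp only: has_field_derivative_def)
qed

text \<open>Here m solves the scalar equation and r the linear equation with rates at m. That the
  rates may be taken at the magnetization of r instead is not part of the data; it rests on
  \<open>spin_eq\<close>.\<close>

locale limit_density = bounded_rates c c_hi Lc for c c_hi Lc +
  fixes T :: real and m :: "real \<Rightarrow> real" and r :: "real \<Rightarrow> real \<times> int \<Rightarrow> real"
  assumes T_pos: "0 < T"
    and m_range: "\<And>t. t \<in> {0..T} \<Longrightarrow> m t \<in> {-1..1}"
    and m_deriv: "\<And>t. t \<in> {0..T} \<Longrightarrow> (m has_real_derivative mag_drift c (m t)) (at t within {0..T})"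
    and r_cont: "\<And>\<sigma>. \<sigma> \<in> spins \<Longrightarrow> continuous_on ({0..T} \<times> UNIV) (\<lambda>(t, x). r t (x, \<sigma>))"
    and r_CV: "\<And>t. t \<in> {0..T} \<Longrightarrow> r t \<in> C_V"
    and r_nonneg: "\<And>t x \<sigma>. t \<in> {0..T} \<Longrightarrow> \<sigma> \<in> spins \<Longrightarrow> 0 \<le> r t (x, \<sigma>)"
    and r_char: "\<And>t y \<sigma>. t \<in> {0..T} \<Longrightarrow> \<sigma> \<in> spins \<Longrightarrow>
      ((\<lambda>t. r t (y + of_int \<sigma> * t, \<sigma>)) has_real_derivative
        c (- \<sigma>) (m t) * r t (y + of_int \<sigma> * t, - \<sigma>) - c \<sigma> (m t) * r t (y + of_int \<sigma> * t, \<sigma>))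
      (at t within {0..T})"
begin

lemma cm_cont: "\<sigma> \<in> spins \<Longrightarrow> continuous_on {0..T} (\<lambda>s. c \<sigma> (m s))"
  by (rule continuous_on_compose2[OF c_continuous DERIV_continuous_on[OF m_deriv]]) (use m_range in auto)

lemma cm_cont2: "\<sigma> \<in> spins \<Longrightarrow> continuous_on ({0..T} \<times> UNIV) (\<lambda>p. c \<sigma> (m (fst p)))"
  by (rule continuous_on_compose2[OF cm_cont]) (auto intro!: continuous_intros)

definition pair_r :: "real \<Rightarrow> (real \<times> int \<Rightarrow> real) \<Rightarrow> real" where
  "pair_r t \<phi> = (\<Sum>\<sigma>\<in>spins. integral {0..1} (\<lambda>x. r t (x, \<sigma>) * \<phi> (x, \<sigma>)))"

lemma param_integral_cont:
  assumes "continuous_on ({0..T} \<times> UNIV) (\<lambda>(t, x). f t x)"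
  shows "continuous_on {0..T} (\<lambda>t. integral {0..1} (f t :: real \<Rightarrow> real))"
  using integral_continuous_on_param[of "{0..T}" 0 1 f] assms
  by (simp add: continuous_on_subset[of "{0..T} \<times> UNIV"] Sigma_mono)

text \<open>The density r is known to be differentiable only along characteristics. In each layer
  the integral is therefore taken in the moving coordinate, the product with G is differentiated
  there, integrals over time and space are exchanged, and periodicity undoes the shift.\<close>

lemma weak_form:
  assumes G_per: "\<And>t. t \<in> {0..T} \<Longrightarrow> periodic_V (G t)"
    and G_cont: "\<And>\<sigma>. \<sigma> \<in> spins \<Longrightarrow> continuous_on ({0..T} \<times> UNIV) (\<lambda>(t, x). G t (x, \<sigma>))"
    and Gt_cont: "\<And>\<sigma>. \<sigma> \<in> spins \<Longrightarrow> continuous_on ({0..T} \<times> UNIV) (\<lambda>(t, x). Gt t (x, \<sigma>))"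
    and Gx_cont: "\<And>\<sigma>. \<sigma> \<in> spins \<Longrightarrow> continuous_on ({0..T} \<times> UNIV) (\<lambda>(t, x). Gx t (x, \<sigma>))"
    and Gt: "\<And>\<sigma> t x. \<sigma> \<in> spins \<Longrightarrow> t \<in> {0..T} \<Longrightarrow> ((\<lambda>s. G s (x, \<sigma>)) has_real_derivative Gt t (x, \<sigma>)) (at t within {0..T})"
    and Gx: "\<And>\<sigma> t x. \<sigma> \<in> spins \<Longrightarrow> t \<in> {0..T} \<Longrightarrow> ((\<lambda>y. G t (y, \<sigma>)) has_real_derivative Gx t (x, \<sigma>)) (at x)"
    and t: "t \<in> {0..T}"
  defines "D \<equiv> \<lambda>s. \<lambda>(x, \<sigma>). Gt s (x, \<sigma>) + of_int \<sigma> * Gx s (x, \<sigma>) + c \<sigma> (m s) * (G s (x, - \<sigma>) - G s (x, \<sigma>))"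
  shows "continuous_on {0..T} (\<lambda>s. pair_r s (D s))"
    and "pair_r t (G t) - pair_r 0 (G 0) = integral {0..t} (\<lambda>s. pair_r s (D s))"
proof -
  note cont_rules = r_cont[unfolded case_prod_unfold] G_cont[unfolded case_prod_unfold]
    Gt_cont[unfolded case_prod_unfold] Gx_cont[unfolded case_prod_unfold] cm_cont2
  define K where "K \<sigma> s x = (c (- \<sigma>) (m s) * r s (x, - \<sigma>) - c \<sigma> (m s) * r s (x, \<sigma>)) * G s (x, \<sigma>) +
    r s (x, \<sigma>) * (Gt s (x, \<sigma>) + of_int \<sigma> * Gx s (x, \<sigma>))" for \<sigma> :: int and s x
  have K_cont: "continuous_on ({0..T} \<times> UNIV) (\<lambda>(s, x). K \<sigma> s x)" if "\<sigma> \<in> spins" for \<sigma>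
    unfolding K_def case_prod_unfold using that by (intro continuous_intros cont_rules) auto
  have D_cont: "continuous_on ({0..T} \<times> UNIV) (\<lambda>(s, x). r s (x, \<sigma>) * D s (x, \<sigma>))" if "\<sigma> \<in> spins" for \<sigma>
    unfolding D_def case_prod_unfold fst_conv snd_conv using that by (intro continuous_intros cont_rules) auto
  show "continuous_on {0..T} (\<lambda>s. pair_r s (D s))"
    unfolding pair_r_def by (intro continuous_on_sum param_integral_cont D_cont)
  have slice: "f s integrable_on {0..1}" if "continuous_on ({0..T} \<times> UNIV) (\<lambda>(s, x). f s x)" "s \<in> {0..T}"
    for f :: "real \<Rightarrow> real \<Rightarrow> real" and s
    by (intro integrable_continuous_interval continuous_on_compose_strip[OF that(1)])
       (use that(2) in \<open>auto intro!: continuous_intros\<close>)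
  \<comment> \<open>Renaming \<sigma> to \<open>- \<sigma>\<close> in the gain terms moves the flip
    from the density to the test function; this requires the sum over both layers.\<close>
  have sum_eq: "(\<Sum>\<sigma>\<in>spins. integral {0..1} (K \<sigma> s)) = pair_r s (D s)" if s: "s \<in> {0..T}" for s
  proof -
    have c1: "continuous_on ({0..T} \<times> UNIV) (\<lambda>(s, x). c \<sigma> (m s) * r s (x, \<sigma>) * G s (x, \<tau>))"
      if "\<sigma> \<in> spins" "\<tau> \<in> spins" for \<sigma> \<tau>
      unfolding case_prod_unfold using that by (intro continuous_intros cont_rules)
    have c2: "continuous_on ({0..T} \<times> UNIV) (\<lambda>(s, x). r s (x, \<sigma>) * (Gt s (x, \<sigma>) + of_int \<sigma> * Gx s (x, \<sigma>)))"
      if "\<sigma> \<in> spins" for \<sigma>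
      unfolding case_prod_unfold using that by (intro continuous_intros cont_rules)
    let ?I = "\<lambda>\<sigma> \<tau>. integral {0..1} (\<lambda>x. c \<sigma> (m s) * r s (x, \<sigma>) * G s (x, \<tau>))"
    let ?J = "\<lambda>\<sigma>. integral {0..1} (\<lambda>x. r s (x, \<sigma>) * (Gt s (x, \<sigma>) + of_int \<sigma> * Gx s (x, \<sigma>)))"
    note ints = slice[OF c1 s] slice[OF c2 s]
    have "integral {0..1} (K \<sigma> s) = ?I (- \<sigma>) \<sigma> - ?I \<sigma> \<sigma> + ?J \<sigma>" if "\<sigma> \<in> spins" for \<sigma>
    proof -
      have "integral {0..1} (K \<sigma> s) = integral {0..1} (\<lambda>x. c (- \<sigma>) (m s) * r s (x, - \<sigma>) * G s (x, \<sigma>) -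
          c \<sigma> (m s) * r s (x, \<sigma>) * G s (x, \<sigma>) + r s (x, \<sigma>) * (Gt s (x, \<sigma>) + of_int \<sigma> * Gx s (x, \<sigma>)))"
        by (intro integral_cong) (simp add: K_def algebra_simps)
      then show ?thesis using that
        by (simp add: Henstock_Kurzweil_Integration.integral_add Henstock_Kurzweil_Integration.integral_diff ints integrable_diff)
    qed
    moreover have "integral {0..1} (\<lambda>x. r s (x, \<sigma>) * D s (x, \<sigma>)) = ?I \<sigma> (- \<sigma>) - ?I \<sigma> \<sigma> + ?J \<sigma>" if "\<sigma> \<in> spins" for \<sigma>
    proof -
      have "integral {0..1} (\<lambda>x. r s (x, \<sigma>) * D s (x, \<sigma>)) = integral {0..1} (\<lambda>x. c \<sigma> (m s) * r s (x, \<sigma>) * G s (x, - \<sigma>) -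
          c \<sigma> (m s) * r s (x, \<sigma>) * G s (x, \<sigma>) + r s (x, \<sigma>) * (Gt s (x, \<sigma>) + of_int \<sigma> * Gx s (x, \<sigma>)))"
        by (intro integral_cong) (simp add: D_def algebra_simps)
      then show ?thesis using that
        by (simp add: Henstock_Kurzweil_Integration.integral_add Henstock_Kurzweil_Integration.integral_diff ints integrable_diff)
    qed
    ultimately show ?thesis by (simp add: pair_r_def sum_spins)
  qed
  have layer: "integral {0..1} (\<lambda>x. r t (x, \<sigma>) * G t (x, \<sigma>)) - integral {0..1} (\<lambda>x. r 0 (x, \<sigma>) * G 0 (x, \<sigma>)) =
      integral {0..t} (\<lambda>s. integral {0..1} (K \<sigma> s))" if \<sigma>: "\<sigma> \<in> spins" for \<sigma>
  proof -
    let ?F = "\<lambda>s y. r s (y + of_int \<sigma> * s, \<sigma>) * G s (y + of_int \<sigma> * s, \<sigma>)"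
    have per: "r s (x + 1, \<tau>) = r s (x, \<tau>)" "G s (x + 1, \<tau>) = G s (x, \<tau>)" if "s \<in> {0..T}" "\<tau> \<in> spins" for s x \<tau>
      using r_CV[OF that(1)] G_per[OF that(1)] that(2) by (auto simp: C_V_def periodic_V_def)
    have shift_cont: "continuous_on ({0..T} \<times> UNIV) (\<lambda>p. f (fst p) (snd p + of_int \<sigma> * fst p))"
      if "continuous_on ({0..T} \<times> UNIV) (\<lambda>(s, x). f s x)" for f :: "real \<Rightarrow> real \<Rightarrow> real"
      by (rule continuous_on_compose_strip[OF that]) (auto intro!: continuous_intros)
    have F: "((\<lambda>s. K \<sigma> s (y + of_int \<sigma> * s)) has_integral (?F t y - ?F 0 y)) {0..t}" for y
    proof (rule fundamental_theorem_of_calculus)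
      fix s assume "s \<in> {0..t}"
      then have s: "s \<in> {0..T}" using t by auto
      have dG: "((\<lambda>s. G s (y + of_int \<sigma> * s, \<sigma>)) has_real_derivative
          Gt s (y + of_int \<sigma> * s, \<sigma>) + of_int \<sigma> * Gx s (y + of_int \<sigma> * s, \<sigma>)) (at s within {0..T})"
        by (rule characteristic_derivative[OF s Gt[OF \<sigma>] Gx[OF \<sigma>] Gx_cont[OF \<sigma>]])
      have "((\<lambda>s. ?F s y) has_real_derivative K \<sigma> s (y + of_int \<sigma> * s)) (at s within {0..T})"
        by (rule derivative_eq_intros r_char[OF s \<sigma>] dG refl)+ (simp add: K_def algebra_simps)
      then show "((\<lambda>s. ?F s y) has_vector_derivative K \<sigma> s (y + of_int \<sigma> * s)) (at s within {0..t})"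
        unfolding has_real_derivative_iff_has_vector_derivative
        by (rule has_vector_derivative_within_subset) (use t in auto)
    qed (use t in auto)
    have F_cont: "continuous_on ({0..T} \<times> UNIV) (\<lambda>(s, y). ?F s y)"
      using shift_cont[OF r_cont[OF \<sigma>]] shift_cont[OF G_cont[OF \<sigma>]]
      unfolding case_prod_unfold by (intro continuous_intros) auto
    have shiftF: "integral {0..1} (?F s) = integral {0..1} (\<lambda>x. r s (x, \<sigma>) * G s (x, \<sigma>))" if s: "s \<in> {0..T}" for s
    proof (rule integral_periodic_shift)
      have "continuous_on ({0..T} \<times> UNIV) (\<lambda>(s, x). r s (x, \<sigma>) * G s (x, \<sigma>))"
        unfolding case_prod_unfold using \<sigma> by (intro continuous_intros cont_rules)
      then show "continuous_on UNIV (\<lambda>x. r s (x, \<sigma>) * G s (x, \<sigma>))"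
        by (rule continuous_on_compose_strip) (use s in \<open>auto intro!: continuous_intros\<close>)
    qed (use per s \<sigma> in auto)
    have shiftK: "integral {0..1} (\<lambda>y. K \<sigma> s (y + of_int \<sigma> * s)) = integral {0..1} (K \<sigma> s)" if s: "s \<in> {0..T}" for s
    proof (rule integral_periodic_shift)
      show "continuous_on UNIV (K \<sigma> s)"
        by (rule continuous_on_compose_strip[OF K_cont[OF \<sigma>]]) (use s in \<open>auto intro!: continuous_intros\<close>)
      have K_as: "K \<sigma> s x = (c (- \<sigma>) (m s) * r s (x, - \<sigma>) - c \<sigma> (m s) * r s (x, \<sigma>)) * G s (x, \<sigma>) +
        r s (x, \<sigma>) * (Gt s (x, \<sigma>) + of_int \<sigma> * Gx s (x, \<sigma>))" for x by (simp add: K_def)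
      have "Gt s (x + 1, \<sigma>) = Gt s (x, \<sigma>)" for x
        using periodic_time_derivative[where g = "\<lambda>s x. G s (x, \<sigma>)" and g' = "\<lambda>x. Gt s (x, \<sigma>)", OF T_pos s]
          per \<sigma> Gt[OF \<sigma> s] by blast
      moreover have "Gx s (x + 1, \<sigma>) = Gx s (x, \<sigma>)" for x
        using periodic_derivative[where f = "\<lambda>x. G s (x, \<sigma>)" and f' = "\<lambda>x. Gx s (x, \<sigma>)"]
          per \<sigma> s Gx[OF \<sigma> s] by blast
      ultimately show "K \<sigma> s (x + 1) = K \<sigma> s x" for x
        unfolding K_as using per s \<sigma> by simp
    qed
    have "integral {0..1} (?F t) - integral {0..1} (?F 0) = integral {0..1} (\<lambda>y. ?F t y - ?F 0 y)"
      using t T_pos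
      by (intro Henstock_Kurzweil_Integration.integral_diff[symmetric] slice[OF F_cont]) auto
    also have "\<dots> = integral {0..1} (\<lambda>y. integral {0..t} (\<lambda>s. K \<sigma> s (y + of_int \<sigma> * s)))"
      using integral_unique[OF F] by simp
    also have "\<dots> = integral {0..t} (\<lambda>s. integral {0..1} (\<lambda>y. K \<sigma> s (y + of_int \<sigma> * s)))"
    proof -
      have "continuous_on (cbox (0, 0) (1, t)) (\<lambda>(y, s). K \<sigma> s (y + of_int \<sigma> * s))"
        unfolding case_prod_unfold
        by (rule continuous_on_compose_strip[OF K_cont[OF \<sigma>]])
           (use t in \<open>auto simp: cbox_Pair_eq intro!: continuous_intros\<close>)
      from integral_swap_continuous[OF this] show ?thesis by simp
    qed
    also have "\<dots> = integral {0..t} (\<lambda>s. integral {0..1} (K \<sigma> s))"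
      by (rule integral_cong) (use shiftK t in auto)
    finally show ?thesis using shiftF t T_pos by simp
  qed
  have "pair_r t (G t) - pair_r 0 (G 0) = (\<Sum>\<sigma>\<in>spins. integral {0..t} (\<lambda>s. integral {0..1} (K \<sigma> s)))"
    unfolding pair_r_def sum_subtractf[symmetric] by (intro sum.cong refl layer)
  also have "\<dots> = integral {0..t} (\<lambda>s. \<Sum>\<sigma>\<in>spins. integral {0..1} (K \<sigma> s))"
  proof (rule integral_sum[symmetric])
    fix \<sigma> assume "\<sigma> \<in> spins"
    from param_integral_cont[OF K_cont[OF this]] show "(\<lambda>s. integral {0..1} (K \<sigma> s)) integrable_on {0..t}"
      using t by (intro integrable_continuous_interval) (auto intro: continuous_on_subset)
  qed simp
  also have "\<dots> = integral {0..t} (\<lambda>s. pair_r s (D s))"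
    using sum_eq t by (intro integral_cong) auto
  finally show "pair_r t (G t) - pair_r 0 (G 0) = integral {0..t} (\<lambda>s. pair_r s (D s))" .
qed

end

section \<open>Weak solutions in Fourier modes and uniqueness\<close>

lemma mode_derivative:
  "((\<lambda>y. mode k \<sigma> b (y, \<tau>)) has_real_derivative 2 * pi * of_int k * mode k \<sigma> (b + pi / 2) (x, \<tau>)) (at x)"
proof -
  have "cos (2 * pi * of_int k * x + (b + pi / 2)) = - sin (2 * pi * of_int k * x + b)"
    using cos_add[of "2 * pi * of_int k * x + b" "pi / 2"] by (simp add: add.assoc)
  then show ?thesis
    unfolding mode_def by (auto intro!: derivative_eq_intros)
qed

lemma smooth_time_V_mode: "smooth_time_V T (\<lambda>_. mode k \<sigma> b)"
  unfolding smooth_time_V_def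
proof (intro conjI ballI)
  show "periodic_V (mode k \<sigma> b)" using mode_C_V by (simp add: C_V_def)
  fix \<tau> :: int
  \<comment> \<open>Each space derivative multiplies by \<open>2 * pi * k\<close> and advances the
    phase by \<open>pi / 2\<close>; all time derivatives vanish.\<close>
  let ?D = "\<lambda>i j (t :: real) x. of_bool (i = (0 :: nat)) * ((2 * pi * of_int k) ^ j * mode k \<sigma> (b + real j * (pi / 2)) (x, \<tau>))"
  show "\<exists>D. (\<forall>t\<in>{0..T}. \<forall>x. D 0 0 t x = mode k \<sigma> b (x, \<tau>)) \<and>
        (\<forall>i j. continuous_on ({0..T} \<times> UNIV) (\<lambda>(t, x). D i j t x)) \<and>
        (\<forall>i j. \<forall>t\<in>{0..T}. \<forall>x.
           ((\<lambda>s. D i j s x) has_real_derivative D (Suc i) j t x) (at t within {0..T}) \<and>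
           ((\<lambda>y. D i j t y) has_real_derivative D i (Suc j) t x) (at x))"
  proof (intro exI[of _ ?D] conjI ballI allI)
    fix i j :: nat and t x :: real
    show "continuous_on ({0..T} \<times> UNIV) (\<lambda>(t, x). ?D i j t x)"
      unfolding mode_def by (auto intro!: continuous_intros simp: case_prod_unfold)
    show "((\<lambda>s. ?D i j s x) has_real_derivative ?D (Suc i) j t x) (at t within {0..T})"
      by simp
    have "((\<lambda>y. ?D i j t y) has_real_derivative of_bool (i = 0) * ((2 * pi * of_int k) ^ j *
        (2 * pi * of_int k * mode k \<sigma> (b + real j * (pi / 2) + pi / 2) (x, \<tau>)))) (at x)"
      by (intro DERIV_cmult mode_derivative)
    moreover have "b + real (Suc j) * (pi / 2) = b + real j * (pi / 2) + pi / 2"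
      by (simp add: distrib_right)
    ultimately show "((\<lambda>y. ?D i j t y) has_real_derivative ?D i (Suc j) t x) (at x)"
      by (simp only: power_Suc mult_ac)
  qed simp
qed

text \<open>A right-continuous function is the limit of its values at grid points to the right, and
  these are measurable step functions of t.\<close>

lemma cadlag_measurable:
  fixes f :: "real \<Rightarrow> real"
  assumes "\<And>t. t \<in> {0..<T} \<Longrightarrow> (f \<longlongrightarrow> f t) (at_right t)" and T: "0 \<le> T"
  shows "f \<in> borel_measurable (restrict_space borel {0..T})"
proof -
  \<comment> \<open>Rounding down and adding 1 puts the sampled time strictly to the right of t for
    \<open>t < T\<close>; the minimum with T makes the formula exact at
    \<open>t = T\<close>.\<close>
  define g where "g n t = f (min T ((of_int \<lfloor>t * real (Suc n)\<rfloor> + 1) / real (Suc n)))" for n t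
  have "(\<lambda>t. g n t) \<in> borel_measurable borel" for n
    unfolding g_def
    by (rule measurable_compose[of "\<lambda>t. \<lfloor>t * real (Suc n)\<rfloor>" borel "count_space UNIV"
          "\<lambda>i. f (min T ((of_int i + 1) / real (Suc n)))"]) measurable
  then have m: "g n \<in> borel_measurable (restrict_space borel {0..T})" for n
    by (rule measurable_restrict_space1)
  have lim: "(\<lambda>n. g n t) \<longlonglongrightarrow> f t" if t: "t \<in> {0..T}" for t
  proof (cases "t = T")
    case True
    have "g n T = f T" for n
    proof -
      have "T * real (Suc n) \<le> of_int \<lfloor>T * real (Suc n)\<rfloor> + 1" by linarith
      then have "T \<le> (of_int \<lfloor>T * real (Suc n)\<rfloor> + 1) / real (Suc n)" by (simp add: le_divide_eq del: of_nat_Suc)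
      then show ?thesis by (simp add: g_def min_absorb1 del: of_nat_Suc)
    qed
    then show ?thesis using True by simp
  next
    case False
    let ?s = "\<lambda>n. min T ((of_int \<lfloor>t * real (Suc n)\<rfloor> + 1) / real (Suc n))"
    have gt: "t < ?s n" for n
    proof -
      have "t * real (Suc n) < of_int \<lfloor>t * real (Suc n)\<rfloor> + 1" by linarith
      then have "t < (of_int \<lfloor>t * real (Suc n)\<rfloor> + 1) / real (Suc n)" by (simp add: less_divide_eq del: of_nat_Suc)
      then show ?thesis using False t by simp
    qed
    have le: "?s n \<le> t + 1 / real (Suc n)" for n
    proof -
      have "of_int \<lfloor>t * real (Suc n)\<rfloor> \<le> t * real (Suc n)" by simp
      then have "(of_int \<lfloor>t * real (Suc n)\<rfloor> + 1) / real (Suc n) \<le> (t * real (Suc n) + 1) / real (Suc n)"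
        by (intro divide_right_mono) auto
      also have "\<dots> = t + 1 / real (Suc n)" by (simp add: add_divide_distrib del: of_nat_Suc)
      finally show ?thesis by linarith
    qed
    have "?s \<longlonglongrightarrow> t"
    proof (rule tendsto_sandwich[of "\<lambda>_. t" _ _ "\<lambda>n. t + 1 / real (Suc n)"])
      show "(\<lambda>n. t + 1 / real (Suc n)) \<longlonglongrightarrow> t"
        using tendsto_add[OF tendsto_const LIMSEQ_inverse_real_of_nat, of t] by (simp add: inverse_eq_divide)
      show "(\<lambda>n. t) \<longlonglongrightarrow> t" by simp
    qed (use less_imp_le[OF gt] le in \<open>simp_all del: of_nat_Suc\<close>)
    then have "filterlim ?s (at_right t) sequentially"
      by (rule tendsto_imp_filterlim_at_right) (use gt in auto)
    then have "(\<lambda>n. f (?s n)) \<longlonglongrightarrow> f t"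
      by (rule filterlim_compose[rotated]) (use assms(1) t False in auto)
    then show ?thesis by (simp add: g_def)
  qed
  show ?thesis
    by (rule borel_measurable_LIMSEQ_real[where u = g, OF _ m]) (use lim in \<open>auto simp: space_restrict_space\<close>)
qed

lemma spin_fun_C_V [simp]: "spin_fun \<in> C_V"
  unfolding C_V_def periodic_V_def spin_fun_def by auto

lemma sum_modes:
  "\<sigma> \<in> spins \<Longrightarrow> mode 0 1 0 (x, \<sigma>) + mode 0 (-1) 0 (x, \<sigma>) = 1"
  "\<sigma> \<in> spins \<Longrightarrow> mode 0 1 0 (x, \<sigma>) - mode 0 (-1) 0 (x, \<sigma>) = spin_fun (x, \<sigma>)"
  by (auto simp: mode_def spin_fun_def spins_def)

lemma pairing_one_modes: "pairing \<beta> (\<lambda>_. 1) = pairing \<beta> (mode 0 1 0) + pairing \<beta> (mode 0 (-1) 0)"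
  and pairing_spin_modes: "pairing \<beta> spin_fun = pairing \<beta> (mode 0 1 0) - pairing \<beta> (mode 0 (-1) 0)"
  unfolding pairing_add[OF mode_C_V mode_C_V, symmetric] pairing_diff[OF mode_C_V mode_C_V, symmetric]
  by (rule pairing_cong; simp add: sum_modes)+

text \<open>The spin is bounded by the mass, so it vanishes with the mass and the product identity
  includes mass zero. The last formula expresses the magnetization through pairings, that is,
  without the density.\<close>

lemma magnetization_density:
  assumes "has_density_V \<beta> q"
  shows "magnetization q \<in> {-1..1}"
    and "magnetization q * pairing \<beta> (\<lambda>_. 1) = pairing \<beta> spin_fun"
    and "magnetization q = (if pairing \<beta> (\<lambda>_. 1) = 0 then 0 else pairing \<beta> spin_fun / pairing \<beta> (\<lambda>_. 1))"
proof -
  have 1: "inner_V q (\<lambda>_. 1) = pairing \<beta> (\<lambda>_. 1)"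
    using has_density_pairing_inner[OF assms C_V_const] by simp
  have "inner_V q (\<lambda>(x, \<sigma>). of_bool (\<sigma> = 1) - of_bool (\<sigma> = -1)) = inner_V q spin_fun"
    unfolding inner_V_def
    by (intro sum.cong refl set_lebesgue_integral_cong) (auto simp: spin_fun_def spins_def)
  then have 2: "inner_V q (\<lambda>(x, \<sigma>). of_bool (\<sigma> = 1) - of_bool (\<sigma> = -1)) = pairing \<beta> spin_fun"
    using has_density_pairing_inner[OF assms spin_fun_C_V] by simp
  show eq: "magnetization q = (if pairing \<beta> (\<lambda>_. 1) = 0 then 0 else pairing \<beta> spin_fun / pairing \<beta> (\<lambda>_. 1))"
    unfolding magnetization_def 1 2 ..
  have *: "\<bar>pairing \<beta> spin_fun\<bar> \<le> 1 * pairing \<beta> (\<lambda>_. 1)"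
    by (rule abs_pairing_le[OF spin_fun_C_V]) (auto simp: spin_fun_def spins_def)
  show "magnetization q * pairing \<beta> (\<lambda>_. 1) = pairing \<beta> spin_fun"
  proof (cases "pairing \<beta> (\<lambda>_. 1) = 0")
    case True
    then have "pairing \<beta> spin_fun = 0" using * by simp
    then show ?thesis using True by simp
  qed (simp add: eq)
  show "magnetization q \<in> {-1..1}"
  proof (cases "pairing \<beta> (\<lambda>_. 1) = 0")
    case False
    then have "0 < pairing \<beta> (\<lambda>_. 1)" using pairing_one_nonneg[of \<beta>] by linarith
    then show ?thesis using * by (auto simp: eq abs_le_iff le_divide_eq divide_le_eq)
  qed (simp add: eq)
qed

text \<open>A mode that does not depend on time is an admissible test function, and its equation
  contains only modes of the same frequency.\<close>

lemma weak_equation_mode: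
  assumes T: "0 < T" and we: "weak_equation c T \<beta> q" and \<sigma>: "\<sigma> \<in> spins" and t: "t \<in> {0..T}"
  shows "pairing (\<beta> t) (mode k \<sigma> b) - pairing (\<beta> 0) (mode k \<sigma> b) =
    (LBINT s:{0..t}. 2 * pi * of_int (k * \<sigma>) * pairing (\<beta> s) (mode k \<sigma> (b + pi / 2)) +
      (c (- \<sigma>) (magnetization (q s)) * pairing (\<beta> s) (mode k (- \<sigma>) b) -
       c \<sigma> (magnetization (q s)) * pairing (\<beta> s) (mode k \<sigma> b)))"
proof -
  have D: "pairing (\<beta> s) (\<lambda>(x, \<tau>). vector_derivative (\<lambda>r. mode k \<sigma> b (x, \<tau>)) (at s within {0..T}) +
        of_int \<tau> * deriv (\<lambda>y. mode k \<sigma> b (y, \<tau>)) x +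
        c \<tau> (magnetization (q s)) * (mode k \<sigma> b (x, - \<tau>) - mode k \<sigma> b (x, \<tau>))) =
      2 * pi * of_int (k * \<sigma>) * pairing (\<beta> s) (mode k \<sigma> (b + pi / 2)) +
      (c (- \<sigma>) (magnetization (q s)) * pairing (\<beta> s) (mode k (- \<sigma>) b) -
       c \<sigma> (magnetization (q s)) * pairing (\<beta> s) (mode k \<sigma> b))"
    (is "pairing _ ?L = _") if s: "s \<in> {0..T}" for s
  proof -
    have vd: "vector_derivative (\<lambda>r. z) (at s within {0..T}) = 0" for z :: real
      by (rule vector_derivative_within_closed_interval[OF T s has_vector_derivative_const])
    have dd: "deriv (\<lambda>y. mode k \<sigma> b (y, \<tau>)) x = 2 * pi * of_int k * mode k \<sigma> (b + pi / 2) (x, \<tau>)" for x \<tau>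
      by (rule DERIV_imp_deriv[OF mode_derivative])
    have "pairing (\<beta> s) ?L = pairing (\<beta> s) (\<lambda>v. 2 * pi * of_int (k * \<sigma>) * mode k \<sigma> (b + pi / 2) v +
        (c (- \<sigma>) (magnetization (q s)) * mode k (- \<sigma>) b v - c \<sigma> (magnetization (q s)) * mode k \<sigma> b v))"
    proof (rule pairing_cong)
      fix x \<tau> assume "\<tau> \<in> spins"
      have "?L (x, \<tau>) = of_int \<tau> * (2 * pi * of_int k * mode k \<sigma> (b + pi / 2) (x, \<tau>)) +
          c \<tau> (magnetization (q s)) * (mode k \<sigma> b (x, - \<tau>) - mode k \<sigma> b (x, \<tau>))"
        by (simp add: vd dd)
      also have "\<dots> = 2 * pi * of_int (k * \<sigma>) * mode k \<sigma> (b + pi / 2) (x, \<tau>) +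
        (c (- \<sigma>) (magnetization (q s)) * mode k (- \<sigma>) b (x, \<tau>) - c \<sigma> (magnetization (q s)) * mode k \<sigma> b (x, \<tau>))"
        using \<sigma> \<open>\<tau> \<in> spins\<close> by (auto simp: mode_def spins_def)
      finally show "?L (x, \<tau>) = 2 * pi * of_int (k * \<sigma>) * mode k \<sigma> (b + pi / 2) (x, \<tau>) +
        (c (- \<sigma>) (magnetization (q s)) * mode k (- \<sigma>) b (x, \<tau>) - c \<sigma> (magnetization (q s)) * mode k \<sigma> b (x, \<tau>))" .
    qed
    also have "\<dots> = 2 * pi * of_int (k * \<sigma>) * pairing (\<beta> s) (mode k \<sigma> (b + pi / 2)) +
      (c (- \<sigma>) (magnetization (q s)) * pairing (\<beta> s) (mode k (- \<sigma>) b) -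
       c \<sigma> (magnetization (q s)) * pairing (\<beta> s) (mode k \<sigma> b))"
      by (simp only: pairing_add pairing_diff C_V_cmult C_V_diff mode_C_V pairing_cmult)
    finally show ?thesis .
  qed
  have "pairing (\<beta> t) (mode k \<sigma> b) - pairing (\<beta> 0) (mode k \<sigma> b) =
    (LBINT s:{0..t}. pairing (\<beta> s) (\<lambda>(x, \<tau>). vector_derivative (\<lambda>r. mode k \<sigma> b (x, \<tau>)) (at s within {0..T}) +
        of_int \<tau> * deriv (\<lambda>y. mode k \<sigma> b (y, \<tau>)) x +
        c \<tau> (magnetization (q s)) * (mode k \<sigma> b (x, - \<tau>) - mode k \<sigma> b (x, \<tau>))))"
    using we smooth_time_V_mode[of T k \<sigma> b] t unfolding weak_equation_def by fastforce
  also have "\<dots> = (LBINT s:{0..t}. 2 * pi * of_int (k * \<sigma>) * pairing (\<beta> s) (mode k \<sigma> (b + pi / 2)) +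
      (c (- \<sigma>) (magnetization (q s)) * pairing (\<beta> s) (mode k (- \<sigma>) b) -
       c \<sigma> (magnetization (q s)) * pairing (\<beta> s) (mode k \<sigma> b)))"
    using t by (intro set_lebesgue_integral_cong) (auto simp: D)
  finally show ?thesis .
qed

text \<open>For the supremum S of \<open>u t * exp (- l * t)\<close> the inequality yields
  \<open>S \<le> S / 2\<close>. This form suits solutions that are a priori only right-continuous in
  time.\<close>

lemma gronwall_zero:
  fixes u :: "real \<Rightarrow> real"
  assumes C: "0 \<le> C" and B: "\<And>t. t \<in> {0..T} \<Longrightarrow> 0 \<le> u t \<and> u t \<le> B"
    and le: "\<And>t. t \<in> {0..T} \<Longrightarrow> u t \<le> C * (LBINT s:{0..t}. u s)"
    and int: "\<And>t. t \<in> {0..T} \<Longrightarrow> set_integrable lborel {0..t} u" and t: "t \<in> {0..T}"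
  shows "u t = 0"
proof -
  define l where "l = 2 * C + 1"
  have l: "0 < l" "C / l \<le> 1 / 2" using C by (auto simp: l_def field_simps)
  define S where "S = (SUP t\<in>{0..T}. u t * exp (- l * t))"
  have le_B: "u t * exp (- l * t) \<le> B" if "t \<in> {0..T}" for t
    using mult_mono[of "u t" B "exp (- l * t)" 1] B[OF that] that l by auto
  have bdd: "bdd_above ((\<lambda>t. u t * exp (- l * t)) ` {0..T})" by (rule bdd_aboveI2[OF le_B])
  have up: "u t \<le> S * exp (l * t)" if "t \<in> {0..T}" for t
  proof -
    have "u t * exp (- l * t) \<le> S" unfolding S_def by (rule cSUP_upper[OF that bdd])
    then have "u t * exp (- l * t) * exp (l * t) \<le> S * exp (l * t)" by (rule mult_right_mono) simp
    then show ?thesis by (simp add: mult.assoc exp_add[symmetric])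
  qed
  have S0: "0 \<le> S"
    using cSUP_upper[OF t bdd] B[OF t] unfolding S_def by (auto intro: order.trans[rotated])
  have half: "u t * exp (- l * t) \<le> S / 2" if t: "t \<in> {0..T}" for t
  proof -
    have "((\<lambda>s. S * exp (l * s)) has_integral (S / l * exp (l * t) - S / l * exp (l * 0))) {0..t}"
      using t l by (intro fundamental_theorem_of_calculus)
        (auto intro!: derivative_eq_intros simp flip: has_real_derivative_iff_has_vector_derivative)
    note I = integral_unique[OF this]
    have ex: "set_integrable lborel {0..t} (\<lambda>s. S * exp (l * s))"
      by (rule borel_integrable_atLeastAtMost') (auto intro!: continuous_intros)
    have "u t \<le> C * (LBINT s:{0..t}. u s)" by (rule le[OF t])
    also have "\<dots> \<le> C * (LBINT s:{0..t}. S * exp (l * s))"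
      using C t up by (intro mult_left_mono set_integral_mono int ex) auto
    also have "(LBINT s:{0..t}. S * exp (l * s)) = S / l * exp (l * t) - S / l"
      unfolding set_borel_integral_eq_integral(2)[OF ex] I by simp
    also have "C * (S / l * exp (l * t) - S / l) \<le> C * (S / l * exp (l * t))"
      using C S0 l by (intro mult_left_mono) auto
    also have "\<dots> = (C / l) * (S * exp (l * t))" by simp
    also have "\<dots> \<le> (1 / 2) * (S * exp (l * t))" using l S0 by (intro mult_right_mono) auto
    finally have "u t * exp (- l * t) \<le> (1 / 2) * (S * exp (l * t)) * exp (- l * t)" by (rule mult_right_mono) simp
    also have "\<dots> = S / 2" by (simp add: mult.assoc exp_add[symmetric])
    finally show ?thesis .
  qed
  have "S \<le> S / 2" unfolding S_def by (rule cSUP_least) (use t half[unfolded S_def] in auto)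
  then have "S = 0" using S0 by simp
  then show ?thesis using up[OF t] B[OF t] by simp
qed

section \<open>Uniqueness of weak solutions\<close>

context bounded_rates
begin

definition weak_solution :: "real \<Rightarrow> (real \<Rightarrow> radon_V) \<Rightarrow> (real \<Rightarrow> real \<times> int \<Rightarrow> real) \<Rightarrow> bool" where
  "weak_solution T \<beta> q \<longleftrightarrow> \<beta> \<in> skorokhod_space T \<and> (\<forall>t\<in>{0..T}. has_density_V (\<beta> t) (q t)) \<and> weak_equation c T \<beta> q"

definition mode_drift :: "(real \<Rightarrow> radon_V) \<Rightarrow> (real \<Rightarrow> real \<times> int \<Rightarrow> real) \<Rightarrow> int \<Rightarrow> int \<Rightarrow> real \<Rightarrow> real \<Rightarrow> real" where
  "mode_drift \<beta> q k \<sigma> b s = 2 * pi * of_int (k * \<sigma>) * pairing (\<beta> s) (mode k \<sigma> (b + pi / 2)) +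
      (c (- \<sigma>) (magnetization (q s)) * pairing (\<beta> s) (mode k (- \<sigma>) b) -
       c \<sigma> (magnetization (q s)) * pairing (\<beta> s) (mode k \<sigma> b))"

text \<open>The densities \<open>q t\<close> come without any regularity in t. The magnetization,
  however, is a quotient of pairings with \<open>\<beta> t\<close>, and these are right-continuous
  in t.\<close>

lemma weak_solution_measurable:
  assumes T: "0 < T" and ws: "weak_solution T \<beta> q"
  shows "\<phi> \<in> C_V \<Longrightarrow> (\<lambda>t. pairing (\<beta> t) \<phi>) \<in> borel_measurable (restrict_space borel {0..T})"
    and "\<sigma> \<in> spins \<Longrightarrow> (\<lambda>t. c \<sigma> (magnetization (q t))) \<in> borel_measurable (restrict_space borel {0..T})"
proof -
  show m: "(\<lambda>t. pairing (\<beta> t) \<phi>) \<in> borel_measurable (restrict_space borel {0..T})" if \<phi>: "\<phi> \<in> C_V" for \<phi>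
  proof (rule cadlag_measurable)
    fix t assume "t \<in> {0..<T}"
    then have "(\<beta> \<longlongrightarrow> \<beta> t) (at_right t)"
      using ws by (auto simp: weak_solution_def skorokhod_space_def cadlag_def)
    then show "((\<lambda>t. pairing (\<beta> t) \<phi>) \<longlongrightarrow> pairing (\<beta> t) \<phi>) (at_right t)"
      using \<phi> by (simp add: tendsto_radon_V_iff)
  qed (use T in simp)
  assume \<sigma>: "\<sigma> \<in> spins"
  have "(\<lambda>t. if pairing (\<beta> t) (\<lambda>_. 1) = 0 then 0 else pairing (\<beta> t) spin_fun / pairing (\<beta> t) (\<lambda>_. 1))
      \<in> borel_measurable (restrict_space borel {0..T})"
    using m[OF C_V_const[of 1]] m[OF spin_fun_C_V] by measurable
  then have mag: "(\<lambda>t. magnetization (q t)) \<in> borel_measurable (restrict_space borel {0..T})"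
  proof (rule measurable_cong[THEN iffD1, rotated])
    fix w assume "w \<in> space (restrict_space borel {0..T})"
    then have "has_density_V (\<beta> w) (q w)" using ws by (auto simp: weak_solution_def space_restrict_space)
    from magnetization_density(3)[OF this]
    show "(if pairing (\<beta> w) (\<lambda>_. 1) = 0 then 0 else pairing (\<beta> w) spin_fun / pairing (\<beta> w) (\<lambda>_. 1)) =
        magnetization (q w)" by simp
  qed
  have "(\<lambda>t. magnetization (q t)) \<in> measurable (restrict_space borel {0..T}) (restrict_space borel {-1..1})"
    using mag ws magnetization_density(1)
    by (intro measurable_restrict_space2) (auto simp: weak_solution_def space_restrict_space)
  from measurable_compose[OF this borel_measurable_continuous_on_restrict[OF c_continuous[OF \<sigma>]]]
  show "(\<lambda>t. c \<sigma> (magnetization (q t))) \<in> borel_measurable (restrict_space borel {0..T})" .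
qed

lemma set_integrable_bounded:
  fixes f :: "real \<Rightarrow> real"
  assumes m: "f \<in> borel_measurable (restrict_space borel {0..T})" and t: "t \<in> {0..T}"
    and B: "\<And>s. s \<in> {0..t} \<Longrightarrow> \<bar>f s\<bar> \<le> B"
  shows "set_integrable lborel {0..t} f"
  unfolding set_integrable_def
proof (rule integrableI_bounded_set[where A = "{0..t}" and B = B])
  have "(\<lambda>s. indicator {0..T} s *\<^sub>R f s) \<in> borel_measurable borel"
    using m by (simp add: borel_measurable_restrict_space_iff)
  then have "(\<lambda>s. indicator {0..t} s * (indicator {0..T} s *\<^sub>R f s)) \<in> borel_measurable borel" by measurable
  moreover have "(\<lambda>s. indicator {0..t} s * (indicator {0..T} s *\<^sub>R f s)) = (\<lambda>s. indicator {0..t} s *\<^sub>R f s)"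
    using t by (auto simp: indicator_def)
  ultimately show "(\<lambda>s. indicator {0..t} s *\<^sub>R f s) \<in> borel_measurable lborel" by simp
qed (use B t in \<open>auto simp: emeasure_lborel_Icc_eq\<close>)

end

text \<open>The constant test function 1 is changed neither by transport nor by flips.\<close>

lemma weak_equation_mass:
  assumes T: "0 < T" and we: "weak_equation c T \<beta> q" and t: "t \<in> {0..T}"
  shows "pairing (\<beta> t) (\<lambda>_. 1) = pairing (\<beta> 0) (\<lambda>_. 1)"
proof -
  have "smooth_time_V T (\<lambda>_ _. 1)"
    unfolding smooth_time_V_def
  proof (intro conjI ballI)
    fix \<sigma> :: int
    show "\<exists>D. (\<forall>t\<in>{0..T}. \<forall>x. D 0 0 t x = 1) \<and>
        (\<forall>i j. continuous_on ({0..T} \<times> UNIV) (\<lambda>(t, x). D i j t x)) \<and>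
        (\<forall>i j. \<forall>t\<in>{0..T}. \<forall>x.
           ((\<lambda>s. D i j s x) has_real_derivative D (Suc i) j t x) (at t within {0..T}) \<and>
           ((\<lambda>y. D i j t y) has_real_derivative D i (Suc j) t x) (at x))"
      by (rule exI[of _ "\<lambda>i j (t :: real) (x :: real). of_bool (i = (0 :: nat) \<and> j = (0 :: nat)) :: real"]) (auto simp: case_prod_unfold)
  qed (simp add: periodic_V_def)
  then have "pairing (\<beta> t) (\<lambda>_. 1) - pairing (\<beta> 0) (\<lambda>_. 1) -
     (LBINT s:{0..t}. pairing (\<beta> s) (\<lambda>(x, \<sigma>).
        vector_derivative (\<lambda>r. 1) (at s within {0..T}) + of_int \<sigma> * deriv (\<lambda>y. 1) x +
        c \<sigma> (magnetization (q s)) * (1 - 1))) = 0"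
    using we t unfolding weak_equation_def by blast
  moreover have "pairing (\<beta> s) (\<lambda>(x, \<sigma>).
        vector_derivative (\<lambda>r. 1) (at s within {0..T}) + of_int \<sigma> * deriv (\<lambda>y. 1) x +
        c \<sigma> (magnetization (q s)) * (1 - 1)) = 0" if "s \<in> {0..T}" for s
  proof -
    have "vector_derivative (\<lambda>r. 1 :: real) (at s within {0..T}) = 0"
      by (rule vector_derivative_within_closed_interval[OF T that has_vector_derivative_const])
    then show ?thesis by (simp add: pairing_def case_prod_unfold)
  qed
  then have "(LBINT s:{0..t}. pairing (\<beta> s) (\<lambda>(x, \<sigma>).
        vector_derivative (\<lambda>r. 1) (at s within {0..T}) + of_int \<sigma> * deriv (\<lambda>y. 1) x +
        c \<sigma> (magnetization (q s)) * (1 - 1))) = (LBINT s:{0..t}. 0)"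
    using t by (intro set_lebesgue_integral_cong) auto
  ultimately show ?thesis by (simp add: set_lebesgue_integral_def)
qed

context bounded_rates
begin

lemma mode_drift_measurable:
  assumes "0 < T" "weak_solution T \<beta> q" "\<sigma> \<in> spins"
  shows "mode_drift \<beta> q k \<sigma> b \<in> borel_measurable (restrict_space borel {0..T})"
  using weak_solution_measurable(1)[OF assms(1,2) mode_C_V] weak_solution_measurable(2)[OF assms(1,2), of \<sigma>]
    weak_solution_measurable(2)[OF assms(1,2), of "- \<sigma>"] assms(3)
  unfolding mode_drift_def[abs_def] by simp

lemma abs_pairing_mode_le:
  assumes "0 < T" "weak_solution T \<beta> q" "t \<in> {0..T}"
  shows "\<bar>pairing (\<beta> t) (mode k \<sigma> b)\<bar> \<le> pairing (\<beta> 0) (\<lambda>_. 1)"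
  using abs_pairing_le[OF mode_C_V, of k \<sigma> b 1 "\<beta> t"] abs_mode_le weak_equation_mass[OF assms(1) _ assms(3), of c \<beta> q] assms(2)
  by (simp add: weak_solution_def)

text \<open>The densities are compared only through their magnetizations and the measures only
  through modes. Equality of the measures follows from \<open>radon_V_eqI\<close> at each time, and
  that of the paths from extensionality.\<close>

lemma weak_solution_unique:
  assumes T: "0 < T" and ws: "weak_solution T \<beta> q" and ws': "weak_solution T \<beta>' q'"
    and init: "\<beta> 0 = \<beta>' 0"
  shows "\<beta> = \<beta>'"
proof -
  define M where "M = pairing (\<beta> 0) (\<lambda>_. 1)"
  have M0: "0 \<le> M" by (simp add: M_def pairing_one_nonneg)
  have mass: "pairing (\<beta> t) (\<lambda>_. 1) = M" "pairing (\<beta>' t) (\<lambda>_. 1) = M" if "t \<in> {0..T}" for t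
    using weak_equation_mass[OF T _ that] ws ws' init by (auto simp: weak_solution_def M_def)
  have dens: "has_density_V (\<beta> t) (q t)" "has_density_V (\<beta>' t) (q' t)" if "t \<in> {0..T}" for t
    using ws ws' that by (auto simp: weak_solution_def)
  note mag = magnetization_density(1)[OF dens(1)] magnetization_density(1)[OF dens(2)]
  define \<Delta> where "\<Delta> k \<sigma> b t = pairing (\<beta> t) (mode k \<sigma> b) - pairing (\<beta>' t) (mode k \<sigma> b)" for k \<sigma> b t
  have "\<Delta> k \<sigma> b t = 0" if \<sigma>: "\<sigma> \<in> spins" and b: "b \<in> {0, pi / 2}" and t: "t \<in> {0..T}" for k \<sigma> b t
  proof -
    \<comment> \<open>The modes of frequency k, and those of frequency 0, whose difference is the
      spin that governs the rates. At frequency 0 the transport term vanishes, so phase 0 alone is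
      closed.\<close>
    define I where "I = ({k} \<times> spins \<times> {0, pi / 2}) \<union> ({0} \<times> spins \<times> {0 :: real})"
    define u where "u t = (\<Sum>(k, \<sigma>, b)\<in>I. \<bar>\<Delta> k \<sigma> b t\<bar>)" for t
    have fin: "finite I" by (simp add: I_def)
    have u_ge: "\<bar>\<Delta> k \<sigma> b t\<bar> \<le> u t" if "(k, \<sigma>, b) \<in> I" for k \<sigma> b t
      using member_le_sum[OF that, of "\<lambda>(k, \<sigma>, b). \<bar>\<Delta> k \<sigma> b t\<bar>"] fin by (auto simp: u_def)
    have u0: "0 \<le> u t" for t unfolding u_def by (auto intro: sum_nonneg)
    have \<Delta>_meas: "\<Delta> k \<sigma> b \<in> borel_measurable (restrict_space borel {0..T})" for k \<sigma> b
      unfolding \<Delta>_def[abs_def]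
      using weak_solution_measurable(1)[OF T ws mode_C_V] weak_solution_measurable(1)[OF T ws' mode_C_V] by simp
    have u_meas: "u \<in> borel_measurable (restrict_space borel {0..T})"
      unfolding u_def[abs_def] case_prod_unfold using \<Delta>_meas by simp
    have \<Delta>_le: "\<bar>\<Delta> k \<sigma> b t\<bar> \<le> 2 * M" if "t \<in> {0..T}" for k \<sigma> b t
      using abs_pairing_mode_le[OF T ws that, of k \<sigma> b] abs_pairing_mode_le[OF T ws' that, of k \<sigma> b] init
      by (simp add: \<Delta>_def M_def)
    have u_le: "u t \<le> real (card I) * (2 * M)" if "t \<in> {0..T}" for t
      unfolding u_def by (rule sum_bounded_above) (use \<Delta>_le[OF that] in auto)
    \<comment> \<open>Transport contributes \<open>2 * pi * \<bar>k'\<bar>\<close>, each of the two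
      flip terms \<open>2 * Lc + c_hi\<close>; the 2 in front of \<open>Lc\<close> is that of the
      bound on the spin difference below.\<close>
    define C1 where "C1 k' = 2 * pi * \<bar>of_int k'\<bar> + 4 * Lc + 2 * c_hi" for k' :: int
    have C1: "0 \<le> C1 k'" for k' using Lc_nonneg c_hi_nonneg by (simp add: C1_def)
    have drift: "\<bar>mode_drift \<beta> q k' \<sigma> b s - mode_drift \<beta>' q' k' \<sigma> b s\<bar> \<le> C1 k' * u s"
      if i: "(k', \<sigma>, b) \<in> I" and s: "s \<in> {0..T}" for k' \<sigma> b s
    proof -
      have \<sigma>: "\<sigma> \<in> spins" using i by (auto simp: I_def)
      \<comment> \<open>Multiplying by the common mass M avoids a division; the spin is a difference
        of two modes of frequency 0.\<close>
      have spin: "M * \<bar>magnetization (q s) - magnetization (q' s)\<bar> \<le> 2 * u s"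
      proof -
        have "M * (magnetization (q s) - magnetization (q' s)) = \<Delta> 0 1 0 s - \<Delta> 0 (-1) 0 s"
          using magnetization_density(2)[OF dens(1)[OF s]] magnetization_density(2)[OF dens(2)[OF s]] mass[OF s]
          by (simp add: pairing_spin_modes \<Delta>_def algebra_simps)
        then have "\<bar>M * (magnetization (q s) - magnetization (q' s))\<bar> \<le> \<bar>\<Delta> 0 1 0 s\<bar> + \<bar>\<Delta> 0 (-1) 0 s\<bar>"
          by simp
        also have "\<dots> \<le> u s + u s" by (intro add_mono u_ge) (auto simp: I_def)
        finally show ?thesis using M0 by (simp add: abs_mult)
      qed
      have prod: "\<bar>c \<tau> (magnetization (q s)) * pairing (\<beta> s) (mode k' \<tau>' b) -
          c \<tau> (magnetization (q' s)) * pairing (\<beta>' s) (mode k' \<tau>' b)\<bar> \<le> (2 * Lc + c_hi) * u s"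
        if \<tau>: "\<tau> \<in> spins" "\<tau>' \<in> spins" for \<tau> \<tau>'
      proof -
        have "\<bar>c \<tau> (magnetization (q s)) - c \<tau> (magnetization (q' s))\<bar> * \<bar>pairing (\<beta> s) (mode k' \<tau>' b)\<bar>
            \<le> (Lc * \<bar>magnetization (q s) - magnetization (q' s)\<bar>) * M"
          using c_lip[OF \<tau>(1) mag(1)[OF s] mag(2)[OF s]] abs_pairing_mode_le[OF T ws s] Lc_nonneg
          unfolding M_def by (intro mult_mono) auto
        also have "\<dots> = Lc * (M * \<bar>magnetization (q s) - magnetization (q' s)\<bar>)" by simp
        also have "\<dots> \<le> Lc * (2 * u s)" using spin Lc_nonneg by (intro mult_left_mono)
        finally have 1: "\<bar>(c \<tau> (magnetization (q s)) - c \<tau> (magnetization (q' s))) * pairing (\<beta> s) (mode k' \<tau>' b)\<bar> \<le> 2 * Lc * u s"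
          by (simp add: abs_mult)
        have "(k', \<tau>', b) \<in> I" using i \<tau> by (auto simp: I_def)
        then have 2: "\<bar>c \<tau> (magnetization (q' s)) * \<Delta> k' \<tau>' b s\<bar> \<le> c_hi * u s"
          unfolding abs_mult using abs_c_le[OF \<tau>(1) mag(2)[OF s]] u_ge[of k' \<tau>' b s] c_hi_nonneg by (intro mult_mono) auto
        have "c \<tau> (magnetization (q s)) * pairing (\<beta> s) (mode k' \<tau>' b) -
          c \<tau> (magnetization (q' s)) * pairing (\<beta>' s) (mode k' \<tau>' b) =
          (c \<tau> (magnetization (q s)) - c \<tau> (magnetization (q' s))) * pairing (\<beta> s) (mode k' \<tau>' b) +
          c \<tau> (magnetization (q' s)) * \<Delta> k' \<tau>' b s"
          by (simp add: \<Delta>_def algebra_simps)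
        then show ?thesis using 1 2 by (simp add: distrib_right)
      qed
      have transport: "\<bar>2 * pi * of_int (k' * \<sigma>) * \<Delta> k' \<sigma> (b + pi / 2) s\<bar> \<le> 2 * pi * \<bar>of_int k'\<bar> * u s"
      proof (cases "k' = 0")
        case False
        have "\<bar>\<Delta> k' \<sigma> (b + pi / 2) s\<bar> \<le> u s"
        proof (cases "b = 0")
          case True
          then show ?thesis using i False by (intro u_ge) (auto simp: I_def)
        next
          case b: False
          then have b: "b + pi / 2 = pi" using i by (auto simp: I_def)
          have "pairing \<gamma> (mode k' \<sigma> pi) = - pairing \<gamma> (mode k' \<sigma> 0)" for \<gamma>
          proof -
            have "pairing \<gamma> (mode k' \<sigma> pi) = pairing \<gamma> (\<lambda>v. (-1) * mode k' \<sigma> 0 v)"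
              by (rule pairing_cong) (simp add: mode_def)
            then show ?thesis unfolding pairing_cmult by simp
          qed
          then have "\<Delta> k' \<sigma> pi s = - \<Delta> k' \<sigma> 0 s" by (simp add: \<Delta>_def)
          moreover have "(k', \<sigma>, 0) \<in> I" using i False by (auto simp: I_def)
          ultimately show ?thesis using u_ge[of k' \<sigma> 0 s] by (simp add: b)
        qed
        moreover have "\<bar>2 * pi * real_of_int (k' * \<sigma>)\<bar> = 2 * pi * \<bar>of_int k'\<bar>"
          using \<sigma> by (auto simp: abs_mult spins_def)
        ultimately show ?thesis unfolding abs_mult[of "2 * pi * of_int (k' * \<sigma>)"]
          by (intro mult_mono) auto
      qed (use u0 in simp)
      have "mode_drift \<beta> q k' \<sigma> b s - mode_drift \<beta>' q' k' \<sigma> b s =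
        0 + 2 * pi * of_int (k' * \<sigma>) * \<Delta> k' \<sigma> (b + pi / 2) s +
        (c (- \<sigma>) (magnetization (q s)) * pairing (\<beta> s) (mode k' (- \<sigma>) b) -
          c (- \<sigma>) (magnetization (q' s)) * pairing (\<beta>' s) (mode k' (- \<sigma>) b)) -
        (c \<sigma> (magnetization (q s)) * pairing (\<beta> s) (mode k' \<sigma> b) -
          c \<sigma> (magnetization (q' s)) * pairing (\<beta>' s) (mode k' \<sigma> b))"
        by (simp add: mode_drift_def \<Delta>_def algebra_simps)
      then have "\<bar>mode_drift \<beta> q k' \<sigma> b s - mode_drift \<beta>' q' k' \<sigma> b s\<bar> \<le>
          0 + 2 * pi * \<bar>of_int k'\<bar> * u s + (2 * Lc + c_hi) * u s + (2 * Lc + c_hi) * u s"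
        by (rule abs_combine4) (use transport prod \<sigma> in auto)
      also have "\<dots> = C1 k' * u s" by (simp add: C1_def algebra_simps)
      finally show ?thesis .
    qed
    have C1_le: "C1 k' \<le> C1 k" if "(k', \<sigma>, b) \<in> I" for k' \<sigma> b
      using that by (auto simp: I_def C1_def)
    have u_int: "set_integrable lborel {0..t} u" if "t \<in> {0..T}" for t
      by (rule set_integrable_bounded[OF u_meas that, of "real (card I) * (2 * M)"]) (use u_le u0 that in auto)
    have drift_bound: "\<bar>mode_drift \<gamma> p k' \<sigma> b s\<bar> \<le> (2 * pi * \<bar>of_int (k' * \<sigma>)\<bar> + 2 * c_hi) * pairing (\<gamma> 0) (\<lambda>_. 1)"
      if w: "weak_solution T \<gamma> p" and \<sigma>: "\<sigma> \<in> spins" and s: "s \<in> {0..T}" for \<gamma> p k' \<sigma> b s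
    proof -
      have p: "\<bar>pairing (\<gamma> s) (mode k' \<tau> b')\<bar> \<le> pairing (\<gamma> 0) (\<lambda>_. 1)" for \<tau> b' by (rule abs_pairing_mode_le[OF T w s])
      have mg: "magnetization (p s) \<in> {-1..1}" using w s by (intro magnetization_density(1)[of "\<gamma> s"]) (auto simp: weak_solution_def)
      have cp: "\<bar>c \<tau> (magnetization (p s)) * pairing (\<gamma> s) (mode k' \<tau> b)\<bar> \<le> c_hi * pairing (\<gamma> 0) (\<lambda>_. 1)" if "\<tau> \<in> spins" for \<tau>
        unfolding abs_mult using abs_c_le[OF that mg] p c_hi_nonneg by (intro mult_mono) auto
      have tp: "\<bar>2 * pi * of_int (k' * \<sigma>) * pairing (\<gamma> s) (mode k' \<sigma> (b + pi / 2))\<bar> \<le> 2 * pi * \<bar>of_int (k' * \<sigma>)\<bar> * pairing (\<gamma> 0) (\<lambda>_. 1)"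
        unfolding abs_mult[of "2 * pi * of_int (k' * \<sigma>)"] using p by (intro mult_mono) (auto simp: abs_mult)
      have "mode_drift \<gamma> p k' \<sigma> b s = 0 + 2 * pi * of_int (k' * \<sigma>) * pairing (\<gamma> s) (mode k' \<sigma> (b + pi / 2)) +
          c (- \<sigma>) (magnetization (p s)) * pairing (\<gamma> s) (mode k' (- \<sigma>) b) -
          c \<sigma> (magnetization (p s)) * pairing (\<gamma> s) (mode k' \<sigma> b)"
        by (simp add: mode_drift_def)
      then have "\<bar>mode_drift \<gamma> p k' \<sigma> b s\<bar> \<le> 0 + 2 * pi * \<bar>of_int (k' * \<sigma>)\<bar> * pairing (\<gamma> 0) (\<lambda>_. 1) +
          c_hi * pairing (\<gamma> 0) (\<lambda>_. 1) + c_hi * pairing (\<gamma> 0) (\<lambda>_. 1)"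
        by (rule abs_combine4) (use tp cp \<sigma> in auto)
      then show ?thesis by (simp add: algebra_simps)
    qed
    have drift_int: "set_integrable lborel {0..t} (mode_drift \<gamma> p k' \<sigma> b)"
      if "weak_solution T \<gamma> p" "\<sigma> \<in> spins" "t \<in> {0..T}" for \<gamma> p k' \<sigma> b t
      by (rule set_integrable_bounded[where B = "(2 * pi * \<bar>of_int (k' * \<sigma>)\<bar> + 2 * c_hi) * pairing (\<gamma> 0) (\<lambda>_. 1)",
            OF mode_drift_measurable[OF T that(1,2)] that(3)])
         (use drift_bound[OF that(1,2)] that(3) in auto)
    have step: "\<bar>\<Delta> k' \<sigma> b t\<bar> \<le> C1 k * (LBINT s:{0..t}. u s)" if i: "(k', \<sigma>, b) \<in> I" and t: "t \<in> {0..T}" for k' \<sigma> b t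
    proof -
      have \<sigma>: "\<sigma> \<in> spins" using i by (auto simp: I_def)
      note di = drift_int[OF ws \<sigma> t, of k' b] drift_int[OF ws' \<sigma> t, of k' b]
      have "\<Delta> k' \<sigma> b t = (LBINT s:{0..t}. mode_drift \<beta> q k' \<sigma> b s) - (LBINT s:{0..t}. mode_drift \<beta>' q' k' \<sigma> b s)"
        using weak_equation_mode[OF T _ \<sigma> t, of c \<beta> q k' b] weak_equation_mode[OF T _ \<sigma> t, of c \<beta>' q' k' b] ws ws' init
        by (simp add: weak_solution_def mode_drift_def \<Delta>_def)
      also have "\<dots> = (LBINT s:{0..t}. mode_drift \<beta> q k' \<sigma> b s - mode_drift \<beta>' q' k' \<sigma> b s)"
        using set_integral_diff(2)[OF di] by simp
      finally have "\<bar>\<Delta> k' \<sigma> b t\<bar> = \<bar>LBINT s:{0..t}. mode_drift \<beta> q k' \<sigma> b s - mode_drift \<beta>' q' k' \<sigma> b s\<bar>" by simp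
      also have "\<dots> \<le> (LBINT s:{0..t}. \<bar>mode_drift \<beta> q k' \<sigma> b s - mode_drift \<beta>' q' k' \<sigma> b s\<bar>)"
        using set_integral_norm_bound[OF set_integral_diff(1)[OF di]] by simp
      also have "\<dots> \<le> (LBINT s:{0..t}. C1 k * u s)"
      proof (rule set_integral_mono)
        show "set_integrable lborel {0..t} (\<lambda>s. \<bar>mode_drift \<beta> q k' \<sigma> b s - mode_drift \<beta>' q' k' \<sigma> b s\<bar>)"
          by (rule set_integrable_abs[OF set_integral_diff(1)[OF di]])
        show "set_integrable lborel {0..t} (\<lambda>s. C1 k * u s)" using u_int[OF t] by simp
        fix s assume "s \<in> {0..t}"
        then have "s \<in> {0..T}" using t by auto
        then show "\<bar>mode_drift \<beta> q k' \<sigma> b s - mode_drift \<beta>' q' k' \<sigma> b s\<bar> \<le> C1 k * u s"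
          using drift[OF i] mult_right_mono[OF C1_le[OF i] u0[of s]] by force
      qed
      also have "\<dots> = C1 k * (LBINT s:{0..t}. u s)" by simp
      finally show ?thesis .
    qed
    have "u t = 0"
    proof (rule gronwall_zero[of "real (card I) * C1 k" T u "real (card I) * (2 * M)", OF _ _ _ u_int t])
      show "0 \<le> real (card I) * C1 k" using C1 by simp
      fix t assume t: "t \<in> {0..T}"
      show "0 \<le> u t \<and> u t \<le> real (card I) * (2 * M)" using u0 u_le[OF t] by simp
      have "u t \<le> real (card I) * (C1 k * (LBINT s:{0..t}. u s))"
        unfolding u_def[of t] by (rule sum_bounded_above) (use step[OF _ t] in auto)
      then show "u t \<le> real (card I) * C1 k * (LBINT s:{0..t}. u s)" by simp
    qed
    moreover have "(k, \<sigma>, b) \<in> I" using \<sigma> b by (auto simp: I_def)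
    ultimately show "\<Delta> k \<sigma> b t = 0" using u_ge[of k \<sigma> b t] by simp
  qed
  note modes = this
  have "pairing (\<beta> t) \<phi> = pairing (\<beta>' t) \<phi>" if \<phi>: "\<phi> \<in> C_V" and t: "t \<in> {0..T}" for \<phi> t
    using \<phi>
  proof (induction rule: C_V_induct)
    case (mode k \<sigma> b)
    then show ?case using modes[of \<sigma> b t k] t by (simp add: \<Delta>_def)
  next
    case (add f g)
    then show ?case by (simp add: pairing_add)
  next
    case (scale f r)
    then show ?case by (simp add: pairing_cmult)
  next
    case (limit f)
    have "\<bar>pairing (\<beta> t) f - pairing (\<beta>' t) f\<bar> \<le> 0 + e" if "0 < e" for e
    proof -
      \<comment> \<open>The two approximation errors are each at most M times this number; the
        summand 1 covers \<open>M = 0\<close>.\<close>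
      have "0 < e / (2 * M + 1)" using that M0 by simp
      from limit(2)[OF this] obtain g where g: "g \<in> C_V" "pairing (\<beta> t) g = pairing (\<beta>' t) g"
        "\<And>x \<sigma>. \<sigma> \<in> spins \<Longrightarrow> \<bar>f (x, \<sigma>) - g (x, \<sigma>)\<bar> \<le> e / (2 * M + 1)" by blast
      have d: "\<bar>pairing \<gamma> f - pairing \<gamma> g\<bar> \<le> e / (2 * M + 1) * pairing \<gamma> (\<lambda>_. 1)" for \<gamma>
        using abs_pairing_le[OF C_V_diff[OF limit(1) g(1)], of "e / (2 * M + 1)" \<gamma>] g(3) pairing_diff[OF limit(1) g(1)]
        by simp
      have "\<bar>pairing (\<beta> t) f - pairing (\<beta>' t) f\<bar> \<le> e / (2 * M + 1) * M + e / (2 * M + 1) * M"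
      proof -
        define K where "K = e / (2 * M + 1) * M"
        have "\<bar>pairing (\<beta> t) f - pairing (\<beta> t) g\<bar> \<le> K" "\<bar>pairing (\<beta>' t) f - pairing (\<beta>' t) g\<bar> \<le> K"
          using d[of "\<beta> t", unfolded mass(1)[OF t]] d[of "\<beta>' t", unfolded mass(2)[OF t]] by (simp_all add: K_def)
        then show ?thesis unfolding K_def[symmetric] using g(2) by linarith
      qed
      also have "\<dots> = e * (2 * M / (2 * M + 1))" by (simp add: field_simps)
      also have "\<dots> \<le> e * 1" using that M0 by (intro mult_left_mono) auto
      finally show ?thesis by simp
    qed
    then have "\<bar>pairing (\<beta> t) f - pairing (\<beta>' t) f\<bar> \<le> 0" by (rule field_le_epsilon)
    then show ?case by simp
  qed
  then have "\<beta> t = \<beta>' t" if "t \<in> {0..T}" for t using that by (intro radon_V_eqI) auto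
  then show ?thesis
    using ws ws' by (intro extensionalityI[of \<beta> "{0..T}" \<beta>']) (auto simp: weak_solution_def skorokhod_space_def)
qed

end

section \<open>The initial law\<close>

lemma nat_pmf_expectation:
  fixes p :: "nat pmf"
  assumes "(\<lambda>n. pmf p n * f n) sums s" "summable (\<lambda>n. \<bar>pmf p n * f n\<bar>)"
  shows "integrable (measure_pmf p) f" "measure_pmf.expectation p f = s"
proof -
  have int: "integrable (count_space UNIV) (\<lambda>n. pmf p n * f n)"
    using assms(2) by (simp add: integrable_count_space_nat_iff)
  show "integrable (measure_pmf p) f"
    unfolding measure_pmf_eq_density using int by (subst integrable_density) auto
  have "measure_pmf.expectation p f = (\<integral>n. pmf p n * f n \<partial>count_space UNIV)"
    unfolding measure_pmf_eq_density by (subst integral_density) auto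
  also have "\<dots> = s"
    using integral_count_space_nat[OF int] assms(1) by (simp add: sums_iff)
  finally show "measure_pmf.expectation p f = s" .
qed

text \<open>The identity \<open>n * p n = r * p (n - 1)\<close> for the weights shifts the index and
  reduces each moment to lower ones.\<close>

lemma poisson_sums:
  fixes r :: real
  assumes "0 < r"
  shows "(\<lambda>n. pmf (poisson_pmf r) n * 1) sums 1"
    and "(\<lambda>n. pmf (poisson_pmf r) n * real n) sums r"
    and "(\<lambda>n. pmf (poisson_pmf r) n * (real n)\<^sup>2) sums (r\<^sup>2 + r)"
proof -
  let ?p = "\<lambda>n. r ^ n / fact n * exp (- r)"
  have e: "?p sums 1"
  proof -
    have "(\<lambda>n. r ^ n /\<^sub>R fact n * exp (- r)) sums (exp r * exp (- r))"
      by (intro sums_mult2 exp_converges)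
    then show ?thesis by (simp add: exp_minus divide_inverse mult.commute)
  qed
  then show "(\<lambda>n. pmf (poisson_pmf r) n * 1) sums 1" using assms by simp
  have shift: "?p (Suc n) * real (Suc n) = r * ?p n" for n
  proof -
    have "fact (Suc n) = real (Suc n) * fact n" by (simp only: fact_Suc of_nat_mult of_nat_id)
    then show ?thesis by (simp del: fact_Suc of_nat_Suc)
  qed
  have "(\<lambda>n. ?p (Suc n) * real (Suc n)) sums (r * 1)"
    unfolding shift by (rule sums_mult[OF e])
  then have "(\<lambda>n. ?p n * real n) sums (r * 1 + ?p 0 * real 0)" by (rule sums_Suc)
  then have m1: "(\<lambda>n. ?p n * real n) sums r" by simp
  then show "(\<lambda>n. pmf (poisson_pmf r) n * real n) sums r" using assms by simp
  have "(\<lambda>n. r * (?p n * real n + ?p n)) sums (r * (r + 1))"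
    by (intro sums_mult sums_add m1 e)
  moreover have "?p (Suc n) * (real (Suc n))\<^sup>2 = r * (?p n * real n + ?p n)" for n
  proof -
    have "?p (Suc n) * (real (Suc n))\<^sup>2 = (?p (Suc n) * real (Suc n)) * real (Suc n)"
      by (simp only: power2_eq_square mult.assoc)
    also have "\<dots> = r * ?p n * real (Suc n)" by (simp only: shift)
    also have "r * q * real (Suc n) = r * (q * real n + q)" for q by (simp add: algebra_simps)
    finally show ?thesis .
  qed
  ultimately have "(\<lambda>n. ?p (Suc n) * (real (Suc n))\<^sup>2) sums (r * (r + 1))" by simp
  then have "(\<lambda>n. ?p n * (real n)\<^sup>2) sums (r * (r + 1) + ?p 0 * (real 0)\<^sup>2)" by (rule sums_Suc)
  then have "(\<lambda>n. ?p n * (real n)\<^sup>2) sums (r\<^sup>2 + r)" by (simp add: power2_eq_square algebra_simps)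
  then show "(\<lambda>n. pmf (poisson_pmf r) n * (real n)\<^sup>2) sums (r\<^sup>2 + r)" using assms by simp
qed

lemma pois_moments:
  assumes "0 \<le> r"
  shows "integrable (pois r) real" "measure_pmf.expectation (pois r) real = r"
    "integrable (pois r) (\<lambda>n. (real n)\<^sup>2)" "measure_pmf.expectation (pois r) (\<lambda>n. (real n)\<^sup>2) = r\<^sup>2 + r"
proof -
  have "integrable (pois r) real \<and> measure_pmf.expectation (pois r) real = r \<and>
    integrable (pois r) (\<lambda>n. (real n)\<^sup>2) \<and> measure_pmf.expectation (pois r) (\<lambda>n. (real n)\<^sup>2) = r\<^sup>2 + r"
  proof (cases "r = 0")
    case True
    then show ?thesis by (auto simp: pois_def intro!: integrable_measure_pmf_finite)
  next
    case False
    then have r: "0 < r" using assms by simp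
    note s = poisson_sums[OF r]
    have "integrable (poisson_pmf r) real" "measure_pmf.expectation (poisson_pmf r) real = r"
      by (rule nat_pmf_expectation[OF s(2)]; use s(2) in \<open>auto simp: sums_iff\<close>)+
    moreover have "integrable (poisson_pmf r) (\<lambda>n. (real n)\<^sup>2)" "measure_pmf.expectation (poisson_pmf r) (\<lambda>n. (real n)\<^sup>2) = r\<^sup>2 + r"
      by (rule nat_pmf_expectation[OF s(3)]; use s(3) in \<open>auto simp: sums_iff\<close>)+
    ultimately show ?thesis using False by (simp add: pois_def)
  qed
  then show "integrable (pois r) real" "measure_pmf.expectation (pois r) real = r"
    "integrable (pois r) (\<lambda>n. (real n)\<^sup>2)" "measure_pmf.expectation (pois r) (\<lambda>n. (real n)\<^sup>2) = r\<^sup>2 + r"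
    by auto
qed

text \<open>The expectation of a product over all coordinates factorizes. Factors equal to 1 at the
  other coordinates give the moments of one and of two coordinates, hence the covariances; of the
  double sum for the square of Y only the diagonal remains.\<close>

lemma Pi_pmf_variance:
  fixes w m s :: "'a \<Rightarrow> real" and p :: "'a \<Rightarrow> nat pmf"
  assumes A: "finite A"
    and p: "\<And>v. v \<in> A \<Longrightarrow> integrable (p v) real"
      "\<And>v. v \<in> A \<Longrightarrow> measure_pmf.expectation (p v) real = m v"
      "\<And>v. v \<in> A \<Longrightarrow> integrable (p v) (\<lambda>n. (real n)\<^sup>2)"
      "\<And>v. v \<in> A \<Longrightarrow> measure_pmf.expectation (p v) (\<lambda>n. (real n)\<^sup>2) = (m v)\<^sup>2 + s v"
  defines "Y \<equiv> \<lambda>x. \<Sum>v\<in>A. w v * (real (x v) - m v)"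
  shows "integrable (Pi_pmf A 0 p) Y" "measure_pmf.expectation (Pi_pmf A 0 p) Y = 0"
    "integrable (Pi_pmf A 0 p) (\<lambda>x. (Y x)\<^sup>2)"
    "measure_pmf.expectation (Pi_pmf A 0 p) (\<lambda>x. (Y x)\<^sup>2) = (\<Sum>v\<in>A. (w v)\<^sup>2 * s v)"
proof -
  let ?Q = "Pi_pmf A 0 p"
  have one: "integrable ?Q (\<lambda>x. real (x u))" "measure_pmf.expectation ?Q (\<lambda>x. real (x u)) = m u"
    if u: "u \<in> A" for u
  proof -
    let ?h = "\<lambda>v n. if v = u then real n else 1"
    have eq: "(\<Prod>v\<in>A. ?h v (x v)) = real (x u)" for x :: "'a \<Rightarrow> nat"
      using u A by simp
    have int: "integrable (p v) (?h v)" if "v \<in> A" for v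
      using p(1)[OF that] by (cases "v = u") auto
    show "integrable ?Q (\<lambda>x. real (x u))"
      using integrable_prod_Pi_pmf[where p = p and dflt = 0, OF A int] by (simp add: eq)
    have "(\<Prod>v\<in>A. measure_pmf.expectation (p v) (?h v)) = (\<Prod>v\<in>A. if v = u then m v else 1)"
      by (intro prod.cong) (auto simp: p(2))
    then have "(\<Prod>v\<in>A. measure_pmf.expectation (p v) (?h v)) = m u" using A u by simp
    then show "measure_pmf.expectation ?Q (\<lambda>x. real (x u)) = m u"
      using expectation_prod_Pi_pmf[where p = p and dflt = 0 and f = ?h, OF A int] by (simp add: eq)
  qed
  have two: "integrable ?Q (\<lambda>x. real (x u) * real (x v)) \<and>
      measure_pmf.expectation ?Q (\<lambda>x. real (x u) * real (x v)) = m u * m v + (if v = u then s u else 0)"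
    if u: "u \<in> A" and v: "v \<in> A" for u v
  proof (cases "u = v")
    case True
    let ?h = "\<lambda>a n. if a = u then (real n)\<^sup>2 else 1"
    have eq: "(\<Prod>a\<in>A. ?h a (x a)) = real (x u) * real (x u)" for x :: "'a \<Rightarrow> nat"
      using u A by (simp add: power2_eq_square)
    have int: "integrable (p a) (?h a)" if "a \<in> A" for a using p(3)[OF that] by (cases "a = u") auto
    have "(\<Prod>a\<in>A. measure_pmf.expectation (p a) (?h a)) = (\<Prod>a\<in>A. if a = u then (m a)\<^sup>2 + s a else 1)"
      by (intro prod.cong) (auto simp: p(4))
    then have e: "(\<Prod>a\<in>A. measure_pmf.expectation (p a) (?h a)) = m u * m u + s u"
      using A u by (simp add: power2_eq_square)
    show ?thesis
      using integrable_prod_Pi_pmf[where p = p and dflt = 0, OF A int]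
        expectation_prod_Pi_pmf[where p = p and dflt = 0 and f = ?h, OF A int] True
      unfolding eq e by simp
  next
    case False
    let ?h = "\<lambda>a n. (if a = u then real n else 1) * (if a = v then real n else 1)"
    have eq: "(\<Prod>a\<in>A. ?h a (x a)) = real (x u) * real (x v)" for x :: "'a \<Rightarrow> nat"
      using u v A by (simp add: prod.distrib)
    have int: "integrable (p a) (?h a)" if "a \<in> A" for a
      using p(1)[OF that] False by (cases "a = u"; cases "a = v") auto
    have "(\<Prod>a\<in>A. measure_pmf.expectation (p a) (?h a)) =
        (\<Prod>a\<in>A. (if a = u then m a else 1) * (if a = v then m a else 1))"
      using False by (intro prod.cong) (auto simp: p(2))
    then have e: "(\<Prod>a\<in>A. measure_pmf.expectation (p a) (?h a)) = m u * m v"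
      using A u v by (simp add: prod.distrib)
    show ?thesis
      using integrable_prod_Pi_pmf[where p = p and dflt = 0, OF A int]
        expectation_prod_Pi_pmf[where p = p and dflt = 0 and f = ?h, OF A int] False
      unfolding eq e by simp
  qed
  have centered: "integrable ?Q (\<lambda>x. (real (x u) - m u) * (real (x v) - m v)) \<and>
      measure_pmf.expectation ?Q (\<lambda>x. (real (x u) - m u) * (real (x v) - m v)) = (if v = u then s u else 0)"
    if u: "u \<in> A" and v: "v \<in> A" for u v
  proof -
    have eq: "(\<lambda>x. (real (x u) - m u) * (real (x v) - m v)) =
        (\<lambda>x. real (x u) * real (x v) - m u * real (x v) - m v * real (x u) + m u * m v)"
      by (rule ext) (simp add: algebra_simps)
    show ?thesis unfolding eq using two[OF u v] one[OF u] one[OF v] by (simp add: algebra_simps)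
  qed
  show "integrable ?Q Y" unfolding Y_def using one
    by (intro Bochner_Integration.integrable_sum integrable_mult_right Bochner_Integration.integrable_diff) auto
  show "measure_pmf.expectation ?Q Y = 0" unfolding Y_def using one by (simp add: Bochner_Integration.integral_sum)
  have sq: "(Y x)\<^sup>2 = (\<Sum>u\<in>A. \<Sum>v\<in>A. (w u * w v) * ((real (x u) - m u) * (real (x v) - m v)))" for x
    unfolding Y_def power2_eq_square sum_product by (intro sum.cong refl) (simp add: mult_ac)
  show "integrable ?Q (\<lambda>x. (Y x)\<^sup>2)"
    unfolding sq using centered by (intro Bochner_Integration.integrable_sum integrable_mult_right) auto
  have "measure_pmf.expectation ?Q (\<lambda>x. (Y x)\<^sup>2) =
      (\<Sum>u\<in>A. measure_pmf.expectation ?Q (\<lambda>x. \<Sum>v\<in>A. (w u * w v) * ((real (x u) - m u) * (real (x v) - m v))))"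
    unfolding sq using centered
    by (intro Bochner_Integration.integral_sum Bochner_Integration.integrable_sum integrable_mult_right) auto
  also have "\<dots> = (\<Sum>u\<in>A. \<Sum>v\<in>A. measure_pmf.expectation ?Q (\<lambda>x. (w u * w v) * ((real (x u) - m u) * (real (x v) - m v))))"
    using centered by (intro sum.cong refl Bochner_Integration.integral_sum integrable_mult_right) auto
  also have "\<dots> = (\<Sum>u\<in>A. \<Sum>v\<in>A. if v = u then (w u)\<^sup>2 * s u else 0)"
    using centered by (intro sum.cong refl) (auto simp: power2_eq_square)
  also have "\<dots> = (\<Sum>v\<in>A. (w v)\<^sup>2 * s v)"
    using A by simp
  finally show "measure_pmf.expectation ?Q (\<lambda>x. (Y x)\<^sup>2) = (\<Sum>v\<in>A. (w v)\<^sup>2 * s v)" .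
qed

section \<open>Law of large numbers for the initial configuration\<close>

lemma riemann_sum_tendsto:
  fixes f :: "real \<Rightarrow> real"
  assumes f: "continuous_on {0..1} f"
  shows "(\<lambda>N. (\<Sum>x\<in>{0..<int N}. f (of_int x / real N)) / real N) \<longlonglongrightarrow> integral {0..1} f"
proof (rule tendstoI)
  fix e :: real assume e: "0 < e"
  have "uniformly_continuous_on {0..1} f" by (rule compact_uniformly_continuous[OF f]) simp
  then obtain d where d: "0 < d" "\<And>x y. x \<in> {0..1} \<Longrightarrow> y \<in> {0..1} \<Longrightarrow> dist y x < d \<Longrightarrow> dist (f y) (f x) < e / 2"
    unfolding uniformly_continuous_on_def using half_gt_zero[OF e] by metis
  have int: "f integrable_on {a..b}" if "0 \<le> a" "b \<le> 1" for a b
    using f that by (intro integrable_continuous_interval) (auto intro: continuous_on_subset)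
  have "\<forall>\<^sub>F N in sequentially. 1 / real N < d \<and> 0 < N"
  proof -
    have "(\<lambda>n. 1 / real n) \<longlonglongrightarrow> 0" by (rule lim_const_over_n)
    then have "\<forall>\<^sub>F n in sequentially. 1 / real n < d" by (rule order_tendstoD(2)) (use d in simp)
    then show ?thesis using eventually_gt_at_top[of "0 :: nat"] by eventually_elim simp
  qed
  then show "\<forall>\<^sub>F N in sequentially. dist ((\<Sum>x\<in>{0..<int N}. f (of_int x / real N)) / real N) (integral {0..1} f) < e"
  proof eventually_elim
    case (elim N)
    then have N: "0 < real N" by simp
    \<comment> \<open>Cell by cell: each cell of length \<open>1 / N\<close> adds an error of at
      most \<open>e / 2 / N\<close>, by uniform continuity.\<close>
    have "n \<le> N \<Longrightarrow> \<bar>(\<Sum>i<n. f (real i / real N)) / real N - integral {0..real n / real N} f\<bar> \<le> real n * (e / 2 / real N)" for n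
    proof (induction n)
      case (Suc n)
      let ?a = "real n / real N" and ?b = "real (Suc n) / real N"
      have ab: "0 \<le> ?a" "?a \<le> ?b" "?b \<le> 1" "?b - ?a = 1 / real N"
        using N Suc.prems by (auto simp: divide_right_mono field_simps)
      have "norm (integral {?a..?b} (\<lambda>x. f ?a - f x)) \<le> (e / 2) * (?b - ?a)"
      proof (rule integral_bound)
        have "continuous_on {?a..?b} f" by (rule continuous_on_subset[OF f]) (use ab in auto)
        then show "continuous_on {?a..?b} (\<lambda>x. f ?a - f x)" by (intro continuous_intros)
        fix x assume x: "x \<in> {?a..?b}"
        have x': "?a \<le> x" "x \<le> ?b" using x by (simp_all only: atLeastAtMost_iff)
        have "x \<in> {0..1}" "?a \<in> {0..1}"
          unfolding atLeastAtMost_iff using x' ab by (blast intro: order.trans)+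
        moreover have "dist ?a x < d"
          using x' ab(4) elim unfolding dist_real_def by linarith
        ultimately have "dist (f ?a) (f x) < e / 2" by (rule d(2))
        then show "norm (f ?a - f x) \<le> e / 2" by (simp add: dist_real_def)
      qed (use ab in auto)
      also have "integral {?a..?b} (\<lambda>x. f ?a - f x) = f ?a / real N - integral {?a..?b} f"
        using int[of ?a ?b] ab by (subst Henstock_Kurzweil_Integration.integral_diff) (auto simp: ab(4))
      finally have 1: "\<bar>f ?a / real N - integral {?a..?b} f\<bar> \<le> e / 2 / real N" unfolding ab(4) by simp
      have 2: "integral {0..?b} f = integral {0..?a} f + integral {?a..?b} f"
        using ab int by (intro Henstock_Kurzweil_Integration.integral_combine[symmetric]) auto
      have "(\<Sum>i<Suc n. f (real i / real N)) / real N - integral {0..?b} f =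
          ((\<Sum>i<n. f (real i / real N)) / real N - integral {0..?a} f) + (f ?a / real N - integral {?a..?b} f)"
      proof -
        have "(\<Sum>i<Suc n. f (real i / real N)) / real N = (\<Sum>i<n. f (real i / real N)) / real N + f ?a / real N"
          by (simp add: add_divide_distrib)
        then show ?thesis using 2 by linarith
      qed
      then have "\<bar>(\<Sum>i<Suc n. f (real i / real N)) / real N - integral {0..?b} f\<bar> \<le> real n * (e / 2 / real N) + e / 2 / real N"
        using Suc 1 by linarith
      also have "\<dots> = real (Suc n) * (e / 2 / real N)"
        by (simp only: of_nat_Suc distrib_right mult_1_left add.commute)
      finally show ?case .
    qed simp
    from this[of N] have "\<bar>(\<Sum>i<N. f (real i / real N)) / real N - integral {0..1} f\<bar> \<le> e / 2"
      using N by simp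
    moreover have "(\<Sum>x\<in>{0..<int N}. f (of_int x / real N)) = (\<Sum>i<N. f (real i / real N))"
      by (rule sum.reindex_bij_witness[where i = int and j = nat]) auto
    ultimately show ?case using e by (simp add: dist_real_def)
  qed
qed

text \<open>The mean square splits into variance and squared bias. Independent Poisson variables
  with weights of order 1/N have a variance of order 1/N in total, and the bias is the error of a
  Riemann sum.\<close>

lemma lin_stat_initial_tendsto:
  assumes \<rho>: "\<rho> \<in> C_V" "\<And>x \<sigma>. \<sigma> \<in> spins \<Longrightarrow> 0 \<le> \<rho> (x, \<sigma>)" and \<phi>: "\<phi> \<in> C_V"
    and z: "z = (\<Sum>\<sigma>\<in>spins. integral {0..1} (\<lambda>x. \<rho> (x, \<sigma>) * \<phi> (x, \<sigma>)))"
  shows "(\<lambda>N. \<integral>\<^sup>+x. ennreal ((lin_stat N \<phi> x - z)\<^sup>2) \<partial>initial_law N \<rho>) \<longlonglongrightarrow> 0"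
proof -
  obtain B where B: "0 < B" "\<And>x \<sigma>. \<sigma> \<in> spins \<Longrightarrow> \<bar>\<phi> (x, \<sigma>)\<bar> \<le> B" using C_V_bounded[OF \<phi>] by metis
  obtain R where R: "0 < R" "\<And>x \<sigma>. \<sigma> \<in> spins \<Longrightarrow> \<bar>\<rho> (x, \<sigma>)\<bar> \<le> R" using C_V_bounded[OF \<rho>(1)] by metis
  define mean where "mean N = (\<Sum>\<sigma>\<in>spins. (\<Sum>x\<in>{0..<int N}. \<rho> (of_int x / real N, \<sigma>) * \<phi> (of_int x / real N, \<sigma>)) / real N)" for N
  have mean_lim: "mean \<longlonglongrightarrow> z"
    unfolding mean_def z
  proof (intro tendsto_sum riemann_sum_tendsto)
    fix \<sigma> assume "\<sigma> \<in> spins"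
    then have "continuous_on UNIV (\<lambda>x. \<rho> (x, \<sigma>) * \<phi> (x, \<sigma>))"
      using \<rho> \<phi> by (intro continuous_intros) (auto simp: C_V_def)
    then show "continuous_on {0..1} (\<lambda>x. \<rho> (x, \<sigma>) * \<phi> (x, \<sigma>))" by (rule continuous_on_subset) simp
  qed
  have bound: "(\<integral>\<^sup>+x. ennreal ((lin_stat N \<phi> x - z)\<^sup>2) \<partial>initial_law N \<rho>) \<le> ennreal (2 * B\<^sup>2 * R / real N + (mean N - z)\<^sup>2)"
    if N: "0 < N" for N
  proof -
    let ?m = "\<lambda>v :: int \<times> int. \<rho> (of_int (fst v) / real N, snd v)"
    let ?w = "\<lambda>v :: int \<times> int. \<phi> (of_int (fst v) / real N, snd v) / real N"
    let ?Y = "\<lambda>x. \<Sum>v\<in>sites N. ?w v * (real (x v) - ?m v)"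
    have m0: "0 \<le> ?m v" "?m v \<le> R" if "v \<in> sites N" for v
      using \<rho>(2)[of "snd v"] R(2)[of "snd v" "of_int (fst v) / real N"] that by (auto simp: sites_def abs_le_iff)
    note pm = pois_moments[OF m0(1)]
    note V = Pi_pmf_variance[where w = ?w and s = ?m, OF finite_sites pm]
    have law: "initial_law N \<rho> = Pi_pmf (sites N) 0 (\<lambda>v. pois (?m v))"
      by (simp add: initial_law_def case_prod_unfold)
    have mean_eq: "(\<Sum>v\<in>sites N. ?w v * ?m v) = mean N"
      unfolding mean_def sites_def sum_divide_distrib
      by (subst sum.swap) (simp add: sum.cartesian_product case_prod_unfold mult.commute)
    have Y: "lin_stat N \<phi> x - z = ?Y x + (mean N - z)" for x
      by (simp add: lin_stat_def case_prod_unfold mean_eq[symmetric] right_diff_distrib sum_subtractf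
          sum_divide_distrib mult.commute)
    have sq: "(lin_stat N \<phi> x - z)\<^sup>2 = (?Y x)\<^sup>2 + (2 * (mean N - z)) * ?Y x + (mean N - z)\<^sup>2" for x
      unfolding Y by (simp add: power2_eq_square algebra_simps)
    have int: "integrable (initial_law N \<rho>) (\<lambda>x. (lin_stat N \<phi> x - z)\<^sup>2)"
      unfolding sq law using V by simp
    have "(\<integral>\<^sup>+x. ennreal ((lin_stat N \<phi> x - z)\<^sup>2) \<partial>initial_law N \<rho>) =
        ennreal (measure_pmf.expectation (initial_law N \<rho>) (\<lambda>x. (lin_stat N \<phi> x - z)\<^sup>2))"
      by (rule nn_integral_eq_integral[OF int]) simp
    also have "measure_pmf.expectation (initial_law N \<rho>) (\<lambda>x. (lin_stat N \<phi> x - z)\<^sup>2) =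
        (\<Sum>v\<in>sites N. (?w v)\<^sup>2 * ?m v) + (mean N - z)\<^sup>2"
      unfolding sq law using V by simp
    also have "(\<Sum>v\<in>sites N. (?w v)\<^sup>2 * ?m v) \<le> (\<Sum>v\<in>sites N. (B / real N)\<^sup>2 * R)"
    proof (intro sum_mono mult_mono m0)
      fix v assume "v \<in> sites N"
      then have "\<bar>\<phi> (of_int (fst v) / real N, snd v)\<bar> \<le> B" by (intro B(2)) (auto simp: sites_def)
      from power_mono[OF this, of 2] show "(?w v)\<^sup>2 \<le> (B / real N)\<^sup>2"
        by (simp add: power_divide divide_right_mono)
    qed auto
    also have "(\<Sum>v\<in>sites N. (B / real N)\<^sup>2 * R) = 2 * B\<^sup>2 * R / real N"
      using N by (simp add: sites_def spins_def power2_eq_square)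
    finally show ?thesis by (simp add: ennreal_leI)
  qed
  have lim: "(\<lambda>N. ennreal (2 * B\<^sup>2 * R / real N + (mean N - z)\<^sup>2)) \<longlonglongrightarrow> ennreal 0"
  proof (rule tendsto_ennrealI)
    have "(\<lambda>N. 2 * B\<^sup>2 * R / real N + (mean N - z)\<^sup>2) \<longlonglongrightarrow> 0 + (z - z)\<^sup>2"
      by (intro tendsto_intros mean_lim lim_const_over_n)
    then show "(\<lambda>N. 2 * B\<^sup>2 * R / real N + (mean N - z)\<^sup>2) \<longlonglongrightarrow> 0" by simp
  qed
  show ?thesis
  proof (rule tendsto_sandwich[of "\<lambda>_. 0" _ _ "\<lambda>N. ennreal (2 * B\<^sup>2 * R / real N + (mean N - z)\<^sup>2)"])
    show "\<forall>\<^sub>F N in sequentially. (\<integral>\<^sup>+x. ennreal ((lin_stat N \<phi> x - z)\<^sup>2) \<partial>initial_law N \<rho>)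
        \<le> ennreal (2 * B\<^sup>2 * R / real N + (mean N - z)\<^sup>2)"
      using eventually_gt_at_top[of "0 :: nat"] by eventually_elim (rule bound)
  qed (use lim in auto)
qed

section \<open>The limiting trajectory\<close>

lemma finite_measure_leb_V: "finite_measure leb_V"
proof (rule finite_measureI)
  interpret B: sigma_finite_measure "count_space spins"
    by (rule sigma_finite_measure_count_space_finite) simp
  have "emeasure leb_V ({0..<1} \<times> spins) = emeasure (restrict_space lborel {0..<1 :: real}) {0..<1} * emeasure (count_space spins) spins"
    unfolding leb_V_def by (rule B.emeasure_pair_measure_Times) (auto simp: sets_restrict_space_iff)
  also have "\<dots> < \<infinity>"
    by (simp add: emeasure_restrict_space ennreal_mult_less_top of_nat_less_top less_top[symmetric])
  finally show "emeasure leb_V (space leb_V) \<noteq> \<infinity>" by (simp add: space_leb_V)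
qed

definition dens :: "(real \<times> int \<Rightarrow> real) \<Rightarrow> radon_V" where
  "dens r = Abs_radon_V (density leb_V (\<lambda>v. ennreal (r v)))"

lemma has_density_dens:
  assumes r: "r \<in> C_V" "\<And>x \<sigma>. \<sigma> \<in> spins \<Longrightarrow> 0 \<le> r (x, \<sigma>)"
  shows "has_density_V (dens r) r"
proof -
  obtain B where B: "0 < B" "\<And>x \<sigma>. \<sigma> \<in> spins \<Longrightarrow> \<bar>r (x, \<sigma>)\<bar> \<le> B" using C_V_bounded[OF r(1)] by metis
  have m: "r \<in> borel_measurable leb_V"
    using C_V_measurable[OF r(1)] measurable_cong_sets[OF sets_leb_V refl] by blast
  have "finite_measure (density leb_V (\<lambda>v. ennreal (r v)))"
  proof (rule finite_measureI)
    have "emeasure (density leb_V (\<lambda>v. ennreal (r v))) (space leb_V) = (\<integral>\<^sup>+v. ennreal (r v) * indicator (space leb_V) v \<partial>leb_V)"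
      by (rule emeasure_density) (use m in auto)
    also have "\<dots> \<le> (\<integral>\<^sup>+v. ennreal B \<partial>leb_V)"
    proof (rule nn_integral_mono)
      fix v assume "v \<in> space leb_V"
      then show "ennreal (r v) * indicator (space leb_V) v \<le> ennreal B"
        using B(2)[of "snd v" "fst v"] by (auto simp: space_leb_V abs_le_iff intro!: ennreal_leI)
    qed
    also have "\<dots> < \<infinity>"
      using finite_measure.emeasure_finite[OF finite_measure_leb_V, of "space leb_V"]
      by (auto simp: ennreal_mult_less_top less_top)
    finally show "emeasure (density leb_V (\<lambda>v. ennreal (r v))) (space (density leb_V (\<lambda>v. ennreal (r v)))) \<noteq> \<infinity>"
      by simp
  qed
  then have "Rep_radon_V (dens r) = density leb_V (\<lambda>v. ennreal (r v))"
    unfolding dens_def by (intro Abs_radon_V_inverse) (simp add: sets_leb_V)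
  then show ?thesis
    using C_V_measurable[OF r(1)] r(2) by (auto simp: has_density_V_def space_V_space)
qed

lemma has_density_unique:
  assumes "has_density_V \<beta> r" "has_density_V \<gamma> q" "\<And>v. v \<in> space V_space \<Longrightarrow> r v = q v"
  shows "\<beta> = \<gamma>"
proof -
  have "density leb_V (\<lambda>v. ennreal (r v)) = density leb_V (\<lambda>v. ennreal (q v))"
    using assms measurable_cong_sets[OF sets_leb_V refl, of borel]
    by (intro density_cong) (auto simp: has_density_V_def space_V_space space_leb_V intro!: AE_I2)
  then show ?thesis using assms(1,2) by (simp add: has_density_V_def flip: Rep_radon_V_inject)
qed

lemma continuous_lborel_integral:
  fixes f :: "real \<Rightarrow> real"
  assumes "continuous_on {a..b} f"
  shows "(LBINT x:{a..b}. f x) = integral {a..b} f"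
  by (rule set_borel_integral_eq_integral(2)[OF borel_integrable_atLeastAtMost'[OF assms]])

text \<open>The assumption ties m to r at time 0 in product form, so that an initial profile of mass
  0 is included.\<close>

locale limit_trajectory = limit_density +
  assumes spin0: "pair_r 0 spin_fun = m 0 * pair_r 0 (\<lambda>_. 1)"
begin

definition alpha :: "real \<Rightarrow> radon_V" where
  "alpha = (\<lambda>t\<in>{0..T}. dens (r t))"

lemma alpha_density: "t \<in> {0..T} \<Longrightarrow> has_density_V (alpha t) (r t)"
  unfolding alpha_def using has_density_dens[OF r_CV r_nonneg] by simp

lemma pairing_alpha:
  assumes t: "t \<in> {0..T}" and \<phi>: "\<phi> \<in> C_V"
  shows "pairing (alpha t) \<phi> = pair_r t \<phi>"
  unfolding has_density_pairing[OF alpha_density[OF t] \<phi>] pair_r_def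
proof (intro sum.cong refl continuous_lborel_integral)
  fix \<sigma> assume "\<sigma> \<in> spins"
  then have "continuous_on UNIV (\<lambda>x. r t (x, \<sigma>) * \<phi> (x, \<sigma>))"
    using r_CV[OF t] \<phi> by (intro continuous_intros) (auto simp: C_V_def)
  then show "continuous_on {0..1} (\<lambda>x. r t (x, \<sigma>) * \<phi> (x, \<sigma>))" by (rule continuous_on_subset) simp
qed

lemma C_V_slice_cont:
  assumes "\<phi> \<in> C_V" "\<sigma> \<in> spins"
  shows "continuous_on ({0..T} \<times> UNIV) (\<lambda>(t :: real, x). \<phi> (x, \<sigma>))"
proof -
  have "continuous_on UNIV (\<lambda>x. \<phi> (x, \<sigma>))" using assms by (simp add: C_V_def)
  from continuous_on_compose2[OF this, of "{0..T} \<times> UNIV" snd] show ?thesis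
    by (simp add: case_prod_unfold continuous_on_snd)
qed

lemma pairing_alpha_cont:
  assumes \<phi>: "\<phi> \<in> C_V"
  shows "continuous_on {0..T} (\<lambda>t. pairing (alpha t) \<phi>)"
proof -
  have "continuous_on {0..T} (\<lambda>t. pair_r t \<phi>)"
    unfolding pair_r_def
  proof (intro continuous_on_sum param_integral_cont)
    fix \<sigma> assume \<sigma>: "\<sigma> \<in> spins"
    show "continuous_on ({0..T} \<times> UNIV) (\<lambda>(t, x). r t (x, \<sigma>) * \<phi> (x, \<sigma>))"
      using continuous_on_mult[OF r_cont[OF \<sigma>] C_V_slice_cont[OF \<phi> \<sigma>]] by (simp add: case_prod_unfold)
  qed
  then show ?thesis by (rule continuous_on_eq) (simp add: pairing_alpha[OF _ \<phi>])
qed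

lemma alpha_skorokhod: "alpha \<in> skorokhod_space T"
  unfolding skorokhod_space_def cadlag_def
proof (intro CollectI IntI conjI ballI)
  show "alpha \<in> extensional {0..T}" by (simp add: alpha_def)
  fix t assume t: "t \<in> {0..<T}"
  show "(alpha \<longlongrightarrow> alpha t) (at_right t)"
    unfolding tendsto_radon_V_iff
  proof
    fix \<phi> assume "\<phi> \<in> C_V"
    then have "((\<lambda>s. pairing (alpha s) \<phi>) \<longlongrightarrow> pairing (alpha t) \<phi>) (at t within {0..T})"
      using pairing_alpha_cont t by (auto simp: continuous_on)
    moreover have "at_right t = at t within {t..T}" using t by (simp add: at_within_Icc_at_right)
    ultimately show "((\<lambda>s. pairing (alpha s) \<phi>) \<longlongrightarrow> pairing (alpha t) \<phi>) (at_right t)"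
      using t by (simp only:) (erule tendsto_within_subset, auto)
  qed
next
  fix t assume t: "t \<in> {0<..T}"
  have "(alpha \<longlongrightarrow> alpha t) (at_left t)"
    unfolding tendsto_radon_V_iff
  proof
    fix \<phi> assume "\<phi> \<in> C_V"
    then have "((\<lambda>s. pairing (alpha s) \<phi>) \<longlongrightarrow> pairing (alpha t) \<phi>) (at t within {0..T})"
      using pairing_alpha_cont t by (auto simp: continuous_on)
    moreover have "at_left t = at t within {0..t}" using t by (simp add: at_within_Icc_at_left)
    ultimately show "((\<lambda>s. pairing (alpha s) \<phi>) \<longlongrightarrow> pairing (alpha t) \<phi>) (at_left t)"
      using t by (simp only:) (erule tendsto_within_subset, auto)
  qed
  then show "\<exists>l. (alpha \<longlongrightarrow> l) (at_left t)" by blast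
qed

lemma mass_const:
  assumes t: "t \<in> {0..T}"
  shows "pairing (alpha t) (\<lambda>_. 1) = pairing (alpha 0) (\<lambda>_. 1)"
proof -
  have "pair_r t (\<lambda>_. 1) - pair_r 0 (\<lambda>_. 1) = integral {0..t} (\<lambda>s. pair_r s
      (\<lambda>(x, \<sigma>). (\<lambda>_. 0 :: real) (x, \<sigma>) + of_int \<sigma> * (\<lambda>_. 0 :: real) (x, \<sigma>) + c \<sigma> (m s) * (1 - 1)))"
    by (rule weak_form(2)[where G = "\<lambda>_ _. 1" and Gt = "\<lambda>_ _. 0" and Gx = "\<lambda>_ _. 0"])
       (use t in \<open>auto simp: periodic_V_def case_prod_unfold\<close>)
  also have "\<dots> = 0" by (simp add: pair_r_def case_prod_unfold)
  finally show ?thesis using t T_pos by (simp add: pairing_alpha)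
qed

text \<open>The deterministic magnetization solves the linear equation satisfied by the magnetization of the density.\<close>

lemma spin_eq:
  assumes t: "t \<in> {0..T}"
  shows "pairing (alpha t) spin_fun = m t * pairing (alpha t) (\<lambda>_. 1)"
proof -
  define M where "M = pairing (alpha 0) (\<lambda>_. 1)"
  define S where "S t = pairing (alpha t) spin_fun" for t
  have D: "pair_r s (\<lambda>(x, \<sigma>). (\<lambda>_. 0 :: real) (x, \<sigma>) + of_int \<sigma> * (\<lambda>_. 0 :: real) (x, \<sigma>) +
    c \<sigma> (m s) * (spin_fun (x, - \<sigma>) - spin_fun (x, \<sigma>))) = c (-1) (m s) * (M - S s) - c 1 (m s) * (M + S s)"
    (is "pair_r s ?D = _") if s: "s \<in> {0..T}" for s
  proof -
    \<comment> \<open>A flip out of spin 1 changes the spin by -2, a flip out of spin -1 by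
      2.\<close>
    let ?D' = "\<lambda>v. (- 2 * c 1 (m s)) * mode 0 1 0 v + 2 * c (-1) (m s) * mode 0 (-1) 0 v"
    have "pair_r s ?D = pair_r s ?D'"
      unfolding pair_r_def
    proof (intro sum.cong refl integral_cong)
      fix \<sigma> x assume "\<sigma> \<in> spins"
      then have "?D (x, \<sigma>) = ?D' (x, \<sigma>)"
        by (cases rule: spins_cases) (simp_all add: mode_def spin_fun_def)
      then show "r s (x, \<sigma>) * ?D (x, \<sigma>) = r s (x, \<sigma>) * ?D' (x, \<sigma>)" by (rule arg_cong)
    qed
    also have "\<dots> = pairing (alpha s) ?D'"
      by (intro pairing_alpha[symmetric] s C_V_add C_V_cmult mode_C_V)
    also have "\<dots> = (- 2 * c 1 (m s)) * pairing (alpha s) (mode 0 1 0) + 2 * c (-1) (m s) * pairing (alpha s) (mode 0 (-1) 0)"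
      by (simp only: pairing_add C_V_cmult mode_C_V pairing_cmult)
    also have "\<dots> = c (-1) (m s) * (M - S s) - c 1 (m s) * (M + S s)"
    proof -
      have MS: "M = pairing (alpha s) (mode 0 1 0) + pairing (alpha s) (mode 0 (-1) 0)"
        "S s = pairing (alpha s) (mode 0 1 0) - pairing (alpha s) (mode 0 (-1) 0)"
        using pairing_one_modes[of "alpha s"] pairing_spin_modes[of "alpha s"] mass_const[OF s]
        by (simp_all add: M_def S_def)
      show ?thesis unfolding MS by (simp add: algebra_simps)
    qed
    finally show ?thesis .
  qed
  have cont: "continuous_on {0..T} (\<lambda>s. c (-1) (m s) * (M - S s) - c 1 (m s) * (M + S s))"
    unfolding S_def by (intro continuous_intros cm_cont pairing_alpha_cont) auto
  have S_eq: "S t = S 0 + integral {0..t} (\<lambda>s. c (-1) (m s) * (M - S s) - c 1 (m s) * (M + S s))" if t: "t \<in> {0..T}" for t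
  proof -
    have "pair_r t spin_fun - pair_r 0 spin_fun = integral {0..t} (\<lambda>s. pair_r s
      (\<lambda>(x, \<sigma>). (\<lambda>_. 0 :: real) (x, \<sigma>) + of_int \<sigma> * (\<lambda>_. 0 :: real) (x, \<sigma>) + c \<sigma> (m s) * (spin_fun (x, - \<sigma>) - spin_fun (x, \<sigma>))))"
      by (rule weak_form(2)[where G = "\<lambda>_. spin_fun" and Gt = "\<lambda>_ _. 0" and Gx = "\<lambda>_ _. 0"])
         (use t in \<open>auto simp: periodic_V_def case_prod_unfold spin_fun_def\<close>)
    also have "\<dots> = integral {0..t} (\<lambda>s. c (-1) (m s) * (M - S s) - c 1 (m s) * (M + S s))"
      by (rule integral_cong) (use D t in auto)
    finally show ?thesis using t T_pos by (simp add: S_def pairing_alpha)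
  qed
  have S_der: "(S has_real_derivative c (-1) (m t) * (M - S t) - c 1 (m t) * (M + S t)) (at t within {0..T})"
    if t: "t \<in> {0..T}" for t
  proof -
    have "((\<lambda>t. S 0 + integral {0..t} (\<lambda>s. c (-1) (m s) * (M - S s) - c 1 (m s) * (M + S s)))
        has_real_derivative c (-1) (m t) * (M - S t) - c 1 (m t) * (M + S t)) (at t within {0..T})"
      using integral_has_real_derivative[OF cont t] by (auto intro!: derivative_eq_intros)
    then show ?thesis
      by (rule has_field_derivative_transform_within[OF _ zero_less_one t]) (rule S_eq[symmetric])
  qed
  \<comment> \<open>The difference \<open>S t - m t * M\<close> solves a homogeneous linear equation
    with nonpositive coefficient; its square starts at 0 and cannot grow.\<close>
  define d where "d t = (S t - m t * M)\<^sup>2" for t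
  have d_der: "(d has_real_derivative - 2 * (c 1 (m t) + c (-1) (m t)) * d t) (at t within {0..T})"
    if t: "t \<in> {0..T}" for t
    unfolding d_def
    by (rule derivative_eq_intros S_der[OF t] m_deriv[OF t] refl)+
       (simp add: mag_drift_def power2_eq_square algebra_simps)
  have "d t \<le> 0"
  proof (rule barrier[OF d_der _ _ t])
    show "d 0 \<le> 0" using spin0 T_pos by (simp add: d_def S_def M_def pairing_alpha)
    fix t assume "t \<in> {0..T}" "0 < d t"
    then show "- 2 * (c 1 (m t) + c (-1) (m t)) * d t \<le> 0"
      using c_nonneg[OF _ m_range, of 1 t] c_nonneg[OF _ m_range, of "-1" t]
      by (intro mult_nonpos_nonneg) auto
  qed
  then have "S t = m t * M" by (simp add: d_def)
  then show ?thesis using mass_const[OF t] by (simp add: S_def M_def)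
qed

lemma magnetization_r:
  assumes t: "t \<in> {0..T}"
  shows "pairing (alpha t) (\<lambda>_. 1) = 0 \<or> magnetization (r t) = m t"
  using magnetization_density(3)[OF alpha_density[OF t]] spin_eq[OF t] by auto

text \<open>If the mass is 0, the magnetization is 0 by convention and may differ from
  \<open>m t\<close>, but then every pairing vanishes. So the two may be exchanged inside products
  with pairings, which is how they occur in the weak equation.\<close>

lemma c_magnetization_r:
  assumes t: "t \<in> {0..T}" and \<phi>: "\<phi> \<in> C_V"
  shows "c \<sigma> (magnetization (r t)) * pairing (alpha t) \<phi> = c \<sigma> (m t) * pairing (alpha t) \<phi>"
proof (cases "pairing (alpha t) (\<lambda>_. 1) = 0")
  case True
  obtain B where "0 < B" "\<And>x \<sigma>. \<sigma> \<in> spins \<Longrightarrow> \<bar>\<phi> (x, \<sigma>)\<bar> \<le> B" using C_V_bounded[OF \<phi>] by metis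
  then have "pairing (alpha t) \<phi> = 0" using abs_pairing_le[OF \<phi>, of B "alpha t"] True by simp
  then show ?thesis by simp
next
  case False
  then show ?thesis using magnetization_r[OF t] by simp
qed

lemma alpha_weak_equation: "weak_equation c T alpha r"
  unfolding weak_equation_def
proof (intro allI impI ballI)
  fix G t assume G: "smooth_time_V T G" and t: "t \<in> {0..T}"
  have "\<exists>D :: nat \<Rightarrow> nat \<Rightarrow> real \<Rightarrow> real \<Rightarrow> real.
        (\<forall>t\<in>{0..T}. \<forall>x. D 0 0 t x = G t (x, \<sigma>)) \<and>
        (\<forall>i j. continuous_on ({0..T} \<times> UNIV) (\<lambda>(t, x). D i j t x)) \<and>
        (\<forall>i j. \<forall>t\<in>{0..T}. \<forall>x.
           ((\<lambda>s. D i j s x) has_real_derivative D (Suc i) j t x) (at t within {0..T}) \<and>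
           ((\<lambda>y. D i j t y) has_real_derivative D i (Suc j) t x) (at x))" if "\<sigma> \<in> spins" for \<sigma>
    using G that by (simp add: smooth_time_V_def)
  then have "\<forall>\<sigma>\<in>spins. \<exists>D :: nat \<Rightarrow> nat \<Rightarrow> real \<Rightarrow> real \<Rightarrow> real.
        (\<forall>t\<in>{0..T}. \<forall>x. D 0 0 t x = G t (x, \<sigma>)) \<and>
        (\<forall>i j. continuous_on ({0..T} \<times> UNIV) (\<lambda>(t, x). D i j t x)) \<and>
        (\<forall>i j. \<forall>t\<in>{0..T}. \<forall>x.
           ((\<lambda>s. D i j s x) has_real_derivative D (Suc i) j t x) (at t within {0..T}) \<and>
           ((\<lambda>y. D i j t y) has_real_derivative D i (Suc j) t x) (at x))" ..
  from bchoice[OF this] obtain D :: "int \<Rightarrow> nat \<Rightarrow> nat \<Rightarrow> real \<Rightarrow> real \<Rightarrow> real" where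
    D: "\<forall>\<sigma>\<in>spins. (\<forall>t\<in>{0..T}. \<forall>x. D \<sigma> 0 0 t x = G t (x, \<sigma>)) \<and>
        (\<forall>i j. continuous_on ({0..T} \<times> UNIV) (\<lambda>(t, x). D \<sigma> i j t x)) \<and>
        (\<forall>i j. \<forall>t\<in>{0..T}. \<forall>x.
           ((\<lambda>s. D \<sigma> i j s x) has_real_derivative D \<sigma> (Suc i) j t x) (at t within {0..T}) \<and>
           ((\<lambda>y. D \<sigma> i j t y) has_real_derivative D \<sigma> i (Suc j) t x) (at x))" ..
  then have
    D0: "\<And>\<sigma> t x. \<sigma> \<in> spins \<Longrightarrow> t \<in> {0..T} \<Longrightarrow> D \<sigma> 0 0 t x = G t (x, \<sigma>)" and
    Dc: "\<And>\<sigma> i j. \<sigma> \<in> spins \<Longrightarrow> continuous_on ({0..T} \<times> UNIV) (\<lambda>(t, x). D \<sigma> i j t x)" and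
    Dt: "\<And>\<sigma> i j t x. \<sigma> \<in> spins \<Longrightarrow> t \<in> {0..T} \<Longrightarrow> ((\<lambda>s. D \<sigma> i j s x) has_real_derivative D \<sigma> (Suc i) j t x) (at t within {0..T})" and
    Dx: "\<And>\<sigma> i j t x. \<sigma> \<in> spins \<Longrightarrow> t \<in> {0..T} \<Longrightarrow> ((\<lambda>y. D \<sigma> i j t y) has_real_derivative D \<sigma> i (Suc j) t x) (at x)"
    by blast+
  have per: "periodic_V (G t)" if "t \<in> {0..T}" for t using G that by (simp add: smooth_time_V_def)
  define Gt where "Gt t = (\<lambda>(x, \<sigma>). D \<sigma> 1 0 t x)" for t
  define Gx where "Gx t = (\<lambda>(x, \<sigma>). D \<sigma> 0 1 t x)" for t
  have Gt: "((\<lambda>s. G s (x, \<sigma>)) has_real_derivative Gt t (x, \<sigma>)) (at t within {0..T})"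
    if "\<sigma> \<in> spins" "t \<in> {0..T}" for \<sigma> t x
  proof -
    have "((\<lambda>s. D \<sigma> 0 0 s x) has_real_derivative Gt t (x, \<sigma>)) (at t within {0..T})"
      using Dt[OF that, of 0 0 x] by (simp add: Gt_def)
    then show ?thesis
      by (rule has_field_derivative_transform_within[OF _ zero_less_one that(2)]) (simp add: D0 that)
  qed
  have Gx: "((\<lambda>y. G t (y, \<sigma>)) has_real_derivative Gx t (x, \<sigma>)) (at x)" if "\<sigma> \<in> spins" "t \<in> {0..T}" for \<sigma> t x
    using Dx[OF that, of 0 0 x] D0[OF that] by (simp add: Gx_def)
  have Gc: "continuous_on ({0..T} \<times> UNIV) (\<lambda>(t, x). G t (x, \<sigma>))" if "\<sigma> \<in> spins" for \<sigma>
    by (rule continuous_on_eq[OF Dc[OF that, of 0 0]]) (auto simp: D0 that)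
  have Gtc: "continuous_on ({0..T} \<times> UNIV) (\<lambda>(t, x). Gt t (x, \<sigma>))" if "\<sigma> \<in> spins" for \<sigma>
    using Dc[OF that, of 1 0] by (simp add: Gt_def)
  have Gxc: "continuous_on ({0..T} \<times> UNIV) (\<lambda>(t, x). Gx t (x, \<sigma>))" if "\<sigma> \<in> spins" for \<sigma>
    using Dc[OF that, of 0 1] by (simp add: Gx_def)
  define E where "E s = (\<lambda>(x, \<sigma>). Gt s (x, \<sigma>) + of_int \<sigma> * Gx s (x, \<sigma>) + c \<sigma> (m s) * (G s (x, - \<sigma>) - G s (x, \<sigma>)))" for s
  have wf: "continuous_on {0..T} (\<lambda>s. pair_r s (E s))" "pair_r t (G t) - pair_r 0 (G 0) = integral {0..t} (\<lambda>s. pair_r s (E s))"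
    unfolding E_def using weak_form[OF per Gc Gtc Gxc Gt Gx t] by blast+
  have slice: "continuous_on UNIV (\<lambda>x. f s x)" if "continuous_on ({0..T} \<times> UNIV) (\<lambda>(s, x). f s x)" "s \<in> {0..T}"
    for f :: "real \<Rightarrow> real \<Rightarrow> real" and s
    by (rule continuous_on_compose_strip[OF that(1)]) (use that(2) in \<open>auto intro!: continuous_intros\<close>)
  have G_CV: "G s \<in> C_V" if s: "s \<in> {0..T}" for s
    using per[OF s] slice[OF Gc s] by (simp add: C_V_def)
  have base_CV: "(\<lambda>(x, \<sigma>). Gt s (x, \<sigma>) + of_int \<sigma> * Gx s (x, \<sigma>)) \<in> C_V" if s: "s \<in> {0..T}" for s
    unfolding C_V_def periodic_V_def
  proof (intro CollectI conjI allI ballI)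
    fix \<sigma> assume \<sigma>: "\<sigma> \<in> spins"
    show "continuous_on UNIV (\<lambda>x. case (x, \<sigma>) of (x, \<sigma>) \<Rightarrow> Gt s (x, \<sigma>) + of_int \<sigma> * Gx s (x, \<sigma>))"
      unfolding prod.case by (intro continuous_intros slice[OF Gtc[OF \<sigma>] s] slice[OF Gxc[OF \<sigma>] s])
    fix x
    have p: "G s (x + 1, \<sigma>) = G s (x, \<sigma>)" if "s \<in> {0..T}" for s x
      using per[OF that] \<sigma> by (simp add: periodic_V_def)
    have "Gt s (x + 1, \<sigma>) = Gt s (x, \<sigma>)"
      using periodic_time_derivative[where g = "\<lambda>s x. G s (x, \<sigma>)" and g' = "\<lambda>x. Gt s (x, \<sigma>)", OF T_pos s]
        p Gt[OF \<sigma> s] by blast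
    moreover have "Gx s (x + 1, \<sigma>) = Gx s (x, \<sigma>)"
      using periodic_derivative[where f = "\<lambda>x. G s (x, \<sigma>)" and f' = "\<lambda>x. Gx s (x, \<sigma>)"]
        p[OF s] Gx[OF \<sigma> s] by blast
    ultimately show "(case (x + 1, \<sigma>) of (x, \<sigma>) \<Rightarrow> Gt s (x, \<sigma>) + of_int \<sigma> * Gx s (x, \<sigma>)) =
        (case (x, \<sigma>) of (x, \<sigma>) \<Rightarrow> Gt s (x, \<sigma>) + of_int \<sigma> * Gx s (x, \<sigma>))" by simp
  qed
  have flip_CV: "flip \<tau> (G s) \<in> C_V" if s: "s \<in> {0..T}" for \<tau> s
    using G_CV[OF s] unfolding flip_def C_V_def periodic_V_def by (auto intro!: continuous_intros)
  \<comment> \<open>The rate is pulled out of the pairing layer by layer, to reach the form in which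
    \<open>c_magnetization_r\<close> exchanges \<open>magnetization (r s)\<close> for
    \<open>m s\<close>.\<close>
  have split: "pairing (alpha s) (\<lambda>(x, \<sigma>). Gt s (x, \<sigma>) + of_int \<sigma> * Gx s (x, \<sigma>) + c \<sigma> z * (G s (x, - \<sigma>) - G s (x, \<sigma>))) =
      pairing (alpha s) (\<lambda>(x, \<sigma>). Gt s (x, \<sigma>) + of_int \<sigma> * Gx s (x, \<sigma>)) +
      (c 1 z * pairing (alpha s) (flip 1 (G s)) + c (-1) z * pairing (alpha s) (flip (-1) (G s)))"
    if s: "s \<in> {0..T}" for s z
  proof -
    have "pairing (alpha s) (\<lambda>(x, \<sigma>). Gt s (x, \<sigma>) + of_int \<sigma> * Gx s (x, \<sigma>) + c \<sigma> z * (G s (x, - \<sigma>) - G s (x, \<sigma>))) =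
      pairing (alpha s) (\<lambda>v. (\<lambda>(x, \<sigma>). Gt s (x, \<sigma>) + of_int \<sigma> * Gx s (x, \<sigma>)) v +
        (c 1 z * flip 1 (G s) v + c (-1) z * flip (-1) (G s) v))"
      by (rule pairing_cong) (auto simp: flip_def spins_def)
    also have "\<dots> = pairing (alpha s) (\<lambda>(x, \<sigma>). Gt s (x, \<sigma>) + of_int \<sigma> * Gx s (x, \<sigma>)) +
      (c 1 z * pairing (alpha s) (flip 1 (G s)) + c (-1) z * pairing (alpha s) (flip (-1) (G s)))"
      by (simp only: pairing_add base_CV[OF s] flip_CV[OF s] C_V_add C_V_cmult pairing_cmult)
    finally show ?thesis .
  qed
  have E_CV: "E s \<in> C_V" if s: "s \<in> {0..T}" for s
  proof -
    \<comment> \<open>\<open>C_V\<close> constrains the layers in \<open>spins\<close> only, so E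
      may be replaced by 0 off them, and is compared on them with the combination \<open>?f\<close>
      of functions already known to be in \<open>C_V\<close>.\<close>
    have "(\<lambda>(x, \<sigma>). of_bool (\<sigma> \<in> spins) * E s (x, \<sigma>)) \<in> C_V \<Longrightarrow> E s \<in> C_V"
      unfolding C_V_def periodic_V_def by auto
    moreover have "(\<lambda>(x, \<sigma>). of_bool (\<sigma> \<in> spins) * E s (x, \<sigma>)) \<in> C_V"
    proof -
      let ?f = "\<lambda>v. (\<lambda>(x, \<sigma>). Gt s (x, \<sigma>) + of_int \<sigma> * Gx s (x, \<sigma>)) v +
        (c 1 (m s) * flip 1 (G s) v + c (-1) (m s) * flip (-1) (G s) v)"
      have f: "?f \<in> C_V" by (intro C_V_add C_V_cmult base_CV[OF s] flip_CV[OF s])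
      have "?f (x, \<sigma>) = E s (x, \<sigma>)" if "\<sigma> \<in> spins" for x \<sigma>
        using that by (auto simp: E_def flip_def spins_def)
      with f show ?thesis unfolding C_V_def periodic_V_def by auto
    qed
    ultimately show ?thesis by blast
  qed
  have integrand: "pairing (alpha s) (\<lambda>(x, \<sigma>). vector_derivative (\<lambda>r. G r (x, \<sigma>)) (at s within {0..T}) +
        of_int \<sigma> * deriv (\<lambda>y. G s (y, \<sigma>)) x + c \<sigma> (magnetization (r s)) * (G s (x, - \<sigma>) - G s (x, \<sigma>))) = pair_r s (E s)"
    if s: "s \<in> {0..T}" for s
  proof -
    have vd: "vector_derivative (\<lambda>r. G r (x, \<sigma>)) (at s within {0..T}) = Gt s (x, \<sigma>)" if "\<sigma> \<in> spins" for x \<sigma>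
      using Gt[OF that s, of x]
      by (intro vector_derivative_within_closed_interval[OF T_pos s]) (simp add: has_real_derivative_iff_has_vector_derivative)
    have dx: "deriv (\<lambda>y. G s (y, \<sigma>)) x = Gx s (x, \<sigma>)" if "\<sigma> \<in> spins" for x \<sigma>
      by (rule DERIV_imp_deriv[OF Gx[OF that s]])
    have "pairing (alpha s) (\<lambda>(x, \<sigma>). vector_derivative (\<lambda>r. G r (x, \<sigma>)) (at s within {0..T}) +
        of_int \<sigma> * deriv (\<lambda>y. G s (y, \<sigma>)) x + c \<sigma> (magnetization (r s)) * (G s (x, - \<sigma>) - G s (x, \<sigma>))) =
      pairing (alpha s) (\<lambda>(x, \<sigma>). Gt s (x, \<sigma>) + of_int \<sigma> * Gx s (x, \<sigma>) + c \<sigma> (magnetization (r s)) * (G s (x, - \<sigma>) - G s (x, \<sigma>)))"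
      by (rule pairing_cong) (simp add: vd dx)
    also have "\<dots> = pairing (alpha s) (E s)"
      unfolding E_def split[OF s] by (simp only: c_magnetization_r[OF s flip_CV[OF s]])
    also have "\<dots> = pair_r s (E s)" by (rule pairing_alpha[OF s E_CV[OF s]])
    finally show ?thesis .
  qed
  have "(LBINT s:{0..t}. pairing (alpha s) (\<lambda>(x, \<sigma>). vector_derivative (\<lambda>r. G r (x, \<sigma>)) (at s within {0..T}) +
        of_int \<sigma> * deriv (\<lambda>y. G s (y, \<sigma>)) x + c \<sigma> (magnetization (r s)) * (G s (x, - \<sigma>) - G s (x, \<sigma>)))) =
      (LBINT s:{0..t}. pair_r s (E s))"
    using t by (intro set_lebesgue_integral_cong) (auto simp: integrand)
  also have "\<dots> = integral {0..t} (\<lambda>s. pair_r s (E s))"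
    using wf(1) t by (intro continuous_lborel_integral) (auto intro: continuous_on_subset)
  also have "\<dots> = pairing (alpha t) (G t) - pairing (alpha 0) (G 0)"
    using wf(2) t T_pos by (simp add: pairing_alpha G_CV)
  finally show "pairing (alpha t) (G t) - pairing (alpha 0) (G 0) -
     (LBINT s:{0..t}. pairing (alpha s) (\<lambda>(x, \<sigma>). vector_derivative (\<lambda>r. G r (x, \<sigma>)) (at s within {0..T}) +
        of_int \<sigma> * deriv (\<lambda>y. G s (y, \<sigma>)) x + c \<sigma> (magnetization (r s)) * (G s (x, - \<sigma>) - G s (x, \<sigma>)))) = 0"
    by simp
qed

lemma alpha_weak_solution: "weak_solution T alpha r"
  using alpha_skorokhod alpha_density alpha_weak_equation by (auto simp: weak_solution_def)

text \<open>Once the rates are taken at m, the integrated equation of a mode has a continuous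
  integrand and can be differentiated. This provides the data for the supermartingale.\<close>

lemma alpha_limit_modes: "limit_modes c c_hi Lc T m (\<lambda>k \<sigma> b t. pairing (alpha t) (mode k \<sigma> b))"
proof
  show "0 \<le> T" using T_pos by simp
  show "pairing (alpha t) (mode k \<sigma> pi) = - pairing (alpha t) (mode k \<sigma> 0)" for k \<sigma> t
  proof -
    have "pairing (alpha t) (mode k \<sigma> pi) = pairing (alpha t) (\<lambda>v. (-1) * mode k \<sigma> 0 v)"
      by (rule pairing_cong) (simp add: mode_def)
    then show ?thesis unfolding pairing_cmult by simp
  qed
  fix k \<sigma> b t assume \<sigma>: "\<sigma> \<in> spins" and t: "t \<in> {0..T}"
  let ?f = "\<lambda>s. 2 * pi * of_int (k * \<sigma>) * pairing (alpha s) (mode k \<sigma> (b + pi / 2)) +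
      c (- \<sigma>) (m s) * pairing (alpha s) (mode k (- \<sigma>) b) - c \<sigma> (m s) * pairing (alpha s) (mode k \<sigma> b)"
  have cont: "continuous_on {0..T} ?f"
    using \<sigma> by (intro continuous_intros cm_cont pairing_alpha_cont mode_C_V) auto
  have eq: "pairing (alpha s) (mode k \<sigma> b) = pairing (alpha 0) (mode k \<sigma> b) + integral {0..s} ?f" if s: "s \<in> {0..T}" for s
  proof -
    have "pairing (alpha s) (mode k \<sigma> b) - pairing (alpha 0) (mode k \<sigma> b) = (LBINT s:{0..s}. ?f s)"
      unfolding weak_equation_mode[OF T_pos alpha_weak_equation \<sigma> s]
      using s by (intro set_lebesgue_integral_cong) (auto simp: c_magnetization_r)
    also have "\<dots> = integral {0..s} ?f"
      using cont s by (intro continuous_lborel_integral) (auto intro: continuous_on_subset)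
    finally show ?thesis by simp
  qed
  have "((\<lambda>s. pairing (alpha 0) (mode k \<sigma> b) + integral {0..s} ?f) has_real_derivative ?f t) (at t within {0..T})"
    using integral_has_real_derivative[OF cont t] by (auto intro!: derivative_eq_intros)
  then show "((\<lambda>t. pairing (alpha t) (mode k \<sigma> b)) has_real_derivative ?f t) (at t within {0..T})"
    by (rule has_field_derivative_transform_within[OF _ zero_less_one t]) (rule eq[symmetric])
qed (use m_range m_deriv in auto)

end

section \<open>Convergence\<close>

definition uniformly_close_in_prob ::
  "real \<Rightarrow> (nat \<Rightarrow> 'w measure) \<Rightarrow> (nat \<Rightarrow> 'w \<Rightarrow> real \<Rightarrow> radon_V) \<Rightarrow> (real \<Rightarrow> radon_V) \<Rightarrow> (real \<times> int \<Rightarrow> real) \<Rightarrow> bool" where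
  "uniformly_close_in_prob T M Z \<alpha> \<phi> \<longleftrightarrow> (\<forall>e>0. \<forall>d>0. \<forall>\<^sub>F N in sequentially. \<exists>B\<in>sets (M N).
      measure (M N) B \<le> d \<and> (\<forall>\<omega>\<in>space (M N) - B. \<forall>t\<in>{0..T}. \<bar>pairing (Z N \<omega> t) \<phi> - pairing (\<alpha> t) \<phi>\<bar> < e))"

text \<open>Common scheme for sums, multiples and limits: closeness for k follows pathwise from
  closeness for two functions, each of which is granted half of the exceptional probability
  d.\<close>

lemma uniformly_close_combine:
  assumes prob: "\<And>N. 0 < N \<Longrightarrow> prob_space (M N)"
    and h: "\<And>e. 0 < e \<Longrightarrow> \<exists>f g e1 e2. uniformly_close_in_prob T M Z \<alpha> f \<and> uniformly_close_in_prob T M Z \<alpha> g \<and>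
      0 < e1 \<and> 0 < e2 \<and> (\<forall>N \<omega> t. t \<in> {0..T} \<longrightarrow>
      \<bar>pairing (Z N \<omega> t) f - pairing (\<alpha> t) f\<bar> < e1 \<longrightarrow> \<bar>pairing (Z N \<omega> t) g - pairing (\<alpha> t) g\<bar> < e2 \<longrightarrow>
      \<bar>pairing (Z N \<omega> t) k - pairing (\<alpha> t) k\<bar> < e)"
  shows "uniformly_close_in_prob T M Z \<alpha> k"
  unfolding uniformly_close_in_prob_def
proof (intro allI impI)
  fix e d :: real assume e: "0 < e" and d: "0 < d"
  obtain f g e1 e2 where f: "uniformly_close_in_prob T M Z \<alpha> f" and g: "uniformly_close_in_prob T M Z \<alpha> g"
    and e12: "0 < e1" "0 < e2" "\<And>N \<omega> t. t \<in> {0..T} \<Longrightarrow>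
      \<bar>pairing (Z N \<omega> t) f - pairing (\<alpha> t) f\<bar> < e1 \<Longrightarrow> \<bar>pairing (Z N \<omega> t) g - pairing (\<alpha> t) g\<bar> < e2 \<Longrightarrow>
      \<bar>pairing (Z N \<omega> t) k - pairing (\<alpha> t) k\<bar> < e"
    using h[OF e] by blast
  have "\<forall>\<^sub>F N in sequentially. \<exists>B\<in>sets (M N). measure (M N) B \<le> d / 2 \<and>
      (\<forall>\<omega>\<in>space (M N) - B. \<forall>t\<in>{0..T}. \<bar>pairing (Z N \<omega> t) f - pairing (\<alpha> t) f\<bar> < e1)"
    using f[unfolded uniformly_close_in_prob_def, rule_format, OF e12(1) half_gt_zero[OF d]] .
  moreover have "\<forall>\<^sub>F N in sequentially. \<exists>B\<in>sets (M N). measure (M N) B \<le> d / 2 \<and>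
      (\<forall>\<omega>\<in>space (M N) - B. \<forall>t\<in>{0..T}. \<bar>pairing (Z N \<omega> t) g - pairing (\<alpha> t) g\<bar> < e2)"
    using g[unfolded uniformly_close_in_prob_def, rule_format, OF e12(2) half_gt_zero[OF d]] .
  ultimately show "\<forall>\<^sub>F N in sequentially. \<exists>B\<in>sets (M N). measure (M N) B \<le> d \<and>
      (\<forall>\<omega>\<in>space (M N) - B. \<forall>t\<in>{0..T}. \<bar>pairing (Z N \<omega> t) k - pairing (\<alpha> t) k\<bar> < e)"
    using eventually_gt_at_top[of "0 :: nat"]
  proof eventually_elim
    case (elim N)
    interpret prob_space "M N" by (rule prob[OF elim(3)])
    obtain B1 where B1: "B1 \<in> sets (M N)" "measure (M N) B1 \<le> d / 2"
      "\<And>\<omega> t. \<omega> \<in> space (M N) - B1 \<Longrightarrow> t \<in> {0..T} \<Longrightarrow> \<bar>pairing (Z N \<omega> t) f - pairing (\<alpha> t) f\<bar> < e1"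
      using elim(1) by blast
    obtain B2 where B2: "B2 \<in> sets (M N)" "measure (M N) B2 \<le> d / 2"
      "\<And>\<omega> t. \<omega> \<in> space (M N) - B2 \<Longrightarrow> t \<in> {0..T} \<Longrightarrow> \<bar>pairing (Z N \<omega> t) g - pairing (\<alpha> t) g\<bar> < e2"
      using elim(2) by blast
    show ?case
    proof (intro bexI[of _ "B1 \<union> B2"] conjI ballI)
      show "B1 \<union> B2 \<in> sets (M N)" using B1 B2 by simp
      show "measure (M N) (B1 \<union> B2) \<le> d"
        using measure_Un_le[OF B1(1) B2(1)] B1(2) B2(2) by simp
      fix \<omega> t assume "\<omega> \<in> space (M N) - (B1 \<union> B2)" "t \<in> {0..T}"
      then show "\<bar>pairing (Z N \<omega> t) k - pairing (\<alpha> t) k\<bar> < e"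
        by (intro e12(3) B1(3) B2(3)) auto
    qed
  qed
qed

text \<open>Empirical measures have random, unbounded mass, so a uniform approximation of test
  functions is of use only where the mass is under control. The constant function 1, a sum of two
  modes, is therefore the second function of \<open>uniformly_close_combine\<close> in the limit
  case.\<close>

lemma uniformly_close_C_V:
  assumes prob: "\<And>N. 0 < N \<Longrightarrow> prob_space (M N)"
    and modes: "\<And>k \<sigma> b. \<sigma> \<in> spins \<Longrightarrow> b \<in> {0, pi / 2} \<Longrightarrow> uniformly_close_in_prob T M Z \<alpha> (mode k \<sigma> b)"
    and mass: "\<And>t. t \<in> {0..T} \<Longrightarrow> pairing (\<alpha> t) (\<lambda>_. 1) \<le> q"
    and \<phi>: "\<phi> \<in> C_V"
  shows "uniformly_close_in_prob T M Z \<alpha> \<phi>"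
proof -
  have add_close: "uniformly_close_in_prob T M Z \<alpha> (\<lambda>v. f v + g v)"
    if fg: "f \<in> C_V" "g \<in> C_V" "uniformly_close_in_prob T M Z \<alpha> f" "uniformly_close_in_prob T M Z \<alpha> g" for f g
  proof (rule uniformly_close_combine[OF prob])
    fix e :: real assume "0 < e"
    have "\<bar>(x + y) - (x' + y')\<bar> < e" if "\<bar>x - x'\<bar> < e / 2" "\<bar>y - y'\<bar> < e / 2" for x x' y y'
      using that by linarith
    then show "\<exists>f' g' e1 e2. uniformly_close_in_prob T M Z \<alpha> f' \<and> uniformly_close_in_prob T M Z \<alpha> g' \<and>
      0 < e1 \<and> 0 < e2 \<and> (\<forall>N \<omega> t. t \<in> {0..T} \<longrightarrow>
      \<bar>pairing (Z N \<omega> t) f' - pairing (\<alpha> t) f'\<bar> < e1 \<longrightarrow> \<bar>pairing (Z N \<omega> t) g' - pairing (\<alpha> t) g'\<bar> < e2 \<longrightarrow>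
      \<bar>pairing (Z N \<omega> t) (\<lambda>v. f v + g v) - pairing (\<alpha> t) (\<lambda>v. f v + g v)\<bar> < e)"
      using fg \<open>0 < e\<close> unfolding pairing_add[OF fg(1,2)]
      by (intro exI[of _ f] exI[of _ g] exI[of _ "e / 2"]) simp
  qed
  have "uniformly_close_in_prob T M Z \<alpha> (\<lambda>v. mode 0 1 0 v + mode 0 (-1) 0 v)"
    by (intro add_close mode_C_V modes) auto
  moreover have "pairing \<beta> (\<lambda>v. mode 0 1 0 v + mode 0 (-1) 0 v) = pairing \<beta> (\<lambda>_. 1)" for \<beta>
    by (rule pairing_cong) (simp add: sum_modes)
  ultimately have one: "uniformly_close_in_prob T M Z \<alpha> (\<lambda>_. 1)"
    by (simp add: uniformly_close_in_prob_def)
  show ?thesis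
    using \<phi>
  proof (induction rule: C_V_induct)
    case (mode k \<sigma> b)
    then show ?case by (rule modes)
  next
    case (add f g)
    then show ?case by (intro add_close)
  next
    case (scale f r)
    show ?case
    proof (rule uniformly_close_combine[OF prob])
      fix e :: real assume e: "0 < e"
      have "\<bar>r * x - r * y\<bar> < e" if "\<bar>x - y\<bar> < e / (\<bar>r\<bar> + 1)" for x y
      proof -
        have "\<bar>r * x - r * y\<bar> = \<bar>r\<bar> * \<bar>x - y\<bar>" by (simp add: right_diff_distrib[symmetric] abs_mult del: right_diff_distrib)
        also have "\<dots> \<le> (\<bar>r\<bar> + 1) * \<bar>x - y\<bar>" by (intro mult_right_mono) auto
        also have "\<dots> < (\<bar>r\<bar> + 1) * (e / (\<bar>r\<bar> + 1))" using that by (intro mult_strict_left_mono) auto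
        finally show ?thesis by simp
      qed
      moreover have "0 < e / (\<bar>r\<bar> + 1)" using e by simp
      ultimately show "\<exists>f' g' e1 e2. uniformly_close_in_prob T M Z \<alpha> f' \<and> uniformly_close_in_prob T M Z \<alpha> g' \<and>
        0 < e1 \<and> 0 < e2 \<and> (\<forall>N \<omega> t. t \<in> {0..T} \<longrightarrow>
        \<bar>pairing (Z N \<omega> t) f' - pairing (\<alpha> t) f'\<bar> < e1 \<longrightarrow> \<bar>pairing (Z N \<omega> t) g' - pairing (\<alpha> t) g'\<bar> < e2 \<longrightarrow>
        \<bar>pairing (Z N \<omega> t) (\<lambda>v. r * f v) - pairing (\<alpha> t) (\<lambda>v. r * f v)\<bar> < e)"
        unfolding pairing_cmult using scale(2) by blast
    qed
  next
    case (limit f)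
    define q' where "q' = max q 0"
    have q': "0 \<le> q'" "q \<le> q'" by (simp_all add: q'_def)
    show ?case
    proof (rule uniformly_close_combine[OF prob])
      fix e :: real assume e: "0 < e"
      \<comment> \<open>Off the exceptional event both masses are at most \<open>q' + 1\<close>, so
        replacing f by g costs at most \<open>e / 4\<close> on either side.\<close>
      define e' where "e' = e / (4 * (q' + 1))"
      have "q' + 1 \<noteq> 0" using q' by linarith
      then have e': "0 < e'" "e' * (q' + 1) = e / 4" using e q' by (auto simp: e'_def divide_simps)
      obtain g where g: "g \<in> C_V" "uniformly_close_in_prob T M Z \<alpha> g"
        "\<And>x \<sigma>. \<sigma> \<in> spins \<Longrightarrow> \<bar>f (x, \<sigma>) - g (x, \<sigma>)\<bar> \<le> e'"
        using limit(2)[OF e'(1)] by blast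
      have diff: "\<bar>pairing \<gamma> f - pairing \<gamma> g\<bar> \<le> e' * pairing \<gamma> (\<lambda>_. 1)" for \<gamma>
        using abs_pairing_le[OF C_V_diff[OF limit(1) g(1)], of e' \<gamma>] g(3) pairing_diff[OF limit(1) g(1)] by simp
      have key: "\<bar>pairing (Z N \<omega> t) f - pairing (\<alpha> t) f\<bar> < e"
        if t: "t \<in> {0..T}" and 1: "\<bar>pairing (Z N \<omega> t) g - pairing (\<alpha> t) g\<bar> < e / 4"
          and 2: "\<bar>pairing (Z N \<omega> t) (\<lambda>_. 1) - pairing (\<alpha> t) (\<lambda>_. 1)\<bar> < 1" for N \<omega> t
      proof -
        have "e' * pairing (Z N \<omega> t) (\<lambda>_. 1) \<le> e' * (q' + 1)"
          using 2 mass[OF t] q' e' by (intro mult_left_mono) auto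
        then have a: "\<bar>pairing (Z N \<omega> t) f - pairing (Z N \<omega> t) g\<bar> \<le> e / 4"
          using diff[of "Z N \<omega> t"] e'(2) by linarith
        have "e' * pairing (\<alpha> t) (\<lambda>_. 1) \<le> e' * (q' + 1)"
          using mass[OF t] q' e' by (intro mult_left_mono) auto
        then have b: "\<bar>pairing (\<alpha> t) f - pairing (\<alpha> t) g\<bar> \<le> e / 4"
          using diff[of "\<alpha> t"] e'(2) by linarith
        show ?thesis using a b 1 e by linarith
      qed
      show "\<exists>f' g' e1 e2. uniformly_close_in_prob T M Z \<alpha> f' \<and> uniformly_close_in_prob T M Z \<alpha> g' \<and>
        0 < e1 \<and> 0 < e2 \<and> (\<forall>N \<omega> t. t \<in> {0..T} \<longrightarrow>
        \<bar>pairing (Z N \<omega> t) f' - pairing (\<alpha> t) f'\<bar> < e1 \<longrightarrow> \<bar>pairing (Z N \<omega> t) g' - pairing (\<alpha> t) g'\<bar> < e2 \<longrightarrow>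
        \<bar>pairing (Z N \<omega> t) f - pairing (\<alpha> t) f\<bar> < e)"
        using g(2) one e key by (intro exI[of _ g] exI[of _ "\<lambda>_. 1"] exI[of _ "e / 4"] exI[of _ 1]) simp
    qed
  qed
qed

section \<open>From the initial error to a bound on the modes\<close>

context limit_modes
begin

text \<open>A bound for the potential at time 0 made of squared centred statistics and a term of
  order 1/N; z stands for the limiting mass. It mentions neither the semigroup nor the process, so
  its expectation can be studied as N grows.\<close>

definition initial_error :: "int \<Rightarrow> real \<Rightarrow> nat \<Rightarrow> (int \<times> int \<Rightarrow> nat) \<Rightarrow> real" where
  "initial_error k z N x = (lin_stat N (\<lambda>v. spin_fun v - mh 0) x)\<^sup>2 +
     (\<Sum>(\<sigma>, b)\<in>spins \<times> {0, pi / 2}. (lin_stat N (mode k \<sigma> b) x - a k \<sigma> b 0)\<^sup>2) +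
     T * (5 * ((2 * pi * of_int k) ^ 4 + (1 + c_hi) * (2 * pi * \<bar>of_int k\<bar> + 2)\<^sup>2)) *
       ((1 + 4 * z\<^sup>2) / real N + 4 * (lin_stat N (\<lambda>_. 1) x - z)\<^sup>2)"

text \<open>Each square is the squared error of a linear statistic, whose mean vanishes by
  \<open>lin_stat_initial_tendsto\<close>. In \<open>ennreal\<close> the integrals of the
  nonnegative terms add up without integrability conditions.\<close>

lemma initial_error_tendsto:
  assumes \<rho>: "\<rho> \<in> C_V" "\<And>x \<sigma>. \<sigma> \<in> spins \<Longrightarrow> 0 \<le> \<rho> (x, \<sigma>)"
  defines "w \<equiv> (\<lambda>\<phi>. \<Sum>\<sigma>\<in>spins. integral {0..1} (\<lambda>x. \<rho> (x, \<sigma>) * \<phi> (x, \<sigma>)))"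
  assumes mh0: "w (\<lambda>v. spin_fun v - mh 0) = 0"
    and a0: "\<And>\<sigma> b. \<sigma> \<in> spins \<Longrightarrow> a k \<sigma> b 0 = w (mode k \<sigma> b)"
  shows "(\<lambda>N. \<integral>\<^sup>+x. ennreal (initial_error k (w (\<lambda>_. 1)) N x) \<partial>initial_law N \<rho>) \<longlonglongrightarrow> 0"
proof -
  define z where "z = w (\<lambda>_. 1)"
  define K where "K = T * (5 * ((2 * pi * of_int k) ^ 4 + (1 + c_hi) * (2 * pi * \<bar>of_int k\<bar> + 2)\<^sup>2))"
  have K: "0 \<le> K" using T_nonneg c_hi_nonneg by (simp add: K_def)
  let ?I = "\<lambda>N f. \<integral>\<^sup>+x. ennreal (f x) \<partial>initial_law N \<rho>"
  let ?p = "\<lambda>N p x. (lin_stat N (mode k (fst p) (snd p)) x - a k (fst p) (snd p) 0)\<^sup>2"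
  have eq: "?I N (initial_error k z N) = ?I N (\<lambda>x. (lin_stat N (\<lambda>v. spin_fun v - mh 0) x - 0)\<^sup>2) +
      (\<Sum>p\<in>spins \<times> {0, pi / 2}. ?I N (?p N p)) +
      (ennreal (K * ((1 + 4 * z\<^sup>2) / real N)) + ennreal (4 * K) * ?I N (\<lambda>x. (lin_stat N (\<lambda>_. 1) x - z)\<^sup>2))" for N
  proof -
    have "ennreal (initial_error k z N x) = ennreal ((lin_stat N (\<lambda>v. spin_fun v - mh 0) x - 0)\<^sup>2) +
      (\<Sum>p\<in>spins \<times> {0, pi / 2}. ennreal (?p N p x)) +
      (ennreal (K * ((1 + 4 * z\<^sup>2) / real N)) + ennreal (4 * K) * ennreal ((lin_stat N (\<lambda>_. 1) x - z)\<^sup>2))" for x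
    proof -
      have "initial_error k z N x = (lin_stat N (\<lambda>v. spin_fun v - mh 0) x - 0)\<^sup>2 + (\<Sum>p\<in>spins \<times> {0, pi / 2}. ?p N p x) +
         (K * ((1 + 4 * z\<^sup>2) / real N) + (4 * K) * (lin_stat N (\<lambda>_. 1) x - z)\<^sup>2)"
        unfolding initial_error_def K_def[symmetric] by (simp add: case_prod_unfold algebra_simps)
      then show ?thesis
        using K by (simp add: sum_nonneg ennreal_mult[symmetric] sum_ennreal flip: ennreal_plus)
    qed
    then show ?thesis
      by (simp add: nn_integral_add nn_integral_sum nn_integral_cmult del: sum_ennreal)
  qed
  have spin: "(\<lambda>v. spin_fun v - mh 0) \<in> C_V" by (intro C_V_diff spin_fun_C_V C_V_const)
  have "(\<lambda>N. ?I N (initial_error k z N)) \<longlonglongrightarrow> 0 + (\<Sum>p\<in>spins \<times> {0, pi / 2}. 0) + (ennreal 0 + ennreal (4 * K) * 0)"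
    unfolding eq
  proof (intro tendsto_add tendsto_sum ennreal_tendsto_cmult tendsto_ennrealI)
    show "(\<lambda>N. ?I N (\<lambda>x. (lin_stat N (\<lambda>v. spin_fun v - mh 0) x - 0)\<^sup>2)) \<longlonglongrightarrow> 0"
      by (rule lin_stat_initial_tendsto[OF \<rho> spin mh0[unfolded w_def, symmetric]])
    show "(\<lambda>N. ?I N (?p N p)) \<longlonglongrightarrow> 0" if "p \<in> spins \<times> {0, pi / 2}" for p
      by (rule lin_stat_initial_tendsto[OF \<rho> mode_C_V]) (use a0[of "fst p" "snd p"] that in \<open>auto simp: w_def\<close>)
    show "(\<lambda>N. K * ((1 + 4 * z\<^sup>2) / real N)) \<longlonglongrightarrow> 0"
      using tendsto_mult_right_zero[OF lim_const_over_n[of "1 + 4 * z\<^sup>2"], of K] by simp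
    show "(\<lambda>N. ?I N (\<lambda>x. (lin_stat N (\<lambda>_. 1) x - z)\<^sup>2)) \<longlonglongrightarrow> 0"
      by (rule lin_stat_initial_tendsto[OF \<rho> C_V_const]) (simp_all add: w_def z_def)
  qed simp
  then show ?thesis by (simp add: z_def)
qed

end

context particle_limit
begin

lemma potential_initial_le: "potential k 0 x \<le> initial_error k z N x"
proof -
  let ?q = "lin_stat N (\<lambda>_. 1) x"
  let ?A = "2 * pi * (of_int k :: real)" and ?B = "(1 + c_hi) * (2 * pi * \<bar>of_int k\<bar> + 2)\<^sup>2"
  have N: "1 \<le> real N" using N_pos by simp
  have B0: "0 \<le> ?B" using c_hi_nonneg by simp
  have q0: "0 \<le> ?q" by (rule lin_stat_one_nonneg)
  have dev: "deviation k 0 x = (lin_stat N (\<lambda>v. spin_fun v - mh 0) x)\<^sup>2 +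
     (\<Sum>(\<sigma>, b)\<in>spins \<times> {0, pi / 2}. (lin_stat N (mode k \<sigma> b) x - a k \<sigma> b 0)\<^sup>2)"
  proof -
    have "lin_stat N (\<lambda>v. spin_fun v - mh 0) x = lin_stat N spin_fun x - mh 0 * ?q"
      using lin_stat_diff[of N spin_fun "\<lambda>_. mh 0" x] lin_stat_cmult[of N "mh 0" "\<lambda>_. 1" x] by simp
    moreover have "finite (Some ` (spins \<times> {0, pi / 2}))" by simp
    ultimately show ?thesis
      unfolding deviation_def mode_set_def
      by (subst sum.insert) (auto simp: stat_def target_def sum.reindex case_prod_unfold)
  qed
  have "noise k x = 5 * (?A ^ 4 * (?q\<^sup>2 / (real N)\<^sup>2) + ?B * (?q / real N))"
    unfolding noise_def Let_def power_divide power_mult_distrib by (simp add: power_mult[symmetric] del: power_mult)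
  also have "\<dots> \<le> 5 * (?A ^ 4 * ((?q\<^sup>2 + ?q) / real N) + ?B * ((?q\<^sup>2 + ?q) / real N))"
  proof (intro mult_left_mono add_mono B0)
    have "real N \<le> (real N)\<^sup>2" using N by (simp add: power2_eq_square)
    then have "?q\<^sup>2 / (real N)\<^sup>2 \<le> ?q\<^sup>2 / real N" using N by (intro divide_left_mono) auto
    also have "\<dots> \<le> (?q\<^sup>2 + ?q) / real N" using q0 by (intro divide_right_mono) auto
    finally show "?q\<^sup>2 / (real N)\<^sup>2 \<le> (?q\<^sup>2 + ?q) / real N" .
    show "?q / real N \<le> (?q\<^sup>2 + ?q) / real N" by (intro divide_right_mono) auto
  qed auto
  also have "\<dots> = 5 * (?A ^ 4 + ?B) * ((?q\<^sup>2 + ?q) / real N)" by (simp add: algebra_simps)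
  also have "\<dots> \<le> 5 * (?A ^ 4 + ?B) * ((1 + 4 * z\<^sup>2) / real N + 4 * (?q - z)\<^sup>2)"
  proof (intro mult_left_mono)
    \<comment> \<open>Completing squares: the noise is quadratic in the mass q, and this bounds
      \<open>q^2 + q\<close> by a constant, which is still divided by N, plus a multiple of the
      squared error of the mass.\<close>
    have "1 + 4 * z\<^sup>2 + 4 * (?q - z)\<^sup>2 - (?q\<^sup>2 + ?q) = (?q - 1)\<^sup>2 / 2 + 2 * (?q - 2 * z)\<^sup>2 + ?q\<^sup>2 / 2 + 1 / 2"
      by (simp add: power2_eq_square field_simps)
    also have "0 \<le> \<dots>" by (intro add_nonneg_nonneg) auto
    finally have "?q\<^sup>2 + ?q \<le> 1 + 4 * z\<^sup>2 + 4 * (?q - z)\<^sup>2" by simp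
    then have "(?q\<^sup>2 + ?q) / real N \<le> (1 + 4 * z\<^sup>2 + 4 * (?q - z)\<^sup>2) / real N" by (intro divide_right_mono) auto
    also have "\<dots> = (1 + 4 * z\<^sup>2) / real N + 4 * (?q - z)\<^sup>2 / real N" by (rule add_divide_distrib)
    also have "4 * (?q - z)\<^sup>2 / real N \<le> 4 * (?q - z)\<^sup>2 / 1" using N by (intro divide_left_mono) auto
    finally show "(?q\<^sup>2 + ?q) / real N \<le> (1 + 4 * z\<^sup>2) / real N + 4 * (?q - z)\<^sup>2" by simp
    show "0 \<le> 5 * (?A ^ 4 + ?B)" using B0 by simp
  qed
  finally have "noise k x * T \<le> 5 * (?A ^ 4 + ?B) * ((1 + 4 * z\<^sup>2) / real N + 4 * (?q - z)\<^sup>2) * T"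
    using T_nonneg by (rule mult_right_mono)
  then show ?thesis
    unfolding potential_def initial_error_def dev by (simp add: mult_ac)
qed

text \<open>A potential of at most \<open>e^2 * exp (- growth k * T)\<close> forces a deviation of
  at most the square of e at every time. The constant is written out because it has to be chosen
  before N and the semigroup.\<close>

lemma mode_deviation_event:
  assumes paths: "markov_paths M T (configs N) P X \<mu>"
    and cad: "\<And>\<omega>. \<omega> \<in> space M \<Longrightarrow> cadlag T (\<lambda>t. X t \<omega>)"
    and e: "0 < e"
  obtains B where "B \<in> sets M"
    "ennreal (e\<^sup>2 * exp (- (10 * (2 * pi * \<bar>of_int k\<bar> + 4 * Lc + 2 * c_hi) + 5) * T)) * emeasure M B
      \<le> (\<integral>\<^sup>+x. ennreal (initial_error k z N x) \<partial>\<mu>)"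
    "\<And>\<omega> t \<sigma> b. \<omega> \<in> space M - B \<Longrightarrow> t \<in> {0..T} \<Longrightarrow> \<sigma> \<in> spins \<Longrightarrow> b \<in> {0, pi / 2} \<Longrightarrow>
      \<bar>lin_stat N (mode k \<sigma> b) (X t \<omega>) - a k \<sigma> b t\<bar> \<le> e"
proof -
  interpret markov_paths M T "configs N" P X \<mu> by (rule paths)
  have g: "growth k = 10 * (2 * pi * \<bar>of_int k\<bar> + 4 * Lc + 2 * c_hi) + 5"
    by (simp add: growth_def C0_def)
  have g0: "0 \<le> growth k" using C0_nonneg[of k] by (simp add: growth_def)
  define r where "r = e\<^sup>2 * exp (- growth k * T)"
  have r: "0 < r" using e by (simp add: r_def)
  obtain B where B: "B \<in> sets M" "ennreal r * emeasure M B \<le> (\<integral>\<^sup>+x. ennreal (potential k 0 x) \<partial>\<mu>)"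
    "\<And>\<omega> t. \<omega> \<in> space M - B \<Longrightarrow> t \<in> {0..T} \<Longrightarrow> potential k t (X t \<omega>) \<le> r"
  proof (rule maximal_inequality[where G = "potential k" and r = r])
    fix s t x assume s: "0 \<le> s" "s \<le> t" "t \<le> T" and "x \<in> configs N"
    then have x: "x \<in> sector N (particles N x)" by (simp add: sector_def)
    have fin: "finite (set_pmf (P (t - s) x))"
      using set_P_sector[OF x, of "t - s"] s finite_subset[OF _ finite_sector] by auto
    have "(\<integral>\<^sup>+y. ennreal (potential k t y) \<partial>P (t - s) x) = ennreal (E (t - s) x (potential k t))"
      unfolding E_def
      by (intro nn_integral_eq_integral integrable_measure_pmf_finite fin AE_I2 potential_nonneg s)
    also have "\<dots> \<le> ennreal (potential k s x)" by (intro ennreal_leI potential_supermartingale[OF x] s)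
    finally show "(\<integral>\<^sup>+y. ennreal (potential k t y) \<partial>P (t - s) x) \<le> ennreal (potential k s x)" .
  next
    fix \<omega> t assume \<omega>: "\<omega> \<in> space M" and t: "0 \<le> t" "t < T"
    have "step_path T (\<lambda>t. X t \<omega>)" by (rule cadlag_step_path[OF cad[OF \<omega>]]) (use X_in \<omega> in auto)
    then show "\<forall>\<^sub>F s in at_right t. X s \<omega> = X t \<omega>" using t by (simp add: step_path_def)
  qed (use r potential_continuous in auto)
  show thesis
  proof (rule that[OF B(1)])
    show "ennreal (e\<^sup>2 * exp (- (10 * (2 * pi * \<bar>of_int k\<bar> + 4 * Lc + 2 * c_hi) + 5) * T)) * emeasure M B
      \<le> (\<integral>\<^sup>+x. ennreal (initial_error k z N x) \<partial>\<mu>)"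
      using B(2) unfolding r_def g
      by (rule order.trans) (intro nn_integral_mono ennreal_leI potential_initial_le)
    fix \<omega> t \<sigma> b assume \<omega>: "\<omega> \<in> space M - B" and t: "t \<in> {0..T}" and i: "\<sigma> \<in> spins" "b \<in> {0, pi / 2}"
    have i': "Some (\<sigma>, b) \<in> mode_set" using i by (simp add: mode_set_def)
    have "0 \<le> noise k (X t \<omega>) * (T - t)" using noise_nonneg t by (intro mult_nonneg_nonneg) auto
    then have "exp (- growth k * t) * deviation k t (X t \<omega>) \<le> r"
      using B(3)[OF \<omega> t] unfolding potential_def by linarith
    then have "exp (growth k * t) * (exp (- growth k * t) * deviation k t (X t \<omega>)) \<le> exp (growth k * t) * r"
      by (rule mult_left_mono) simp
    then have "deviation k t (X t \<omega>) \<le> e\<^sup>2 * exp (growth k * t - growth k * T)"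
      by (simp add: r_def mult.assoc[symmetric] exp_add[symmetric]) (simp add: exp_diff exp_minus field_simps)
    also have "\<dots> \<le> e\<^sup>2 * 1"
      using t g0 by (intro mult_left_mono) (auto intro: mult_left_mono)
    finally have "sqrt (deviation k t (X t \<omega>)) \<le> sqrt (e\<^sup>2)" by (intro real_sqrt_le_mono) simp
    also have "\<dots> = e" using e by simp
    finally show "\<bar>lin_stat N (mode k \<sigma> b) (X t \<omega>) - a k \<sigma> b t\<bar> \<le> e"
      using abs_le_deviation[OF i', of k "X t \<omega>" t] by (simp add: stat_def target_def)
  qed
qed

end

lemma markov_process_paths:
  assumes proc: "markov_process M T (configs N) L X" and T: "0 < T"
    and initial: "distr M (count_space UNIV) (X 0) = measure_pmf (initial_law N \<rho>)"
  obtains P where "markov_semigroup (configs N) P" "has_generator (configs N) P L"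
    "markov_paths M T (configs N) P X (initial_law N \<rho>)"
proof -
  obtain P where P: "markov_semigroup (configs N) P" "has_generator (configs N) P L" "markov_property M T (configs N) P X"
    using proc by (auto simp: markov_process_def)
  have X: "X t \<in> measurable M (count_space (configs N))" if "t \<in> {0..T}" for t
    using proc that by (simp add: markov_process_def)
  \<comment> \<open>The law of \<open>X 0\<close> is taken on all functions, whereas the process is
    given as measurable into \<open>configs N\<close>.\<close>
  have X0: "X 0 \<in> measurable M (count_space UNIV)"
  proof (rule measurableI)
    fix A
    have "X 0 -` A \<inter> space M = X 0 -` (A \<inter> configs N) \<inter> space M"
      using measurable_space[OF X[of 0]] T by auto
    then show "X 0 -` A \<inter> space M \<in> sets M"
      using measurable_sets[OF X[of 0], of "A \<inter> configs N"] T by simp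
  qed simp
  have "markov_paths M T (configs N) P X (initial_law N \<rho>)"
  proof (intro markov_paths.intro markov_paths_axioms.intro)
    show "prob_space M" using proc by (simp add: markov_process_def)
    show "set_pmf (initial_law N \<rho>) \<subseteq> configs N"
      using set_Pi_pmf_subset[of "sites N" 0] by (auto simp: initial_law_def configs_def)
    fix x
    have "pmf (initial_law N \<rho>) x = measure (distr M (count_space UNIV) (X 0)) {x}"
      unfolding initial by (simp add: measure_pmf_single)
    also have "\<dots> = measure M {\<omega> \<in> space M. X 0 \<omega> = x}"
      by (subst measure_distr[OF X0]) (auto intro!: arg_cong[where f = "measure M"])
    finally show "measure M {\<omega> \<in> space M. X 0 \<omega> = x} = pmf (initial_law N \<rho>) x" ..
  qed (use P T X countable_configs in auto)
  with P that show thesis by blast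
qed

text \<open>Doob's inequality divides the expected initial error by a level that does not depend on
  N, so the vanishing of this error makes the exceptional probability small.\<close>

lemma (in limit_modes) mode_uniformly_close:
  assumes T: "0 < T"
    and \<rho>: "\<rho> \<in> C_V" "\<And>x \<sigma>. \<sigma> \<in> spins \<Longrightarrow> 0 \<le> \<rho> (x, \<sigma>)"
  defines "w \<equiv> (\<lambda>\<phi>. \<Sum>\<sigma>\<in>spins. integral {0..1} (\<lambda>x. \<rho> (x, \<sigma>) * \<phi> (x, \<sigma>)))"
  assumes mh0: "w (\<lambda>v. spin_fun v - mh 0) = 0"
    and a0: "\<And>\<sigma> b. \<sigma> \<in> spins \<Longrightarrow> a k \<sigma> b 0 = w (mode k \<sigma> b)"
    and \<alpha>: "\<And>t \<sigma> b. t \<in> {0..T} \<Longrightarrow> \<sigma> \<in> spins \<Longrightarrow> pairing (\<alpha> t) (mode k \<sigma> b) = a k \<sigma> b t"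
    and process: "\<And>N. 0 < N \<Longrightarrow> markov_process (M N) T (configs N) (generator c N) (\<eta> N)"
    and initial: "\<And>N. 0 < N \<Longrightarrow> distr (M N) (count_space UNIV) (\<eta> N 0) = measure_pmf (initial_law N \<rho>)"
    and i: "\<sigma> \<in> spins" "b \<in> {0, pi / 2}"
  shows "uniformly_close_in_prob T M (\<lambda>N. empirical_path T N (\<eta> N)) \<alpha> (mode k \<sigma> b)"
  unfolding uniformly_close_in_prob_def
proof (intro allI impI)
  fix e d :: real assume e: "0 < e" and d: "0 < d"
  \<comment> \<open>Half of e, since \<open>mode_deviation_event\<close> gives a weak
    inequality.\<close>
  define r where "r = (e / 2)\<^sup>2 * exp (- (10 * (2 * pi * \<bar>of_int k\<bar> + 4 * Lc + 2 * c_hi) + 5) * T)"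
  have r: "0 < r" using e by (simp add: r_def)
  have "\<forall>\<^sub>F N in sequentially.
      (\<integral>\<^sup>+x. ennreal (initial_error k (w (\<lambda>_. 1)) N x) \<partial>initial_law N \<rho>) < ennreal (r * d)"
  proof (rule order_tendstoD(2))
    show "(\<lambda>N. \<integral>\<^sup>+x. ennreal (initial_error k (w (\<lambda>_. 1)) N x) \<partial>initial_law N \<rho>) \<longlonglongrightarrow> 0"
      unfolding w_def by (rule initial_error_tendsto[OF \<rho>]) (use mh0 a0 in \<open>simp_all add: w_def\<close>)
  qed (use r d in simp)
  then show "\<forall>\<^sub>F N in sequentially. \<exists>B\<in>sets (M N). measure (M N) B \<le> d \<and>
      (\<forall>\<omega>\<in>space (M N) - B. \<forall>t\<in>{0..T}.
        \<bar>pairing (empirical_path T N (\<eta> N) \<omega> t) (mode k \<sigma> b) - pairing (\<alpha> t) (mode k \<sigma> b)\<bar> < e)"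
    using eventually_gt_at_top[of "0 :: nat"]
  proof eventually_elim
    case (elim N)
    obtain P where P: "markov_semigroup (configs N) P" "has_generator (configs N) P (generator c N)"
      and paths: "markov_paths (M N) T (configs N) P (\<eta> N) (initial_law N \<rho>)"
      using markov_process_paths[OF process[OF elim(2)] T initial[OF elim(2)]] by blast
    interpret particle_limit c c_hi Lc T mh a N P
      using P elim(2) by unfold_locales auto
    interpret markov_paths "M N" T "configs N" P "\<eta> N" "initial_law N \<rho>" by (rule paths)
    obtain B where B: "B \<in> sets (M N)"
      "ennreal r * emeasure (M N) B \<le> (\<integral>\<^sup>+x. ennreal (initial_error k (w (\<lambda>_. 1)) N x) \<partial>initial_law N \<rho>)"
      "\<And>\<omega> t \<sigma> b. \<omega> \<in> space (M N) - B \<Longrightarrow> t \<in> {0..T} \<Longrightarrow> \<sigma> \<in> spins \<Longrightarrow> b \<in> {0, pi / 2} \<Longrightarrow>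
        \<bar>lin_stat N (mode k \<sigma> b) (\<eta> N t \<omega>) - a k \<sigma> b t\<bar> \<le> e / 2"
    proof (rule mode_deviation_event[OF paths, of "e / 2" k "w (\<lambda>_. 1)"])
      show "cadlag T (\<lambda>t. \<eta> N t \<omega>)" if "\<omega> \<in> space (M N)" for \<omega>
        using process[OF elim(2)] that by (simp add: markov_process_def)
    qed (use e in \<open>simp_all add: r_def\<close>)
    have "ennreal (r * measure (M N) B) \<le> ennreal (r * d)"
      using B(2) elim(1) r by (simp add: ennreal_mult emeasure_eq_measure)
    then have "measure (M N) B \<le> d" using r d by (simp add: ennreal_le_iff)
    moreover have "\<bar>pairing (empirical_path T N (\<eta> N) \<omega> t) (mode k \<sigma> b) - pairing (\<alpha> t) (mode k \<sigma> b)\<bar> < e"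
      if "\<omega> \<in> space (M N) - B" "t \<in> {0..T}" for \<omega> t
      using B(3)[OF that i] that e i
      by (simp add: empirical_path_def pairing_empirical_lin_stat[OF elim(2) mode_C_V] \<alpha>)
    ultimately show ?case using B(1) by blast
  qed
qed

theorem theorem2p1:
  fixes T L c_lo c_hi :: real
    and c :: "int \<Rightarrow> real \<Rightarrow> real"
    and \<rho> :: "real \<times> int \<Rightarrow> real"
    and M :: "nat \<Rightarrow> 'w measure"
    and \<eta> :: "nat \<Rightarrow> real \<Rightarrow> 'w \<Rightarrow> int \<times> int \<Rightarrow> nat"
  assumes T: "0 < T"
    and c_lower: "0 < c_lo" "\<And>\<sigma> m. \<sigma> \<in> spins \<Longrightarrow> m \<in> {-1..1} \<Longrightarrow> c_lo \<le> c \<sigma> m"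
    and c_upper: "\<And>\<sigma> m. \<sigma> \<in> spins \<Longrightarrow> m \<in> {-1..1} \<Longrightarrow> c \<sigma> m \<le> c_hi"
    and c_lipschitz: "0 < L" "\<And>\<sigma> m\<^sub>1 m\<^sub>2. \<sigma> \<in> spins \<Longrightarrow> m\<^sub>1 \<in> {-1..1} \<Longrightarrow> m\<^sub>2 \<in> {-1..1} \<Longrightarrow>
          \<bar>c \<sigma> m\<^sub>1 - c \<sigma> m\<^sub>2\<bar> \<le> L * \<bar>m\<^sub>1 - m\<^sub>2\<bar>"
    and \<rho>_smooth: "smooth_V \<rho>"
    and \<rho>_nonneg: "\<And>x \<sigma>. \<sigma> \<in> spins \<Longrightarrow> 0 \<le> \<rho> (x, \<sigma>)"
    and process: "\<And>N. 0 < N \<Longrightarrow> markov_process (M N) T (configs N) (generator c N) (\<eta> N)"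
    and initial: "\<And>N. 0 < N \<Longrightarrow>
          distr (M N) (count_space UNIV) (\<eta> N 0) = measure_pmf (initial_law N \<rho>)"
  shows "\<exists>\<alpha>. hydrodynamic_trajectory c T \<rho> \<alpha> \<and>
          (\<forall>\<beta>. hydrodynamic_trajectory c T \<rho> \<beta> \<longrightarrow> \<beta> = \<alpha>) \<and>
          weakly_converges (skorokhod T)
            (\<lambda>N. distr (M N) (borel_of (skorokhod T)) (empirical_path T N (\<eta> N)))
            (return (borel_of (skorokhod T)) \<alpha>)"
proof -
  interpret bounded_rates c c_hi L
  proof
    show "0 \<le> c \<sigma> m" if "\<sigma> \<in> spins" "m \<in> {-1..1}" for \<sigma> m
      using c_lower(1) c_lower(2)[OF that] by linarith
  qed (use c_upper c_lipschitz in auto)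
  have \<rho>: "\<rho> \<in> C_V"
  proof -
    have "(\<lambda>y. \<rho> (y, \<sigma>)) differentiable (at x)" if "\<sigma> \<in> spins" for \<sigma> x
    proof -
      have "(deriv ^^ 0) (\<lambda>y. \<rho> (y, \<sigma>)) differentiable (at x)"
        using \<rho>_smooth that unfolding smooth_V_def by blast
      then show ?thesis by simp
    qed
    then have "continuous_on UNIV (\<lambda>y. \<rho> (y, \<sigma>))" if "\<sigma> \<in> spins" for \<sigma>
      using that differentiable_imp_continuous_within by (intro continuous_at_imp_continuous_on) blast
    then show ?thesis using \<rho>_smooth by (simp add: C_V_def smooth_V_def)
  qed
  \<comment> \<open>Viewing the initial profile as a measure gives the range of its magnetization
    and the relation between its spin and its mass.\<close>
  have dens_\<rho>: "has_density_V (dens \<rho>) \<rho>" by (rule has_density_dens[OF \<rho> \<rho>_nonneg])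
  obtain m where m: "m 0 = magnetization \<rho>" "\<And>t. t \<in> {0..T} \<Longrightarrow> m t \<in> {-1..1}"
    "\<And>t. t \<in> {0..T} \<Longrightarrow> (m has_real_derivative mag_drift c (m t)) (at t within {0..T})"
    using magnetization_ode[OF less_imp_le[OF T] magnetization_density(1)[OF dens_\<rho>]] by blast
  obtain r where r: "\<And>\<sigma>. \<sigma> \<in> spins \<Longrightarrow> continuous_on ({0..T} \<times> UNIV) (\<lambda>(t, x). r t (x, \<sigma>))"
    "\<And>t. t \<in> {0..T} \<Longrightarrow> r t \<in> C_V"
    "\<And>t x \<sigma>. t \<in> {0..T} \<Longrightarrow> \<sigma> \<in> spins \<Longrightarrow> 0 \<le> r t (x, \<sigma>)"
    "\<And>x \<sigma>. \<sigma> \<in> spins \<Longrightarrow> r 0 (x, \<sigma>) = \<rho> (x, \<sigma>)"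
    "\<And>t y \<sigma>. t \<in> {0..T} \<Longrightarrow> \<sigma> \<in> spins \<Longrightarrow>
      ((\<lambda>t. r t (y + of_int \<sigma> * t, \<sigma>)) has_real_derivative
        c (- \<sigma>) (m t) * r t (y + of_int \<sigma> * t, - \<sigma>) - c \<sigma> (m t) * r t (y + of_int \<sigma> * t, \<sigma>))
      (at t within {0..T})"
    using density_exists[OF less_imp_le[OF T] DERIV_continuous_on[OF m(3)] m(2) \<rho> \<rho>_nonneg] by blast
  interpret limit_density c c_hi L T m r
    by unfold_locales (use T m r in auto)
  have w: "pair_r 0 \<phi> = (\<Sum>\<sigma>\<in>spins. integral {0..1} (\<lambda>x. \<rho> (x, \<sigma>) * \<phi> (x, \<sigma>)))" for \<phi>
    unfolding pair_r_def by (simp add: r(4))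
  have w_dens: "pair_r 0 \<phi> = pairing (dens \<rho>) \<phi>" if "\<phi> \<in> C_V" for \<phi>
    unfolding w has_density_pairing[OF dens_\<rho> that]
  proof (intro sum.cong refl continuous_lborel_integral[symmetric])
    fix \<sigma> assume "\<sigma> \<in> spins"
    then have "continuous_on UNIV (\<lambda>x. \<rho> (x, \<sigma>) * \<phi> (x, \<sigma>))"
      using \<rho> that by (intro continuous_intros) (auto simp: C_V_def)
    then show "continuous_on {0..1} (\<lambda>x. \<rho> (x, \<sigma>) * \<phi> (x, \<sigma>))" by (rule continuous_on_subset) simp
  qed
  have spin: "pair_r 0 spin_fun = m 0 * pair_r 0 (\<lambda>_. 1)"
    using magnetization_density(2)[OF dens_\<rho>] by (simp add: w_dens spin_fun_C_V C_V_const m(1))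
  interpret limit_trajectory c c_hi L T m r by unfold_locales (rule spin)
  interpret modes: limit_modes c c_hi L T m "\<lambda>k \<sigma> b t. pairing (alpha t) (mode k \<sigma> b)"
    by (rule alpha_limit_modes)
  have T0: "0 \<in> {0..T}" using T by simp
  have hyd: "hydrodynamic_trajectory c T \<rho> alpha"
    unfolding hydrodynamic_trajectory_def
    using alpha_skorokhod alpha_density alpha_weak_equation r(4)
    by (intro conjI exI[of _ r]) (auto simp: space_V_space)
  have uniq: "\<beta> = alpha" if \<beta>: "hydrodynamic_trajectory c T \<rho> \<beta>" for \<beta>
  proof -
    obtain q where q: "weak_solution T \<beta> q" "\<forall>v\<in>space V_space. q 0 v = \<rho> v"
      using \<beta> by (auto simp: hydrodynamic_trajectory_def weak_solution_def)
    have "\<beta> 0 = alpha 0"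
    proof (rule has_density_unique[OF _ alpha_density[OF T0]])
      show "has_density_V (\<beta> 0) (q 0)" using q(1) T0 by (simp add: weak_solution_def)
      show "q 0 v = r 0 v" if "v \<in> space V_space" for v
        using q(2) r(4)[of "snd v" "fst v"] that by (auto simp: space_V_space)
    qed
    then show ?thesis by (rule weak_solution_unique[OF T q(1) alpha_weak_solution])
  qed
  have prob: "prob_space (M N)" if "0 < N" for N
    using process[OF that] by (simp add: markov_process_def)
  have modes_close: "uniformly_close_in_prob T M (\<lambda>N. empirical_path T N (\<eta> N)) alpha (mode k \<sigma> b)"
    if "\<sigma> \<in> spins" "b \<in> {0, pi / 2}" for k \<sigma> b
  proof -
    have "pair_r 0 (\<lambda>v. spin_fun v - m 0) = pair_r 0 spin_fun - m 0 * pair_r 0 (\<lambda>_. 1)"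
      using pairing_diff[OF spin_fun_C_V C_V_const[of "m 0"], of "dens \<rho>"] pairing_cmult[of "dens \<rho>" "m 0" "\<lambda>_. 1"]
      by (simp add: w_dens spin_fun_C_V C_V_const C_V_diff)
    then have 1: "pair_r 0 (\<lambda>v. spin_fun v - m 0) = 0" using spin by simp
    have 2: "pairing (alpha 0) (mode k \<sigma> b) = pair_r 0 (mode k \<sigma> b)" for \<sigma> b
      by (rule pairing_alpha[OF T0 mode_C_V])
    show ?thesis
      by (rule modes.mode_uniformly_close[OF T \<rho> _ 1[unfolded w] 2[unfolded w] refl process initial that])
         (rule \<rho>_nonneg)
  qed
  have "weakly_converges (skorokhod T)
      (\<lambda>N. distr (M N) (borel_of (skorokhod T)) (empirical_path T N (\<eta> N)))
      (return (borel_of (skorokhod T)) alpha)"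
  proof (rule weakly_converges_returnI[OF alpha_skorokhod prob])
    show "empirical_path T N (\<eta> N) \<in> measurable (M N) (borel_of (skorokhod T))" if N: "0 < N" for N
    proof -
      obtain P where "markov_paths (M N) T (configs N) P (\<eta> N) (initial_law N \<rho>)"
        using markov_process_paths[OF process[OF N] T initial[OF N]] by blast
      then show ?thesis
        by (rule empirical_path_measurable) (use process[OF N] in \<open>simp add: markov_process_def\<close>)
    qed
    fix \<phi> and e d :: real assume "\<phi> \<in> C_V" "0 < e" "0 < d"
    moreover have "uniformly_close_in_prob T M (\<lambda>N. empirical_path T N (\<eta> N)) alpha \<phi>"
      by (rule uniformly_close_C_V[OF prob modes_close eq_refl[OF mass_const] \<open>\<phi> \<in> C_V\<close>])
    ultimately show "\<forall>\<^sub>F N in sequentially. \<exists>B\<in>sets (M N). measure (M N) B \<le> d \<and> (\<forall>\<omega>\<in>space (M N) - B.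
        \<forall>t\<in>{0..T}. \<bar>pairing (empirical_path T N (\<eta> N) \<omega> t) \<phi> - pairing (alpha t) \<phi>\<bar> < e)"
      unfolding uniformly_close_in_prob_def by blast
  qed
  with hyd uniq show ?thesis by blast
qed

end
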